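(* Let $\mathfrak{g}$ be a seven-dimensional real Lie algebra which is $(2,3)$-trivial and strongly unimodular. Then $\mathfrak{g}$ is solvable, and its nilradical is six-dimensional and is either abelian or isomorphic to one of the following nilpotent Lie algebras: $$\left(0,0,0,0,e^{12},e^{34}\right),\qquad \left(0,0,0,0,e^{13}-e^{24},e^{14}+e^{23}\right).$$
   Context: All Lie algebras are real and finite-dimensional. For a Lie algebra $\mathfrak{g}$, $d$ denotes the Chevalley-Eilenberg differential on $\Lambda^\bullet(\mathfrak{g}^* )$, given on 1-forms by $d\alpha(X,Y)=-\alpha([X,Y])$; $H^k(\mathfrak{g})$ is the $k$-th cohomology group of $(\Lambda^\bullet(\mathfrak{g}^* ),d)$ and $b_k(\mathfrak{g})=\dim H^k(\mathfrak{g})$. $\mathfrak{g}$ is called $(2,3)$-trivial if $b_2(\mathfrak{g})=0=b_3(\mathfrak{g})$. (It is known that a Lie algebra other than $\mathbb{R},\mathbb{R}^2$ with $b_3=0$ is solvable, so the following definition applies to seven-dimensional $(2,3)$-trivial Lie algebras.) A solvable Lie algebra $\mathfrak{g}$ with nilradical $\mathfrak{n}$ is strongly unimodular if, setting $\mathfrak{n}^{0}=\mathfrak{n}$ and $\mathfrak{n}^{i}=[\mathfrak{n},\mathfrak{n}^{i-1}]$ for $i\ge 1$ (the descending central series of $\mathfrak{n}$), for every $X\in\mathfrak{g}$ and every $i\geq 0$ the endomorphism of $\mathfrak{n}^{i}/\mathfrak{n}^{i+1}$ induced by $\mathrm{ad}_X$ is traceless. Notation for nilpotent Lie algebras: $(0,0,0,0,e^{12},e^{34})$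 denotes the six-dimensional Lie algebra having a basis whose dual basis $(e^1,\dots,e^6)$ satisfies $de^1=de^2=de^3=de^4=0$, $de^5=e^{12}$, $de^6=e^{34}$, where $e^{ij}=e^i\wedge e^j$; similarly, $(0,0,0,0,e^{13}-e^{24},e^{14}+e^{23})$ is the one with $de^1=\dots=de^4=0$, $de^5=e^{13}-e^{24}$, $de^6=e^{14}+e^{23}$. *)

theory Defs
  imports "HOL-Analysis.Analysis" "HOL-Library.Function_Algebras"
begin

section \<open>Quotients of real vector spaces\<close>

text \<open>Real-valued functions form a real vector space under the pointwise operations.\<close>

instantiation "fun" :: (type, real_vector) real_vector
begin

definition scaleR_fun :: "real \<Rightarrow> ('a \<Rightarrow> 'b) \<Rightarrow> 'a \<Rightarrow> 'b"
  where "scaleR_fun c f = (\<lambda>x. c *\<^sub>R f x)"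

instance
  by standard (auto simp: scaleR_fun_def plus_fun_def scaleR_add_left scaleR_add_right)

end

text \<open>For subspaces \<open>W \<subseteq> V\<close>, a finite set \<open>S \<subseteq> V\<close> is a basis of \<open>V\<close> modulo \<open>W\<close> if the classes
  \<open>s + W\<close>, for \<open>s \<in> S\<close>, are pairwise distinct and form a basis of the quotient \<open>V/W\<close>;
  distinctness follows from the independence condition.\<close>

definition basis_mod :: "'v::real_vector set \<Rightarrow> 'v set \<Rightarrow> 'v set \<Rightarrow> bool"
  where "basis_mod V W S \<longleftrightarrow> finite S \<and> S \<subseteq> V \<and>
    (\<forall>c. (\<Sum>s\<in>S. c s *\<^sub>R s) \<in> W \<longrightarrow> (\<forall>s\<in>S. c s = 0)) \<and>
    (\<forall>v\<in>V. \<exists>c. v - (\<Sum>s\<in>S. c s *\<^sub>R s) \<in> W)"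

text \<open>The dimension of \<open>V/W\<close>, meaningful when this quotient is finite-dimensional.\<close>

definition quot_dim :: "'v::real_vector set \<Rightarrow> 'v set \<Rightarrow> nat"
  where "quot_dim V W = card (SOME S. basis_mod V W S)"

definition quot_coord :: "'v::real_vector set \<Rightarrow> 'v set \<Rightarrow> 'v \<Rightarrow> 'v \<Rightarrow> real"
  where "quot_coord W S v =
    (THE c. (\<forall>s. s \<notin> S \<longrightarrow> c s = 0) \<and> v - (\<Sum>s\<in>S. c s *\<^sub>R s) \<in> W)"

text \<open>The trace of the endomorphism of \<open>V/W\<close> induced by a linear map \<open>f\<close> with
  \<open>f ` V \<subseteq> V\<close> and \<open>f ` W \<subseteq> W\<close>; as usual it does not depend on the basis chosen.\<close>

definition quot_trace :: "'v::real_vector set \<Rightarrow> 'v set \<Rightarrow> ('v \<Rightarrow> 'v) \<Rightarrow> real"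
  where "quot_trace V W f =
    (let S = (SOME S. basis_mod V W S) in \<Sum>s\<in>S. quot_coord W S (f s) s)"


section \<open>Lie algebras\<close>

text \<open>A Lie algebra is the whole of a real vector space type together with a bracket
  \<open>br\<close>; subalgebras and ideals are subsets of that type.\<close>

locale lie_algebra =
  fixes br :: "'a::real_vector \<Rightarrow> 'a \<Rightarrow> 'a"
  assumes bilinear_br: "bilinear br"
    and br_self: "br x x = 0"
    and jacobi: "br x (br y z) + br y (br z x) + br z (br x y) = 0"

definition lie_prod :: "('a::real_vector \<Rightarrow> 'a \<Rightarrow> 'a) \<Rightarrow> 'a set \<Rightarrow> 'a set \<Rightarrow> 'a set"
  where "lie_prod br A B = span {br x y | x y. x \<in> A \<and> y \<in> B}"

definition lie_ideal :: "('a::real_vector \<Rightarrow> 'a \<Rightarrow> 'a) \<Rightarrow> 'a set \<Rightarrow> bool"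
  where "lie_ideal br I \<longleftrightarrow> subspace I \<and> (\<forall>x. \<forall>y\<in>I. br x y \<in> I)"

primrec derived_series :: "('a::real_vector \<Rightarrow> 'a \<Rightarrow> 'a) \<Rightarrow> 'a set \<Rightarrow> nat \<Rightarrow> 'a set"
  where
    "derived_series br L 0 = L"
  | "derived_series br L (Suc i) = lie_prod br (derived_series br L i) (derived_series br L i)"

primrec lower_central_series :: "('a::real_vector \<Rightarrow> 'a \<Rightarrow> 'a) \<Rightarrow> 'a set \<Rightarrow> nat \<Rightarrow> 'a set"
  where
    "lower_central_series br L 0 = L"
  | "lower_central_series br L (Suc i) = lie_prod br L (lower_central_series br L i)"

definition lie_solvable :: "('a::real_vector \<Rightarrow> 'a \<Rightarrow> 'a) \<Rightarrow> 'a set \<Rightarrow> bool"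
  where "lie_solvable br L \<longleftrightarrow> (\<exists>k. derived_series br L k = {0})"

definition lie_nilpotent :: "('a::real_vector \<Rightarrow> 'a \<Rightarrow> 'a) \<Rightarrow> 'a set \<Rightarrow> bool"
  where "lie_nilpotent br L \<longleftrightarrow> (\<exists>k. lower_central_series br L k = {0})"

definition lie_abelian :: "('a::real_vector \<Rightarrow> 'a \<Rightarrow> 'a) \<Rightarrow> 'a set \<Rightarrow> bool"
  where "lie_abelian br L \<longleftrightarrow> (\<forall>x\<in>L. \<forall>y\<in>L. br x y = 0)"

text \<open>The nilradical is the sum of all nilpotent ideals. In finite dimension this sum is itself
  nilpotent, so that it is the largest nilpotent ideal.\<close>

definition nilradical :: "('a::real_vector \<Rightarrow> 'a \<Rightarrow> 'a) \<Rightarrow> 'a set"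
  where "nilradical br = span (\<Union>{I. lie_ideal br I \<and> lie_nilpotent br I})"

definition lie_isomorphic ::
  "('a::real_vector \<Rightarrow> 'a \<Rightarrow> 'a) \<Rightarrow> 'a set \<Rightarrow> ('b::real_vector \<Rightarrow> 'b \<Rightarrow> 'b) \<Rightarrow> 'b set \<Rightarrow> bool"
  where "lie_isomorphic br L br' L' \<longleftrightarrow> (\<exists>f. bij_betw f L L' \<and>
    (\<forall>x\<in>L. \<forall>y\<in>L. f (x + y) = f x + f y) \<and>
    (\<forall>c. \<forall>x\<in>L. f (c *\<^sub>R x) = c *\<^sub>R f x) \<and>
    (\<forall>x\<in>L. \<forall>y\<in>L. f (br x y) = br' (f x) (f y)))"

text \<open>Only the trace condition is recorded here. Solvability, which belongs to the usual notion
  of strong unimodularity, is deliberately not built in, so that asserting solvability of an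
  algebra satisfying this condition is not a tautology.\<close>

definition strongly_unimodular :: "('a::real_vector \<Rightarrow> 'a \<Rightarrow> 'a) \<Rightarrow> bool"
  where "strongly_unimodular br \<longleftrightarrow>
    (\<forall>x i. quot_trace (lower_central_series br (nilradical br) i)
       (lower_central_series br (nilradical br) (Suc i)) (br x) = 0)"


section \<open>Chevalley--Eilenberg cohomology\<close>

text \<open>A \<open>k\<close>-form takes the list of its arguments and is extended by \<open>0\<close> to lists whose
  length is not \<open>k\<close>.\<close>

definition alt_forms :: "nat \<Rightarrow> ('a::real_vector list \<Rightarrow> real) set"
  where "alt_forms k = {\<omega>.
    (\<forall>xs. length xs \<noteq> k \<longrightarrow> \<omega> xs = 0) \<and>
    (\<forall>xs i. length xs = k \<and> i < k \<longrightarrow> linear (\<lambda>x. \<omega> (xs[i := x]))) \<and>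
    (\<forall>xs. \<not> distinct xs \<longrightarrow> \<omega> xs = 0)}"

text \<open>\<open>(d\<omega>)(x\<^sub>0,\<dots>,x\<^sub>k)\<close> is the sum over \<open>i < j\<close> of
  \<open>(-1)\<^sup>i\<^sup>+\<^sup>j \<omega>([x\<^sub>i,x\<^sub>j],x\<^sub>0,\<dots>,x\<^sub>k)\<close> with \<open>x\<^sub>i\<close> and \<open>x\<^sub>j\<close> omitted from the remaining arguments.\<close>

definition ce_d :: "('a::real_vector \<Rightarrow> 'a \<Rightarrow> 'a) \<Rightarrow> ('a list \<Rightarrow> real) \<Rightarrow> 'a list \<Rightarrow> real"
  where "ce_d br \<omega> xs = (\<Sum>j<length xs. \<Sum>i<j.
    (- 1) ^ (i + j) * \<omega> (br (xs ! i) (xs ! j) # nths xs (- {i, j})))"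

definition cocycles :: "('a::real_vector \<Rightarrow> 'a \<Rightarrow> 'a) \<Rightarrow> nat \<Rightarrow> ('a list \<Rightarrow> real) set"
  where "cocycles br k = {\<omega> \<in> alt_forms k. ce_d br \<omega> = 0}"

primrec coboundaries :: "('a::real_vector \<Rightarrow> 'a \<Rightarrow> 'a) \<Rightarrow> nat \<Rightarrow> ('a list \<Rightarrow> real) set"
  where
    "coboundaries br 0 = {0}"
  | "coboundaries br (Suc k) = ce_d br ` alt_forms k"

definition betti :: "('a::real_vector \<Rightarrow> 'a \<Rightarrow> 'a) \<Rightarrow> nat \<Rightarrow> nat"
  where "betti br k = quot_dim (cocycles br k) (coboundaries br k)"

definition two_three_trivial :: "('a::real_vector \<Rightarrow> 'a \<Rightarrow> 'a) \<Rightarrow> bool"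
  where "two_three_trivial br \<longleftrightarrow> betti br 2 = 0 \<and> betti br 3 = 0"

lemma ce_d_one_form: "ce_d br \<alpha> [x, y] = - \<alpha> [br x y]"
proof -
  have "{..<length [x, y]} = {0, 1}" "{..<1::nat} = {0}" "- {0, Suc 0} \<inter> {0, 1} = {}"
    by auto
  then show ?thesis
    by (simp add: ce_d_def nths_Cons)
qed


section \<open>Two nilpotent Lie algebras of dimension six\<close>

text \<open>\<open>wedge i j\<close> is \<open>e\<^sup>i \<and> e\<^sup>j\<close> for the basis dual to the standard one.\<close>

definition wedge :: "6 \<Rightarrow> 6 \<Rightarrow> real^6 \<Rightarrow> real^6 \<Rightarrow> real"
  where "wedge i j x y = x $ i * y $ j - x $ j * y $ i"

text \<open>The bracket on \<open>\<real>\<^sup>6\<close> for which \<open>e\<^sup>1,\<dots>,e\<^sup>4\<close> are closed, \<open>de\<^sup>5 = A\<close> and \<open>de\<^sup>6 = B\<close>; the signs come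
  from \<open>d\<alpha>(x,y) = -\<alpha>([x,y])\<close>.\<close>

definition two_step_bracket ::
  "(real^6 \<Rightarrow> real^6 \<Rightarrow> real) \<Rightarrow> (real^6 \<Rightarrow> real^6 \<Rightarrow> real) \<Rightarrow> real^6 \<Rightarrow> real^6 \<Rightarrow> real^6"
  where "two_step_bracket A B x y = - A x y *\<^sub>R axis 5 1 - B x y *\<^sub>R axis 6 1"

text \<open>\<open>(0, 0, 0, 0, e\<^sup>1\<^sup>2, e\<^sup>3\<^sup>4)\<close>\<close>

definition br_12_34 :: "real^6 \<Rightarrow> real^6 \<Rightarrow> real^6"
  where "br_12_34 = two_step_bracket (wedge 1 2) (wedge 3 4)"

text \<open>\<open>(0, 0, 0, 0, e\<^sup>1\<^sup>3 - e\<^sup>2\<^sup>4, e\<^sup>1\<^sup>4 + e\<^sup>2\<^sup>3)\<close>\<close>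

definition br_13m24_14p23 :: "real^6 \<Rightarrow> real^6 \<Rightarrow> real^6"
  where "br_13m24_14p23 =
    two_step_bracket (\<lambda>x y. wedge 1 3 x y - wedge 2 4 x y) (\<lambda>x y. wedge 1 4 x y + wedge 2 3 x y)"

definition coord_form :: "6 \<Rightarrow> (real^6) list \<Rightarrow> real"
  where "coord_form i xs = (if length xs = 1 then hd xs $ i else 0)"

lemma ce_d_two_step:
  "ce_d (two_step_bracket A B) (coord_form i) [x, y] =
    (if i = 5 then A x y else if i = 6 then B x y else 0)"
  by (auto simp: ce_d_one_form coord_form_def two_step_bracket_def axis_def)

lemma lie_algebra_br_12_34: "lie_algebra br_12_34"
  by standard
    (auto simp: br_12_34_def two_step_bracket_def wedge_def axis_def bilinear_def linear_iff
      vec_eq_iff algebra_simps)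

lemma lie_algebra_br_13m24_14p23: "lie_algebra br_13m24_14p23"
  by standard
    (auto simp: br_13m24_14p23_def two_step_bracket_def wedge_def axis_def bilinear_def linear_iff
      vec_eq_iff algebra_simps)

end

theory Submission
  imports Defs "HOL-Computational_Algebra.Fundamental_Theorem_Algebra"
begin

text \<open>
  Put \<open>\<kappa>(x,y) = tr(ad x ad y)\<close>. The 3-form \<open>\<kappa>([x,y],z)\<close> is closed, hence exact since \<open>b\<^sub>3 = 0\<close>. A Casimir
  argument on a minimal nonsolvable subalgebra, combined with Cartan's criterion, turns this into nilpotency of \<open>h = [g,g]\<close>;
  no Levi decomposition is needed. From \<open>b\<^sub>2 = 0\<close> one gets \<open>g = \<real>t + h\<close>, so that \<open>h\<close> is the nilradical, and
  the action of \<open>D = ad t\<close> is injective on \<open>H\<^sup>1\<close>, \<open>H\<^sup>2\<close> and \<open>H\<^sup>3\<close> of \<open>h\<close>. By the trace conditions certain explicit closed forms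
  are \<open>D\<close>-invariant up to exact forms, hence exact, which excludes \<open>dim [h,h] = 1, 3, 4\<close>. If \<open>dim [h,h] = 2\<close>, then
  \<open>h\<close> is two-step nilpotent and given by a pencil of 2-forms on the 4-dimensional space \<open>h/[h,h]\<close>. Its Pfaffian, a binary quadratic
  form, is nondegenerate by injectivity on \<open>H\<^sup>3\<close>, and its signature decides between the two algebras.
\<close>

section \<open>Traces and nilpotent maps\<close>

text \<open>Exactness of the Killing 3-form is inherited by every subalgebra, although the other
  cohomology hypotheses are not; this is why a smallest nonsolvable subalgebra \<open>L\<close> can
  be studied alone. It turns out to be simple. There exactness says that the primitive plus the
  trace form is a derivation of \<open>L\<close> into its dual; being inner it is antisymmetric, so
  its symmetric part, the trace form, vanishes, against Cartan. Nilpotency criteria speak about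
  eigenvalues, hence the passage to the complexification. For \<open>h\<close> itself two facts pull
  in opposite directions. A traceless map of a line is zero, so \<open>D\<close> kills every
  one-dimensional quotient of the lower central series, and in larger quotients tracelessness makes
  top exterior powers invariant; injectivity on cohomology forbids the invariant classes that arise
  this way. In the surviving case a Pfaffian with two real zeros gives two decomposable forms, the
  model with \<open>e12\<close> and \<open>e34\<close>. A definite one gives the real and imaginary
  parts of one complex decomposable form, and the model is the complex Heisenberg algebra viewed
  over the reals.\<close>

definition trc :: "('v::euclidean_space \<Rightarrow> 'v) \<Rightarrow> real"
  where "trc f = (\<Sum>b\<in>Basis. f b \<bullet> b)"

lemma trc_add: "trc (\<lambda>x. f x + g x) = trc f + trc g"
  by (simp add: trc_def inner_add_left sum.distrib)

lemma trc_diff: "trc (\<lambda>x. f x - g x) = trc f - trc g"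
  by (simp add: trc_def inner_diff_left sum_subtractf)

lemma trc_scaleR: "trc (\<lambda>x. c *\<^sub>R f x) = c * trc f"
  by (simp add: trc_def sum_distrib_left)

lemma trc_zero: "trc (\<lambda>x. 0) = 0"
  by (simp add: trc_def)

lemma trc_sum: "trc (\<lambda>x. \<Sum>i\<in>I. f i x) = (\<Sum>i\<in>I. trc (f i))"
  unfolding trc_def inner_sum_left by (rule sum.swap)

lemma trc_commute:
  fixes f g :: "'v::euclidean_space \<Rightarrow> 'v"
  assumes "linear f" "linear g"
  shows "trc (\<lambda>x. f (g x)) = trc (\<lambda>x. g (f x))"
proof -
  have *: "f' (g' b) \<bullet> b = (\<Sum>c\<in>Basis. (g' b \<bullet> c) * (f' c \<bullet> b))" if "linear f'" for f' g' :: "'v \<Rightarrow> 'v" and b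
  proof -
    have "f' (g' b) = f' (\<Sum>c\<in>Basis. (g' b \<bullet> c) *\<^sub>R c)"
      by (simp add: euclidean_representation)
    also have "\<dots> = (\<Sum>c\<in>Basis. (g' b \<bullet> c) *\<^sub>R f' c)"
      using that by (simp add: linear_sum linear_scale)
    finally show ?thesis
      by (simp add: inner_sum_left)
  qed
  have "trc (\<lambda>x. f (g x)) = (\<Sum>b\<in>Basis. \<Sum>c\<in>Basis. (g b \<bullet> c) * (f c \<bullet> b))"
    unfolding trc_def by (intro sum.cong refl *[OF assms(1)])
  also have "\<dots> = (\<Sum>c\<in>Basis. \<Sum>b\<in>Basis. (f c \<bullet> b) * (g b \<bullet> c))"
    by (subst sum.swap) (simp add: mult.commute)
  also have "\<dots> = trc (\<lambda>x. g (f x))"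
    unfolding trc_def by (intro sum.cong refl *[OF assms(2), symmetric])
  finally show ?thesis .
qed

text \<open>This reads off the trace of an operator once it is expanded along fixed vectors, as is
  done when a trace form is compared with a Casimir operator.\<close>

lemma trc_rank_one:
  assumes "linear \<phi>"
  shows "trc (\<lambda>x. \<phi> x *\<^sub>R v) = \<phi> v"
proof -
  have "\<phi> v = \<phi> (\<Sum>b\<in>Basis. (v \<bullet> b) *\<^sub>R b)"
    by (simp add: euclidean_representation)
  also have "\<dots> = (\<Sum>b\<in>Basis. (v \<bullet> b) *\<^sub>R \<phi> b)"
    using assms by (simp add: linear_sum linear_scale)
  finally show ?thesis
    by (simp add: trc_def mult.commute)
qed

lemma linear_funpow: "linear f \<Longrightarrow> linear (f ^^ n)"
  for f :: "'v::real_vector \<Rightarrow> 'v"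
proof (induction n)
  case 0
  then show ?case by (simp add: linear_iff)
next
  case (Suc n)
  then show ?case using linear_compose[of "f ^^ n" f] by (simp add: o_def)
qed

lemma funpow_in: "(\<And>v. v \<in> S \<Longrightarrow> f v \<in> S) \<Longrightarrow> v \<in> S \<Longrightarrow> (f ^^ n) v \<in> S"
  by (induction n) auto

text \<open>The last clause expresses orthogonality. It turns the trace of \<open>p\<close> into a
  sum of squared norms, the source of positivity in \<open>trc_projection\<close>.\<close>

lemma orth_proj_exists:
  fixes W :: "'v::euclidean_space set"
  assumes "subspace W"
  obtains p where "linear p" "\<And>v. p v \<in> W" "\<And>w. w \<in> W \<Longrightarrow> p w = w" "\<And>v. p v \<bullet> v = p v \<bullet> p v"
proof -
  obtain B where B: "B \<subseteq> W" "pairwise orthogonal B" "\<And>x. x \<in> B \<Longrightarrow> norm x = 1" "independent B" "span B = W"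
    using orthonormal_basis_subspace[OF assms] by metis
  have fin: "finite B" using B(4) independent_bound by blast
  define p where "p v = (\<Sum>b\<in>B. (v \<bullet> b) *\<^sub>R b)" for v
  have lin: "linear p"
    unfolding p_def by (rule linear_compose_sum) (auto simp: linear_iff inner_add_left algebra_simps)
  have inW: "p v \<in> W" for v
    unfolding p_def using B by (metis (no_types, lifting) span_base span_scale span_sum)
  have onb: "b \<bullet> c = (if b = c then 1 else 0)" if "b \<in> B" "c \<in> B" for b c
    using that B(2,3) by (auto simp: pairwise_def orthogonal_def norm_eq_1)
  have pb: "p b = b" if "b \<in> B" for b
  proof -
    have "p b = (\<Sum>c\<in>B. (if b = c then 1 else 0) *\<^sub>R c)"
      unfolding p_def using onb that by (intro sum.cong) auto
    also have "\<dots> = (\<Sum>c\<in>B. if b = c then c else 0)"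
      by (intro sum.cong) auto
    also have "\<dots> = b" using fin that by simp
    finally show ?thesis .
  qed
  have id: "p w = w" if "w \<in> W" for w
    using linear_eq_on_span[of p "\<lambda>x. x" B w] lin pb that B(5) by (simp add: linear_iff)
  have dot: "p v \<bullet> u = v \<bullet> p u" for v u
    unfolding p_def by (simp add: inner_sum_left inner_sum_right inner_commute mult.commute)
  have "p v \<bullet> v = p v \<bullet> p v" for v
    using dot[of "p v" v] id[OF inW] by simp
  with lin inW id show ?thesis using that by blast
qed

text \<open>A projection onto \<open>U\<close> along a complement of \<open>W\<close> turns the action on \<open>U/W\<close> into an action on the whole space.\<close>

lemma section_proj_exists:
  fixes U W :: "'v::euclidean_space set"
  assumes "subspace U" "subspace W" "W \<subseteq> U"
  obtains p where "linear p" "\<And>v. p v \<in> U" "\<And>w. w \<in> W \<Longrightarrow> p w = 0" "\<And>u. u \<in> U \<Longrightarrow> p u - u \<in> W"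
    "\<And>v. p (p v) = p v"
proof -
  obtain p where p: "linear p" "\<And>v. p v \<in> U" "\<And>w. w \<in> U \<Longrightarrow> p w = w"
    using orth_proj_exists[OF assms(1)] by metis
  obtain q where q: "linear q" "\<And>v. q v \<in> W" "\<And>w. w \<in> W \<Longrightarrow> q w = w"
    using orth_proj_exists[OF assms(2)] by metis
  define r where "r v = p v - q (p v)" for v
  have rU: "r v \<in> U" for v unfolding r_def using p q assms by (meson subsetD subspace_diff)
  show ?thesis
  proof
    show "linear r"
      unfolding r_def using linear_compose[OF p(1) q(1)] p(1) by (intro linear_compose_sub) (auto simp: o_def)
    show "r v \<in> U" for v by fact
    show "r w = 0" if "w \<in> W" for w using that assms p q by (auto simp: r_def)
    show "r u - u \<in> W" if "u \<in> U" for u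
      using that p q assms by (simp add: r_def subspace_neg)
    show "r (r v) = r v" for v
    proof -
      have "q (r v) = 0" using q by (simp add: r_def linear_diff)
      then show ?thesis using p(3)[OF rU[of v]] by (subst r_def) simp
    qed
  qed
qed

text \<open>The kernels of the powers of \<open>U\<close> increase, so one of maximal dimension
  contains all the others.\<close>

lemma fitting_index:
  fixes U :: "'v::euclidean_space \<Rightarrow> 'v"
  assumes U: "linear U"
  obtains n where "\<And>m v. (U ^^ m) v = 0 \<Longrightarrow> (U ^^ n) v = 0"
proof -
  define K where "K j = {v. (U ^^ j) v = 0}" for j
  have sub: "subspace (K j)" for j
    unfolding K_def using linear_subspace_kernel[OF linear_funpow[OF U]] .
  have mono: "K i \<subseteq> K j" if "i \<le> j" for i j
  proof
    fix v assume "v \<in> K i"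
    moreover have "(U ^^ j) v = (U ^^ (j - i)) ((U ^^ i) v)"
      using that by (metis comp_apply funpow_add le_add_diff_inverse2)
    ultimately show "v \<in> K j"
      using linear_0[OF linear_funpow[OF U]] by (simp add: K_def)
  qed
  obtain n where n: "\<And>j. dim (K j) \<le> dim (K n)"
  proof -
    have "finite (range (\<lambda>j. dim (K j)))"
      by (rule finite_subset[of _ "{..DIM('v)}"]) (auto intro: dim_subset_UNIV)
    then have "Max (range (\<lambda>j. dim (K j))) \<in> range (\<lambda>j. dim (K j))"
      by (intro Max_in) auto
    then obtain n where "Max (range (\<lambda>j. dim (K j))) = dim (K n)" by auto
    then show ?thesis using that[of n] Max_ge[OF \<open>finite _\<close>] by auto
  qed
  have "K m \<subseteq> K n" for m
  proof (cases "m \<le> n")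
    case False
    then have "K n = K m"
      using subspace_dim_equal[OF sub sub mono[of n m] n[of m]] by simp
    then show ?thesis by simp
  qed (use mono in blast)
  then show ?thesis using that[of n] by (auto simp: K_def)
qed

text \<open>Writing \<open>p\<^sub>k\<close> for a projection onto the image of \<open>N\<^sup>k\<close>, one has \<open>tr (N p\<^sub>k) = tr (p\<^sub>k\<^sub>+\<^sub>1 N p\<^sub>k) = tr (N p\<^sub>k p\<^sub>k\<^sub>+\<^sub>1) = tr (N p\<^sub>k\<^sub>+\<^sub>1)\<close>.\<close>

lemma trc_nilpotent:
  fixes N :: "'v::euclidean_space \<Rightarrow> 'v"
  assumes N: "linear N" and nil: "\<And>v. \<exists>k. (N ^^ k) v = 0"
  shows "trc N = 0"
proof -
  obtain n where n: "\<And>m v. (N ^^ m) v = 0 \<Longrightarrow> (N ^^ n) v = 0"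
    using fitting_index[OF N] by blast
  have zero: "(N ^^ n) v = 0" for v using nil n by blast
  have "\<exists>p. linear p \<and> (\<forall>v. p v \<in> range (N ^^ k)) \<and> (\<forall>w\<in>range (N ^^ k). p w = w) \<and> trc N = trc (\<lambda>v. N (p v))" for k
  proof (induction k)
    case 0
    show ?case by (rule exI[of _ "\<lambda>x. x"]) (simp add: linear_iff)
  next
    case (Suc k)
    then obtain p where p: "linear p" "\<And>v. p v \<in> range (N ^^ k)" "\<And>w. w \<in> range (N ^^ k) \<Longrightarrow> p w = w"
      "trc N = trc (\<lambda>v. N (p v))" by blast
    have "subspace (range (N ^^ Suc k))"
      using linear_subspace_image[OF linear_funpow[OF N] subspace_UNIV] .
    then obtain q where q: "linear q" "\<And>v. q v \<in> range (N ^^ Suc k)" "\<And>w. w \<in> range (N ^^ Suc k) \<Longrightarrow> q w = w"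
      using orth_proj_exists by metis
    have np: "N (p v) \<in> range (N ^^ Suc k)" for v using p(2)[of v] by auto
    have pq: "p (q v) = q v" for v
    proof -
      obtain u where "q v = (N ^^ Suc k) u" using q(2)[of v] by auto
      then have "q v = (N ^^ k) (N u)" by (simp add: funpow_swap1)
      then show ?thesis using p(3) by simp
    qed
    have "trc (\<lambda>v. N (p v)) = trc (\<lambda>v. q (N (p v)))"
      using q(3)[OF np] by simp
    also have "\<dots> = trc (\<lambda>v. N (p (q v)))"
      using trc_commute[OF q(1), of "\<lambda>v. N (p v)"] p(1) N linear_compose[of p N] by (simp add: o_def)
    finally show ?case using q pq p(4) by auto
  qed
  from this[of n] obtain p where p: "\<And>v. p v \<in> range (N ^^ n)" "trc N = trc (\<lambda>v. N (p v))"
    by blast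
  then have "p v = 0" for v using zero by auto
  then show ?thesis using p(2) N by (simp add: linear_0 trc_zero)
qed

text \<open>If \<open>q\<close> is the orthogonal projection onto the image of \<open>E\<close>,
  then \<open>q E = E\<close> and \<open>E q = q\<close>, so both have the same trace, and that of
  \<open>q\<close> is a sum of squared norms.\<close>

lemma trc_projection:
  fixes E :: "'v::euclidean_space \<Rightarrow> 'v"
  assumes E: "linear E" and idem: "\<And>v. E (E v) = E v"
  shows "trc E \<ge> 0" and "trc E = 0 \<Longrightarrow> E v = 0"
proof -
  obtain q where q: "linear q" "\<And>v. q v \<in> range E" "\<And>w. w \<in> range E \<Longrightarrow> q w = w" "\<And>v. q v \<bullet> v = q v \<bullet> q v"
    using orth_proj_exists[OF linear_subspace_image[OF E subspace_UNIV]] by metis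
  have Eq: "E (q v) = q v" for v using q(2)[of v] idem by auto
  have "trc E = trc (\<lambda>v. q (E v))" using q(3) by simp
  also have "\<dots> = trc q" using trc_commute[OF q(1) E] Eq by simp
  finally have tr: "trc E = (\<Sum>b\<in>Basis. q b \<bullet> q b)" by (simp add: trc_def q(4))
  then show "trc E \<ge> 0" by (simp add: sum_nonneg)
  assume "trc E = 0"
  then have "q b = 0" if "b \<in> Basis" for b
    using tr that by (simp add: sum_nonneg_eq_0_iff)
  then have "q v = 0" for v
    using linear_eq_on_span[of q "\<lambda>_. 0" Basis v] q(1) by (simp add: linear_iff)
  then show "E v = 0" using q(3)[of "E v"] by simp
qed

section \<open>Primary decomposition over the complex numbers\<close>

lemma funpow_commute: "(\<And>v. f (g v) = g (f v)) \<Longrightarrow> f ((g ^^ n) v) = (g ^^ n) (f v)"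
  by (induction n) auto

lemma funpow_add_apply: "(f ^^ (m + n)) x = (f ^^ m) ((f ^^ n) x)"
  by (simp add: funpow_add)

text \<open>The vectors are indexed by numbers and may repeat; a repetition is itself a relation and
  is treated apart from the linearly dependent set.\<close>

lemma linear_relation_exists:
  fixes w :: "nat \<Rightarrow> 'v::euclidean_space"
  obtains c where "\<exists>i\<le>DIM('v). c i \<noteq> 0" "(\<Sum>i\<le>DIM('v). c i *\<^sub>R w i) = 0"
proof (cases "inj_on w {..DIM('v)}")
  case False
  then obtain i j where ij: "i \<le> DIM('v)" "j \<le> DIM('v)" "i \<noteq> j" "w i = w j"
    by (auto simp: inj_on_def)
  define c :: "nat \<Rightarrow> real" where "c k = (if k = i then 1 else 0) - (if k = j then 1 else 0)" for k
  have "(\<Sum>k\<le>DIM('v). c k *\<^sub>R w k) = (\<Sum>k\<le>DIM('v). if k = i then w k else 0) - (\<Sum>k\<le>DIM('v). if k = j then w k else 0)"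
    unfolding sum_subtractf[symmetric] by (intro sum.cong) (auto simp: c_def)
  also have "\<dots> = 0" using ij by simp
  finally have "(\<Sum>k\<le>DIM('v). c k *\<^sub>R w k) = 0" .
  moreover have "c i \<noteq> 0" using ij by (simp add: c_def)
  ultimately show ?thesis using that ij(1) by blast
next
  case True
  then have "card (w ` {..DIM('v)}) = Suc (DIM('v))" by (simp add: card_image)
  then have "dependent (w ` {..DIM('v)})"
    using independent_bound[of "w ` {..DIM('v)}"] by linarith
  then obtain u v where u: "v \<in> w ` {..DIM('v)}" "u v \<noteq> 0" "(\<Sum>v\<in>w ` {..DIM('v)}. u v *\<^sub>R v) = 0"
    using dependent_finite[of "w ` {..DIM('v)}"] by auto
  then have "(\<Sum>i\<le>DIM('v). u (w i) *\<^sub>R w i) = 0"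
    using True by (simp add: sum.reindex)
  then show ?thesis using that[of "\<lambda>i. u (w i)"] u(1,2) by auto
qed

text \<open>A complex vector space is kept as a real Euclidean space with a map \<open>J\<close>
  playing the role of multiplication by the imaginary unit, so that dimensions, projections and
  traces remain the real ones. \<open>csc\<close> is then complex scalar multiplication.\<close>

locale complex_structure =
  fixes J :: "'w::euclidean_space \<Rightarrow> 'w"
  assumes linear_J: "linear J" and J_J: "J (J v) = - v"
begin

definition csc :: "complex \<Rightarrow> 'w \<Rightarrow> 'w"
  where "csc c v = Re c *\<^sub>R v + Im c *\<^sub>R J v"

definition clin :: "('w \<Rightarrow> 'w) \<Rightarrow> bool"
  where "clin T \<longleftrightarrow> linear T \<and> (\<forall>v. T (J v) = J (T v))"

definition shift :: "('w \<Rightarrow> 'w) \<Rightarrow> complex \<Rightarrow> 'w \<Rightarrow> 'w"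
  where "shift T c v = T v - csc c v"

lemma linear_csc: "linear (csc c)"
  using linear_J by (simp add: linear_iff csc_def algebra_simps)

lemma csc_add_left: "csc (a + b) v = csc a v + csc b v"
  by (simp add: csc_def algebra_simps)

lemma csc_minus_left: "csc (- a) v = - csc a v"
  by (simp add: csc_def)

lemma csc_mult: "csc (a * b) v = csc a (csc b v)"
  using linear_J by (simp add: csc_def linear_iff J_J algebra_simps)

lemma csc_of_real: "csc (of_real r) v = r *\<^sub>R v"
  by (simp add: csc_def)

lemma csc_one: "csc 1 v = v"
  by (simp add: csc_def)

lemma csc_eq_0: "csc c v = 0 \<Longrightarrow> c = 0 \<or> v = 0"
  by (metis csc_mult csc_one left_inverse linear_0 linear_csc)

lemma clin_csc: "clin (csc c)"
  using linear_J by (simp add: clin_def linear_csc) (simp add: csc_def linear_iff)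

lemma clin_commute_csc: "clin T \<Longrightarrow> T (csc c v) = csc c (T v)"
  by (simp add: clin_def csc_def linear_iff)

lemma clin_shift: "clin T \<Longrightarrow> clin (shift T c)"
  using clin_csc[of c] by (auto simp: clin_def shift_def[abs_def] linear_compose_sub linear_diff linear_J)

lemma clin_shift_commute: "clin T \<Longrightarrow> T (shift T c v) = shift T c (T v)"
  by (simp add: shift_def clin_commute_csc) (simp add: clin_def linear_diff clin_commute_csc)

lemma clin_shift_shift: "clin T \<Longrightarrow> shift T a (shift T b v) = shift T b (shift T a v)"
  using linear_csc[of a] linear_csc[of b]
  by (simp add: shift_def clin_commute_csc clin_def linear_diff)
    (simp add: csc_mult[symmetric] mult.commute)

lemma csc_in: "subspace S \<Longrightarrow> (\<And>v. v \<in> S \<Longrightarrow> J v \<in> S) \<Longrightarrow> v \<in> S \<Longrightarrow> csc c v \<in> S"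
  by (simp add: csc_def subspace_add subspace_scale)

definition poly_op :: "('w \<Rightarrow> 'w) \<Rightarrow> complex poly \<Rightarrow> 'w \<Rightarrow> 'w"
  where "poly_op T p u = (\<Sum>i\<le>degree p. csc (coeff p i) ((T ^^ i) u))"

lemma poly_op_eq:
  assumes "degree p \<le> n"
  shows "poly_op T p u = (\<Sum>i\<le>n. csc (coeff p i) ((T ^^ i) u))"
  unfolding poly_op_def using assms
  by (intro sum.mono_neutral_left) (auto simp: coeff_eq_0 csc_def)

lemma poly_op_linear_factor:
  assumes T: "clin T"
  shows "poly_op T ([:- l, 1:] * q) u = poly_op T q (T u - csc l u)"
proof -
  let ?n = "degree q"
  have deg: "degree ([:- l, 1:] * q) \<le> Suc ?n"
    using degree_mult_le[of "[:- l, 1:]" q] by simp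
  have co: "coeff ([:- l, 1:] * q) i = - l * coeff q i + (case i of 0 \<Rightarrow> 0 | Suc j \<Rightarrow> coeff q j)" for i
    by (simp add: coeff_pCons split: nat.split)
  have pw: "(T ^^ i) (T u - csc l u) = (T ^^ Suc i) u - csc l ((T ^^ i) u)" for i
  proof -
    have "linear (T ^^ i)" using T linear_funpow by (auto simp: clin_def)
    moreover have "(T ^^ i) (csc l u) = csc l ((T ^^ i) u)"
      using funpow_commute[of "csc l" T i u] clin_commute_csc[OF T] by simp
    ultimately show ?thesis by (simp add: linear_diff funpow_swap1)
  qed
  have "poly_op T ([:- l, 1:] * q) u =
      (\<Sum>i\<le>Suc ?n. csc (- l * coeff q i) ((T ^^ i) u)) + (\<Sum>i\<le>Suc ?n. csc (case i of 0 \<Rightarrow> 0 | Suc j \<Rightarrow> coeff q j) ((T ^^ i) u))"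
    by (simp only: poly_op_eq[OF deg] co csc_add_left sum.distrib)
  also have "(\<Sum>i\<le>Suc ?n. csc (- l * coeff q i) ((T ^^ i) u)) = (\<Sum>i\<le>?n. csc (- l * coeff q i) ((T ^^ i) u))"
    by (simp add: coeff_eq_0) (simp add: csc_def)
  also have "(\<Sum>i\<le>Suc ?n. csc (case i of 0 \<Rightarrow> 0 | Suc j \<Rightarrow> coeff q j) ((T ^^ i) u)) = (\<Sum>i\<le>?n. csc (coeff q i) ((T ^^ Suc i) u))"
    by (subst sum.atMost_Suc_shift) (simp add: csc_def)
  also have "(\<Sum>i\<le>?n. csc (- l * coeff q i) ((T ^^ i) u)) + (\<Sum>i\<le>?n. csc (coeff q i) ((T ^^ Suc i) u))
      = (\<Sum>i\<le>?n. csc (coeff q i) ((T ^^ i) (T u - csc l u)))"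
    unfolding sum.distrib[symmetric] pw linear_diff[OF linear_csc]
    by (intro sum.cong refl) (simp add: csc_minus_left csc_mult[symmetric] mult.commute)
  also have "\<dots> = poly_op T q (T u - csc l u)"
    by (simp add: poly_op_def)
  finally show ?thesis .
qed

text \<open>Split off a root \<open>l\<close> of \<open>p\<close>. Either \<open>u\<close> is an
  eigenvector for \<open>l\<close>, or \<open>T u - l u\<close> is a nonzero vector of
  \<open>S\<close> annihilated by a polynomial of smaller degree.\<close>

lemma eigenvector_from_poly:
  assumes T: "clin T" and S: "subspace S" "\<And>v. v \<in> S \<Longrightarrow> J v \<in> S" "\<And>v. v \<in> S \<Longrightarrow> T v \<in> S"
  shows "p \<noteq> 0 \<Longrightarrow> u \<in> S \<Longrightarrow> u \<noteq> 0 \<Longrightarrow> poly_op T p u = 0 \<Longrightarrow> \<exists>l v. v \<in> S \<and> v \<noteq> 0 \<and> T v = csc l v"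
proof (induction "degree p" arbitrary: p u)
  case 0
  then obtain a where "p = [:a:]" by (metis degree_eq_zeroE)
  with 0 show ?case using csc_eq_0 by (auto simp: poly_op_def)
next
  case (Suc n)
  then have "\<not> constant (poly p)" by (simp add: constant_degree)
  then obtain l where "poly p l = 0" using fundamental_theorem_of_algebra by blast
  then obtain q where q: "p = [:- l, 1:] * q" by (metis dvdE poly_eq_0_iff_dvd)
  then have "q \<noteq> 0" using Suc.prems by auto
  then have "degree p = degree [:- l, 1:] + degree q"
    unfolding q by (intro degree_mult_eq) auto
  then have deg: "n = degree q" using Suc.hyps(2) by simp
  show ?case
  proof (cases "T u - csc l u = 0")
    case True
    then show ?thesis using Suc.prems by auto
  next
    case False
    moreover have "T u - csc l u \<in> S" using S Suc.prems csc_in by (simp add: subspace_diff)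
    moreover have "poly_op T q (T u - csc l u) = 0"
      using Suc.prems(4) poly_op_linear_factor[OF T] q by metis
    ultimately show ?thesis using Suc.hyps(1)[OF deg \<open>q \<noteq> 0\<close>] by blast
  qed
qed

lemma eigenvector_exists:
  assumes T: "clin T" and S: "subspace S" "\<And>v. v \<in> S \<Longrightarrow> J v \<in> S" "\<And>v. v \<in> S \<Longrightarrow> T v \<in> S" "S \<noteq> {0}"
  obtains l v where "v \<in> S" "v \<noteq> 0" "T v = csc l v"
proof -
  obtain u where u: "u \<in> S" "u \<noteq> 0" using S(1,4) subspace_0 by blast
  \<comment> \<open>A relation with real coefficients among the iterates of \<open>u\<close> is
    enough; it is then read as a complex polynomial.\<close>
  obtain c where c: "\<exists>i\<le>DIM('w). c i \<noteq> 0" "(\<Sum>i\<le>DIM('w). c i *\<^sub>R (T ^^ i) u) = 0"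
    using linear_relation_exists[of "\<lambda>i. (T ^^ i) u"] by blast
  define p where "p = (\<Sum>i\<le>DIM('w). monom (complex_of_real (c i)) i)"
  have co: "coeff p k = (if k \<le> DIM('w) then of_real (c k) else 0)" for k
    by (simp add: p_def coeff_sum coeff_monom)
  then have "p \<noteq> 0" using c(1) by (metis coeff_0 of_real_eq_0_iff)
  moreover have "degree p \<le> DIM('w)" by (rule degree_le) (simp add: co)
  then have "poly_op T p u = 0" using c(2) by (simp add: poly_op_eq co csc_of_real)
  ultimately show ?thesis
    using eigenvector_from_poly[OF T S(1-3), of p u] u that by blast
qed

text \<open>Both shifts commute and each lowers one of the exponents, so by induction on
  \<open>a + b\<close> both kill \<open>v\<close>; subtracting gives
  \<open>(l - m) v = 0\<close>.\<close>

lemma generalized_eigenspaces_disjoint: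
  assumes T: "clin T" and lm: "l \<noteq> m"
  shows "(shift T l ^^ a) v = 0 \<Longrightarrow> (shift T m ^^ b) v = 0 \<Longrightarrow> v = 0"
proof (induction "a + b" arbitrary: a b v rule: less_induct)
  case less
  show ?case
  proof (cases "a = 0 \<or> b = 0")
    case True
    then show ?thesis using less.prems by auto
  next
    case False
    then obtain a' b' where ab: "a = Suc a'" "b = Suc b'" by (metis not0_implies_Suc)
    have z: "shift T c 0 = 0" "(shift T c ^^ n) 0 = 0" for c n
      using clin_shift[OF T, of c] linear_0 linear_0[OF linear_funpow] by (auto simp: clin_def)
    have "(shift T l ^^ a') (shift T l v) = 0" "(shift T m ^^ b') (shift T m v) = 0"
      using less.prems ab by (simp_all add: funpow_swap1)
    moreover have "(shift T m ^^ b) (shift T l v) = 0"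
      using funpow_commute[of "shift T l" "shift T m", OF clin_shift_shift[OF T], of b v, symmetric] less.prems z by simp
    moreover have "(shift T l ^^ a) (shift T m v) = 0"
      using funpow_commute[of "shift T m" "shift T l", OF clin_shift_shift[OF T], of a v, symmetric] less.prems z by simp
    moreover have "a' + b < a + b" "a + b' < a + b" using ab by simp_all
    ultimately have "shift T l v = 0" "shift T m v = 0"
      using less.hyps[of a' b "shift T l v"] less.hyps[of a b' "shift T m v"] by blast+
    then have "csc l v = csc m v" by (simp add: shift_def)
    then have "csc (l - m) v = 0"
      by (simp add: csc_def algebra_simps)
    then show ?thesis using csc_eq_0 lm by fastforce
  qed
qed

text \<open>Induction on the dimension: an eigenvalue \<open>l\<close> splits off the generalized eigenspace \<open>ker (T - l)\<^sup>n\<close>, with complement the image of \<open>(T - l)\<^sup>n\<close>.\<close>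

lemma primary_decomposition:
  assumes T: "clin T"
  shows "subspace S \<Longrightarrow> (\<And>v. v \<in> S \<Longrightarrow> J v \<in> S) \<Longrightarrow> (\<And>v. v \<in> S \<Longrightarrow> T v \<in> S) \<Longrightarrow>
    \<exists>\<Lambda> E. finite \<Lambda> \<and> (\<forall>l\<in>\<Lambda>. linear (E l) \<and> (\<forall>v\<in>S. E l v \<in> S \<and> E l (T v) = T (E l v) \<and>
      E l (J v) = J (E l v) \<and> (\<exists>k. (shift T l ^^ k) (E l v) = 0))) \<and> (\<forall>v\<in>S. (\<Sum>l\<in>\<Lambda>. E l v) = v)"
proof (induction "dim S" arbitrary: S rule: less_induct)
  case less
  note S = less.prems
  show ?case
  proof (cases "S = {0}")
    case True
    then show ?thesis by (intro exI[of _ "{}"]) auto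
  next
    case False
    obtain l u where u: "u \<in> S" "u \<noteq> 0" "T u = csc l u"
      using eigenvector_exists[OF T S False] by blast
    define U where "U = shift T l"
    have cU: "clin U" using clin_shift[OF T] by (simp add: U_def)
    then have linU: "linear U" by (simp add: clin_def)
    have US: "U v \<in> S" if "v \<in> S" for v
      using that S csc_in by (simp add: U_def shift_def subspace_diff)
    obtain n where n: "\<And>m v. (U ^^ m) v = 0 \<Longrightarrow> (U ^^ n) v = 0"
      using fitting_index[OF linU] by blast
    define V where "V = U ^^ n"
    have linV: "linear V" using linear_funpow[OF linU] by (simp add: V_def)
    have VT: "V (T v) = T (V v)" for v
      unfolding V_def U_def using funpow_commute[of T "shift T l" n v] clin_shift_commute[OF T] by simp
    have VJ: "V (J v) = J (V v)" for v
      unfolding V_def using funpow_commute[of J U n v] cU by (simp add: clin_def)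
    have VV: "V v = 0" if "V (V v) = 0" for v
      using that n[of "n + n" v] by (simp add: V_def funpow_add_apply)
    define I where "I = V ` S"
    have IS: "I \<subseteq> S" using funpow_in[of S U] US by (auto simp: I_def V_def)
    have subI: "subspace I" unfolding I_def using linear_subspace_image[OF linV S(1)] .
    have injV: "inj_on V I"
    proof (rule inj_onI)
      fix x y assume xy: "x \<in> I" "y \<in> I" "V x = V y"
      then have "x - y \<in> I" using subI subspace_diff by blast
      then obtain v where v: "x - y = V v" by (auto simp: I_def)
      then have "V (V v) = 0" using xy(3) linV by (metis eq_iff_diff_eq_0 linear_diff)
      then have "V v = 0" using VV by blast
      then show "x = y" using v by simp
    qed
    have VI: "V ` I = I"
    proof (rule subspace_dim_equal)
      show "subspace (V ` I)" using linear_subspace_image[OF linV subI] .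
      show "V ` I \<subseteq> I" using IS by (auto simp: I_def)
      show "dim I \<le> dim (V ` I)"
        using dim_image_eq[OF linV, of I] injV subI by (simp add: span_eq_iff[THEN iffD2])
    qed (fact subI)
    obtain g where g: "linear g" "\<And>v. v \<in> I \<Longrightarrow> g (V v) = v"
      using linear_exists_left_inverse_on[OF linV subI injV] by blast
    \<comment> \<open>As \<open>g\<close> inverts \<open>V\<close> on \<open>I\<close>, this is the
      projection of \<open>S\<close> onto \<open>I\<close> along the kernel of
      \<open>V\<close>.\<close>
    define pr where "pr v = g (V v)" for v
    have linpr: "linear pr" unfolding pr_def using linear_compose[OF linV g(1)] by (simp add: o_def)
    have prI: "pr v \<in> I" "V (pr v) = V v" if v: "v \<in> S" for v
    proof -
      have "V v \<in> V ` I" using v VI by (auto simp: I_def)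
      then obtain w where "w \<in> I" "V v = V w" by blast
      then show "pr v \<in> I" "V (pr v) = V v" by (simp_all add: pr_def g(2))
    qed
    have prunique: "pr v = w" if "w \<in> I" "V w = V v" for v w
      using that g(2)[of w] by (simp add: pr_def)
    have TI: "T v \<in> I" "J v \<in> I" if "v \<in> I" for v
      using that VT VJ S by (auto simp: I_def image_iff) metis+
    have prT: "pr (T v) = T (pr v)" "pr (J v) = J (pr v)" if "v \<in> S" for v
      using that prI[OF that] by (auto intro!: prunique simp: TI VT VJ)
    have "dim I < dim S"
    proof -
      have "u \<notin> I"
      proof
        assume "u \<in> I"
        have "U u = 0" using u by (simp add: U_def shift_def)
        then have "V u = 0" using n[of 1 u] by (simp add: V_def)
        then show False using injV \<open>u \<in> I\<close> subspace_0[OF subI] u(2) linear_0[OF linV]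
          by (metis inj_onD)
      qed
      then show ?thesis using IS u(1) subspace_dim_equal[OF subI S(1) IS]
        by (metis not_le)
    qed
    from less.hyps[OF this subI TI(2) TI(1)] obtain \<Lambda> E where E1: "finite \<Lambda>"
      and H: "\<forall>l\<in>\<Lambda>. linear (E l) \<and> (\<forall>v\<in>I. E l v \<in> I \<and> E l (T v) = T (E l v) \<and>
        E l (J v) = J (E l v) \<and> (\<exists>k. (shift T l ^^ k) (E l v) = 0))"
      and E7: "\<forall>v\<in>I. (\<Sum>l\<in>\<Lambda>. E l v) = v"
      by blast
    have E: "finite \<Lambda>"
      "\<And>m. m \<in> \<Lambda> \<Longrightarrow> linear (E m)"
      "\<And>m v. m \<in> \<Lambda> \<Longrightarrow> v \<in> I \<Longrightarrow> E m v \<in> I"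
      "\<And>m v. m \<in> \<Lambda> \<Longrightarrow> v \<in> I \<Longrightarrow> E m (T v) = T (E m v)"
      "\<And>m v. m \<in> \<Lambda> \<Longrightarrow> v \<in> I \<Longrightarrow> E m (J v) = J (E m v)"
      "\<And>m v. m \<in> \<Lambda> \<Longrightarrow> v \<in> I \<Longrightarrow> \<exists>k. (shift T m ^^ k) (E m v) = 0"
      "\<And>v. v \<in> I \<Longrightarrow> (\<Sum>m\<in>\<Lambda>. E m v) = v"
      using E1 H E7 by blast+
    define E' where "E' m = (if m = l then (\<lambda>v. v - pr v) else (\<lambda>v. E m (pr v)))" for m
    \<comment> \<open>The value \<open>l\<close> may formally recur in the index set obtained for
      \<open>I\<close>; its component there is zero because \<open>V\<close> is injective on
      \<open>I\<close>.\<close>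
    have El: "E l w = 0" if lw: "l \<in> \<Lambda>" "w \<in> I" for w
    proof -
      obtain k where "(U ^^ k) (E l w) = 0" using E(6)[OF lw] by (auto simp: U_def)
      then have "V (E l w) = 0" using n by (auto simp: V_def)
      then show ?thesis
        using injV E(3)[OF lw] subspace_0[OF subI] linear_0[OF linV] by (metis inj_onD)
    qed
    show ?thesis
    proof (intro exI[of _ "insert l \<Lambda>"] exI[of _ E'] conjI ballI)
      show "finite (insert l \<Lambda>)" using E by simp
      fix m assume m: "m \<in> insert l \<Lambda>"
      show "linear (E' m)"
      proof (cases "m = l")
        case True
        then show ?thesis using linpr by (simp add: E'_def linear_compose_sub linear_ident)
      next
        case False
        then show ?thesis using linear_compose[OF linpr E(2)] m by (simp add: E'_def o_def)
      qed
      fix v assume v: "v \<in> S"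
      show "E' m v \<in> S"
        using v prI[OF v] IS E(3)[of m "pr v"] m subspace_diff[OF S(1)] by (auto simp: E'_def)
      show "E' m (T v) = T (E' m v)"
        using v prI[OF v] E(4)[of m "pr v"] m T by (auto simp: E'_def prT clin_def linear_diff)
      show "E' m (J v) = J (E' m v)"
        using v prI[OF v] E(5)[of m "pr v"] m linear_J by (auto simp: E'_def prT linear_diff)
      show "\<exists>k. (shift T m ^^ k) (E' m v) = 0"
      proof (cases "m = l")
        case True
        have "V (v - pr v) = 0" using prI[OF v] linV by (simp add: linear_diff)
        then show ?thesis using True by (auto simp: E'_def V_def U_def)
      next
        case False
        then show ?thesis using E(6)[of m "pr v"] prI[OF v] m by (simp add: E'_def)
      qed
    next
      fix v assume v: "v \<in> S"
      have "(\<Sum>m\<in>insert l \<Lambda>. E' m v) = E' l v + (\<Sum>m\<in>\<Lambda> - {l}. E' m v)"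
        using E(1) by (simp add: sum.insert_remove)
      also have "(\<Sum>m\<in>\<Lambda> - {l}. E' m v) = (\<Sum>m\<in>\<Lambda> - {l}. E m (pr v))"
        by (intro sum.cong) (auto simp: E'_def)
      also have "\<dots> = (\<Sum>m\<in>\<Lambda>. E m (pr v))"
        using E(1) El prI[OF v] by (intro sum.mono_neutral_left) auto
      also have "\<dots> = pr v" using E(7) prI[OF v] by simp
      finally show "(\<Sum>m\<in>insert l \<Lambda>. E' m v) = v" by (simp add: E'_def)
    qed
  qed
qed

text \<open>The map \<open>Y\<close> acts on each generalized eigenspace of \<open>T\<close> as the complex conjugate of the eigenvalue, so that the trace of \<open>T Y\<close> is the sum of the squared absolute values of the eigenvalues.\<close>

lemma conjugate_semisimple_part:
  assumes T: "clin T"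
  shows "\<exists>Y. linear Y \<and> (trc (\<lambda>v. T (Y v)) = 0 \<longrightarrow> (\<forall>v. \<exists>k. (T ^^ k) v = 0)) \<and>
    (\<forall>Z k \<nu> v. (\<forall>j v. Z (Suc j) v = T (Z j v) - Z j (T v) - csc \<nu> (Z j v)) \<longrightarrow> (\<forall>j. clin (Z j)) \<longrightarrow>
      (\<forall>v. Z k v = 0) \<longrightarrow> Y (Z 0 v) - Z 0 (Y v) = csc (cnj \<nu>) (Z 0 v))"
proof -
  from primary_decomposition[OF T subspace_UNIV] obtain \<Lambda> E where fin: "finite \<Lambda>"
    and H: "\<forall>l\<in>\<Lambda>. linear (E l) \<and> (\<forall>v. E l (T v) = T (E l v) \<and> E l (J v) = J (E l v) \<and> (\<exists>k. (shift T l ^^ k) (E l v) = 0))"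
    and sumE: "\<And>v. (\<Sum>l\<in>\<Lambda>. E l v) = v"
    by auto
  have linE: "\<And>l. l \<in> \<Lambda> \<Longrightarrow> linear (E l)"
    and ET: "\<And>l v. l \<in> \<Lambda> \<Longrightarrow> E l (T v) = T (E l v)"
    and EJ: "\<And>l v. l \<in> \<Lambda> \<Longrightarrow> E l (J v) = J (E l v)"
    and nilE: "\<And>l v. l \<in> \<Lambda> \<Longrightarrow> \<exists>k. (shift T l ^^ k) (E l v) = 0"
    using H by blast+
  have cE: "clin (E l)" if "l \<in> \<Lambda>" for l using that linE EJ by (simp add: clin_def)
  have Eshift: "E l (shift T m v) = shift T m (E l v)" if "l \<in> \<Lambda>" for l m v
    using that ET clin_commute_csc[OF cE[OF that]] linE[OF that] by (simp add: shift_def linear_diff)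
  have shift0: "(shift T c ^^ n) 0 = 0" for c n
    using clin_shift[OF T, of c] linear_0 linear_0[OF linear_funpow] by (auto simp: clin_def)
  have Egen: "E l v = (if l = m then v else 0)" if l: "l \<in> \<Lambda>" and v: "(shift T m ^^ b) v = 0" "m \<in> \<Lambda>" for l m b v
  proof -
    have other: "E l v = 0" if "l \<in> \<Lambda>" "l \<noteq> m" for l
    proof -
      obtain k where k1: "(shift T l ^^ k) (E l v) = 0" using nilE \<open>l \<in> \<Lambda>\<close> by blast
      have k2: "(shift T m ^^ b) (E l v) = 0"
        using funpow_commute[of "E l" "shift T m" b v] Eshift \<open>l \<in> \<Lambda>\<close> v linE by (simp add: linear_0)
      show ?thesis using generalized_eigenspaces_disjoint[OF T _ k1 k2] that by auto
    qed
    have "v = (\<Sum>l\<in>\<Lambda>. if l = m then E l v else 0)"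
      by (subst sumE[symmetric]) (intro sum.cong refl, auto simp: other)
    then have "v = E m v" using fin v(2) by simp
    then show ?thesis using other l by auto
  qed
  define Y where "Y v = (\<Sum>l\<in>\<Lambda>. csc (cnj l) (E l v))" for v
  have linY: "linear Y" unfolding Y_def
    using linear_compose[OF linE linear_csc] by (intro linear_compose_sum) (simp add: o_def)
  have Ygen: "Y v = csc (cnj m) v" if "(shift T m ^^ b) v = 0" for m b v
  proof (cases "m \<in> \<Lambda>")
    case True
    have "Y v = (\<Sum>l\<in>\<Lambda>. if l = m then csc (cnj l) v else 0)"
      unfolding Y_def using Egen[OF _ that True] by (intro sum.cong refl) (auto simp: linear_0[OF linear_csc])
    then show ?thesis using True fin by simp
  next
    case False
    have "E l v = 0" if "l \<in> \<Lambda>" for l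
    proof -
      obtain k where k1: "(shift T l ^^ k) (E l v) = 0" using nilE \<open>l \<in> \<Lambda>\<close> by blast
      have k2: "(shift T m ^^ b) (E l v) = 0"
        using funpow_commute[of "E l" "shift T m" b v] Eshift \<open>l \<in> \<Lambda>\<close> \<open>(shift T m ^^ b) v = 0\<close> linE by (simp add: linear_0)
      show ?thesis using generalized_eigenspaces_disjoint[OF T _ k1 k2] that False by auto
    qed
    then have "v = 0" using sumE[of v] by simp
    then show ?thesis using linear_0[OF linY] linear_0[OF linear_csc] by simp
  qed
  show ?thesis
  proof (intro exI[of _ Y] conjI impI allI)
    show "linear Y" by fact
  next
    assume tr: "trc (\<lambda>v. T (Y v)) = 0"
    have idem: "E l (E l v) = E l v" if "l \<in> \<Lambda>" for l v
      using nilE[OF that, of v] Egen[OF that] that by auto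
    \<comment> \<open>On the \<open>l\<close>-summand \<open>T Y\<close> is the scalar
      \<open>|l|^2\<close> plus the nilpotent map \<open>N l\<close>, so only the traces of the
      projections \<open>E l\<close> contribute.\<close>
    define N where "N l v = csc (cnj l) (shift T l (E l v))" for l v
    have NT: "T (csc (cnj l) (E l v)) = (cmod l)\<^sup>2 *\<^sub>R E l v + N l v" for l v
    proof -
      have "T (csc (cnj l) (E l v)) = csc (cnj l) (csc l (E l v) + shift T l (E l v))"
        using clin_commute_csc[OF T] by (simp add: shift_def)
      also have "\<dots> = csc (cnj l * l) (E l v) + N l v"
        by (simp add: linear_add[OF linear_csc] csc_mult N_def)
      also have "cnj l * l = of_real ((cmod l)\<^sup>2)"
        by (metis complex_norm_square mult.commute)
      finally show ?thesis by (simp only: csc_of_real)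
    qed
    have trN: "trc (N l) = 0" if l: "l \<in> \<Lambda>" for l
    proof (rule trc_nilpotent)
      have cs: "clin (shift T l)" using clin_shift[OF T] .
      have "linear (shift T l)" using cs by (simp add: clin_def)
      from linear_compose[OF linear_compose[OF linE[OF l] this] linear_csc[of "cnj l"]]
      show "linear (N l)" by (simp add: N_def[abs_def] o_def)
      fix v
      have pow: "(N l ^^ k) v = csc (cnj l ^ k) ((shift T l ^^ k) ((E l ^^ k) v))" for k
      proof (induction k)
        case 0
        then show ?case by (simp add: csc_one)
      next
        case (Suc k)
        have "(N l ^^ Suc k) v = N l (csc (cnj l ^ k) ((shift T l ^^ k) ((E l ^^ k) v)))"
          using Suc by simp
        also have "\<dots> = csc (cnj l) (shift T l (E l (csc (cnj l ^ k) ((shift T l ^^ k) ((E l ^^ k) v)))))"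
          by (simp add: N_def)
        also have "\<dots> = csc (cnj l) (csc (cnj l ^ k) (shift T l ((shift T l ^^ k) (E l ((E l ^^ k) v)))))"
          using clin_commute_csc[OF cE[OF l]] clin_commute_csc[OF cs]
            funpow_commute[of "E l" "shift T l" k] Eshift[OF l] by simp
        finally show ?case by (simp add: csc_mult)
      qed
      obtain k where k: "(shift T l ^^ k) (E l v) = 0" using nilE[OF l] by blast
      have "(E l ^^ Suc j) v = E l v" for j by (induction j) (auto simp: idem[OF l])
      then have "(N l ^^ Suc k) v = csc (cnj l ^ Suc k) (shift T l ((shift T l ^^ k) (E l v)))"
        using pow[of "Suc k"] by simp
      then have "(N l ^^ Suc k) v = 0"
        using k shift0[where c=l and n=1] by (simp add: linear_0[OF linear_csc])
      then show "\<exists>k. (N l ^^ k) v = 0" by blast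
    qed
    have "trc (\<lambda>v. T (Y v)) = trc (\<lambda>v. \<Sum>l\<in>\<Lambda>. (cmod l)\<^sup>2 *\<^sub>R E l v + N l v)"
      using T by (simp add: Y_def linear_sum clin_def NT)
    also have "\<dots> = (\<Sum>l\<in>\<Lambda>. (cmod l)\<^sup>2 * trc (E l))"
      using trN by (simp add: trc_sum trc_add trc_scaleR)
    finally have "(\<Sum>l\<in>\<Lambda>. (cmod l)\<^sup>2 * trc (E l)) = 0" using tr by simp
    moreover have "(cmod l)\<^sup>2 * trc (E l) \<ge> 0" if "l \<in> \<Lambda>" for l
      using trc_projection(1)[of "E l"] linE idem that by simp
    ultimately have "(cmod l)\<^sup>2 * trc (E l) = 0" if "l \<in> \<Lambda>" for l
      using that fin by (simp add: sum_nonneg_eq_0_iff)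
    then have E0: "E l v = 0" if "l \<in> \<Lambda>" "l \<noteq> 0" for l v
      using trc_projection(2)[of "E l"] linE idem that by auto
    fix v
    have sh: "shift T 0 = T" by (auto simp: shift_def csc_def)
    show "\<exists>k. (T ^^ k) v = 0"
    proof (cases "0 \<in> \<Lambda>")
      case True
      have "v = (\<Sum>l\<in>\<Lambda>. if l = 0 then E l v else 0)"
        by (subst sumE[symmetric]) (intro sum.cong refl, auto simp: E0)
      then have "v = E 0 v" using True fin by simp
      then show ?thesis using nilE[OF True, of v] sh by simp
    next
      case False
      then have "(\<Sum>l\<in>\<Lambda>. E l v) = 0" using E0 by (metis sum.neutral)
      then have "v = 0" using sumE[of v] by simp
      then show ?thesis by (intro exI[of _ 0]) simp
    qed
  next
    \<comment> \<open>\<open>Z j\<close> is the \<open>j\<close>-th iterate of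
      \<open>[T, -] - \<nu>\<close> on \<open>Z 0\<close>, so the hypotheses say that
      \<open>Z 0\<close> is a generalized eigenvector of the adjoint action of \<open>T\<close> with
      eigenvalue \<open>\<nu>\<close>.\<close>
    fix Z :: "nat \<Rightarrow> 'w \<Rightarrow> 'w" and k :: nat and \<nu> :: complex and v :: 'w
    assume "\<forall>j v. Z (Suc j) v = T (Z j v) - Z j (T v) - csc \<nu> (Z j v)" "\<forall>j. clin (Z j)" "\<forall>v. Z k v = 0"
    then have Z: "\<And>j v. Z (Suc j) v = T (Z j v) - Z j (T v) - csc \<nu> (Z j v)" "\<And>j. clin (Z j)" "\<And>v. Z k v = 0"
      by blast+
    have Zlin: "linear (Z j)" for j using Z(2) by (simp add: clin_def)
    have step: "shift T (l + \<nu>) (Z j v) = Z (Suc j) v + Z j (shift T l v)" for l j v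
      using clin_commute_csc[OF Z(2)] by (simp add: shift_def Z(1) csc_add_left linear_diff[OF Zlin])
    \<comment> \<open>Such an operator moves the generalized eigenspace of \<open>l\<close> into
      that of \<open>l + \<nu>\<close>. By \<open>step\<close>, one shift either advances
      \<open>Z\<close> along its chain or lowers the exponent of \<open>v\<close>, so
      \<open>a + b\<close> shifts suffice.\<close>
    have gen: "(shift T (l + \<nu>) ^^ (a + b)) (Z j v) = 0" if "j + a = k" "(shift T l ^^ b) v = 0" for j a b l v
      using that
    proof (induction "a + b" arbitrary: a b j v)
      case 0
      then show ?case using linear_0[OF Zlin] by simp
    next
      case (Suc n)
      have lins: "linear (shift T c ^^ i)" for c i
        using clin_shift[OF T] linear_funpow by (auto simp: clin_def)
      have "(shift T (l + \<nu>) ^^ (a + b)) (Z j v) = (shift T (l + \<nu>) ^^ n) (Z (Suc j) v) + (shift T (l + \<nu>) ^^ n) (Z j (shift T l v))"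
        unfolding Suc.hyps(2)[symmetric] funpow_Suc_right comp_apply step linear_add[OF lins] ..
      also have "(shift T (l + \<nu>) ^^ n) (Z (Suc j) v) = 0"
      proof (cases a)
        case 0
        then have "Z (Suc j) v = 0"
          using Suc.prems Z(1)[of j v] Z(3) linear_0[of T] T linear_0[OF linear_csc] by (simp add: clin_def)
        then show ?thesis using shift0 by simp
      next
        case (Suc a')
        then show ?thesis using Suc.hyps(1)[of a' b "Suc j" v] Suc.hyps(2) Suc.prems by simp
      qed
      also have "(shift T (l + \<nu>) ^^ n) (Z j (shift T l v)) = 0"
      proof (cases b)
        case 0
        then have "v = 0" using Suc.prems by simp
        then have "Z j (shift T l v) = 0" using shift0[where c=l and n=1] linear_0[OF Zlin] by simp
        then show ?thesis using shift0 by simp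
      next
        case (Suc b')
        then have "(shift T l ^^ b') (shift T l v) = 0" using Suc.prems by (simp add: funpow_swap1)
        then show ?thesis using Suc.hyps(1)[of a b' j "shift T l v"] Suc.hyps(2) Suc.prems Suc by simp
      qed
      finally show ?case by simp
    qed
    have rule: "Y (Z 0 v) - Z 0 (Y v) = csc (cnj \<nu>) (Z 0 v)" if v: "(shift T l ^^ b) v = 0" for l b v
    proof -
      have "Y (Z 0 v) = csc (cnj (l + \<nu>)) (Z 0 v)"
        using Ygen gen[where j=0 and a=k and l=l and b=b and v=v] v by simp
      moreover have "Z 0 (Y v) = csc (cnj l) (Z 0 v)"
        using Ygen[OF v] clin_commute_csc[OF Z(2)] by simp
      ultimately show ?thesis by (simp add: csc_add_left)
    qed
    have "Y (Z 0 v) - Z 0 (Y v) = (\<Sum>l\<in>\<Lambda>. Y (Z 0 (E l v)) - Z 0 (Y (E l v)))"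
      by (simp add: sum_subtractf linear_sum[OF linY, symmetric] linear_sum[OF Zlin, symmetric] sumE)
    also have "\<dots> = (\<Sum>l\<in>\<Lambda>. csc (cnj \<nu>) (Z 0 (E l v)))"
      using rule nilE by (intro sum.cong refl) blast
    also have "\<dots> = csc (cnj \<nu>) (Z 0 v)"
      by (simp add: linear_sum[OF linear_csc, symmetric] linear_sum[OF Zlin, symmetric] sumE)
    finally show "Y (Z 0 v) - Z 0 (Y v) = csc (cnj \<nu>) (Z 0 v)" .
  qed
qed

end

section \<open>Complexification\<close>

text \<open>A pair \<open>(a, b)\<close> stands for \<open>a + i b\<close>.\<close>

definition cplx_J :: "'v \<times> 'v \<Rightarrow> 'v \<times> 'v::euclidean_space"
  where "cplx_J = (\<lambda>(a, b). (- b, a))"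

definition cplx :: "('v \<Rightarrow> 'v) \<Rightarrow> 'v \<times> 'v \<Rightarrow> 'v \<times> 'v::euclidean_space"
  where "cplx f = (\<lambda>(a, b). (f a, f b))"

interpretation cx: complex_structure "cplx_J :: 'v \<times> 'v \<Rightarrow> 'v \<times> 'v::euclidean_space"
  by standard (auto simp: cplx_J_def linear_iff)

lemma clin_cplx: "linear f \<Longrightarrow> cx.clin (cplx f)"
  unfolding cx.clin_def by (auto simp: cplx_def cplx_J_def linear_neg) (simp add: linear_iff)

lemma linear_cplx: "linear f \<Longrightarrow> linear (cplx f)"
  using clin_cplx cx.clin_def by blast

lemma sum_Basis_prod:
  "(\<Sum>b\<in>(Basis :: ('v::euclidean_space \<times> 'w::euclidean_space) set). f b) =
    (\<Sum>u\<in>Basis. f (u, 0)) + (\<Sum>v\<in>Basis. f (0, v))"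
proof -
  have "(\<lambda>u. (u, 0::'w)) ` (Basis :: 'v set) \<inter> (\<lambda>v. (0, v)) ` Basis = {}"
    using nonzero_Basis by auto
  then show ?thesis
    unfolding Basis_prod_def by (simp add: sum.union_disjoint sum.reindex inj_on_def)
qed

lemma trc_cplx: "trc (cplx f) = 2 * trc f"
  by (simp add: trc_def cplx_def sum_Basis_prod)

lemma trc_J_cplx: "linear f \<Longrightarrow> trc (\<lambda>w. cplx_J (cplx f w)) = 0"
  by (simp add: trc_def cplx_def cplx_J_def sum_Basis_prod linear_0)

lemma cplx_funpow: "(cplx f ^^ k) (a, b) = ((f ^^ k) a, (f ^^ k) b)"
  by (induction k) (auto simp: cplx_def)

text \<open>Jacobson's lemma. With \<open>Y\<close> the conjugate semisimple part of
  \<open>C\<close>, the map \<open>B\<close> commutes with \<open>C\<close> and hence with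
  \<open>Y\<close>, so that \<open>tr (C Y) = tr (A B Y) - tr (B A Y) = 0\<close> by
  cyclicity.\<close>

lemma nilpotent_commutator:
  fixes A B C :: "'v::euclidean_space \<Rightarrow> 'v"
  assumes A: "linear A" and B: "linear B"
    and C: "\<And>v. C v = A (B v) - B (A v)" and comm: "\<And>v. B (C v) = C (B v)"
  shows "\<exists>k. (C ^^ k) v = 0"
proof -
  have linC: "linear C"
    using A B by (simp add: linear_iff C algebra_simps)
  from cx.conjugate_semisimple_part[OF clin_cplx[OF linC]] obtain Y where Y: "linear Y"
    "trc (\<lambda>v. cplx C (Y v)) = 0 \<longrightarrow> (\<forall>v. \<exists>k. (cplx C ^^ k) v = 0)"
    "\<forall>Z k \<nu> v. (\<forall>j v. Z (Suc j) v = cplx C (Z j v) - Z j (cplx C v) - cx.csc \<nu> (Z j v)) \<longrightarrow> (\<forall>j. cx.clin (Z j)) \<longrightarrow>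
      (\<forall>v. Z k v = 0) \<longrightarrow> Y (Z 0 v) - Z 0 (Y v) = cx.csc (cnj \<nu>) (Z 0 v)"
    by blast
  \<comment> \<open>The chain for eigenvalue \<open>0\<close> that starts at \<open>B\<close> stops
    after one step, because \<open>B\<close> commutes with \<open>C\<close>.\<close>
  define Z where "Z j = (if j = 0 then cplx B else (\<lambda>_. 0))" for j :: nat
  have csc0: "cx.csc 0 v = 0" for v :: "'v \<times> 'v" by (simp add: cx.csc_def)
  have ZS: "Z (Suc j) v = cplx C (Z j v) - Z j (cplx C v) - cx.csc 0 (Z j v)" for j v
    using linC by (cases v) (simp add: csc0 Z_def, auto simp: cplx_def comm linear_0 zero_prod_def)
  have Zc: "cx.clin (Z j)" for j
    unfolding Z_def using clin_cplx[OF B] linear_0[OF cx.linear_J] by (auto simp: cx.clin_def linear_iff)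
  have comY: "Y (cplx B v) = cplx B (Y v)" for v
  proof -
    have "\<forall>v. Z 1 v = 0" by (simp add: Z_def)
    then have "Y (Z 0 v) - Z 0 (Y v) = cx.csc (cnj 0) (Z 0 v)"
      using Y(3)[rule_format, of Z 0 1 v] ZS Zc by blast
    then show ?thesis by (simp add: Z_def csc0)
  qed
  have "trc (\<lambda>v. cplx C (Y v)) = trc (\<lambda>v. cplx A (cplx B (Y v)) - cplx B (cplx A (Y v)))"
    by (intro arg_cong[of _ _ trc] ext) (auto simp: cplx_def C split: prod.split)
  also have "\<dots> = trc (\<lambda>v. cplx A (cplx B (Y v))) - trc (\<lambda>v. cplx B (cplx A (Y v)))"
    by (rule trc_diff)
  also have "trc (\<lambda>v. cplx B (cplx A (Y v))) = trc (\<lambda>v. cplx A (Y (cplx B v)))"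
    using trc_commute[OF linear_cplx[OF B], of "\<lambda>v. cplx A (Y v)"] linear_compose[OF Y(1) linear_cplx[OF A]]
    by (simp add: o_def)
  finally have "trc (\<lambda>v. cplx C (Y v)) = 0" by (simp add: comY)
  then obtain k where "(cplx C ^^ k) (v, 0) = 0" using Y(2) by blast
  then show ?thesis by (auto simp: cplx_funpow zero_prod_def)
qed

section \<open>Subalgebras and representations\<close>

lemma max_dim_exists:
  fixes S :: "'v::euclidean_space set"
  assumes "P S"
  obtains M where "P M" "\<And>M'. P M' \<Longrightarrow> dim M' \<le> dim M"
  using ex_has_greatest_nat[of P S dim "Suc (DIM('v))"] assms by (auto simp: less_Suc_eq_le dim_subset_UNIV)

lemma uniform_nilpotency:
  fixes f :: "'v::euclidean_space \<Rightarrow> 'v"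
  assumes f: "linear f" and U: "subspace U" and W: "subspace W" "\<And>w. w \<in> W \<Longrightarrow> f w \<in> W"
    and nil: "\<And>u. u \<in> U \<Longrightarrow> \<exists>k. (f ^^ k) u \<in> W"
  obtains N where "\<And>u k. u \<in> U \<Longrightarrow> N \<le> k \<Longrightarrow> (f ^^ k) u \<in> W"
proof -
  have more: "(f ^^ m) u \<in> W" if "(f ^^ k) u \<in> W" "k \<le> m" for k m u
    using funpow_in[of W f "(f ^^ k) u" "m - k"] W(2) that by (simp add: funpow_add_apply[symmetric])
  obtain B where B: "B \<subseteq> U" "independent B" "U \<subseteq> span B" "card B = dim U"
    using basis_exists[of U] by blast
  obtain k where k: "\<And>b. b \<in> B \<Longrightarrow> (f ^^ k b) b \<in> W" using nil B(1) by (metis subsetD)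
  define N where "N = Max (insert 0 (k ` B))"
  have fin: "finite B" using B(2) independent_bound by blast
  have N: "k b \<le> N" if "b \<in> B" for b using that fin by (simp add: N_def)
  have "span B \<subseteq> {u. (f ^^ N) u \<in> W}"
  proof (rule span_minimal)
    show "B \<subseteq> {u. (f ^^ N) u \<in> W}" using more k N by blast
    show "subspace {u. (f ^^ N) u \<in> W}"
      using linear_subspace_vimage[OF linear_funpow[OF f] W(1)] by (simp add: vimage_def)
  qed
  then show ?thesis using more that[of N] B(3) by blast
qed

lemma subspace_chain_reaches_UNIV:
  fixes F :: "nat \<Rightarrow> 'v::euclidean_space set"
  assumes sub: "\<And>i. subspace (F i)" and inc: "\<And>i. F i \<subseteq> F (Suc i)"
    and strict: "\<And>i. F i \<noteq> UNIV \<Longrightarrow> F i \<noteq> F (Suc i)"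
  obtains k where "F k = UNIV"
proof (rule ccontr)
  assume "\<not> thesis"
  then have ne: "F k \<noteq> UNIV" for k using that by blast
  have "i \<le> dim (F i)" for i
  proof (induction i)
    case (Suc i)
    have "dim (F i) < dim (F (Suc i))"
      using strict[OF ne[of i]] inc[of i] subspace_dim_equal[OF sub sub inc[of i]] by (meson not_le)
    then show ?case using Suc by simp
  qed simp
  from this[of "Suc (DIM('v))"] show False using dim_subset_UNIV[of "F (Suc (DIM('v)))"] by simp
qed

lemma lie_prod_subset:
  "subspace S \<Longrightarrow> (\<And>x y. x \<in> A \<Longrightarrow> y \<in> B \<Longrightarrow> br x y \<in> S) \<Longrightarrow> lie_prod br A B \<subseteq> S"
  unfolding lie_prod_def by (rule span_minimal) auto

lemma lie_prod_in: "x \<in> A \<Longrightarrow> y \<in> B \<Longrightarrow> br x y \<in> lie_prod br A B"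
  unfolding lie_prod_def by (rule span_base) auto

lemma subspace_lie_prod: "subspace (lie_prod br A B)"
  by (simp add: lie_prod_def)

lemma lie_prod_mono: "A \<subseteq> A' \<Longrightarrow> B \<subseteq> B' \<Longrightarrow> lie_prod br A B \<subseteq> lie_prod br A' B'"
  unfolding lie_prod_def by (rule span_mono) auto

definition subalg :: "('a::real_vector \<Rightarrow> 'a \<Rightarrow> 'a) \<Rightarrow> 'a set \<Rightarrow> bool"
  where "subalg br L \<longleftrightarrow> subspace L \<and> (\<forall>x\<in>L. \<forall>y\<in>L. br x y \<in> L)"

text \<open>The bracket relation is demanded only on \<open>L\<close> while \<open>T\<close> is
  defined everywhere, so one and the same \<open>T\<close> serves all subalgebras of
  \<open>L\<close>.\<close>

definition lie_rep :: "('a::real_vector \<Rightarrow> 'a \<Rightarrow> 'a) \<Rightarrow> 'a set \<Rightarrow> ('a \<Rightarrow> 'v::real_vector \<Rightarrow> 'v) \<Rightarrow> bool"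
  where "lie_rep br L T \<longleftrightarrow> bilinear T \<and>
    (\<forall>x\<in>L. \<forall>y\<in>L. \<forall>v. T (br x y) v = T x (T y v) - T y (T x v))"

lemma lie_rep_mono: "lie_rep br L T \<Longrightarrow> M \<subseteq> L \<Longrightarrow> lie_rep br M T"
  by (auto simp: lie_rep_def)

lemma lie_rep_br:
  "lie_rep br L T \<Longrightarrow> x \<in> L \<Longrightarrow> y \<in> L \<Longrightarrow> T (br x y) v = T x (T y v) - T y (T x v)"
  by (simp add: lie_rep_def)

lemma lie_rep_linear: "lie_rep br L T \<Longrightarrow> linear (T x)" "lie_rep br L T \<Longrightarrow> linear (\<lambda>x. T x v)"
  by (auto simp: lie_rep_def bilinear_def)

text \<open>On \<open>U\<close> the map \<open>p\<close> differs from the identity by vectors of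
  \<open>W\<close>, which \<open>L\<close> preserves and \<open>p\<close> kills. The inner
  \<open>p\<close> can therefore be dropped, and this makes compressed operators multiply like
  operators on \<open>U/W\<close>.\<close>

lemma lie_rep_section:
  assumes T: "lie_rep br L T" and p: "linear p" "\<And>v. p v \<in> U" "\<And>w. w \<in> W \<Longrightarrow> p w = 0" "\<And>u. u \<in> U \<Longrightarrow> p u - u \<in> W"
    and U: "\<And>x u. x \<in> L \<Longrightarrow> u \<in> U \<Longrightarrow> T x u \<in> U" and W: "\<And>x w. x \<in> L \<Longrightarrow> w \<in> W \<Longrightarrow> T x w \<in> W"
  shows "lie_rep br L (\<lambda>x v. p (T x (p v)))"
    and "x \<in> L \<Longrightarrow> u \<in> U \<Longrightarrow> p (T x (p u)) = p (T x u)"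
proof -
  note lin = lie_rep_linear[OF T]
  show red: "p (T x (p u)) = p (T x u)" if "x \<in> L" "u \<in> U" for x u
  proof -
    have "p (T x (p u - u)) = 0" using that p W by blast
    then show ?thesis using p(1) lin(1)[of x] by (simp add: linear_diff)
  qed
  have "bilinear (\<lambda>x v. p (T x (p v)))"
    unfolding bilinear_def
    using linear_compose[OF linear_compose[OF p(1) lin(1)] p(1)] linear_compose[OF lin(2) p(1)]
    by (simp add: o_def)
  then show "lie_rep br L (\<lambda>x v. p (T x (p v)))"
    unfolding lie_rep_def using red U p(1,2) lie_rep_br[OF T] by (simp add: linear_diff)
qed

lemma derived_series_mono: "A \<subseteq> B \<Longrightarrow> derived_series br A k \<subseteq> derived_series br B k"
  by (induction k) (simp_all add: lie_prod_mono)

lemma derived_series_0_in: "subspace A \<Longrightarrow> 0 \<in> derived_series br A k"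
  by (cases k) (auto simp: subspace_0 subspace_lie_prod)

lemma lie_solvable_mono: "lie_solvable br B \<Longrightarrow> A \<subseteq> B \<Longrightarrow> subspace A \<Longrightarrow> lie_solvable br A"
  unfolding lie_solvable_def using derived_series_mono derived_series_0_in by (metis subset_singletonD empty_iff)

lemma derived_series_shift: "derived_series br L (Suc k) = derived_series br (lie_prod br L L) k"
  by (induction k) auto

lemma lie_solvable_lie_prod: "lie_solvable br (lie_prod br L L) \<Longrightarrow> lie_solvable br L"
  unfolding lie_solvable_def derived_series_shift[symmetric] by blast

lemma derived_series_perfect: "lie_prod br L L = L \<Longrightarrow> derived_series br L k = L"
  by (induction k) auto

context lie_algebra
begin

lemma linear_br: "linear (br x)" "linear (\<lambda>x. br x y)"
  using bilinear_br by (auto simp: bilinear_def)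

lemma br_add: "br (x + y) z = br x z + br y z" "br x (y + z) = br x y + br x z"
  by (rule linear_add[OF linear_br(2)] linear_add[OF linear_br(1)])+

lemma br_diff: "br (x - y) z = br x z - br y z" "br x (y - z) = br x y - br x z"
  by (rule linear_diff[OF linear_br(2)] linear_diff[OF linear_br(1)])+

lemma br_scaleR: "br (c *\<^sub>R x) z = c *\<^sub>R br x z" "br x (c *\<^sub>R z) = c *\<^sub>R br x z"
  by (rule linear_scale[OF linear_br(2)] linear_scale[OF linear_br(1)])+

lemma br_zero: "br 0 z = 0" "br z 0 = 0"
  by (rule linear_0[OF linear_br(2)] linear_0[OF linear_br(1)])+

lemma br_antisym: "br x y = - br y x"
proof -
  have "br x y + br y x = br (x + y) (x + y)" unfolding br_add by (simp add: br_self)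
  then have "br x y + br y x = 0" by (simp only: br_self)
  then show ?thesis by (simp add: eq_neg_iff_add_eq_0)
qed

lemma br_minus: "br (- x) z = - br x z" "br x (- z) = - br x z"
  by (rule linear_neg[OF linear_br(2)] linear_neg[OF linear_br(1)])+

lemma jacobi': "br (br x y) z = br x (br y z) - br y (br x z)"
  using jacobi[of x y z] br_antisym[of z x] br_antisym[of z "br x y"]
  by (simp add: br_minus algebra_simps)

lemma lie_rep_adjoint: "lie_rep br L br"
  by (simp add: lie_rep_def bilinear_br jacobi')

lemma lie_prod_ideal:
  assumes "\<And>a. a \<in> A \<Longrightarrow> br x a \<in> A" "\<And>b. b \<in> B \<Longrightarrow> br x b \<in> B" "z \<in> lie_prod br A B"
  shows "br x z \<in> lie_prod br A B"
proof -
  have "lie_prod br A B \<subseteq> {z. br x z \<in> lie_prod br A B}"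
  proof (rule lie_prod_subset)
    show "subspace {z. br x z \<in> lie_prod br A B}"
      using linear_subspace_vimage[OF linear_br(1) subspace_lie_prod] by (simp add: vimage_def)
    fix a b assume ab: "a \<in> A" "b \<in> B"
    have "br x (br a b) = br (br x a) b + br a (br x b)" by (simp add: jacobi')
    then show "br a b \<in> {z. br x z \<in> lie_prod br A B}"
      using ab assms(1,2) by (simp add: lie_prod_in subspace_add[OF subspace_lie_prod])
  qed
  then show ?thesis using assms(3) by blast
qed

lemma subalg_lie_prod: "subalg br L \<Longrightarrow> subalg br (lie_prod br L L) \<and> lie_prod br L L \<subseteq> L"
  unfolding subalg_def
  by (metis lie_prod_ideal lie_prod_subset subset_iff subspace_lie_prod)

lemma subspace_lower_central_series: "subspace L \<Longrightarrow> subspace (lower_central_series br L i)"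
  by (cases i) (auto simp: subspace_lie_prod)

end

text \<open>Stage \<open>i\<close> consists of the vectors killed by all products of
  \<open>i\<close> operators from \<open>L\<close>. For the adjoint action of an algebra on itself
  this is the ascending central series.\<close>

primrec null_series :: "'a set \<Rightarrow> ('a \<Rightarrow> 'v::real_vector \<Rightarrow> 'v) \<Rightarrow> nat \<Rightarrow> 'v set"
  where
    "null_series L T 0 = {0}"
  | "null_series L T (Suc i) = {v. \<forall>x\<in>L. T x v \<in> null_series L T i}"

lemma subspace_null_series: "(\<And>x. linear (T x)) \<Longrightarrow> subspace (null_series L T i)"
  by (induction i) (auto simp: subspace_def linear_0 linear_add linear_scale)

lemma null_series_inc: "(\<And>x. linear (T x)) \<Longrightarrow> null_series L T i \<subseteq> null_series L T (Suc i)"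
  by (induction i) (auto simp: linear_0)

section \<open>The theorems of Engel, Lie and Cartan over the reals\<close>

locale euclidean_lie_algebra = lie_algebra br for br :: "'e::euclidean_space \<Rightarrow> 'e \<Rightarrow> 'e"
begin

text \<open>Engel's theorem for the action on \<open>U/W\<close>: a maximal proper subalgebra \<open>M\<close> of \<open>L\<close> containing the kernel of the action has codimension one,
  by induction applied to the action of \<open>M\<close> on \<open>L/M\<close>.\<close>

lemma engel:
  "subalg br L \<Longrightarrow> lie_rep br L T \<Longrightarrow> subspace U \<Longrightarrow> subspace W \<Longrightarrow> W \<subset> U \<Longrightarrow>
   (\<And>x u. x \<in> L \<Longrightarrow> u \<in> U \<Longrightarrow> T x u \<in> U) \<Longrightarrow> (\<And>x w. x \<in> L \<Longrightarrow> w \<in> W \<Longrightarrow> T x w \<in> W) \<Longrightarrow>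
   (\<And>x u. x \<in> L \<Longrightarrow> u \<in> U \<Longrightarrow> \<exists>k. (T x ^^ k) u \<in> W) \<Longrightarrow> \<exists>v\<in>U - W. \<forall>x\<in>L. T x v \<in> W"
  for T :: "'e \<Rightarrow> 'e \<Rightarrow> 'e"
proof (induction "dim L" arbitrary: L T U W rule: less_induct)
  case less
  note L = less.prems(1) and T = less.prems(2) and U = less.prems(3) and W = less.prems(4)
    and WU = less.prems(5) and TU = less.prems(6) and TW = less.prems(7) and nil = less.prems(8)
  have subL: "subspace L" and brL: "\<And>x y. x \<in> L \<Longrightarrow> y \<in> L \<Longrightarrow> br x y \<in> L"
    using L by (auto simp: subalg_def)
  note lin = lie_rep_linear[OF T]
  define A where "A = {x\<in>L. \<forall>u\<in>U. T x u \<in> W}"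
  show ?case
  proof (cases "A = L")
    case True
    moreover obtain v where "v \<in> U - W" using WU by blast
    ultimately show ?thesis unfolding A_def by blast
  next
    case False
    have subA: "subspace A"
      using subL W linear_0[OF lin(2)] linear_add[OF lin(2)] linear_scale[OF lin(2)] unfolding A_def subspace_def by simp
    have "subalg br A"
      unfolding subalg_def
    proof (intro conjI ballI subA)
      fix x y assume "x \<in> A" "y \<in> A"
      then show "br x y \<in> A"
        using brL TU TW subspace_diff[OF W] by (simp add: A_def lie_rep_br[OF T])
    qed
    then have "subalg br A \<and> A \<subseteq> A \<and> A \<subset> L" using False by (auto simp: A_def)
    then obtain M where "subalg br M \<and> A \<subseteq> M \<and> M \<subset> L"
      and max: "\<And>M'. subalg br M' \<and> A \<subseteq> M' \<and> M' \<subset> L \<Longrightarrow> dim M' \<le> dim M"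
      using max_dim_exists[of "\<lambda>M. subalg br M \<and> A \<subseteq> M \<and> M \<subset> L" A] by blast
    then have M: "subalg br M" "A \<subseteq> M" "M \<subset> L" by auto
    have subM: "subspace M" and brM: "\<And>x y. x \<in> M \<Longrightarrow> y \<in> M \<Longrightarrow> br x y \<in> M"
      using M(1) by (auto simp: subalg_def)
    have dimM: "dim M < dim L"
      using M(3) subM subL by (metis dim_subset le_neq_implies_less psubset_eq subspace_dim_equal order_refl)
    have nilM: "\<exists>k. (br x ^^ k) u \<in> M" if x: "x \<in> M" and u: "u \<in> L" for x u
    proof -
      have xL: "x \<in> L" using x M(3) by blast
      obtain N where N: "\<And>u k. u \<in> U \<Longrightarrow> N \<le> k \<Longrightarrow> (T x ^^ k) u \<in> W"
        using uniform_nilpotency[OF lin(1) U W TW[OF xL] nil[OF xL]] by blast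
      have powU: "(T x ^^ i) v \<in> U" if "v \<in> U" for i v using funpow_in[of U "T x"] TU[OF xL] that by blast
      have powW: "(T x ^^ i) v \<in> W" if "v \<in> W" for i v using funpow_in[of W "T x"] TW[OF xL] that by blast
      have brx: "(br x ^^ k) u \<in> L" for k using funpow_in[of L "br x"] brL[OF xL] u by blast
      \<comment> \<open>Expanding the iterated bracket gives products
        \<open>T x ^ i . T u . T x ^ j\<close> with \<open>i + j = 2 * N\<close>, where one exponent
        is at least \<open>N\<close>. Hence \<open>(br x ^^ (2 * N)) u\<close> acts as zero on
        \<open>U/W\<close> and lies in \<open>A\<close>.\<close>
      have "(T x ^^ i) (T ((br x ^^ k) u) ((T x ^^ j) v)) \<in> W" if "v \<in> U" "2 * N \<le> i + j + k" for i j k v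
        using that
      proof (induction k arbitrary: i j)
        case 0
        show ?case
        proof (cases "N \<le> i")
          case True
          then show ?thesis using N TU u powU 0 by simp
        next
          case False
          then have "(T x ^^ j) v \<in> W" using N 0 by simp
          then show ?thesis using TW u powW by simp
        qed
      next
        case (Suc k)
        let ?z = "(br x ^^ k) u"
        have "(T x ^^ i) (T (br x ?z) ((T x ^^ j) v)) = (T x ^^ Suc i) (T ?z ((T x ^^ j) v)) - (T x ^^ i) (T ?z ((T x ^^ Suc j) v))"
          unfolding lie_rep_br[OF T xL brx] linear_diff[OF linear_funpow[OF lin(1)]] by (simp add: funpow_swap1)
        then show ?case using Suc.IH[of "Suc i" j] Suc.IH[of i "Suc j"] Suc.prems subspace_diff[OF W] by simp
      qed
      from this[of _ 0 0 "2 * N"] have "(br x ^^ (2 * N)) u \<in> A" using brx by (simp add: A_def)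
      then show ?thesis using M(2) by blast
    qed
    have "\<exists>y\<in>L - M. \<forall>x\<in>M. br x y \<in> M"
      using less.hyps[OF dimM M(1) lie_rep_adjoint subL subM M(3)] brL brM nilM M(3) by blast
    then obtain y where y: "y \<in> L" "y \<notin> M" "\<And>x. x \<in> M \<Longrightarrow> br x y \<in> M" by blast
    have Ly: "\<exists>m c. m \<in> M \<and> x = m + c *\<^sub>R y" if "x \<in> L" for x
    proof -
      define M' where "M' = {m + c *\<^sub>R y | m c. m \<in> M}"
      have M'eq: "M' = span (insert y M)"
        using subM by (auto simp: M'_def span_insert span_eq_iff[THEN iffD2]) (metis diff_add_cancel add_diff_cancel)+
      then have subM': "subspace M'" by simp
      have M'L: "M' \<subseteq> L" using M(3) y(1) subL by (auto simp: M'_def subspace_add subspace_scale)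
      have "subalg br M'"
        unfolding subalg_def
      proof (intro conjI ballI subM')
        fix a b assume "a \<in> M'" "b \<in> M'"
        then obtain m c m' c' where ab: "a = m + c *\<^sub>R y" "b = m' + c' *\<^sub>R y" "m \<in> M" "m' \<in> M"
          by (auto simp: M'_def)
        have "br a b = br m m' + c' *\<^sub>R br m y - c *\<^sub>R br m' y"
          using br_antisym[of y m'] by (simp add: ab br_add br_scaleR br_self)
        then have "br a b \<in> M" using ab brM y(3) subM by (simp add: subspace_add subspace_diff subspace_scale)
        then have "br a b = br a b + 0 *\<^sub>R y \<and> br a b \<in> M" by simp
        then show "br a b \<in> M'" unfolding M'_def by blast
      qed
      moreover have "A \<subseteq> M'" using M(2) span_superset[of "insert y M"] unfolding M'eq by blast
      moreover have "dim M < dim M'"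
        using subM y(2) by (simp add: M'eq dim_insert span_eq_iff[THEN iffD2])
      ultimately have "M' = L" using max[of M'] M'L by (metis not_le psubsetI)
      then show ?thesis using that by (auto simp: M'_def)
    qed
    define U0 where "U0 = {v\<in>U. \<forall>x\<in>M. T x v \<in> W}"
    have "\<exists>v\<in>U - W. \<forall>x\<in>M. T x v \<in> W"
    proof (rule less.hyps[OF dimM M(1) lie_rep_mono[OF T] U W WU])
    qed (use M(3) TU TW nil in blast)+
    then obtain v where v: "v \<in> U0" "v \<notin> W" by (auto simp: U0_def)
    have TyU0: "T y v \<in> U0" if "v \<in> U0" for v
      unfolding U0_def
    proof (intro CollectI conjI ballI)
      show "T y v \<in> U" using that TU y by (simp add: U0_def)
      fix x assume x: "x \<in> M"
      have "T x (T y v) = T (br x y) v + T y (T x v)"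
        using lie_rep_br[OF T, of x y v] x M(3) y(1) by auto
      then show "T x (T y v) \<in> W"
        using that x y TW subspace_add[OF W] by (simp add: U0_def)
    qed
    \<comment> \<open>The operator \<open>T y\<close> preserves \<open>U0\<close> and is nilpotent
      modulo \<open>W\<close>. Its last iterate of \<open>v\<close> outside \<open>W\<close> is
      killed modulo \<open>W\<close> by \<open>y\<close> as well as by \<open>M\<close>, hence by
      \<open>L\<close>.\<close>
    define k where "k = (LEAST k. (T y ^^ k) v \<in> W)"
    have "\<exists>k. (T y ^^ k) v \<in> W" using nil y(1) v by (simp add: U0_def)
    then have k: "(T y ^^ k) v \<in> W" unfolding k_def by (rule LeastI_ex)
    then obtain k' where k': "k = Suc k'" using v(2) by (cases k) auto
    let ?v = "(T y ^^ k') v"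
    have "?v \<notin> W" using not_less_Least[of k' "\<lambda>k. (T y ^^ k) v \<in> W"] k' by (simp add: k_def[symmetric])
    moreover have v0: "?v \<in> U0" using funpow_in[of U0 "T y"] TyU0 v by blast
    moreover have "T x ?v \<in> W" if "x \<in> L" for x
    proof -
      obtain m c where mc: "m \<in> M" "x = m + c *\<^sub>R y" using Ly \<open>x \<in> L\<close> by blast
      have "T x ?v = T m ?v + c *\<^sub>R T y ?v"
        by (simp add: mc linear_add[OF lin(2)] linear_scale[OF lin(2)])
      moreover have "T y ?v \<in> W" using k k' by simp
      ultimately show ?thesis using v0 mc W by (simp add: U0_def subspace_add subspace_scale)
    qed
    ultimately show ?thesis by (auto simp: U0_def)
  qed
qed

lemma null_series_reaches:
  fixes T :: "'e \<Rightarrow> 'e \<Rightarrow> 'e"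
  assumes lin: "\<And>x. linear (T x)" and ex: "\<And>i. null_series L T i \<noteq> UNIV \<Longrightarrow> \<exists>v. v \<notin> null_series L T i \<and> (\<forall>x\<in>L. T x v \<in> null_series L T i)"
  obtains k where "null_series L T k = UNIV"
proof (rule subspace_chain_reaches_UNIV[of "null_series L T"])
  show "null_series L T i \<noteq> null_series L T (Suc i)" if "null_series L T i \<noteq> UNIV" for i
    using ex[OF that] by auto
qed (use subspace_null_series[of T L] null_series_inc[of T L] lin that in auto)

text \<open>By Engel the null series exhausts the space, and elements of \<open>L\<close> lower it
  by one step. If all of \<open>L\<close> lowers it by \<open>j\<close> steps, commutators lower it
  by at least \<open>j + 1\<close>; since \<open>L\<close> consists of sums of commutators, the drop
  is unbounded and the action is zero.\<close>

lemma engel_perfect: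
  fixes T :: "'e \<Rightarrow> 'e \<Rightarrow> 'e"
  assumes L: "subalg br L" and T: "lie_rep br L T" and perf: "lie_prod br L L = L"
    and nil: "\<And>x u. x \<in> L \<Longrightarrow> \<exists>k. (T x ^^ k) u = 0" and x: "x \<in> L"
  shows "T x u = 0"
proof -
  note lin = lie_rep_linear[OF T]
  let ?F = "null_series L T"
  have sub: "subspace (?F i)" for i using subspace_null_series lin by blast
  have inc: "?F i \<subseteq> ?F (Suc i)" for i using null_series_inc[of T] lin by blast
  obtain k where k: "?F k = UNIV"
  proof (rule null_series_reaches[of T L])
    fix i assume "?F i \<noteq> UNIV"
    then have "\<exists>v\<in>UNIV - ?F i. \<forall>x\<in>L. T x v \<in> ?F i"
      using engel[OF L T subspace_UNIV sub[of i]] inc[of i] nil subspace_0[OF sub] by (smt (verit, ccfv_threshold) UNIV_I mem_Collect_eq null_series.simps(2) psubsetI subset_UNIV subsetD)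
    then show "\<exists>v. v \<notin> ?F i \<and> (\<forall>x\<in>L. T x v \<in> ?F i)" by blast
  qed (use lin in auto)
  have mono: "?F i \<subseteq> ?F j" if "i \<le> j" for i j using that inc lift_Suc_mono_le[of ?F] by blast
  have "\<forall>x\<in>L. \<forall>i. \<forall>v\<in>?F i. T x v \<in> ?F (i - Suc j)" for j
  proof (induction j)
    case 0
    show ?case
    proof (intro ballI allI)
      fix x i v assume "x \<in> L" "v \<in> ?F i"
      then show "T x v \<in> ?F (i - Suc 0)" using lin by (cases i) (auto simp: linear_0)
    qed
  next
    case (Suc j)
    have "L \<subseteq> {x. \<forall>i. \<forall>v\<in>?F i. T x v \<in> ?F (i - Suc (Suc j))}"
    proof (subst perf[symmetric], rule lie_prod_subset)
      show "subspace {x. \<forall>i. \<forall>v\<in>?F i. T x v \<in> ?F (i - Suc (Suc j))}"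
        using sub linear_0[OF lin(2)] linear_add[OF lin(2)] linear_scale[OF lin(2)] unfolding subspace_def by simp
      fix x y assume xy: "x \<in> L" "y \<in> L"
      have "T x (T y v) \<in> ?F (i - Suc (Suc j))" if "x \<in> L" "y \<in> L" "v \<in> ?F i" for x y i v
      proof -
        have "T x (T y v) \<in> ?F (i - Suc j - Suc j)" using Suc that by blast
        moreover have "?F (i - Suc j - Suc j) \<subseteq> ?F (i - Suc (Suc j))" by (rule mono) simp
        ultimately show ?thesis by blast
      qed
      then show "br x y \<in> {x. \<forall>i. \<forall>v\<in>?F i. T x v \<in> ?F (i - Suc (Suc j))}"
        using xy subspace_diff[OF sub] by (simp add: lie_rep_br[OF T])
    qed
    then show ?case by blast
  qed
  from this[of k] x k show ?thesis by (metis UNIV_I diff_is_0_eq le_SucI order_refl null_series.simps(1) singletonD)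
qed

text \<open>A real substitute for Lie's theorem, where common eigenvectors may fail to exist. Let
  \<open>K\<close> be a hyperplane of \<open>L\<close> containing \<open>[L,L]\<close> and
  \<open>y\<close> outside it. By induction \<open>[K,K]\<close> acts trivially on some nonzero
  \<open>U1/W\<close>. There \<open>[y,b]\<close>, for \<open>b\<close> in \<open>K\<close>, acts as
  a commutator that commutes with \<open>b\<close>, hence nilpotently. As \<open>[L,L]\<close>
  consists of such \<open>[y,b]\<close> modulo \<open>[K,K]\<close>, Engel's theorem applies to
  it.\<close>

lemma solvable_derived_null_vector:
  "subalg br L \<Longrightarrow> lie_solvable br L \<Longrightarrow> lie_rep br L T \<Longrightarrow> subspace U \<Longrightarrow> subspace W \<Longrightarrow> W \<subset> U \<Longrightarrow>
   (\<And>x u. x \<in> L \<Longrightarrow> u \<in> U \<Longrightarrow> T x u \<in> U) \<Longrightarrow> (\<And>x w. x \<in> L \<Longrightarrow> w \<in> W \<Longrightarrow> T x w \<in> W) \<Longrightarrow>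
   \<exists>v\<in>U - W. \<forall>x\<in>lie_prod br L L. T x v \<in> W"
  for T :: "'e \<Rightarrow> 'e \<Rightarrow> 'e"
proof (induction "dim L" arbitrary: L U W rule: less_induct)
  case less
  note L = less.prems(1) and sol = less.prems(2) and T = less.prems(3) and U = less.prems(4) and W = less.prems(5)
    and WU = less.prems(6) and TU = less.prems(7) and TW = less.prems(8)
  have subL: "subspace L" and brL: "\<And>x y. x \<in> L \<Longrightarrow> y \<in> L \<Longrightarrow> br x y \<in> L"
    using L by (auto simp: subalg_def)
  note lin = lie_rep_linear[OF T]
  let ?L' = "lie_prod br L L"
  have L'L: "?L' \<subseteq> L" and subalgL': "subalg br ?L'" using subalg_lie_prod[OF L] by auto
  show ?case
  proof (cases "?L' = L")
    case True
    then have "L = {0}" using sol derived_series_perfect[OF True] by (auto simp: lie_solvable_def)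
    then have "T x v \<in> W" if "x \<in> ?L'" for x v
      using that True subspace_0[OF W] linear_0[OF lin(2)] by simp
    moreover obtain v where "v \<in> U - W" using WU by blast
    ultimately show ?thesis by blast
  next
    case False
    then have "subspace ?L' \<and> ?L' \<subseteq> ?L' \<and> ?L' \<subset> L" using L'L subspace_lie_prod by blast
    then obtain K where "subspace K \<and> ?L' \<subseteq> K \<and> K \<subset> L"
      and max: "\<And>M'. subspace M' \<and> ?L' \<subseteq> M' \<and> M' \<subset> L \<Longrightarrow> dim M' \<le> dim K"
      by (rule max_dim_exists[of "\<lambda>M. subspace M \<and> ?L' \<subseteq> M \<and> M \<subset> L"]) (erule that, blast)
    then have subK: "subspace K" and L'K: "?L' \<subseteq> K" and KL: "K \<subset> L" by auto
    have brK: "br x k \<in> K" "br k x \<in> K" if "x \<in> L" "k \<in> K" for x k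
      using that L'K KL by (auto intro!: subsetD[OF L'K] lie_prod_in)
    have dimK: "dim K < dim L"
      using KL subK subL by (metis dim_subset le_neq_implies_less psubset_eq subspace_dim_equal order_refl)
    have subalgK: "subalg br K" using subK brK KL by (auto simp: subalg_def)
    obtain y where y: "y \<in> L" "y \<notin> K" using KL by blast
    have Ly: "\<exists>m c. m \<in> K \<and> x = m + c *\<^sub>R y" if "x \<in> L" for x
    proof -
      let ?M = "span (insert y K)"
      have "?M \<subseteq> L" using y KL subL by (intro span_minimal) auto
      moreover have "?L' \<subseteq> ?M" using L'K span_superset by fastforce
      moreover have "dim K < dim ?M" using subK y(2) by (simp add: dim_insert span_eq_iff[THEN iffD2])
      ultimately have "?M = L" using max[of ?M] subspace_span[of "insert y K"] by (auto simp: not_le)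
      then have "\<exists>c. x - c *\<^sub>R y \<in> K" using that subK by (auto simp: span_insert span_eq_iff[THEN iffD2])
      then obtain c where "x - c *\<^sub>R y \<in> K" by blast
      then show ?thesis by (intro exI[of _ "x - c *\<^sub>R y"] exI[of _ c]) simp
    qed
    let ?K' = "lie_prod br K K"
    have K'K: "?K' \<subseteq> K" using subalg_lie_prod[OF subalgK] by blast
    have "\<exists>v\<in>U - W. \<forall>x\<in>?K'. T x v \<in> W"
    proof (rule less.hyps[OF dimK subalgK _ _ U W WU])
      show "lie_solvable br K" using lie_solvable_mono[OF sol _ subK] KL by blast
      show "lie_rep br K T" using lie_rep_mono[OF T] KL by blast
    qed (use TU TW KL in auto)
    define U1 where "U1 = {v\<in>U. \<forall>x\<in>?K'. T x v \<in> W}"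
    have subU1: "subspace U1"
      using U W linear_0[OF lin(1)] linear_add[OF lin(1)] linear_scale[OF lin(1)] unfolding U1_def subspace_def by simp
    have K'L: "?K' \<subseteq> L" using K'K KL by blast
    have WU1: "W \<subset> U1"
      using \<open>\<exists>v\<in>U - W. \<forall>x\<in>?K'. T x v \<in> W\<close> WU TW K'L by (auto simp: U1_def)
    have TU1: "T x v \<in> U1" if x: "x \<in> L" and v: "v \<in> U1" for x v
      unfolding U1_def
    proof (intro CollectI conjI ballI)
      show "T x v \<in> U" using TU x v by (simp add: U1_def)
      fix k assume k: "k \<in> ?K'"
      then have xk: "br x k \<in> ?K'" using lie_prod_ideal[of K x K k] brK x by blast
      have "T (br x k) v = T x (T k v) - T k (T x v)"
        using lie_rep_br[OF T x, of k v] k K'L by blast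
      then have "T k (T x v) = T x (T k v) - T (br x k) v" by simp
      then show "T k (T x v) \<in> W" using v k xk TW[OF x] subspace_diff[OF W] by (simp add: U1_def)
    qed
    obtain p where p: "linear p" "\<And>v. p v \<in> U1" "\<And>w. w \<in> W \<Longrightarrow> p w = 0" "\<And>u. u \<in> U1 \<Longrightarrow> p u - u \<in> W" "\<And>v. p (p v) = p v"
      using section_proj_exists[OF subU1 W] WU1 by (metis psubset_imp_subset)
    define S where "S x v = p (T x (p v))" for x v
    have Srep: "lie_rep br L S" and Sp: "\<And>x u. x \<in> L \<Longrightarrow> u \<in> U1 \<Longrightarrow> p (T x (p u)) = p (T x u)"
      unfolding S_def using lie_rep_section[OF T p(1-4) TU1 TW] by blast+
    have nilyb: "\<exists>k. (T (br y b) ^^ k) u \<in> W" if b: "b \<in> K" and u: "u \<in> U1" for b u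
    proof -
      let ?c = "br y b"
      have bL: "b \<in> L" using b KL by blast
      have c: "?c \<in> K" "?c \<in> L" using brK(1)[OF y(1) b] KL by blast+
      \<comment> \<open>The bracket of \<open>b\<close> with \<open>[y,b]\<close> lies in
        \<open>[K,K]\<close>, which acts as zero on \<open>U1/W\<close>.\<close>
      have "S b (S ?c v) = S ?c (S b v)" for v
      proof -
        have "br b ?c \<in> ?K'" using b c lie_prod_in by blast
        then have "S (br b ?c) v = 0" using p(2)[of v] p(3) by (simp add: S_def U1_def)
        then show ?thesis using lie_rep_br[OF Srep bL c(2)] by simp
      qed
      then obtain k where k: "(S ?c ^^ k) (p u) = 0"
        using nilpotent_commutator[OF lie_rep_linear(1)[OF Srep] lie_rep_linear(1)[OF Srep] lie_rep_br[OF Srep y(1) bL]] by blast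
      have inU1: "(T ?c ^^ k) u \<in> U1" for k using funpow_in[of U1 "T ?c"] TU1 c u by blast
      have "p ((T ?c ^^ k) u) = (S ?c ^^ k) (p u)" for k
      proof (induction k)
        case (Suc k)
        have "p ((T ?c ^^ Suc k) u) = p (T ?c (p ((T ?c ^^ k) u)))"
          using Sp[OF c(2) inU1] by simp
        also have "\<dots> = S ?c (p ((T ?c ^^ k) u))" by (simp add: S_def p(5))
        finally show ?case using Suc by simp
      qed simp
      then have "p ((T ?c ^^ k) u) = 0" using k by simp
      then have "- ((T ?c ^^ k) u) \<in> W" using p(4)[OF inU1[of k]] by simp
      then show ?thesis using subspace_neg[OF W] by fastforce
    qed
    have L'dec: "\<exists>b\<in>K. x - br y b \<in> ?K'" if "x \<in> ?L'" for x
    proof -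
      have "?L' \<subseteq> {x. \<exists>b\<in>K. x - br y b \<in> ?K'}"
      proof (rule lie_prod_subset)
        show "subspace {x. \<exists>b\<in>K. x - br y b \<in> ?K'}"
          unfolding subspace_def
        proof (intro conjI allI ballI impI)
          show "0 \<in> {x. \<exists>b\<in>K. x - br y b \<in> ?K'}"
            using subspace_0[OF subK] subspace_0[OF subspace_lie_prod] by (auto simp: br_zero intro!: bexI[of _ 0])
          fix x z assume "x \<in> {x. \<exists>b\<in>K. x - br y b \<in> ?K'}" "z \<in> {x. \<exists>b\<in>K. x - br y b \<in> ?K'}"
          then obtain b b' where "b \<in> K" "b' \<in> K" "x - br y b \<in> ?K'" "z - br y b' \<in> ?K'" by blast
          then show "x + z \<in> {x. \<exists>b\<in>K. x - br y b \<in> ?K'}"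
            using subspace_add[OF subK, of b b'] subspace_add[OF subspace_lie_prod, of "x - br y b" br K K "z - br y b'"]
            by (auto simp: br_add algebra_simps intro!: bexI[of _ "b + b'"])
        next
          fix c x assume "x \<in> {x. \<exists>b\<in>K. x - br y b \<in> ?K'}"
          then obtain b where "b \<in> K" "x - br y b \<in> ?K'" by blast
          then show "c *\<^sub>R x \<in> {x. \<exists>b\<in>K. x - br y b \<in> ?K'}"
            using subspace_scale[OF subK, of b c] subspace_scale[OF subspace_lie_prod, of "x - br y b" br K K c]
            by (auto simp: br_scaleR algebra_simps intro!: bexI[of _ "c *\<^sub>R b"])
        qed
        fix x z assume "x \<in> L" "z \<in> L"
        then obtain m c m' c' where xz: "m \<in> K" "m' \<in> K" "x = m + c *\<^sub>R y" "z = m' + c' *\<^sub>R y"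
          using Ly by metis
        have "br x z - br y (c *\<^sub>R m' - c' *\<^sub>R m) = br m m'"
          using br_antisym[of m y] by (simp add: xz br_add br_diff br_scaleR br_self)
        then show "br x z \<in> {x. \<exists>b\<in>K. x - br y b \<in> ?K'}"
          using xz subK by (auto intro!: bexI[of _ "c *\<^sub>R m' - c' *\<^sub>R m"] lie_prod_in simp: subspace_diff subspace_scale)
      qed
      then show ?thesis using that by blast
    qed
    have "\<exists>v\<in>U1 - W. \<forall>x\<in>?L'. T x v \<in> W"
    proof (rule engel[OF subalgL' lie_rep_mono[OF T L'L] subU1 W WU1])
      fix x u assume x: "x \<in> ?L'" and u: "u \<in> U1"
      show "T x u \<in> U1" using TU1 x u L'L by blast
      obtain b where b: "b \<in> K" "x - br y b \<in> ?K'" using L'dec[OF x] by blast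
      have cL: "br y b \<in> L" using brK(1)[OF y(1) b(1)] KL by blast
      have "(T x ^^ k) u - (T (br y b) ^^ k) u \<in> W \<and> (T (br y b) ^^ k) u \<in> U1" for k
      proof (induction k)
        case 0
        then show ?case using u subspace_0[OF W] by simp
      next
        case (Suc k)
        let ?r = "(T x ^^ k) u" and ?s = "(T (br y b) ^^ k) u"
        have "T x (?r - ?s) \<in> W" using Suc TW x L'L by blast
        moreover have "T (x - br y b) ?s \<in> W" using Suc b(2) by (simp add: U1_def)
        moreover have "T x ?r - T (br y b) ?s = T x (?r - ?s) + T (x - br y b) ?s"
          by (simp add: linear_diff[OF lin(1)] linear_diff[OF lin(2)])
        ultimately show ?case using subspace_add[OF W] TU1[OF cL] Suc by simp
      qed
      moreover obtain k where "(T (br y b) ^^ k) u \<in> W" using nilyb[OF b(1) u] by blast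
      ultimately show "\<exists>k. (T x ^^ k) u \<in> W"
        using subspace_add[OF W] by (metis diff_add_cancel)
    qed (use TW L'L in auto)
    then show ?thesis by (auto simp: U1_def)
  qed
qed

text \<open>The null series of \<open>[g,g]\<close> in \<open>g\<close> consists of ideals and grows
  until it fills the space, by the preceding lemma applied to each quotient; the lower central
  series of \<open>[g,g]\<close> descends along it.\<close>

lemma derived_nilpotent_of_solvable:
  assumes sol: "lie_solvable br UNIV"
  shows "lie_nilpotent br (lie_prod br UNIV UNIV)"
proof -
  let ?h = "lie_prod br UNIV UNIV"
  let ?F = "null_series ?h br"
  have sub: "subspace (?F i)" for i using subspace_null_series linear_br by blast
  have inv: "br x v \<in> ?F i" if "v \<in> ?F i" for i x v
    using that
  proof (induction i arbitrary: x v)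
    case 0
    then show ?case by (simp add: br_zero)
  next
    case (Suc i)
    have "br z (br x v) \<in> ?F i" if z: "z \<in> ?h" for z
    proof -
      have "br z (br x v) = br (br z x) v + br x (br z v)" by (simp add: jacobi')
      moreover have "br (br z x) v \<in> ?F i" using Suc.prems lie_prod_in[of _ UNIV _ UNIV] by auto
      moreover have "br x (br z v) \<in> ?F i" using Suc z by auto
      ultimately show ?thesis using subspace_add[OF sub] by simp
    qed
    then show ?case by simp
  qed
  obtain k where k: "?F k = UNIV"
  proof (rule null_series_reaches[of br ?h])
    fix i assume "?F i \<noteq> UNIV"
    then have "\<exists>v\<in>UNIV - ?F i. \<forall>x\<in>?h. br x v \<in> ?F i"
      using solvable_derived_null_vector[OF _ sol lie_rep_adjoint subspace_UNIV sub[of i]] inv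
      by (auto simp: subalg_def)
    then show "\<exists>v. v \<notin> ?F i \<and> (\<forall>x\<in>?h. br x v \<in> ?F i)" by blast
  qed (use linear_br in auto)
  have "lower_central_series br ?h j \<subseteq> ?F (k - j)" if "j \<le> k" for j
    using that
  proof (induction j)
    case 0
    then show ?case using k by simp
  next
    case (Suc j)
    then have kj: "k - j = Suc (k - Suc j)" by simp
    show ?case
      unfolding lower_central_series.simps using Suc kj by (intro lie_prod_subset sub) auto
  qed
  from this[of k] have "lower_central_series br ?h k = {0}"
    using subspace_0[OF subspace_lower_central_series[OF subspace_lie_prod]] by auto
  then show ?thesis by (auto simp: lie_nilpotent_def)
qed

text \<open>Cartan's criterion: if \<open>Y\<close> is the conjugate semisimple part of \<open>T x\<close>, then \<open>[T b, Y]\<close> is again given by an element of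
  the complexification of \<open>L\<close>, and \<open>tr (T [a, b] Y) = tr (T a [T b, Y]) = 0\<close>.\<close>

lemma cartan_nilpotent:
  fixes T :: "'e \<Rightarrow> 'e \<Rightarrow> 'e"
  assumes L: "subalg br L" and T: "lie_rep br L T" and x: "x \<in> L" "x \<in> lie_prod br L L"
    and tr: "\<And>a b. a \<in> L \<Longrightarrow> b \<in> L \<Longrightarrow> trc (\<lambda>v. T a (T b v)) = 0"
  shows "\<exists>k. (T x ^^ k) u = 0"
proof -
  note lin = lie_rep_linear[OF T]
  have subL: "subspace L" and brL: "\<And>x y. x \<in> L \<Longrightarrow> y \<in> L \<Longrightarrow> br x y \<in> L"
    using L by (auto simp: subalg_def)
  define X where "X = cplx (T x)"
  from cx.conjugate_semisimple_part[OF clin_cplx[OF lin(1)[of x]], folded X_def] obtain Y where Y: "linear Y"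
    "trc (\<lambda>v. X (Y v)) = 0 \<longrightarrow> (\<forall>v. \<exists>k. (X ^^ k) v = 0)"
    "\<forall>Z k \<nu> v. (\<forall>j v. Z (Suc j) v = X (Z j v) - Z j (X v) - cx.csc \<nu> (Z j v)) \<longrightarrow> (\<forall>j. cx.clin (Z j)) \<longrightarrow>
      (\<forall>v. Z k v = 0) \<longrightarrow> Y (Z 0 v) - Z 0 (Y v) = cx.csc (cnj \<nu>) (Z 0 v)"
    by blast
  \<comment> \<open>\<open>R\<close> is the complex linear extension of \<open>T\<close> to pairs
    \<open>c\<close>, which represent elements of the complexification of \<open>L\<close>.\<close>
  define R where "R c w = cplx (T (fst c)) w + cplx_J (cplx (T (snd c)) w)" for c w :: "'e \<times> 'e"
  have clinR: "cx.clin (R c)" for c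
    using lin(1)[of "fst c"] lin(1)[of "snd c"] unfolding R_def cx.clin_def
    by (auto simp: linear_iff cplx_def cplx_J_def algebra_simps linear_neg[OF lin(1)])
  have linRl: "linear (\<lambda>c. R c w)" for w
    using lin(2) unfolding R_def
    by (auto simp: linear_iff cplx_def cplx_J_def algebra_simps split: prod.split)
  have Rcsc: "R (cx.csc l c) w = cx.csc l (R c w)" for l c w
    unfolding R_def cx.csc_def
    by (cases c; cases w) (simp add: cplx_def cplx_J_def linear_add[OF lin(2)] linear_diff[OF lin(2)]
      linear_scale[OF lin(2)] linear_neg[OF lin(2)] algebra_simps)
  define a where "a = cplx (br x)"
  have clina: "cx.clin a" using clin_cplx[OF linear_br(1)] by (simp add: a_def)
  have Ra: "R (a c) w = X (R c w) - R c (X w)" if "c \<in> L \<times> L" for c w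
    using that
    by (cases c; cases w) (simp add: a_def X_def R_def cplx_def cplx_J_def lie_rep_br[OF T x(1)]
      linear_diff[OF lin(1)] linear_add[OF lin(1)] linear_neg[OF lin(1)] algebra_simps)
  have aL: "a c \<in> L \<times> L" "cplx_J c \<in> L \<times> L" if "c \<in> L \<times> L" for c
    using that brL x(1) subL by (auto simp: a_def cplx_def cplx_J_def subspace_neg)
  have subLL: "subspace (L \<times> L)" using subL subspace_Times by blast
  have "\<exists>\<Lambda> E. finite \<Lambda> \<and> (\<forall>l\<in>\<Lambda>. linear (E l) \<and> (\<forall>v\<in>L \<times> L. E l v \<in> L \<times> L \<and> E l (a v) = a (E l v) \<and>
        E l (cplx_J v) = cplx_J (E l v) \<and> (\<exists>k. (cx.shift a l ^^ k) (E l v) = 0))) \<and> (\<forall>v\<in>L \<times> L. (\<Sum>l\<in>\<Lambda>. E l v) = v)"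
    by (rule cx.primary_decomposition[OF clina subLL]) (erule aL)+
  then obtain \<Lambda> E where fin: "finite \<Lambda>"
    and H: "\<forall>l\<in>\<Lambda>. linear (E l) \<and> (\<forall>v\<in>L \<times> L. E l v \<in> L \<times> L \<and> E l (a v) = a (E l v) \<and>
        E l (cplx_J v) = cplx_J (E l v) \<and> (\<exists>k. (cx.shift a l ^^ k) (E l v) = 0))"
    and sumE: "\<forall>v\<in>L \<times> L. (\<Sum>l\<in>\<Lambda>. E l v) = v"
    by - (elim exE conjE, rule that)
  \<comment> \<open>Decompose \<open>b\<close> into generalized eigenvectors of \<open>ad x\<close>.
    Bracketing with \<open>Y\<close> multiplies each component by the conjugate eigenvalue, so the
    result is the action of the correspondingly rescaled sum \<open>c\<close>.\<close>
  have comm: "\<exists>c\<in>L \<times> L. \<forall>w. Y (cplx (T b) w) - cplx (T b) (Y w) = R c w" if b: "b \<in> L" for b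
  proof -
    have b0: "(b, 0) \<in> L \<times> L" using b subspace_0[OF subL] by simp
    have EL: "E l (b, 0) \<in> L \<times> L" if "l \<in> \<Lambda>" for l using H b0 that by blast
    have one: "Y (R (E l (b, 0)) w) - R (E l (b, 0)) (Y w) = cx.csc (cnj l) (R (E l (b, 0)) w)" if l: "l \<in> \<Lambda>" for l w
    proof -
      obtain k where k: "(cx.shift a l ^^ k) (E l (b, 0)) = 0" using H b0 l by blast
      define Z where "Z j = R ((cx.shift a l ^^ j) (E l (b, 0)))" for j
      have "cx.shift a l c \<in> L \<times> L" if "c \<in> L \<times> L" for c
      proof -
        have "cx.csc l c \<in> L \<times> L" by (rule cx.csc_in[OF subLL _ that]) (erule aL)
        then show ?thesis unfolding cx.shift_def by (rule subspace_diff[OF subLL aL(1)[OF that]])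
      qed
      then have inL: "(cx.shift a l ^^ j) (E l (b, 0)) \<in> L \<times> L" for j
        by (rule funpow_in[of "L \<times> L" "cx.shift a l"]) (assumption | rule EL[OF l])+
      have ZS: "Z (Suc j) v = X (Z j v) - Z j (X v) - cx.csc l (Z j v)" for j v
        using linear_diff[OF linRl] by (simp add: Z_def cx.shift_def[of a l "(cx.shift a l ^^ j) (E l (b, 0))"] Rcsc Ra[OF inL])
      have Z0: "Z k v = 0" for v using k linear_0[OF linRl] by (simp add: Z_def)
      have "cx.clin (Z j)" for j by (simp add: Z_def clinR)
      then have "Y (Z 0 w) - Z 0 (Y w) = cx.csc (cnj l) (Z 0 w)"
        using Y(3)[rule_format, of Z l k w] ZS Z0 by blast
      then show ?thesis by (simp add: Z_def)
    qed
    define c where "c = (\<Sum>l\<in>\<Lambda>. cx.csc (cnj l) (E l (b, 0)))"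
    have "c \<in> L \<times> L"
      unfolding c_def using EL cx.csc_in[OF subLL aL(2)] by (intro subspace_sum[OF subLL]) auto
    moreover have "Y (cplx (T b) w) - cplx (T b) (Y w) = R c w" for w
    proof -
      have Rb: "cplx (T b) w = (\<Sum>l\<in>\<Lambda>. R (E l (b, 0)) w)" for w
      proof -
        have "cplx (T b) w = R (b, 0) w"
          by (cases w) (simp add: R_def cplx_def cplx_J_def linear_0[OF lin(2)] zero_prod_def)
        also have "\<dots> = R (\<Sum>l\<in>\<Lambda>. E l (b, 0)) w" using sumE b0 by simp
        finally show ?thesis by (simp add: linear_sum[OF linRl])
      qed
      show ?thesis
        by (simp add: Rb linear_sum[OF Y(1)] sum_subtractf[symmetric] one c_def linear_sum[OF linRl] Rcsc)
    qed
    ultimately show ?thesis by blast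
  qed
  have trR: "trc (\<lambda>w. cplx (T a) (R c w)) = 0" if "a \<in> L" "c \<in> L \<times> L" for a c
  proof -
    have eq: "cplx (T a) (R c w) = cplx (\<lambda>v. T a (T (fst c) v)) w + cplx_J (cplx (\<lambda>v. T a (T (snd c) v)) w)" for w
      by (cases w) (simp add: R_def cplx_def cplx_J_def linear_add[OF lin(1)] linear_neg[OF lin(1)] linear_diff[OF lin(1)])
    have "linear (\<lambda>v. T a (T (snd c) v))" using linear_compose[OF lin(1) lin(1)] by (simp add: o_def)
    then show ?thesis using that tr unfolding eq trc_add by (auto simp: trc_cplx trc_J_cplx)
  qed
  have "lie_prod br L L \<subseteq> {z. trc (\<lambda>w. cplx (T z) (Y w)) = 0}"
  proof (rule lie_prod_subset)
    have "linear (\<lambda>z. trc (\<lambda>w. cplx (T z) (Y w)))"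
    proof (rule linearI)
      fix z z' :: 'e and r :: real
      have "cplx (T (z + z')) w = cplx (T z) w + cplx (T z') w" "cplx (T (r *\<^sub>R z)) w = r *\<^sub>R cplx (T z) w" for w
        by (cases w; simp add: cplx_def linear_add[OF lin(2)] linear_scale[OF lin(2)])+
      then show "trc (\<lambda>w. cplx (T (z + z')) (Y w)) = trc (\<lambda>w. cplx (T z) (Y w)) + trc (\<lambda>w. cplx (T z') (Y w))"
        "trc (\<lambda>w. cplx (T (r *\<^sub>R z)) (Y w)) = r *\<^sub>R trc (\<lambda>w. cplx (T z) (Y w))"
        by (simp_all add: trc_add trc_scaleR)
    qed
    from linear_subspace_kernel[OF this] show "subspace {z. trc (\<lambda>w. cplx (T z) (Y w)) = 0}" .
    fix p q assume pq: "p \<in> L" "q \<in> L"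
    obtain c where c: "c \<in> L \<times> L" "\<And>w. Y (cplx (T q) w) - cplx (T q) (Y w) = R c w" using comm[OF pq(2)] by blast
    have lc: "linear (cplx (T z))" for z using linear_cplx[OF lin(1)] .
    have "trc (\<lambda>w. cplx (T (br p q)) (Y w)) = trc (\<lambda>w. cplx (T p) (cplx (T q) (Y w)) - cplx (T q) (cplx (T p) (Y w)))"
      by (intro arg_cong[of _ _ trc] ext) (auto simp: cplx_def lie_rep_br[OF T pq] split: prod.split)
    also have "\<dots> = trc (\<lambda>w. cplx (T p) (cplx (T q) (Y w))) - trc (\<lambda>w. cplx (T q) (cplx (T p) (Y w)))"
      by (rule trc_diff)
    also have "trc (\<lambda>w. cplx (T q) (cplx (T p) (Y w))) = trc (\<lambda>w. cplx (T p) (Y (cplx (T q) w)))"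
      using trc_commute[OF lc, of "\<lambda>w. cplx (T p) (Y w)"] linear_compose[OF Y(1) lc] by (simp add: o_def)
    also have "trc (\<lambda>w. cplx (T p) (cplx (T q) (Y w))) - trc (\<lambda>w. cplx (T p) (Y (cplx (T q) w)))
        = - trc (\<lambda>w. cplx (T p) (R c w))"
      unfolding c(2)[symmetric] linear_diff[OF lc] trc_diff by simp
    also have "\<dots> = 0" using trR[OF pq(1) c(1)] by simp
    finally show "br p q \<in> {z. trc (\<lambda>w. cplx (T z) (Y w)) = 0}" by simp
  qed
  then have "trc (\<lambda>v. X (Y v)) = 0" using x(2) by (auto simp: X_def)
  then obtain k where "(X ^^ k) (u, 0) = 0" using Y(2) by blast
  then show ?thesis by (auto simp: X_def cplx_funpow zero_prod_def)
qed

text \<open>Cartan's criterion makes every element of \<open>L = [L,L]\<close> act nilpotently, and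
  a perfect algebra of nilpotent operators acts as zero.\<close>

lemma trace_form_zero_imp_trivial:
  fixes T :: "'e \<Rightarrow> 'e \<Rightarrow> 'e"
  assumes "subalg br L" "lie_rep br L T" "lie_prod br L L = L"
    and "\<And>a b. a \<in> L \<Longrightarrow> b \<in> L \<Longrightarrow> trc (\<lambda>v. T a (T b v)) = 0" and "x \<in> L"
  shows "T x u = 0"
  using engel_perfect[OF assms(1-3)] cartan_nilpotent[OF assms(1,2)] assms(3-5) by blast

end

section \<open>Casimir operators\<close>

definition trace_form :: "('a \<Rightarrow> 'v \<Rightarrow> 'v::euclidean_space) \<Rightarrow> 'a \<Rightarrow> 'a \<Rightarrow> real"
  where "trace_form T x y = trc (\<lambda>v. T x (T y v))"

lemma trace_form_sym: "lie_rep br L T \<Longrightarrow> trace_form T x y = trace_form T y x"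
  unfolding trace_form_def using trc_commute lie_rep_linear(1) by blast

lemma trace_form_bilinear:
  fixes T :: "'a::real_vector \<Rightarrow> 'v::euclidean_space \<Rightarrow> 'v"
  assumes T: "lie_rep br L T"
  shows "bilinear (trace_form T)"
proof -
  note lin = lie_rep_linear[OF T]
  have 1: "linear (\<lambda>x. trace_form T x y)" for y
    unfolding trace_form_def
    by (rule linearI) (simp_all add: linear_add[OF lin(2)] linear_scale[OF lin(2)] trc_add trc_scaleR)
  moreover have "linear (\<lambda>y. trace_form T x y)" for x
    using 1[of x] trace_form_sym[OF T] by simp
  ultimately show ?thesis by (simp add: bilinear_def)
qed

lemma trace_form_invariant:
  fixes T :: "'a::real_vector \<Rightarrow> 'v::euclidean_space \<Rightarrow> 'v"
  assumes T: "lie_rep br L T" and L: "x \<in> L" "y \<in> L" "z \<in> L"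
  shows "trace_form T (br x y) z = trace_form T x (br y z)"
proof -
  note lin = lie_rep_linear[OF T]
  have "trc (\<lambda>v. T y (T x (T z v))) = trc (\<lambda>v. T x (T z (T y v)))"
    using trc_commute[OF lin(1), of "\<lambda>v. T x (T z v)" y] linear_compose[OF lin(1) lin(1)] by (simp add: o_def)
  then show ?thesis
    by (simp add: trace_form_def lie_rep_br[OF T] L trc_diff linear_diff[OF lin(1)])
qed

text \<open>Dual bases \<open>e\<close>, \<open>e'\<close> of \<open>L/R\<close> for an invariant
  form whose radical in \<open>L\<close> is the ideal \<open>R\<close>. Everything is stated modulo
  \<open>R\<close> inside \<open>L\<close>, and the quotient algebra is never formed.\<close>

locale casimir_data = euclidean_lie_algebra br for br :: "'e::euclidean_space \<Rightarrow> 'e \<Rightarrow> 'e" +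
  fixes L R :: "'e set" and B :: "'e \<Rightarrow> 'e \<Rightarrow> real" and I :: "'e set" and e e' :: "'e \<Rightarrow> 'e"
  assumes subalg_L: "subalg br L" and subspace_R: "subspace R" and R_sub: "R \<subseteq> L"
    and R_ideal: "x \<in> L \<Longrightarrow> r \<in> R \<Longrightarrow> br x r \<in> R"
    and B_bilinear: "bilinear B" and B_sym: "B x y = B y x"
    and B_inv: "x \<in> L \<Longrightarrow> y \<in> L \<Longrightarrow> z \<in> L \<Longrightarrow> B (br x y) z = B x (br y z)"
    and B_R: "r \<in> R \<Longrightarrow> x \<in> L \<Longrightarrow> B r x = 0"
    and B_nondeg: "x \<in> L \<Longrightarrow> (\<And>y. y \<in> L \<Longrightarrow> B x y = 0) \<Longrightarrow> x \<in> R"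
    and finite_I: "finite I" and e_L: "i \<in> I \<Longrightarrow> e i \<in> L" "i \<in> I \<Longrightarrow> e' i \<in> L"
    and dual_1: "x \<in> L \<Longrightarrow> x - (\<Sum>i\<in>I. B x (e' i) *\<^sub>R e i) \<in> R"
    and dual_2: "x \<in> L \<Longrightarrow> x - (\<Sum>i\<in>I. B x (e i) *\<^sub>R e' i) \<in> R"
    and dual_one: "i \<in> I \<Longrightarrow> B (e i) (e' i) = 1"
begin

lemma L_br: "x \<in> L \<Longrightarrow> y \<in> L \<Longrightarrow> br x y \<in> L"
  using subalg_L by (auto simp: subalg_def)

lemma R_ideal': "r \<in> R \<Longrightarrow> x \<in> L \<Longrightarrow> br r x \<in> R"
  using R_ideal br_antisym[of r x] subspace_neg[OF subspace_R] by metis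

lemma expand_left:
  fixes \<psi> :: "'e \<Rightarrow> 'b::real_vector"
  assumes "linear \<psi>" "\<And>r. r \<in> R \<Longrightarrow> \<psi> r = 0" "x \<in> L"
  shows "\<psi> x = (\<Sum>i\<in>I. B x (e' i) *\<^sub>R \<psi> (e i))" and "\<psi> x = (\<Sum>i\<in>I. B x (e i) *\<^sub>R \<psi> (e' i))"
proof -
  have "\<psi> x - \<psi> (\<Sum>i\<in>I. B x (e' i) *\<^sub>R e i) = 0" "\<psi> x - \<psi> (\<Sum>i\<in>I. B x (e i) *\<^sub>R e' i) = 0"
    using assms dual_1[OF assms(3)] dual_2[OF assms(3)] by (metis linear_diff)+
  then show "\<psi> x = (\<Sum>i\<in>I. B x (e' i) *\<^sub>R \<psi> (e i))" "\<psi> x = (\<Sum>i\<in>I. B x (e i) *\<^sub>R \<psi> (e' i))"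
    using assms(1) by (simp_all add: linear_sum linear_scale)
qed

text \<open>Invariance of the Casimir tensor, tested against a bilinear map: in dual bases the
  matrices of \<open>ad y\<close> are negative transposes of each other.\<close>

lemma casimir_invariance:
  fixes \<phi> :: "'e \<Rightarrow> 'e \<Rightarrow> 'b::real_vector"
  assumes \<phi>: "bilinear \<phi>" and R: "\<And>r x. r \<in> R \<Longrightarrow> x \<in> L \<Longrightarrow> \<phi> r x = 0" "\<And>r x. r \<in> R \<Longrightarrow> x \<in> L \<Longrightarrow> \<phi> x r = 0"
    and y: "y \<in> L"
  shows "(\<Sum>i\<in>I. \<phi> (br (e' i) y) (e i) + \<phi> (e' i) (br (e i) y)) = 0"
proof -
  have l1: "linear (\<lambda>a. \<phi> a b)" and l2: "linear (\<phi> a)" for a b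
    using \<phi> by (auto simp: bilinear_def)
  have "(\<Sum>i\<in>I. \<phi> (br (e' i) y) (e i)) = (\<Sum>i\<in>I. \<Sum>j\<in>I. B (br (e' i) y) (e j) *\<^sub>R \<phi> (e' j) (e i))"
    by (intro sum.cong refl expand_left(2)[OF l1] R L_br y e_L)
  moreover have "(\<Sum>i\<in>I. \<phi> (e' i) (br (e i) y)) = (\<Sum>i\<in>I. \<Sum>j\<in>I. B (br (e i) y) (e' j) *\<^sub>R \<phi> (e' i) (e j))"
    by (intro sum.cong refl expand_left(1)[OF l2] R L_br y e_L)
  moreover have "\<dots> = (\<Sum>i\<in>I. \<Sum>j\<in>I. B (br (e j) y) (e' i) *\<^sub>R \<phi> (e' j) (e i))"
    by (rule sum.swap)
  moreover have "B (br (e j) y) (e' i) = - B (br (e' i) y) (e j)" if "i \<in> I" "j \<in> I" for i j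
  proof -
    have "B (br (e j) y) (e' i) = B (br y (e' i)) (e j)"
      using B_inv[OF e_L(1)[OF that(2)] y e_L(2)[OF that(1)]] B_sym by simp
    then show ?thesis
      using br_antisym[of y "e' i"] B_bilinear by (simp add: bilinear_lneg)
  qed
  ultimately show ?thesis
    by (simp add: sum.distrib sum_negf)
qed

end

context euclidean_lie_algebra
begin

text \<open>An orthonormal basis of a complement \<open>Q\<close> of \<open>R\<close> serves as
  \<open>e\<close>. The map \<open>S\<close> represents \<open>B\<close> on \<open>Q\<close> through
  the inner product; it is bijective by nondegeneracy, and its inverse supplies the dual
  basis.\<close>

lemma casimir_data_exists:
  assumes L: "subalg br L" and R: "subspace R" "R \<subseteq> L" "\<And>x r. x \<in> L \<Longrightarrow> r \<in> R \<Longrightarrow> br x r \<in> R"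
    and B: "bilinear B" "\<And>x y. B x y = B y x"
      "\<And>x y z. x \<in> L \<Longrightarrow> y \<in> L \<Longrightarrow> z \<in> L \<Longrightarrow> B (br x y) z = B x (br y z)"
      "\<And>r x. r \<in> R \<Longrightarrow> x \<in> L \<Longrightarrow> B r x = 0"
      "\<And>x. x \<in> L \<Longrightarrow> (\<And>y. y \<in> L \<Longrightarrow> B x y = 0) \<Longrightarrow> x \<in> R"
  shows "\<exists>I e e'. casimir_data br L R B I e e'"
proof -
  have subL: "subspace L" using L by (simp add: subalg_def)
  obtain p where p: "linear p" "\<And>v. p v \<in> L" "\<And>w. w \<in> R \<Longrightarrow> p w = 0" "\<And>u. u \<in> L \<Longrightarrow> p u - u \<in> R" "\<And>v. p (p v) = p v"
    using section_proj_exists[OF subL R(1,2)] by blast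
  define Q where "Q = range p"
  have subQ: "subspace Q" unfolding Q_def using linear_subspace_image[OF p(1) subspace_UNIV] .
  have QL: "Q \<subseteq> L" using p(2) by (auto simp: Q_def)
  have pQ: "p q = q" if "q \<in> Q" for q using that p(5) by (auto simp: Q_def)
  obtain I where I: "I \<subseteq> Q" "pairwise orthogonal I" "\<And>x. x \<in> I \<Longrightarrow> norm x = 1" "independent I" "span I = Q"
    using orthonormal_basis_subspace[OF subQ] by metis
  have fin: "finite I" using I(4) independent_bound by blast
  have onb: "b \<bullet> c = (if b = c then 1 else 0)" if "b \<in> I" "c \<in> I" for b c
    using that I(2,3) by (auto simp: pairwise_def orthogonal_def norm_eq_1)
  have Bl: "linear (B x)" "linear (\<lambda>x. B x y)" for x y using B(1) by (auto simp: bilinear_def)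
  define S where "S x = (\<Sum>i\<in>I. B x i *\<^sub>R i)" for x
  have linS: "linear S" unfolding S_def
    by (intro linear_compose_sum ballI linearI) (simp_all add: linear_add[OF Bl(2)] linear_scale[OF Bl(2)] scaleR_add_left)
  have SQ: "S x \<in> Q" for x
    unfolding S_def using I(1) subQ by (intro subspace_sum subspace_scale) auto
  have Sin: "S x \<bullet> j = B x j" if "j \<in> I" for x j
  proof -
    have "S x \<bullet> j = (\<Sum>i\<in>I. if i = j then B x i else 0)"
      unfolding S_def inner_sum_left using onb that by (intro sum.cong) auto
    then show ?thesis using fin that by simp
  qed
  have perpQ: "x \<in> R" if x: "x \<in> L" and 0: "\<And>i. i \<in> I \<Longrightarrow> B x i = 0" for x
  proof (rule B(5)[OF x])
    fix y assume y: "y \<in> L"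
    have "p y \<in> span I" using I(5) by (simp add: Q_def)
    then have "B x (p y) = 0"
      using linear_eq_0_on_span[OF Bl(1)] 0 by blast
    moreover have "B x (p y - y) = 0" using B(2,4) p(4)[OF y] x by metis
    ultimately show "B x y = 0" using linear_diff[OF Bl(1)] by simp
  qed
  have injS: "inj_on S Q"
  proof (rule inj_onI)
    fix x y assume xy: "x \<in> Q" "y \<in> Q" "S x = S y"
    then have q: "x - y \<in> Q" using subspace_diff[OF subQ] by blast
    have "S (x - y) = 0" using xy linear_diff[OF linS] by simp
    then have "x - y \<in> R" using perpQ[of "x - y"] Sin[of _ "x - y"] q QL by force
    then show "x = y" using p(3) pQ[OF q] by fastforce
  qed
  have "S ` Q = Q"
  proof (rule subspace_dim_equal)
    show "subspace (S ` Q)" using linear_subspace_image[OF linS subQ] .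
    show "dim Q \<le> dim (S ` Q)"
      using dim_image_eq[OF linS, of Q] injS subQ by (simp add: span_eq_iff[THEN iffD2])
  qed (use SQ subQ in auto)
  then have "i \<in> S ` Q" if "i \<in> I" for i using that I(1) by (simp add: subsetD)
  then have "\<exists>q. q \<in> Q \<and> S q = i" if "i \<in> I" for i using that by (metis imageE)
  then obtain e' where e': "\<And>i. i \<in> I \<Longrightarrow> e' i \<in> Q" "\<And>i. i \<in> I \<Longrightarrow> S (e' i) = i" by metis
  have dual: "B (e' i) j = (if i = j then 1 else 0)" if "i \<in> I" "j \<in> I" for i j
    using Sin[OF that(2), of "e' i"] e'(2)[OF that(1)] onb[OF that] by simp
  have "casimir_data br L R B I (\<lambda>i. i) e'"
  proof (unfold_locales)
    fix x assume x: "x \<in> L"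
    have exp: "p x = (\<Sum>i\<in>I. (p x \<bullet> i) *\<^sub>R i)"
    proof -
      have "p x \<in> span I" using I(5) by (simp add: Q_def)
      moreover have "linear (\<lambda>v. \<Sum>i\<in>I. (v \<bullet> i) *\<^sub>R i)"
        by (intro linear_compose_sum ballI linearI) (simp_all add: inner_add_left scaleR_add_left)
      moreover have "(\<Sum>i\<in>I. (j \<bullet> i) *\<^sub>R i) = j" if "j \<in> I" for j
      proof -
        have "(\<Sum>i\<in>I. (j \<bullet> i) *\<^sub>R i) = (\<Sum>i\<in>I. if i = j then i else 0)"
          using onb that by (intro sum.cong) auto
        then show ?thesis using fin that by simp
      qed
      ultimately show ?thesis
        using linear_eq_on_span[of "\<lambda>v. v" "\<lambda>v. \<Sum>i\<in>I. (v \<bullet> i) *\<^sub>R i" I "p x"] by (simp add: linear_ident)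
    qed
    have "B x (e' j) = p x \<bullet> j" if "j \<in> I" for j
    proof -
      have eL: "e' j \<in> L" using e'(1)[OF that] QL by blast
      have "B (p x - x) (e' j) = 0" using B(4)[OF p(4)[OF x] eL] .
      then have "B x (e' j) = B (p x) (e' j)" using linear_diff[OF Bl(2)] by simp
      also have "\<dots> = B (e' j) (p x)" by (rule B(2))
      also have "\<dots> = (\<Sum>i\<in>I. (p x \<bullet> i) * B (e' j) i)"
        by (subst exp) (simp add: linear_sum[OF Bl(1)] linear_scale[OF Bl(1)])
      also have "\<dots> = (\<Sum>i\<in>I. if i = j then p x \<bullet> i else 0)"
        using dual[OF that] by (intro sum.cong) auto
      also have "\<dots> = p x \<bullet> j" using fin that by simp
      finally show ?thesis .
    qed
    then have "(\<Sum>i\<in>I. B x (e' i) *\<^sub>R i) = p x" by (subst exp) (intro sum.cong, auto)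
    then show "x - (\<Sum>i\<in>I. B x (e' i) *\<^sub>R i) \<in> R"
      using subspace_neg[OF R(1) p(4)[OF x]] by simp
    have sL: "(\<Sum>i\<in>I. B x i *\<^sub>R e' i) \<in> L"
      using e'(1) QL by (intro subspace_sum[OF subL] subspace_scale[OF subL]) auto
    show "x - (\<Sum>i\<in>I. B x i *\<^sub>R e' i) \<in> R"
    proof (rule perpQ)
      show "x - (\<Sum>i\<in>I. B x i *\<^sub>R e' i) \<in> L" using x sL subspace_diff[OF subL] by blast
      fix j assume j: "j \<in> I"
      have "B (\<Sum>i\<in>I. B x i *\<^sub>R e' i) j = (\<Sum>i\<in>I. if i = j then B x i else 0)"
        unfolding linear_sum[OF Bl(2)] linear_scale[OF Bl(2)] using dual j by (intro sum.cong) auto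
      also have "\<dots> = B x j" using fin j by simp
      finally show "B (x - (\<Sum>i\<in>I. B x i *\<^sub>R e' i)) j = 0" by (simp add: linear_diff[OF Bl(2)])
    qed
  next
    fix i assume i: "i \<in> I"
    show "i \<in> L" "e' i \<in> L" using i I(1) QL e'(1) by auto
    show "B i (e' i) = 1" using dual[OF i i] B(2)[of i] by simp
  qed (use L R B fin in auto)
  then show ?thesis by blast
qed

text \<open>The Killing form of \<open>L/R\<close> being nondegenerate, its Casimir operator is the identity of \<open>L/R\<close>;
  hence the derivation \<open>x \<mapsto> G x\<close> of \<open>L/R\<close> into its dual is inner.\<close>

lemma quotient_coadjoint_derivation_inner:
  assumes L: "subalg br L" and R: "subspace R" "R \<subseteq> L" "\<And>x r. x \<in> L \<Longrightarrow> r \<in> R \<Longrightarrow> br x r \<in> R"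
    and p: "linear p" "\<And>v. p v \<in> L" "\<And>w. w \<in> R \<Longrightarrow> p w = 0" "\<And>u. u \<in> L \<Longrightarrow> p u - u \<in> R" "\<And>v. p (p v) = p v"
    and nondeg: "\<And>x. x \<in> L \<Longrightarrow> (\<And>y. y \<in> L \<Longrightarrow> trace_form (\<lambda>x v. p (br x (p v))) x y = 0) \<Longrightarrow> x \<in> R"
    and G: "bilinear G" "\<And>r x. r \<in> R \<Longrightarrow> x \<in> L \<Longrightarrow> G r x = 0" "\<And>r x. r \<in> R \<Longrightarrow> x \<in> L \<Longrightarrow> G x r = 0"
      "\<And>x y z. x \<in> L \<Longrightarrow> y \<in> L \<Longrightarrow> z \<in> L \<Longrightarrow> G (br x y) z = G x (br y z) - G y (br x z)"
  shows "\<exists>\<theta>. linear \<theta> \<and> (\<forall>x\<in>L. \<forall>y\<in>L. G x y = \<theta> (br x y)) \<and> (\<forall>r\<in>R. \<theta> r = (0::real))"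
proof -
  have subL: "subspace L" and brL: "\<And>x y. x \<in> L \<Longrightarrow> y \<in> L \<Longrightarrow> br x y \<in> L"
    using L by (auto simp: subalg_def)
  define T where "T x v = p (br x (p v))" for x v
  have T: "lie_rep br L T" and pT: "\<And>x u. x \<in> L \<Longrightarrow> u \<in> L \<Longrightarrow> p (br x (p u)) = p (br x u)"
    unfolding T_def using lie_rep_section[OF lie_rep_adjoint p(1-4) brL R(3)] by blast+
  let ?B = "trace_form T"
  have TR: "T r v = 0" if "r \<in> R" for r v
  proof -
    have "br r (p v) \<in> R" using R(3)[OF p(2) that] br_antisym[of r "p v"] subspace_neg[OF R(1)] by metis
    then show ?thesis using p(3) by (simp add: T_def)
  qed
  have BR: "?B r x = 0" if "r \<in> R" for r x using TR[OF that] by (simp add: trace_form_def trc_zero)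
  have "\<exists>I e e'. casimir_data br L R ?B I e e'"
    using casimir_data_exists[OF L R trace_form_bilinear[OF T] trace_form_sym[OF T] trace_form_invariant[OF T] BR]
      nondeg unfolding T_def by blast
  then obtain I e e' where "casimir_data br L R ?B I e e'" by blast
  then interpret C: casimir_data br L R ?B I e e' .
  have Gl: "linear (G x)" "linear (\<lambda>x. G x y)" for x y using G(1) by (auto simp: bilinear_def)
  have Bl: "linear (?B x)" "linear (\<lambda>x. ?B x y)" for x y
    using trace_form_bilinear[OF T] by (auto simp: bilinear_def)
  \<comment> \<open>The cocycle \<open>G\<close> is contracted with the Casimir tensor. This yields
    a primitive of \<open>G\<close> with \<open>Cas\<close> applied to its second argument.\<close>
  define \<theta> where "\<theta> v = (\<Sum>i\<in>I. G (e i) (br (e' i) v))" for v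
  define Cas where "Cas w = (\<Sum>i\<in>I. br (e i) (br (e' i) w))" for w
  have CasL: "Cas w \<in> L" if "w \<in> L" for w
    unfolding Cas_def using that C.e_L brL by (intro subspace_sum[OF subL]) auto
  have GCas: "G z (Cas w) = \<theta> (br z w)" if z: "z \<in> L" and w: "w \<in> L" for z w
  proof -
    have inv: "(\<Sum>i\<in>I. G (e i) (br (br (e' i) z) w) + G (br (e i) z) (br (e' i) w)) = 0"
    proof (rule C.casimir_invariance[of "\<lambda>a b. G b (br a w)", OF _ _ _ z])
      show "bilinear (\<lambda>a b. G b (br a w))"
        unfolding bilinear_def using Gl(2) linear_compose[OF linear_br(2) Gl(1)] by (simp add: o_def)
    qed (use G(2,3) w brL C.R_ideal' in auto)
    have "G z (Cas w) = (\<Sum>i\<in>I. G z (br (e i) (br (e' i) w)))"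
      by (simp add: Cas_def linear_sum[OF Gl(1)])
    also have "\<dots> = (\<Sum>i\<in>I. G (e i) (br (e' i) (br z w)) - (G (e i) (br (br (e' i) z) w) + G (br (e i) z) (br (e' i) w)))"
    proof (intro sum.cong refl)
      fix i assume i: "i \<in> I"
      have "G z (br (e i) (br (e' i) w)) = G (br z (e i)) (br (e' i) w) + G (e i) (br z (br (e' i) w))"
        using G(4)[OF z C.e_L(1)[OF i] brL[OF C.e_L(2)[OF i] w]] by simp
      moreover have "br (e' i) (br z w) = br (br (e' i) z) w + br z (br (e' i) w)" by (simp add: jacobi')
      moreover have "G (br z (e i)) (br (e' i) w) = - G (br (e i) z) (br (e' i) w)"
        using br_antisym[of z "e i"] linear_neg[OF Gl(2)] by simp
      ultimately show "G z (br (e i) (br (e' i) w)) = G (e i) (br (e' i) (br z w)) - (G (e i) (br (br (e' i) z) w) + G (br (e i) z) (br (e' i) w))"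
        by (simp add: linear_add[OF Gl(1)])
    qed
    also have "\<dots> = \<theta> (br z w)"
      unfolding sum_subtractf inv by (simp add: \<theta>_def)
    finally show ?thesis .
  qed
  \<comment> \<open>The trace defining the form at \<open>w\<close>, \<open>v\<close> is expanded in
    the dual bases, and invariance moves the brackets until \<open>Cas w\<close> appears in place of
    \<open>w\<close>; nondegeneracy then compares the two.\<close>
  have CasB: "Cas w - w \<in> R" if w: "w \<in> L" for w
  proof (rule C.B_nondeg)
    show "Cas w - w \<in> L" using CasL[OF w] w subspace_diff[OF subL] by blast
    fix v assume v: "v \<in> L"
    have pB: "?B (p u) z = ?B u z" if "u \<in> L" for u z
      using BR[OF p(4)[OF that]] linear_diff[OF Bl(2)] by simp
    have TT: "T w (T v u) = (\<Sum>i\<in>I. ?B (T w (T v u)) (e' i) *\<^sub>R p (e i))" for u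
    proof -
      have "T w (T v u) = p (T w (T v u))" by (simp add: T_def p(5))
      also have "\<dots> = (\<Sum>i\<in>I. ?B (T w (T v u)) (e' i) *\<^sub>R p (e i))"
        by (rule C.expand_left(1)[OF p(1,3)]) (auto simp: T_def p(2))
      finally show ?thesis .
    qed
    have linTT: "linear (\<lambda>u. ?B (T w (T v u)) z)" for z
      using linear_compose[OF linear_compose[OF lie_rep_linear(1)[OF T, of v] lie_rep_linear(1)[OF T, of w]] Bl(2)[of z]]
      by (simp add: o_def)
    have "?B w v = trc (\<lambda>u. \<Sum>i\<in>I. ?B (T w (T v u)) (e' i) *\<^sub>R p (e i))"
      unfolding trace_form_def[of T w v] by (rule arg_cong[of _ _ trc], rule ext, rule TT)
    also have "\<dots> = (\<Sum>i\<in>I. ?B (T w (T v (p (e i)))) (e' i))"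
      by (simp add: trc_sum trc_rank_one[OF linTT])
    also have "\<dots> = (\<Sum>i\<in>I. ?B (br (e i) (br (e' i) w)) v)"
    proof (intro sum.cong refl)
      fix i assume i: "i \<in> I"
      note eL = C.e_L(1)[OF i] C.e_L(2)[OF i]
      have "T w (T v (p (e i))) = p (br w (br v (e i)))"
        using pT[OF v eL(1)] pT[OF w brL[OF v eL(1)]] by (simp add: T_def p(5))
      then have "?B (T w (T v (p (e i)))) (e' i) = ?B (br w (br v (e i))) (e' i)"
        using pB brL w v eL by simp
      also have "\<dots> = ?B w (br (br v (e i)) (e' i))" using C.B_inv w v eL brL by simp
      also have "\<dots> = ?B (br (br v (e i)) (e' i)) w" by (rule C.B_sym)
      also have "\<dots> = ?B (br v (e i)) (br (e' i) w)" using C.B_inv w v eL brL by simp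
      also have "\<dots> = ?B v (br (e i) (br (e' i) w))" using C.B_inv w v eL brL by simp
      also have "\<dots> = ?B (br (e i) (br (e' i) w)) v" by (rule C.B_sym)
      finally show "?B (T w (T v (p (e i)))) (e' i) = ?B (br (e i) (br (e' i) w)) v" .
    qed
    also have "\<dots> = ?B (Cas w) v" by (simp add: Cas_def linear_sum[OF Bl(2)])
    finally show "?B (Cas w - w) v = 0" by (simp add: linear_diff[OF Bl(2)])
  qed
  show ?thesis
  proof (intro exI[of _ \<theta>] conjI ballI)
    show "linear \<theta>" unfolding \<theta>_def
      using linear_compose[OF linear_br(1) Gl(1)] by (intro linear_compose_sum) (simp add: o_def)
    fix x y assume xy: "x \<in> L" "y \<in> L"
    have "G x (Cas y - y) = 0" using G(3)[OF CasB[OF xy(2)] xy(1)] .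
    then show "G x y = \<theta> (br x y)" using GCas[OF xy] linear_diff[OF Gl(1)] by simp
  next
    fix r assume "r \<in> R"
    then show "\<theta> r = 0" unfolding \<theta>_def using G(3) C.R_ideal C.e_L by (intro sum.neutral) blast
  qed
qed

text \<open>If the trace form of \<open>A = R/[R,R]\<close> is nondegenerate on \<open>L/R\<close>, its Casimir operator \<open>C\<close> yields a derivation \<open>\<delta>\<close> of \<open>L\<close> into \<open>A\<close>
  restricting to \<open>C\<close> on \<open>R\<close>; the kernel of \<open>C\<^sup>n \<delta>\<close> is then a proper subalgebra complementing \<open>R\<close>.\<close>

lemma no_nontrivial_abelian_section:
  assumes L: "subalg br L" and perf: "lie_prod br L L = L"
    and min: "\<And>M. subalg br M \<Longrightarrow> M \<subset> L \<Longrightarrow> lie_solvable br M"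
    and R: "subspace R" "R \<subset> L" "\<And>x r. x \<in> L \<Longrightarrow> r \<in> R \<Longrightarrow> br x r \<in> R"
    and p: "linear p" "\<And>v. p v \<in> R" "\<And>w. w \<in> lie_prod br R R \<Longrightarrow> p w = 0" "\<And>u. u \<in> R \<Longrightarrow> p u - u \<in> lie_prod br R R" "\<And>v. p (p v) = p v"
    and nondeg: "\<And>x. x \<in> L \<Longrightarrow> (\<And>y. y \<in> L \<Longrightarrow> trace_form (\<lambda>x v. p (br x (p v))) x y = 0) \<Longrightarrow> x \<in> R"
  shows False
proof -
  have subL: "subspace L" and brL: "\<And>x y. x \<in> L \<Longrightarrow> y \<in> L \<Longrightarrow> br x y \<in> L"
    using L by (auto simp: subalg_def)
  have RL: "R \<subseteq> L" using R(2) by blast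
  let ?R' = "lie_prod br R R"
  have R'ideal: "br x z \<in> ?R'" if "x \<in> L" "z \<in> ?R'" for x z
    using lie_prod_ideal[of R x R z] R(3)[OF that(1)] that(2) by blast
  define T where "T x v = p (br x (p v))" for x v
  have T: "lie_rep br L T" and pT: "\<And>x u. x \<in> L \<Longrightarrow> u \<in> R \<Longrightarrow> p (br x (p u)) = p (br x u)"
    unfolding T_def using lie_rep_section[OF lie_rep_adjoint p(1-4) R(3) R'ideal] by blast+
  note lin = lie_rep_linear[OF T]
  let ?B = "trace_form T"
  have TR: "T r v = 0" if "r \<in> R" for r v
    using p(3)[OF lie_prod_in[OF that p(2)]] by (simp add: T_def)
  have BR: "?B r x = 0" if "r \<in> R" for r x using TR[OF that] by (simp add: trace_form_def trc_zero)
  have "\<exists>I e e'. casimir_data br L R ?B I e e'"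
    using casimir_data_exists[OF L R(1) RL R(3) trace_form_bilinear[OF T] trace_form_sym[OF T] trace_form_invariant[OF T] BR]
      nondeg unfolding T_def by blast
  then obtain I e e' where "casimir_data br L R ?B I e e'" by blast
  then interpret C: casimir_data br L R ?B I e e' .
  define Cas where "Cas v = (\<Sum>i\<in>I. T (e i) (T (e' i) v))" for v
  have linT2: "linear (\<lambda>v. T x (T y v))" for x y using linear_compose[OF lin(1) lin(1)] by (simp add: o_def)
  have linCas: "linear Cas" unfolding Cas_def using linT2 by (intro linear_compose_sum) simp
  \<comment> \<open>This is the coboundary of \<open>p\<close>, a 1-cochain of \<open>L\<close> with
    values in \<open>R/[R,R]\<close>. It vanishes as soon as one argument lies in \<open>R\<close>,
    so it is a 2-cocycle of \<open>L/R\<close>.\<close>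
  define f where "f x y = T x (p y) - T y (p x) - p (br x y)" for x y
  have bilf: "bilinear f"
  proof -
    have "linear (f x)" "linear (\<lambda>x. f x y)" for x y
      unfolding f_def using linear_compose[OF p(1) lin(1)] lin(2) linear_compose[OF linear_br(1) p(1)] linear_compose[OF linear_br(2) p(1)]
      by (auto intro!: linear_compose_sub simp: o_def)
    then show ?thesis by (simp add: bilinear_def)
  qed
  have fl: "linear (f x)" "linear (\<lambda>x. f x y)" for x y using bilf by (auto simp: bilinear_def)
  have fanti: "f x y = - f y x" for x y
    using br_antisym[of x y] linear_neg[OF p(1)] by (simp add: f_def)
  have fR: "f r y = 0" if "r \<in> R" "y \<in> L" for r y
  proof -
    have "T y (p r) = p (br y r)" using pT[OF that(2,1)] by (simp add: T_def p(5))
    then show ?thesis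
      using TR[OF that(1)] br_antisym[of r y] linear_neg[OF p(1)] by (simp add: f_def)
  qed
  have cocycle: "T x (f y z) = T y (f x z) - T z (f x y) + f (br x y) z - f (br x z) y + f (br y z) x"
    if xyz: "x \<in> L" "y \<in> L" "z \<in> L" for x y z
  proof -
    have J: "p (br (br x y) z) = p (br (br x z) y) - p (br (br y z) x)"
    proof -
      have "br (br x y) z = br (br x z) y - br (br y z) x"
        using jacobi'[of x y z] br_antisym[of x "br y z"] br_antisym[of y "br x z"] by simp
      then show ?thesis by (simp add: linear_diff[OF p(1)])
    qed
    show ?thesis
      by (simp add: f_def linear_diff[OF lin(1)] lie_rep_br[OF T] xyz J)
  qed
  \<comment> \<open>Contraction of \<open>f\<close> with the Casimir tensor; \<open>Casf\<close>
    says that its coboundary is \<open>Cas\<close> applied to \<open>f\<close>.\<close>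
  define h where "h z = (\<Sum>i\<in>I. T (e i) (f (e' i) z))" for z
  have linh: "linear h" unfolding h_def
    using linear_compose[OF fl(1) lin(1)] by (intro linear_compose_sum) (simp add: o_def)
  have hR: "h r = 0" if "r \<in> R" for r
  proof -
    have "f (e' i) r = 0" if "i \<in> I" for i
      using fR[OF \<open>r \<in> R\<close> C.e_L(2)[OF that]] fanti[of "e' i" r] by simp
    then show ?thesis by (simp add: h_def linear_0[OF lin(1)])
  qed
  have invf: "(\<Sum>i\<in>I. T (e i) (f (br (e' i) y) z) + T (br (e i) y) (f (e' i) z)) = 0" if "y \<in> L" "z \<in> L" for y z
  proof (rule C.casimir_invariance[of "\<lambda>a b. T b (f a z)", OF _ _ _ that(1)])
    show "bilinear (\<lambda>a b. T b (f a z))"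
      unfolding bilinear_def using lin(2) linear_compose[OF fl(2) lin(1)] by (simp add: o_def)
  qed (use fR TR that linear_0[OF lin(1)] in auto)
  have invT: "(\<Sum>i\<in>I. T (e i) (T (br (e' i) y) v) + T (br (e i) y) (T (e' i) v)) = 0" if "y \<in> L" for y v
  proof (rule C.casimir_invariance[of "\<lambda>a b. T b (T a v)", OF _ _ _ that])
    show "bilinear (\<lambda>a b. T b (T a v))"
      unfolding bilinear_def using lin(2) linear_compose[OF lin(2) lin(1)] by (simp add: o_def)
  qed (use TR linear_0[OF lin(1)] in auto)
  have CasT: "Cas (T y v) = T y (Cas v)" if y: "y \<in> L" for y v
  proof -
    have "Cas (T y v) - T y (Cas v) = (\<Sum>i\<in>I. T (e i) (T (br (e' i) y) v) + T (br (e i) y) (T (e' i) v))"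
      unfolding Cas_def linear_sum[OF lin(1)] sum_subtractf[symmetric]
      by (intro sum.cong refl) (simp add: lie_rep_br[OF T C.e_L(1) y] lie_rep_br[OF T C.e_L(2) y] linear_diff[OF lin(1)])
    then show ?thesis using invT[OF y] by simp
  qed
  have Casf: "Cas (f y z) = T y (h z) - T z (h y) - h (br y z)" if yz: "y \<in> L" "z \<in> L" for y z
  proof -
    have "T (e i) (T (e' i) (f y z)) = T y (T (e i) (f (e' i) z)) - T z (T (e i) (f (e' i) y)) - T (e i) (f (e' i) (br y z))
      + ((T (e i) (f (br (e' i) y) z) + T (br (e i) y) (f (e' i) z)) - (T (e i) (f (br (e' i) z) y) + T (br (e i) z) (f (e' i) y)))"
      if i: "i \<in> I" for i
    proof -
      note eL = C.e_L(1)[OF i] C.e_L(2)[OF i]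
      have "T (e i) (T (e' i) (f y z)) = T (e i) (T y (f (e' i) z)) - T (e i) (T z (f (e' i) y)) + T (e i) (f (br (e' i) y) z)
          - T (e i) (f (br (e' i) z) y) + T (e i) (f (br y z) (e' i))"
        unfolding cocycle[OF eL(2) yz] by (simp add: linear_diff[OF lin(1)] linear_add[OF lin(1)])
      moreover have "T (e i) (f (br y z) (e' i)) = - T (e i) (f (e' i) (br y z))"
        using fanti[of "br y z" "e' i"] by (simp add: linear_neg[OF lin(1)])
      ultimately show ?thesis
        by (simp add: lie_rep_br[OF T eL(1)] yz algebra_simps)
    qed
    then have "Cas (f y z) = (\<Sum>i\<in>I. T y (T (e i) (f (e' i) z)) - T z (T (e i) (f (e' i) y)) - T (e i) (f (e' i) (br y z))
      + ((T (e i) (f (br (e' i) y) z) + T (br (e i) y) (f (e' i) z)) - (T (e i) (f (br (e' i) z) y) + T (br (e i) z) (f (e' i) y))))"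
      by (simp add: Cas_def)
    also have "\<dots> = T y (h z) - T z (h y) - h (br y z)"
      unfolding sum.distrib[of "\<lambda>i. _ i - _ i"] sum_subtractf invf[OF yz] invf[OF yz(2,1)]
      by (simp add: h_def linear_sum[OF lin(1)] sum_subtractf)
    finally show ?thesis .
  qed
  \<comment> \<open>Both terms have the same coboundary, so their difference is a derivation. The
    second term vanishes on \<open>R\<close>, where only \<open>Cas\<close> remains.\<close>
  define \<delta> where "\<delta> x = Cas (p x) - h x" for x
  have lin\<delta>: "linear \<delta>" unfolding \<delta>_def
    using linear_compose[OF p(1) linCas] linh by (intro linear_compose_sub) (simp_all add: o_def)
  have \<delta>br: "\<delta> (br x y) = T x (\<delta> y) - T y (\<delta> x)" if xy: "x \<in> L" "y \<in> L" for x y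
  proof -
    have "Cas (f x y) = T x (Cas (p y)) - T y (Cas (p x)) - Cas (p (br x y))"
      by (simp add: f_def linear_diff[OF linCas] CasT xy)
    then show ?thesis
      using Casf[OF xy] by (simp add: \<delta>_def linear_diff[OF lin(1)] algebra_simps)
  qed
  have "I \<noteq> {}"
  proof
    assume "I = {}"
    then have "L \<subseteq> R" using C.dual_1 by auto
    then show False using R(2) by blast
  qed
  \<comment> \<open>The trace counts the basis of \<open>L/R\<close>, so \<open>Cas\<close> is not
    nilpotent. On the image of its stable power \<open>?N\<close> it is bijective, which later
    splits every element of \<open>L\<close> into parts from \<open>M\<close> and
    \<open>R\<close>.\<close>
  have "trc Cas = (\<Sum>i\<in>I. ?B (e i) (e' i))"
    unfolding Cas_def trc_sum trace_form_def ..
  also have "\<dots> = real (card I)" using C.dual_one by simp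
  finally have "trc Cas \<noteq> 0" using \<open>I \<noteq> {}\<close> C.finite_I by simp
  then obtain v0 where v0: "\<And>k. (Cas ^^ k) v0 \<noteq> 0" using trc_nilpotent[OF linCas] by blast
  obtain n where n: "\<And>m v. (Cas ^^ m) v = 0 \<Longrightarrow> (Cas ^^ n) v = 0" using fitting_index[OF linCas] by blast
  let ?N = "Cas ^^ n"
  have linN: "linear ?N" using linear_funpow[OF linCas] .
  have subN: "subspace (range ?N)" using linear_subspace_image[OF linN subspace_UNIV] .
  have image: "Cas ` range ?N = range ?N"
  proof (rule subspace_dim_equal)
    show "subspace (Cas ` range ?N)" using linear_subspace_image[OF linCas subN] .
    show "Cas ` range ?N \<subseteq> range ?N" by (auto simp: funpow_swap1)
    have "inj_on Cas (range ?N)"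
    proof (rule inj_onI)
      fix x y assume "x \<in> range ?N" "y \<in> range ?N" "Cas x = Cas y"
      then obtain a b where ab: "x = ?N a" "y = ?N b" "Cas (?N a) = Cas (?N b)" by auto
      then have "(Cas ^^ Suc n) (a - b) = 0" by (simp add: linear_diff[OF linN] linear_diff[OF linCas])
      then have "?N (a - b) = 0" by (rule n)
      then show "x = y" by (simp add: ab linear_diff[OF linN])
    qed
    then show "dim (range ?N) \<le> dim (Cas ` range ?N)"
      using dim_image_eq[OF linCas, of "range ?N"] subN by (simp add: span_eq_iff[THEN iffD2])
  qed (fact subN)
  then have range: "\<exists>w. ?N v = ?N (Cas w)" for v
  proof -
    have "?N v \<in> Cas ` range ?N" unfolding image by blast
    then obtain w where "?N v = Cas (?N w)" by blast
    then show ?thesis by (auto simp: funpow_swap1)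
  qed
  have Casp: "Cas (p v) = Cas v" for v by (simp add: Cas_def T_def p(5))
  have N\<delta>p: "?N (\<delta> (p w)) = ?N (Cas w)" for w
    using hR[OF p(2)] by (simp add: \<delta>_def p(5) Casp)
  define M where "M = {x\<in>L. ?N (\<delta> x) = 0}"
  have NT: "?N (T y v) = T y (?N v)" if "y \<in> L" for y v
    using funpow_commute[of "T y" Cas n v] CasT[OF that] by simp
  have "subspace M"
    unfolding M_def subspace_def
    using subL by (simp add: linear_0[OF linN] linear_add[OF linN] linear_scale[OF linN]
      linear_0[OF lin\<delta>] linear_add[OF lin\<delta>] linear_scale[OF lin\<delta>] subspace_0 subspace_add subspace_scale)
  moreover have "br x y \<in> M" if "x \<in> M" "y \<in> M" for x y
    using that brL by (simp add: M_def \<delta>br linear_diff[OF linN] NT linear_0[OF lin(1)])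
  ultimately have subM: "subalg br M" by (simp add: subalg_def)
  have "M \<noteq> L"
  proof
    assume "M = L"
    then have "p v0 \<in> M" using p(2) RL by blast
    then have "?N (Cas v0) = 0" using N\<delta>p by (simp add: M_def)
    then show False using v0[of "Suc n"] by (simp add: funpow_swap1)
  qed
  then have "lie_solvable br M" using min[OF subM] by (auto simp: M_def)
  then obtain k where k: "derived_series br M k = {0}" by (auto simp: lie_solvable_def)
  \<comment> \<open>Since \<open>L = M + R\<close> with \<open>R\<close> an ideal, the derived
    series of \<open>L\<close> stays in that of \<open>M\<close> plus \<open>R\<close>. For solvable
    \<open>M\<close> and perfect \<open>L\<close> this would give \<open>L\<close> contained in
    \<open>R\<close>.\<close>
  have "derived_series br L j \<subseteq> {m + r | m r. m \<in> derived_series br M j \<and> r \<in> R} \<and> derived_series br M j \<subseteq> L" for j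
  proof (induction j)
    case 0
    have "\<exists>m r. x = m + r \<and> m \<in> M \<and> r \<in> R" if "x \<in> L" for x
    proof -
      obtain w where w: "?N (\<delta> x) = ?N (Cas w)" using range by blast
      have "?N (\<delta> (x - p w)) = 0" using N\<delta>p w by (simp add: linear_diff[OF lin\<delta>] linear_diff[OF linN])
      moreover have "x - p w \<in> L" using subspace_diff[OF subL that, of "p w"] p(2) RL by blast
      ultimately have "x - p w \<in> M" by (simp add: M_def)
      then show ?thesis using p(2)[of w] by (intro exI[of _ "x - p w"] exI[of _ "p w"]) simp
    qed
    then show ?case by (auto simp: M_def)
  next
    case (Suc j)
    let ?DM = "derived_series br M j" and ?DL = "derived_series br L j"
    have sub: "subspace {m + r | m r. m \<in> lie_prod br ?DM ?DM \<and> r \<in> R}"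
      using subspace_sums[OF subspace_lie_prod R(1)] by simp
    have "lie_prod br ?DL ?DL \<subseteq> {m + r | m r. m \<in> lie_prod br ?DM ?DM \<and> r \<in> R}"
    proof (rule lie_prod_subset[OF sub])
      fix x y assume "x \<in> ?DL" "y \<in> ?DL"
      then obtain m r m' r' where xy: "x = m + r" "y = m' + r'" "m \<in> ?DM" "m' \<in> ?DM" "r \<in> R" "r' \<in> R"
        using Suc by blast
      have mL: "m \<in> L" "m' \<in> L" "r \<in> L" using xy Suc RL by auto
      have "br x y = br m m' + (br m r' + (br r m' + br r r'))" by (simp add: xy br_add)
      moreover have "br m r' + (br r m' + br r r') \<in> R"
        using xy mL R(3) C.R_ideal' subspace_add[OF R(1)] by simp
      ultimately show "br x y \<in> {m + r | m r. m \<in> lie_prod br ?DM ?DM \<and> r \<in> R}"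
        using lie_prod_in[OF xy(3,4)] by blast
    qed
    moreover have "lie_prod br ?DM ?DM \<subseteq> L" using Suc brL by (intro lie_prod_subset subL) auto
    ultimately show ?case by simp
  qed
  from this[of k] have "L \<subseteq> R" unfolding k derived_series_perfect[OF perf] by auto
  then show False using R(2) by blast
qed

text \<open>Let \<open>L\<close> be a nonsolvable subalgebra of least dimension and \<open>R\<close>
  a proper ideal of \<open>L\<close> of largest dimension; \<open>L\<close> is perfect and
  \<open>R\<close> solvable. If \<open>R\<close> were nonzero, \<open>L\<close> would act trivially
  on \<open>R/[R,R]\<close>, and a functional on that quotient would be at once zero and nonzero.
  Hence \<open>R = {0}\<close>, and the inner derivation given by the primitive plus the trace form
  forces the latter to vanish on \<open>L\<close>.\<close>

lemma exact_killing_form_imp_solvable: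
  assumes \<beta>: "bilinear \<beta>" "\<And>x. \<beta> x x = 0"
    and exact: "\<And>x y z. trace_form br (br x y) z = \<beta> (br x y) z + \<beta> (br y z) x + \<beta> (br z x) y"
  shows "lie_solvable br UNIV"
proof (rule ccontr)
  assume "\<not> lie_solvable br UNIV"
  then have "subalg br UNIV \<and> \<not> lie_solvable br UNIV" by (simp add: subalg_def)
  then obtain L where L: "subalg br L" "\<not> lie_solvable br L"
    and least: "\<And>M. subalg br M \<and> \<not> lie_solvable br M \<Longrightarrow> dim L \<le> dim M"
    using ex_has_least_nat[of "\<lambda>L. subalg br L \<and> \<not> lie_solvable br L" UNIV dim] by blast
  have subL: "subspace L" and brL: "\<And>x y. x \<in> L \<Longrightarrow> y \<in> L \<Longrightarrow> br x y \<in> L"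
    using L by (auto simp: subalg_def)
  have min: "lie_solvable br M" if "subalg br M" "M \<subset> L" for M
  proof (rule ccontr)
    assume "\<not> lie_solvable br M"
    then have "dim L \<le> dim M" using least that by blast
    then show False using that subL subspace_dim_equal[of M L] by (auto simp: subalg_def)
  qed
  have perf: "lie_prod br L L = L"
    using subalg_lie_prod[OF L(1)] min lie_solvable_lie_prod L(2) by blast
  have "lie_solvable br {0}" unfolding lie_solvable_def by (rule exI[of _ 0]) simp
  then have "L \<noteq> {0}" using L(2) by blast
  let ?id = "\<lambda>R. subspace R \<and> R \<subset> L \<and> (\<forall>x\<in>L. \<forall>r\<in>R. br x r \<in> R)"
  have "?id {0}" using \<open>L \<noteq> {0}\<close> subspace_0[OF subL] by (auto simp: br_zero)
  then obtain R where R0: "?id R" and max: "\<And>R'. ?id R' \<Longrightarrow> dim R' \<le> dim R"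
    by (rule max_dim_exists[of ?id]) (erule that, blast)
  have R: "subspace R" "R \<subset> L" "\<And>x r. x \<in> L \<Longrightarrow> r \<in> R \<Longrightarrow> br x r \<in> R" and RL: "R \<subseteq> L" using R0 by auto
  have solR: "lie_solvable br R" using min[of R] R by (auto simp: subalg_def)
  \<comment> \<open>The radical of the trace form is an ideal. It is proper by Cartan's criterion
    and contains \<open>R\<close>, so it is \<open>R\<close> by maximality.\<close>
  have nondeg: "x \<in> R" if T: "lie_rep br L T" and TR: "\<And>r v. r \<in> R \<Longrightarrow> T r v = 0" and nz: "\<exists>x\<in>L. \<exists>v. T x v \<noteq> 0"
      and x: "x \<in> L" and x0: "\<And>y. y \<in> L \<Longrightarrow> trace_form T x y = 0" for T :: "'e \<Rightarrow> 'e \<Rightarrow> 'e" and x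
  proof -
    note Bb = trace_form_bilinear[OF T]
    define I where "I = {x\<in>L. \<forall>y\<in>L. trace_form T x y = 0}"
    have "subspace I"
      unfolding I_def subspace_def using subL Bb
      by (simp add: bilinear_ladd bilinear_lmul bilinear_lzero subspace_0 subspace_add subspace_scale)
    moreover have "br x r \<in> I" if "x \<in> L" "r \<in> I" for x r
    proof -
      have "trace_form T (br x r) y = 0" if "y \<in> L" for y
      proof -
        have "trace_form T (br x r) y = - trace_form T (br r x) y"
          using br_antisym[of x r] Bb by (simp add: bilinear_lneg)
        also have "\<dots> = - trace_form T r (br x y)"
          using trace_form_invariant[OF T] \<open>x \<in> L\<close> \<open>r \<in> I\<close> that by (simp add: I_def)
        finally show ?thesis using \<open>x \<in> L\<close> \<open>r \<in> I\<close> that brL by (simp add: I_def)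
      qed
      then show ?thesis using that brL by (simp add: I_def)
    qed
    moreover have "I \<noteq> L"
    proof
      assume "I = L"
      then have "\<And>a b. a \<in> L \<Longrightarrow> b \<in> L \<Longrightarrow> trc (\<lambda>v. T a (T b v)) = 0"
        unfolding I_def trace_form_def by blast
      from trace_form_zero_imp_trivial[OF L(1) T perf this] nz show False by blast
    qed
    ultimately have "?id I" by (auto simp: I_def)
    then have "dim I \<le> dim R" by (rule max)
    moreover have "R \<subseteq> I" using TR RL by (auto simp: I_def trace_form_def trc_zero)
    ultimately have "R = I" using subspace_dim_equal[OF R(1) \<open>subspace I\<close>] by blast
    then show ?thesis using x x0 by (simp add: I_def)
  qed
  obtain p where p: "linear p" "\<And>v. p v \<in> L" "\<And>w. w \<in> R \<Longrightarrow> p w = 0" "\<And>u. u \<in> L \<Longrightarrow> p u - u \<in> R" "\<And>v. p (p v) = p v"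
    using section_proj_exists[OF subL R(1) RL] by blast
  have Q: "lie_rep br L (\<lambda>x v. p (br x (p v)))" and pQ: "\<And>x u. x \<in> L \<Longrightarrow> u \<in> L \<Longrightarrow> p (br x (p u)) = p (br x u)"
    using lie_rep_section[OF lie_rep_adjoint p(1-4) brL R(3)] by blast+
  have nondegQ: "x \<in> R" if "x \<in> L" "\<And>y. y \<in> L \<Longrightarrow> trace_form (\<lambda>x v. p (br x (p v))) x y = 0" for x
  proof (rule nondeg[OF Q _ _ that])
    fix r v assume "r \<in> R"
    then have "br r (p v) \<in> R" using R(3)[OF p(2)] br_antisym[of r "p v"] subspace_neg[OF R(1)] by metis
    then show "p (br r (p v)) = 0" by (rule p(3))
  next
    show "\<exists>x\<in>L. \<exists>v. p (br x (p v)) \<noteq> 0"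
    proof (rule ccontr)
      assume "\<not> ?thesis"
      then have 0: "p (br x y) = 0" if "x \<in> L" "y \<in> L" for x y using pQ that by metis
      have "br x y \<in> R" if "x \<in> L" "y \<in> L" for x y
        using p(4)[OF brL[OF that]] 0[OF that] subspace_neg[OF R(1)] by fastforce
      then have "lie_prod br L L \<subseteq> R" by (intro lie_prod_subset R(1))
      then show False using perf R(2) by blast
    qed
  qed
  note inner = quotient_coadjoint_derivation_inner[OF L(1) R(1) RL R(3) p nondegQ]
  have "R = {0}"
  proof (rule ccontr)
    assume "R \<noteq> {0}"
    let ?R' = "lie_prod br R R"
    have R'R: "?R' \<subseteq> R" using R RL by (intro lie_prod_subset) auto
    have "?R' \<noteq> R" using solR derived_series_perfect[of br R] \<open>R \<noteq> {0}\<close> by (auto simp: lie_solvable_def)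
    then obtain u0 where u0: "u0 \<in> R" "u0 \<notin> ?R'" using R'R by blast
    have R'ideal: "br x z \<in> ?R'" if "x \<in> L" "z \<in> ?R'" for x z
      using lie_prod_ideal[of R x R z] R(3)[OF that(1)] that(2) by blast
    obtain q where q: "linear q" "\<And>v. q v \<in> R" "\<And>w. w \<in> ?R' \<Longrightarrow> q w = 0" "\<And>u. u \<in> R \<Longrightarrow> q u - u \<in> ?R'" "\<And>v. q (q v) = q v"
      using section_proj_exists[OF R(1) subspace_lie_prod R'R] by blast
    have A: "lie_rep br L (\<lambda>x v. q (br x (q v)))" and qA: "\<And>x u. x \<in> L \<Longrightarrow> u \<in> R \<Longrightarrow> q (br x (q u)) = q (br x u)"
      using lie_rep_section[OF lie_rep_adjoint q(1-4) R(3) R'ideal] by blast+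
    have triv: "br x u \<in> ?R'" if "x \<in> L" "u \<in> R" for x u
    proof (rule ccontr)
      assume nin: "br x u \<notin> ?R'"
      have "q (br x (q u)) \<noteq> 0"
      proof
        assume "q (br x (q u)) = 0"
        then have "- br x u \<in> ?R'" using qA[OF that] q(4)[OF R(3)[OF that]] by simp
        then show False using nin subspace_neg[OF subspace_lie_prod] by fastforce
      qed
      then have nz: "\<exists>x\<in>L. \<exists>v. q (br x (q v)) \<noteq> 0" using that by blast
      have "q (br r (q v)) = 0" if "r \<in> R" for r v
        using q(3)[OF lie_prod_in[OF that q(2)]] .
      from no_nontrivial_abelian_section[OF L(1) perf min R q nondeg[OF A this nz]] show False by blast
    qed
    obtain s where s: "linear s" "\<And>v. s v \<in> ?R'" "\<And>w. w \<in> ?R' \<Longrightarrow> s w = w"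
      using orth_proj_exists[OF subspace_lie_prod] by metis
    \<comment> \<open>A functional that vanishes on \<open>[R,R]\<close> but not at
      \<open>u0\<close>. As \<open>[L,R]\<close> lies in \<open>[R,R]\<close>, the form
      \<open>\<pi> (br x y)\<close> lives on \<open>L/R\<close> and is inner there. So
      \<open>\<pi>\<close> agrees on \<open>L = [L,L]\<close> with a functional vanishing on
      \<open>R\<close>, which is impossible at \<open>u0\<close>.\<close>
    define \<pi> where "\<pi> x = (x - s x) \<bullet> (u0 - s u0)" for x
    have lin\<pi>: "linear \<pi>" unfolding \<pi>_def
      by (rule linearI) (simp_all add: linear_add[OF s(1)] linear_scale[OF s(1)] inner_diff_left inner_add_left algebra_simps)
    have \<pi>R': "\<pi> x = 0" if "x \<in> ?R'" for x using s(3)[OF that] by (simp add: \<pi>_def)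
    have "u0 - s u0 \<noteq> 0" using s(2)[of u0] u0 by auto
    then have \<pi>u0: "\<pi> u0 \<noteq> 0" by (simp add: \<pi>_def)
    have "\<exists>\<theta>. linear \<theta> \<and> (\<forall>x\<in>L. \<forall>y\<in>L. \<pi> (br x y) = \<theta> (br x y)) \<and> (\<forall>r\<in>R. \<theta> r = (0::real))"
    proof (rule inner[of "\<lambda>x y. \<pi> (br x y)"])
      show "bilinear (\<lambda>x y. \<pi> (br x y))"
        unfolding bilinear_def using linear_compose[OF linear_br(1) lin\<pi>] linear_compose[OF linear_br(2) lin\<pi>] by (simp add: o_def)
      fix r x assume "r \<in> R" "x \<in> L"
      then show "\<pi> (br x r) = 0" using triv \<pi>R' by blast
      then show "\<pi> (br r x) = 0" using br_antisym[of r x] linear_neg[OF lin\<pi>] by simp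
    next
      fix x y z
      show "\<pi> (br (br x y) z) = \<pi> (br x (br y z)) - \<pi> (br y (br x z))"
        by (simp add: jacobi' linear_diff[OF lin\<pi>])
    qed blast+
    then obtain \<theta> where \<theta>: "linear \<theta>" "\<And>x y. x \<in> L \<Longrightarrow> y \<in> L \<Longrightarrow> \<pi> (br x y) = \<theta> (br x y)" "\<And>r. r \<in> R \<Longrightarrow> \<theta> r = 0"
      by blast
    have "lie_prod br L L \<subseteq> {z. \<pi> z - \<theta> z = 0}"
      using \<theta>(2) linear_subspace_kernel[OF linear_compose_sub[OF lin\<pi> \<theta>(1)]] by (intro lie_prod_subset) auto
    then have "\<pi> u0 = \<theta> u0" using perf u0 RL by auto
    then show False using \<theta>(3) u0 \<pi>u0 by simp
  qed
  have ad: "lie_rep br UNIV br" by (rule lie_rep_adjoint)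
  note Bb = trace_form_bilinear[OF ad]
  have \<beta>anti: "\<beta> x y = - \<beta> y x" for x y
  proof -
    have "\<beta> x y + \<beta> y x = \<beta> (x + y) (x + y)"
      unfolding bilinear_ladd[OF \<beta>(1)] bilinear_radd[OF \<beta>(1)] by (simp add: \<beta>(2))
    then show ?thesis by (simp add: \<beta>(2))
  qed
  \<comment> \<open>In the derivation identity the trace form alone counts its value at
    \<open>[x,y]\<close>, \<open>z\<close> once too often, and by exactness \<open>\<beta>\<close>
    makes up for precisely this amount.\<close>
  let ?G = "\<lambda>x y. \<beta> x y + trace_form br x y"
  have bilG: "bilinear ?G"
    using \<beta>(1) Bb unfolding bilinear_def by (auto intro: linear_compose_add)
  have "\<exists>\<theta>. linear \<theta> \<and> (\<forall>x\<in>L. \<forall>y\<in>L. ?G x y = \<theta> (br x y)) \<and> (\<forall>r\<in>R. \<theta> r = (0::real))"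
  proof (rule inner[of ?G])
    show "bilinear ?G" by (rule bilG)
    fix r x assume "r \<in> R"
    then have "r = 0" using \<open>R = {0}\<close> by simp
    then show "?G r x = 0" "?G x r = 0" using bilG bilinear_lzero bilinear_rzero by blast+
  next
    fix x y z
    have 1: "trace_form br x (br y z) = trace_form br (br x y) z" "trace_form br y (br x z) = - trace_form br (br x y) z"
      using trace_form_invariant[OF ad, of x y z] trace_form_invariant[OF ad, of y x z] br_antisym[of x y] Bb
      by (simp_all add: bilinear_lneg)
    have "\<beta> y (br x z) = \<beta> (br z x) y" using \<beta>anti[of y "br x z"] br_antisym[of x z] \<beta>(1) by (simp add: bilinear_lneg)
    then show "?G (br x y) z = ?G x (br y z) - ?G y (br x z)"
      using exact[of x y z] 1 \<beta>anti[of x "br y z"] by simp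
  qed blast+
  then obtain \<theta> where \<theta>: "\<And>x y. x \<in> L \<Longrightarrow> y \<in> L \<Longrightarrow> ?G x y = \<theta> (br x y)" "linear \<theta>" by blast
  \<comment> \<open>Adding the identities for \<open>(x, y)\<close> and \<open>(y, x)\<close>
    cancels the antisymmetric \<open>\<beta>\<close> and \<open>\<theta> (br x y)\<close> and leaves
    twice the trace form.\<close>
  have "trace_form br x y = 0" if "x \<in> L" "y \<in> L" for x y
    using \<theta>(1)[OF that] \<theta>(1)[OF that(2,1)] \<beta>anti[of x y] trace_form_sym[OF ad, of x y] br_antisym[of x y] linear_neg[OF \<theta>(2)]
    by simp
  then have "br x u = 0" if "x \<in> L" for x u
    using trace_form_zero_imp_trivial[OF L(1) lie_rep_adjoint perf _ that] by (simp add: trace_form_def)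
  then have "lie_prod br L L \<subseteq> {0}" by (intro lie_prod_subset) auto
  then show False using perf \<open>L \<noteq> {0}\<close> subspace_0[OF subL] by auto
qed

lemma exact_killing_form_imp_derived_nilpotent:
  assumes "bilinear \<beta>" "\<And>x. \<beta> x x = 0"
    and "\<And>x y z. trace_form br (br x y) z = \<beta> (br x y) z + \<beta> (br y z) x + \<beta> (br z x) y"
  shows "lie_nilpotent br (lie_prod br UNIV UNIV)"
  using derived_nilpotent_of_solvable exact_killing_form_imp_solvable assms by blast

end

section \<open>Vanishing of the second and third cohomology\<close>

text \<open>Curried 2-forms, so that multilinear computations become plain rewriting;
  \<open>two_three_trivial_exact\<close> makes the passage from functions on lists.\<close>

definition alternating2 :: "('a::real_vector \<Rightarrow> 'a \<Rightarrow> real) \<Rightarrow> bool"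
  where "alternating2 \<sigma> \<longleftrightarrow> bilinear \<sigma> \<and> (\<forall>x. \<sigma> x x = 0)"

definition alternating3 :: "('a::real_vector \<Rightarrow> 'a \<Rightarrow> 'a \<Rightarrow> real) \<Rightarrow> bool"
  where "alternating3 \<omega> \<longleftrightarrow>
    (\<forall>x y. linear (\<lambda>z. \<omega> z x y) \<and> linear (\<lambda>z. \<omega> x z y) \<and> linear (\<lambda>z. \<omega> x y z)) \<and>
    (\<forall>x y. \<omega> x x y = 0 \<and> \<omega> x y x = 0 \<and> \<omega> x y y = 0)"

text \<open>These are the negatives of the Chevalley--Eilenberg differentials of a 2-form and of a 3-form.\<close>

definition diff2 :: "('a \<Rightarrow> 'a \<Rightarrow> 'a) \<Rightarrow> ('a \<Rightarrow> 'a \<Rightarrow> real) \<Rightarrow> 'a \<Rightarrow> 'a \<Rightarrow> 'a \<Rightarrow> real"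
  where "diff2 br \<beta> x y z = \<beta> (br x y) z + \<beta> (br y z) x + \<beta> (br z x) y"

definition diff3 :: "('a \<Rightarrow> 'a \<Rightarrow> 'a) \<Rightarrow> ('a \<Rightarrow> 'a \<Rightarrow> 'a \<Rightarrow> real) \<Rightarrow> 'a \<Rightarrow> 'a \<Rightarrow> 'a \<Rightarrow> 'a \<Rightarrow> real"
  where "diff3 br \<omega> w x y z = \<omega> (br w x) y z - \<omega> (br w y) x z + \<omega> (br x y) w z
    + \<omega> (br w z) x y - \<omega> (br x z) w y + \<omega> (br y z) w x"

definition closed2_exact :: "('a::real_vector \<Rightarrow> 'a \<Rightarrow> 'a) \<Rightarrow> bool"
  where "closed2_exact br \<longleftrightarrow> (\<forall>\<sigma>. alternating2 \<sigma> \<and> (\<forall>x y z. diff2 br \<sigma> x y z = 0) \<longrightarrow>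
    (\<exists>\<theta>. linear \<theta> \<and> (\<forall>x y. \<sigma> x y = \<theta> (br x y))))"

definition closed3_exact :: "('a::real_vector \<Rightarrow> 'a \<Rightarrow> 'a) \<Rightarrow> bool"
  where "closed3_exact br \<longleftrightarrow> (\<forall>\<omega>. alternating3 \<omega> \<and> (\<forall>w x y z. diff3 br \<omega> w x y z = 0) \<longrightarrow>
    (\<exists>\<beta>. alternating2 \<beta> \<and> (\<forall>x y z. \<omega> x y z = diff2 br \<beta> x y z)))"

lemma alternating2_antisym:
  assumes "alternating2 \<sigma>"
  shows "\<sigma> x y = - \<sigma> y x"
proof -
  have b: "bilinear \<sigma>" and 0: "\<And>x. \<sigma> x x = 0" using assms by (auto simp: alternating2_def)
  have "\<sigma> x y + \<sigma> y x = \<sigma> (x + y) (x + y)"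
    unfolding bilinear_ladd[OF b] bilinear_radd[OF b] by (simp add: 0)
  then show ?thesis by (simp add: 0)
qed

lemma alternating3_antisym:
  assumes "alternating3 \<omega>"
  shows "\<omega> x y z = - \<omega> y x z" "\<omega> x y z = - \<omega> x z y" "\<omega> x y z = - \<omega> z y x"
proof -
  have l: "\<omega> (a + b) c d = \<omega> a c d + \<omega> b c d" "\<omega> c (a + b) d = \<omega> c a d + \<omega> c b d" "\<omega> c d (a + b) = \<omega> c d a + \<omega> c d b" for a b c d
    using assms linear_add[of "\<lambda>z. \<omega> z c d" a b] linear_add[of "\<lambda>z. \<omega> c z d" a b] linear_add[of "\<lambda>z. \<omega> c d z" a b]
    by (simp_all add: alternating3_def)
  have 0: "\<omega> a a b = 0" "\<omega> a b a = 0" "\<omega> b a a = 0" for a b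
    using assms by (auto simp: alternating3_def)
  have "\<omega> x y z + \<omega> y x z = \<omega> (x + y) (x + y) z" unfolding l by (simp add: 0)
  then show "\<omega> x y z = - \<omega> y x z" by (simp only: 0 eq_neg_iff_add_eq_0)
  have "\<omega> x y z + \<omega> x z y = \<omega> x (y + z) (y + z)" unfolding l by (simp add: 0)
  then show "\<omega> x y z = - \<omega> x z y" by (simp only: 0 eq_neg_iff_add_eq_0)
  have "\<omega> x y z + \<omega> z y x = \<omega> (x + z) y (x + z)" unfolding l by (simp add: 0)
  then show "\<omega> x y z = - \<omega> z y x" by (simp only: 0 eq_neg_iff_add_eq_0)
qed

text \<open>\<open>quot_dim\<close> selects a basis with \<open>SOME\<close>, so its value carries
  information only when some basis exists. A family independent modulo \<open>W\<close> of largest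
  size is one, and \<open>N\<close> bounds the sizes.\<close>

lemma basis_mod_exists:
  assumes W: "subspace W" and bound: "\<And>S. finite S \<Longrightarrow> S \<subseteq> V \<Longrightarrow> independent S \<Longrightarrow> card S \<le> N"
  shows "\<exists>S. basis_mod V W S"
proof -
  define P where "P S \<longleftrightarrow> finite S \<and> S \<subseteq> V \<and> (\<forall>c. (\<Sum>s\<in>S. c s *\<^sub>R s) \<in> W \<longrightarrow> (\<forall>s\<in>S. c s = 0))" for S
  have card: "card S \<le> N" if "P S" for S
  proof (rule bound)
    show "independent S"
      using that subspace_0[OF W] dependent_finite[of S] by (auto simp: P_def)
  qed (use that in \<open>auto simp: P_def\<close>)
  have "P {}" by (simp add: P_def)
  then obtain S where S: "P S" and max: "\<And>T. P T \<Longrightarrow> card T \<le> card S"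
    using ex_has_greatest_nat[of P "{}" card "Suc N"] card by (auto simp: less_Suc_eq_le)
  have fin: "finite S" using S by (simp add: P_def)
  have "\<exists>c. v - (\<Sum>s\<in>S. c s *\<^sub>R s) \<in> W" if v: "v \<in> V" for v
  proof (rule ccontr)
    assume no: "\<not> ?thesis"
    have "v \<notin> S"
    proof
      assume "v \<in> S"
      have "(\<Sum>s\<in>S. (if s = v then 1 else 0) *\<^sub>R s) = (\<Sum>s\<in>S. if s = v then s else 0)"
        by (intro sum.cong) auto
      then have "v - (\<Sum>s\<in>S. (if s = v then 1 else 0) *\<^sub>R s) \<in> W"
        using fin \<open>v \<in> S\<close> subspace_0[OF W] by simp
      then have "\<exists>c. v - (\<Sum>s\<in>S. c s *\<^sub>R s) \<in> W" by (rule exI[of _ "\<lambda>s. if s = v then 1 else 0"])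
      then show False using no by contradiction
    qed
    have "P (insert v S)"
      unfolding P_def
    proof (intro conjI allI impI)
      fix c assume c: "(\<Sum>s\<in>insert v S. c s *\<^sub>R s) \<in> W"
      then have c': "c v *\<^sub>R v + (\<Sum>s\<in>S. c s *\<^sub>R s) \<in> W" using fin \<open>v \<notin> S\<close> by simp
      have "c v = 0"
      proof (rule ccontr)
        assume cv: "c v \<noteq> 0"
        have "(1 / c v) *\<^sub>R (c v *\<^sub>R v + (\<Sum>s\<in>S. c s *\<^sub>R s)) \<in> W" using c' subspace_scale[OF W] by blast
        moreover have "(1 / c v) *\<^sub>R (c v *\<^sub>R v + (\<Sum>s\<in>S. c s *\<^sub>R s)) = v - (\<Sum>s\<in>S. (- (c s / c v)) *\<^sub>R s)"
          using cv by (simp add: scaleR_add_right scaleR_sum_right sum_negf)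
        ultimately have "v - (\<Sum>s\<in>S. (- (c s / c v)) *\<^sub>R s) \<in> W" by (simp only:)
        then have "\<exists>c. v - (\<Sum>s\<in>S. c s *\<^sub>R s) \<in> W" by (rule exI[of _ "\<lambda>s. - (c s / c v)"])
        then show False using no by contradiction
      qed
      moreover have "\<forall>s\<in>S. c s = 0" using c' \<open>c v = 0\<close> S by (simp add: P_def)
      ultimately show "\<forall>s\<in>insert v S. c s = 0" by blast
    qed (use S v in \<open>auto simp: P_def\<close>)
    from max[OF this] show False using fin \<open>v \<notin> S\<close> by simp
  qed
  then have "basis_mod V W S" using S by (auto simp: P_def basis_mod_def)
  then show ?thesis by blast
qed

lemma quot_dim_eq_0:
  assumes "\<exists>S. basis_mod V W S" and "quot_dim V W = 0"
  shows "V \<subseteq> W"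
proof -
  define S where "S = (SOME S. basis_mod V W S)"
  have S: "basis_mod V W S" unfolding S_def using someI_ex[OF assms(1)] .
  have "card S = 0" using assms(2) by (simp add: quot_dim_def S_def)
  then have "S = {}" using S by (simp add: basis_mod_def)
  then show ?thesis using S by (auto simp: basis_mod_def)
qed

section \<open>Finite-dimensionality of the spaces of forms\<close>

lemma subspace_alt_forms: "subspace (alt_forms k :: ('a::real_vector list \<Rightarrow> real) set)"
  unfolding subspace_def
proof (intro conjI ballI allI)
  show "0 \<in> (alt_forms k :: ('a list \<Rightarrow> real) set)"
    by (auto simp: alt_forms_def linear_iff)
  fix \<omega> \<omega>' :: "'a list \<Rightarrow> real" assume "\<omega> \<in> alt_forms k" "\<omega>' \<in> alt_forms k"
  then show "\<omega> + \<omega>' \<in> alt_forms k"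
    by (auto simp: alt_forms_def intro: linear_compose_add)
next
  fix c :: real and \<omega> :: "'a list \<Rightarrow> real" assume "\<omega> \<in> alt_forms k"
  then show "c *\<^sub>R \<omega> \<in> alt_forms k"
    by (auto simp: alt_forms_def scaleR_fun_def linear_iff algebra_simps)
qed

lemma alt_forms_linear:
  "\<omega> \<in> alt_forms k \<Longrightarrow> length xs = k \<Longrightarrow> i < k \<Longrightarrow> linear (\<lambda>x. \<omega> (xs[i := x]))"
  by (simp add: alt_forms_def)

lemma sum_fun_apply: "(\<Sum>a\<in>A. g a) x = (\<Sum>a\<in>A. g a x)" for g :: "'a \<Rightarrow> 'b \<Rightarrow> 'c::comm_monoid_add"
  by (induction A rule: infinite_finite_induct) auto

lemma linear_ce_d: "linear (ce_d br)"
  by (rule linearI) (auto simp: ce_d_def fun_eq_iff sum.distrib algebra_simps scaleR_fun_def sum_distrib_left)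

lemma subspace_coboundaries: "subspace (coboundaries br k)"
  using linear_subspace_image[OF linear_ce_d subspace_alt_forms] by (cases k) auto

text \<open>By multilinearity the arguments are replaced by elements of \<open>B\<close> one at a
  time; in the induction \<open>j\<close> bounds the initial segment whose entries are still
  arbitrary.\<close>

lemma alt_form_eq_0:
  assumes \<omega>: "\<omega> \<in> alt_forms k" and B: "span B = UNIV"
    and zero: "\<And>xs. length xs = k \<Longrightarrow> set xs \<subseteq> B \<Longrightarrow> \<omega> xs = 0"
  shows "\<omega> = 0"
proof -
  have "\<omega> xs = 0" if "j \<le> k" "length xs = k" "\<forall>i<k. j \<le> i \<longrightarrow> xs ! i \<in> B" for j xs
    using that
  proof (induction j arbitrary: xs)
    case 0
    then have "set xs \<subseteq> B" by (auto simp: in_set_conv_nth)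
    then show ?case using zero 0 by blast
  next
    case (Suc j)
    have lin: "linear (\<lambda>x. \<omega> (xs[j := x]))"
      using \<omega> Suc.prems by (auto simp: alt_forms_def)
    have "\<omega> (xs[j := b]) = 0" if "b \<in> B" for b
      using Suc.prems that by (intro Suc.IH) (auto simp: nth_list_update)
    then have "\<omega> (xs[j := xs ! j]) = 0"
      using linear_eq_0_on_span[OF lin, of B "xs ! j"] B by auto
    then show ?case by simp
  qed
  then have "\<omega> xs = 0" if "length xs = k" for xs using that by (metis leD le_refl)
  moreover have "\<omega> xs = 0" if "length xs \<noteq> k" for xs using that \<omega> by (auto simp: alt_forms_def)
  ultimately show ?thesis by (auto simp: fun_eq_iff)
qed

text \<open>Restriction to the finitely many lists over a spanning set is injective on
  \<open>k\<close>-forms and embeds them into functions on a finite set.\<close>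

lemma alt_forms_finite_dim:
  assumes B: "finite B" "span B = (UNIV :: 'a::real_vector set)"
    and S: "finite S" "S \<subseteq> (alt_forms k :: ('a list \<Rightarrow> real) set)" "independent S"
  shows "card S \<le> card {xs. set xs \<subseteq> B \<and> length xs = k}"
proof -
  let ?F = "{xs. set xs \<subseteq> B \<and> length xs = k}"
  have finF: "finite ?F" using finite_lists_length_eq[OF B(1)] .
  define r :: "('a list \<Rightarrow> real) \<Rightarrow> 'a list \<Rightarrow> real" where "r \<omega> = (\<lambda>xs. if xs \<in> ?F then \<omega> xs else 0)" for \<omega>
  define ind :: "'a list \<Rightarrow> 'a list \<Rightarrow> real" where "ind ys = (\<lambda>xs. if xs = ys then 1 else 0)" for ys
  have linr: "linear r" by (rule linearI) (auto simp: r_def scaleR_fun_def fun_eq_iff)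
  have spanS: "span S \<subseteq> alt_forms k" using S(2) subspace_alt_forms by (rule span_minimal)
  have inj_span: "inj_on r (span S)"
  proof (subst linear_inj_on_iff_eq_0[OF linr subspace_span], intro ballI impI)
    fix \<omega> assume \<omega>: "\<omega> \<in> span S" "r \<omega> = 0"
    have "\<omega> xs = 0" if "length xs = k" "set xs \<subseteq> B" for xs
      using fun_cong[OF \<omega>(2), of xs] that by (simp add: r_def)
    then show "\<omega> = 0" using alt_form_eq_0[OF _ B(2)] \<omega>(1) spanS by blast
  qed
  have ind': "independent (r ` S)" using linear_independent_injective_image[OF linr S(3) inj_span] .
  have inj: "inj_on r S" using inj_on_subset[OF inj_span span_superset] .
  have "r ` S \<subseteq> span (ind ` ?F)"
  proof (intro image_subsetI)
    fix \<omega>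
    have "r \<omega> = (\<Sum>ys\<in>?F. \<omega> ys *\<^sub>R ind ys)"
    proof
      fix xs
      have "(\<Sum>ys\<in>?F. \<omega> ys *\<^sub>R ind ys) xs = (\<Sum>ys\<in>?F. \<omega> ys * ind ys xs)"
        by (simp add: sum_fun_apply scaleR_fun_def)
      also have "\<dots> = (\<Sum>ys\<in>?F. if xs = ys then \<omega> ys else 0)" by (intro sum.cong) (auto simp: ind_def)
      finally show "r \<omega> xs = (\<Sum>ys\<in>?F. \<omega> ys *\<^sub>R ind ys) xs" using finF by (simp add: r_def)
    qed
    moreover have "(\<Sum>ys\<in>?F. \<omega> ys *\<^sub>R ind ys) \<in> span (ind ` ?F)"
      by (rule span_sum) (rule span_scale, rule span_base, rule imageI)
    ultimately show "r \<omega> \<in> span (ind ` ?F)" by (simp only:)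
  qed
  then have "card (r ` S) \<le> card (ind ` ?F)"
    using independent_span_bound[OF _ ind'] finF by blast
  then show ?thesis using inj finF card_image_le[OF finF, of ind] by (simp add: card_image)
qed

lemma betti_eq_0:
  fixes br :: "'a::real_vector \<Rightarrow> 'a \<Rightarrow> 'a"
  assumes "finite B" "span B = (UNIV :: 'a set)" and "betti br k = 0"
  shows "cocycles br k \<subseteq> coboundaries br k"
proof (rule quot_dim_eq_0)
  show "\<exists>S. basis_mod (cocycles br k) (coboundaries br k) S"
    using alt_forms_finite_dim[OF assms(1,2)]
    by (intro basis_mod_exists[OF subspace_coboundaries]) (auto simp: cocycles_def)
qed (use assms(3) in \<open>simp add: betti_def\<close>)

section \<open>From vanishing Betti numbers to primitives of curried forms\<close>

lemma ce_d_two_form: "ce_d br \<omega> [x, y, z] = - \<omega> [br x y, z] + \<omega> [br x z, y] - \<omega> [br y z, x]"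
  by (simp add: ce_d_def lessThan_Suc numeral_eq_Suc nths_Cons)

lemma ce_d_three_form: "ce_d br \<omega> [w, x, y, z] = - \<omega> [br w x, y, z] + \<omega> [br w y, x, z] - \<omega> [br x y, w, z]
    - \<omega> [br w z, x, y] + \<omega> [br x z, w, y] - \<omega> [br y z, w, x]"
  by (simp add: ce_d_def lessThan_Suc numeral_eq_Suc nths_Cons)

lemma ce_d_other_length:
  assumes "\<omega> \<in> alt_forms k" "length xs \<noteq> Suc k" "k > 0"
  shows "ce_d br \<omega> xs = 0"
  unfolding ce_d_def
proof (intro sum.neutral ballI)
  fix j i assume "j \<in> {..<length xs}" "i \<in> {..<j}"
  then have ij: "i < j" "j < length xs" by auto
  have "{p. p < length xs \<and> p \<in> - {i, j}} = {..<length xs} - {i, j}" by auto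
  then have "length (nths xs (- {i, j})) = length xs - 2"
    using ij by (simp add: length_nths card_Diff_subset)
  then have "length (br (xs ! i) (xs ! j) # nths xs (- {i, j})) \<noteq> k" using ij assms by auto
  then show "(- 1) ^ (i + j) * \<omega> (br (xs ! i) (xs ! j) # nths xs (- {i, j})) = 0"
    using assms(1) by (auto simp: alt_forms_def)
qed

lemma length_eq_conv:
  "length xs = Suc 0 \<longleftrightarrow> (\<exists>x. xs = [x])"
  "length xs = 2 \<longleftrightarrow> (\<exists>x y. xs = [x, y])"
  "length xs = 3 \<longleftrightarrow> (\<exists>x y z. xs = [x, y, z])"
  "length xs = 4 \<longleftrightarrow> (\<exists>w x y z. xs = [w, x, y, z])"
  by (auto simp: length_Suc_conv numeral_eq_Suc)

lemma two_three_trivial_exact: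
  fixes br :: "'a::real_vector \<Rightarrow> 'a \<Rightarrow> 'a"
  assumes lie: "lie_algebra br" and B: "finite B" "span B = (UNIV :: 'a set)" and triv: "two_three_trivial br"
  shows "closed2_exact br" and "closed3_exact br"
proof -
  interpret lie_algebra br by fact
  have c2: "cocycles br 2 \<subseteq> coboundaries br 2" and c3: "cocycles br 3 \<subseteq> coboundaries br 3"
    using betti_eq_0[OF B] triv by (auto simp: two_three_trivial_def)
  show "closed2_exact br"
    unfolding closed2_exact_def
  proof (intro allI impI, elim conjE)
    fix \<sigma> :: "'a \<Rightarrow> 'a \<Rightarrow> real" assume \<sigma>: "alternating2 \<sigma>" and closed: "\<forall>x y z. diff2 br \<sigma> x y z = 0"
    have bil: "linear (\<sigma> x)" "linear (\<lambda>x. \<sigma> x y)" for x y using \<sigma> by (auto simp: alternating2_def bilinear_def)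
    define \<omega> where "\<omega> xs = (if length xs = 2 then \<sigma> (xs ! 0) (xs ! 1) else 0)" for xs :: "'a list"
    have alt: "\<omega> \<in> alt_forms 2"
      unfolding alt_forms_def
    proof (intro CollectI conjI allI impI)
      fix xs :: "'a list" and i :: nat assume "length xs = 2 \<and> i < 2"
      then have "\<exists>a b. xs = [a, b]" "i = 0 \<or> i = 1" by (auto simp: length_eq_conv)
      then obtain a b where "xs = [a, b]" "i = 0 \<or> i = 1" by blast
      then show "linear (\<lambda>x. \<omega> (xs[i := x]))" using bil by (auto simp: \<omega>_def)
    next
      fix xs :: "'a list" assume "\<not> distinct xs"
      then show "\<omega> xs = 0" using \<sigma> by (auto simp: \<omega>_def length_eq_conv alternating2_def)
    qed (auto simp: \<omega>_def)
    have "ce_d br \<omega> xs = 0" for xs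
    proof (cases "length xs = 3")
      case True
      then obtain x y z where xs: "xs = [x, y, z]" by (auto simp: length_eq_conv)
      have "\<sigma> (br z x) y = - \<sigma> (br x z) y" using br_antisym[of z x] linear_neg[OF bil(2)] by simp
      then show ?thesis using closed[rule_format, of x y z] by (simp add: xs ce_d_two_form \<omega>_def diff2_def)
    next
      case False
      then show ?thesis using ce_d_other_length[OF alt] by simp
    qed
    then have "\<omega> \<in> cocycles br 2" using alt by (auto simp: cocycles_def)
    then have "\<omega> \<in> coboundaries br (Suc 1)" using c2 by (auto simp: numeral_2_eq_2)
    then obtain \<eta> where \<eta>: "\<eta> \<in> alt_forms 1" "\<omega> = ce_d br \<eta>" by auto
    have lin: "linear (\<lambda>x. \<eta> [x])"
    proof -
      have "linear (\<lambda>x. \<eta> ([undefined][0 := x]))" using alt_forms_linear[OF \<eta>(1), of "[undefined]" 0] by simp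
      then show ?thesis by simp
    qed
    \<comment> \<open>The primitive changes sign because \<open>ce_d\<close> of a 1-form carries a
      minus, which the curried convention omits.\<close>
    show "\<exists>\<theta>. linear \<theta> \<and> (\<forall>x y. \<sigma> x y = \<theta> (br x y))"
    proof (intro exI[of _ "\<lambda>x. - \<eta> [x]"] conjI allI)
      show "linear (\<lambda>x. - \<eta> [x])" using lin by (rule linear_compose_neg)
      fix x y
      have "\<sigma> x y = \<omega> [x, y]" by (simp add: \<omega>_def)
      then show "\<sigma> x y = - \<eta> [br x y]" by (simp add: \<eta>(2) ce_d_one_form)
    qed
  qed
  show "closed3_exact br"
    unfolding closed3_exact_def
  proof (intro allI impI, elim conjE)
    fix \<sigma> :: "'a \<Rightarrow> 'a \<Rightarrow> 'a \<Rightarrow> real" assume \<sigma>: "alternating3 \<sigma>" and closed: "\<forall>w x y z. diff3 br \<sigma> w x y z = 0"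
    have tri: "linear (\<lambda>z. \<sigma> z x y)" "linear (\<lambda>z. \<sigma> x z y)" "linear (\<lambda>z. \<sigma> x y z)" for x y
      using \<sigma> by (auto simp: alternating3_def)
    define \<omega> where "\<omega> xs = (if length xs = 3 then \<sigma> (xs ! 0) (xs ! 1) (xs ! 2) else 0)" for xs :: "'a list"
    have alt: "\<omega> \<in> alt_forms 3"
      unfolding alt_forms_def
    proof (intro CollectI conjI allI impI)
      fix xs :: "'a list" and i :: nat assume "length xs = 3 \<and> i < 3"
      then have "\<exists>a b c. xs = [a, b, c]" "i = 0 \<or> i = 1 \<or> i = 2" by (auto simp: length_eq_conv)
      then obtain a b c where "xs = [a, b, c]" "i = 0 \<or> i = 1 \<or> i = 2" by blast
      then show "linear (\<lambda>x. \<omega> (xs[i := x]))" using tri by (auto simp: \<omega>_def)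
    next
      fix xs :: "'a list" assume "\<not> distinct xs"
      then show "\<omega> xs = 0" using \<sigma> by (auto simp: \<omega>_def length_eq_conv alternating3_def)
    qed (auto simp: \<omega>_def)
    have "ce_d br \<omega> xs = 0" for xs
    proof (cases "length xs = 4")
      case True
      then obtain w x y z where xs: "xs = [w, x, y, z]" by (auto simp: length_eq_conv)
      then show ?thesis using closed[rule_format, of w x y z] by (simp add: xs ce_d_three_form \<omega>_def diff3_def)
    next
      case False
      then show ?thesis using ce_d_other_length[OF alt] by simp
    qed
    then have "\<omega> \<in> cocycles br 3" using alt by (auto simp: cocycles_def)
    moreover have "coboundaries br 3 = ce_d br ` alt_forms 2" using coboundaries.simps(2)[of br 2] by simp
    ultimately obtain \<eta> where \<eta>: "\<eta> \<in> alt_forms 2" "\<omega> = ce_d br \<eta>" using c3 by blast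
    have lin: "linear (\<lambda>x. \<eta> [x, y])" "linear (\<lambda>x. \<eta> [y, x])" for y
    proof -
      have "linear (\<lambda>x. \<eta> ([undefined, y][0 := x]))" "linear (\<lambda>x. \<eta> ([y, undefined][1 := x]))"
        using alt_forms_linear[OF \<eta>(1), of "[undefined, y]" 0] alt_forms_linear[OF \<eta>(1), of "[y, undefined]" 1] by simp_all
      then show "linear (\<lambda>x. \<eta> [x, y])" "linear (\<lambda>x. \<eta> [y, x])" by simp_all
    qed
    show "\<exists>\<beta>. alternating2 \<beta> \<and> (\<forall>x y z. \<sigma> x y z = diff2 br \<beta> x y z)"
    proof (intro exI[of _ "\<lambda>x y. - \<eta> [x, y]"] conjI allI)
      have "\<eta> [x, x] = 0" for x using \<eta>(1) by (auto simp: alt_forms_def)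
      then show "alternating2 (\<lambda>x y. - \<eta> [x, y])"
        using lin unfolding alternating2_def bilinear_def by (auto intro: linear_compose_neg)
      fix x y z
      have "\<sigma> x y z = \<omega> [x, y, z]" by (simp add: \<omega>_def)
      moreover have "\<eta> [br z x, y] = - \<eta> [br x z, y]" using br_antisym[of z x] linear_neg[OF lin(1)] by simp
      ultimately show "\<sigma> x y z = diff2 br (\<lambda>x y. - \<eta> [x, y]) x y z" by (simp add: \<eta>(2) ce_d_two_form diff2_def)
    qed
  qed
qed

section \<open>Traces on quotients\<close>

text \<open>Basis independence of the trace. The images of the chosen basis \<open>S\<close> are
  expanded through \<open>e\<close>, and exchanging the two sums turns the trace in \<open>S\<close>
  into the trace in \<open>e\<close>.\<close>

lemma quot_trace_eq:
  fixes V W :: "'v::real_vector set" and c :: "nat \<Rightarrow> 'v \<Rightarrow> real"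
  assumes V: "subspace V" and W: "subspace W" "W \<subseteq> V" and f: "linear f" "\<And>v. v \<in> V \<Longrightarrow> f v \<in> V" "\<And>w. w \<in> W \<Longrightarrow> f w \<in> W"
    and e: "\<And>i. i < k \<Longrightarrow> e i \<in> V" and c: "\<And>i. i < k \<Longrightarrow> linear (c i)" "\<And>i w. i < k \<Longrightarrow> w \<in> W \<Longrightarrow> c i w = 0"
      "\<And>i j. i < k \<Longrightarrow> j < k \<Longrightarrow> c i (e j) = (if i = j then 1 else 0)"
    and exp: "\<And>v. v \<in> V \<Longrightarrow> v - (\<Sum>i<k. c i v *\<^sub>R e i) \<in> W"
  shows "quot_trace V W f = (\<Sum>i<k. c i (f (e i)))"
proof -
  have inj: "inj_on e {..<k}" using c(3) by (intro inj_onI) (metis lessThan_iff zero_neq_one)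
  have "basis_mod V W (e ` {..<k})"
    unfolding basis_mod_def
  proof (intro conjI allI impI ballI)
    fix a s assume a: "(\<Sum>s\<in>e ` {..<k}. a s *\<^sub>R s) \<in> W" and s: "s \<in> e ` {..<k}"
    obtain j where j: "j < k" "s = e j" using s by auto
    have "0 = c j (\<Sum>i<k. a (e i) *\<^sub>R e i)" using a c(2)[OF j(1)] inj by (simp add: sum.reindex)
    also have "\<dots> = (\<Sum>i<k. a (e i) * c j (e i))"
      by (simp add: linear_sum[OF c(1)[OF j(1)]] linear_scale[OF c(1)[OF j(1)]])
    also have "\<dots> = (\<Sum>i<k. if j = i then a (e i) else 0)" using c(3)[OF j(1)] by (intro sum.cong) auto
    finally show "a s = 0" using j by simp
  next
    fix v assume v: "v \<in> V"
    have "(\<Sum>s\<in>e ` {..<k}. c (inv_into {..<k} e s) v *\<^sub>R s) = (\<Sum>i<k. c i v *\<^sub>R e i)"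
      using inj by (simp add: sum.reindex)
    then show "\<exists>a. v - (\<Sum>s\<in>e ` {..<k}. a s *\<^sub>R s) \<in> W" using exp[OF v] by metis
  qed (use e in auto)
  then have bS: "basis_mod V W (SOME S. basis_mod V W S)" by (rule someI)
  define S where "S = (SOME S. basis_mod V W S)"
  have S: "finite S" "S \<subseteq> V" "\<And>a. (\<Sum>s\<in>S. a s *\<^sub>R s) \<in> W \<Longrightarrow> \<forall>s\<in>S. a s = 0"
    "\<And>v. v \<in> V \<Longrightarrow> \<exists>a. v - (\<Sum>s\<in>S. a s *\<^sub>R s) \<in> W"
    using bS[folded S_def] unfolding basis_mod_def by blast+
  have uniq: "\<forall>s\<in>S. a s = b s" if "v - (\<Sum>s\<in>S. a s *\<^sub>R s) \<in> W" "v - (\<Sum>s\<in>S. b s *\<^sub>R s) \<in> W" for a b v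
  proof -
    have "(v - (\<Sum>s\<in>S. b s *\<^sub>R s)) - (v - (\<Sum>s\<in>S. a s *\<^sub>R s)) \<in> W" using that subspace_diff[OF W(1)] by blast
    then have "(\<Sum>s\<in>S. (a s - b s) *\<^sub>R s) \<in> W" by (simp add: scaleR_diff_left sum_subtractf)
    then show ?thesis using S(3)[of "\<lambda>s. a s - b s"] by simp
  qed
  let ?d = "quot_coord W S"
  have d: "v - (\<Sum>s\<in>S. ?d v s *\<^sub>R s) \<in> W" if v: "v \<in> V" for v
  proof -
    obtain a where a: "v - (\<Sum>s\<in>S. a s *\<^sub>R s) \<in> W" using S(4)[OF v] by blast
    define b where "b s = (if s \<in> S then a s else 0)" for s
    have "(\<Sum>s\<in>S. b s *\<^sub>R s) = (\<Sum>s\<in>S. a s *\<^sub>R s)" by (intro sum.cong) (auto simp: b_def)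
    then have b: "(\<forall>s. s \<notin> S \<longrightarrow> b s = 0) \<and> v - (\<Sum>s\<in>S. b s *\<^sub>R s) \<in> W" using a by (simp add: b_def)
    moreover have "b' = b" if "(\<forall>s. s \<notin> S \<longrightarrow> b' s = 0) \<and> v - (\<Sum>s\<in>S. b' s *\<^sub>R s) \<in> W" for b'
    proof
      fix s show "b' s = b s" using uniq[of v b' b] that b by (cases "s \<in> S") auto
    qed
    ultimately have "?d v = b" unfolding quot_coord_def by (rule the_equality)
    then show ?thesis using b by simp
  qed
  have "?d (f s) s = (\<Sum>i<k. c i s * ?d (f (e i)) s)" if s: "s \<in> S" for s
  proof -
    have sV: "s \<in> V" using s S(2) by blast
    let ?a = "\<lambda>t. \<Sum>i<k. c i s * ?d (f (e i)) t"
    have "f s - (\<Sum>i<k. c i s *\<^sub>R f (e i)) = f (s - (\<Sum>i<k. c i s *\<^sub>R e i))"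
      by (simp add: linear_diff[OF f(1)] linear_sum[OF f(1)] linear_scale[OF f(1)])
    then have 1: "f s - (\<Sum>i<k. c i s *\<^sub>R f (e i)) \<in> W" using f(3) exp[OF sV] by simp
    have 2: "(\<Sum>i<k. c i s *\<^sub>R (f (e i) - (\<Sum>t\<in>S. ?d (f (e i)) t *\<^sub>R t))) \<in> W"
      using d f(2) e by (intro subspace_sum[OF W(1)] subspace_scale[OF W(1)]) auto
    have "(\<Sum>t\<in>S. ?a t *\<^sub>R t) = (\<Sum>i<k. c i s *\<^sub>R (\<Sum>t\<in>S. ?d (f (e i)) t *\<^sub>R t))"
      unfolding scaleR_sum_left scaleR_sum_right by (subst sum.swap) simp
    then have E: "f s - (\<Sum>t\<in>S. ?a t *\<^sub>R t) = (f s - (\<Sum>i<k. c i s *\<^sub>R f (e i))) + (\<Sum>i<k. c i s *\<^sub>R (f (e i) - (\<Sum>t\<in>S. ?d (f (e i)) t *\<^sub>R t)))"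
      by (simp add: scaleR_diff_right sum_subtractf)
    have "f s - (\<Sum>t\<in>S. ?a t *\<^sub>R t) \<in> W" unfolding E by (rule subspace_add[OF W(1) 1 2])
    from uniq[OF d[OF f(2)[OF sV]] this] s show ?thesis by (rule bspec)
  qed
  then have "(\<Sum>s\<in>S. ?d (f s) s) = (\<Sum>s\<in>S. \<Sum>i<k. c i s * ?d (f (e i)) s)" by simp
  also have "\<dots> = (\<Sum>i<k. \<Sum>s\<in>S. ?d (f (e i)) s * c i s)" by (subst sum.swap) (simp add: mult.commute)
  also have "\<dots> = (\<Sum>i<k. c i (f (e i)))"
  proof (intro sum.cong refl)
    fix i assume "i \<in> {..<k}"
    then have i: "i < k" by simp
    have "c i (f (e i) - (\<Sum>s\<in>S. ?d (f (e i)) s *\<^sub>R s)) = 0" using c(2)[OF i] d[OF f(2)[OF e[OF i]]] by blast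
    then show "(\<Sum>s\<in>S. ?d (f (e i)) s * c i s) = c i (f (e i))"
      by (simp add: linear_diff[OF c(1)[OF i]] linear_sum[OF c(1)[OF i]] linear_scale[OF c(1)[OF i]])
  qed
  finally show ?thesis by (simp add: quot_trace_def S_def Let_def)
qed

context euclidean_lie_algebra
begin

lemma closed3_exact_imp_derived_nilpotent:
  assumes "closed3_exact br"
  shows "lie_nilpotent br (lie_prod br UNIV UNIV)"
proof -
  have ad: "lie_rep br UNIV br" by (rule lie_rep_adjoint)
  let ?B = "trace_form br"
  note Bb = trace_form_bilinear[OF ad]
  have Bl: "linear (?B x)" "linear (\<lambda>x. ?B x y)" for x y using Bb by (auto simp: bilinear_def)
  have inv: "?B (br x y) z = ?B x (br y z)" for x y z using trace_form_invariant[OF ad] by blast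
  have sym: "?B x y = ?B y x" for x y by (rule trace_form_sym[OF ad])
  let ?w = "\<lambda>x y z. ?B (br x y) z"
  have "alternating3 ?w"
    unfolding alternating3_def
  proof (intro conjI allI)
    fix x y
    show "linear (\<lambda>z. ?B (br z x) y)" "linear (\<lambda>z. ?B (br x z) y)"
      using linear_compose[OF linear_br(2) Bl(2)] linear_compose[OF linear_br(1) Bl(2)] by (simp_all add: o_def)
    show "linear (?B (br x y))" by (rule Bl)
    show "?B (br x x) y = 0" "?B (br x y) y = 0"
      using Bl by (simp_all add: br_self linear_0[OF Bl(2)] linear_0[OF Bl(1)] inv)
    show "?B (br x y) x = 0" using br_antisym[of x y] by (simp add: linear_neg[OF Bl(2)] inv br_self linear_0[OF Bl(1)])
  qed
  moreover have "diff3 br ?w w x y z = 0" for w x y z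
  proof -
    \<comment> \<open>Invariance brings all six terms of the differential to the shape
      \<open>?B _ z\<close>, where the first arguments cancel by the Jacobi identity.\<close>
    have "?B (br (br w z) x) y = - ?B (br w (br x y)) z" "?B (br (br x z) w) y = - ?B (br x (br w y)) z"
      "?B (br (br y z) w) x = - ?B (br y (br w x)) z"
      using inv[of "br w z" x y] inv[of "br x z" w y] inv[of "br y z" w x]
        inv[of z w "br x y"] inv[of z x "br w y"] inv[of z y "br w x"]
        br_antisym[of w z] br_antisym[of x z] br_antisym[of y z] sym
      by (simp_all add: linear_neg[OF Bl(2)] linear_neg[OF Bl(1)])
    then have "diff3 br ?w w x y z = ?B (br (br w x) y - br (br w y) x + br (br x y) w - br w (br x y) + br x (br w y) - br y (br w x)) z"
      by (simp add: diff3_def linear_add[OF Bl(2)] linear_diff[OF Bl(2)])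
    also have "br (br w x) y - br (br w y) x + br (br x y) w - br w (br x y) + br x (br w y) - br y (br w x) = 0"
    proof -
      have "br w (br x y) = br x (br w y) - br y (br w x)"
        using jacobi'[of w x y] br_antisym[of "br w x" y] by (simp add: algebra_simps)
      then show ?thesis
        unfolding br_antisym[of "br w x" y] br_antisym[of "br w y" x] br_antisym[of "br x y" w] by simp
    qed
    finally show ?thesis by (simp add: linear_0[OF Bl(2)])
  qed
  ultimately obtain \<beta> where "alternating2 \<beta>" "\<And>x y z. ?w x y z = diff2 br \<beta> x y z"
    using assms unfolding closed3_exact_def by blast
  then show ?thesis
    using exact_killing_form_imp_derived_nilpotent[of \<beta>] by (auto simp: alternating2_def diff2_def)
qed

end

section \<open>Coordinates modulo a subspace\<close>

lemma separating_functional: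
  fixes S :: "'v::euclidean_space set"
  assumes "subspace S" "y \<notin> S"
  obtains \<gamma> :: "'v \<Rightarrow> real" where "linear \<gamma>" "\<And>s. s \<in> S \<Longrightarrow> \<gamma> s = 0" "\<gamma> y = 1"
proof -
  obtain p where p: "linear p" "\<And>v. p v \<in> S" "\<And>w. w \<in> S \<Longrightarrow> p w = w"
    using orth_proj_exists[OF assms(1)] by metis
  define u where "u = y - p y"
  have u: "u \<bullet> u \<noteq> 0" using p(2)[of y] assms(2) by (auto simp: u_def)
  show ?thesis
  proof
    show "linear (\<lambda>x. ((x - p x) \<bullet> u) / (u \<bullet> u))"
      by (rule linearI) (simp_all add: linear_add[OF p(1)] linear_scale[OF p(1)] inner_diff_left inner_add_left
        add_divide_distrib diff_divide_distrib algebra_simps)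
    show "((s - p s) \<bullet> u) / (u \<bullet> u) = 0" if "s \<in> S" for s using p(3)[OF that] by simp
    show "((y - p y) \<bullet> u) / (u \<bullet> u) = 1" using u by (simp add: u_def)
  qed
qed

text \<open>A basis of \<open>V/W\<close> with its dual coordinates. The coordinates are linear on
  the whole space and vanish on \<open>W\<close>, so they can be composed with any map and used
  directly as closed 1-forms.\<close>

definition coords_mod :: "'v::real_vector set \<Rightarrow> 'v set \<Rightarrow> nat \<Rightarrow> (nat \<Rightarrow> 'v) \<Rightarrow> (nat \<Rightarrow> 'v \<Rightarrow> real) \<Rightarrow> bool"
  where "coords_mod V W k e c \<longleftrightarrow> (\<forall>i<k. e i \<in> V \<and> linear (c i) \<and> (\<forall>w\<in>W. c i w = 0) \<and>
    (\<forall>j<k. c i (e j) = (if i = j then 1 else 0))) \<and> (\<forall>v\<in>V. v - (\<Sum>i<k. c i v *\<^sub>R e i) \<in> W)"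

text \<open>Counting dimensions, no \<open>e i\<close> lies in the span of the others and
  \<open>W\<close>; functionals separating each from that span are the coordinates.\<close>

lemma coords_mod_spanning:
  fixes V W :: "'v::euclidean_space set"
  assumes V: "subspace V" and W: "subspace W" and dim: "dim V = dim W + k"
    and e: "\<And>i. i < k \<Longrightarrow> e i \<in> V" and span: "V = span (e ` {..<k} \<union> W)"
  shows "\<exists>c. coords_mod V W k e c"
proof -
  have notin: "e i \<notin> span (e ` ({..<k} - {i}) \<union> W)" if i: "i < k" for i
  proof
    let ?S = "e ` ({..<k} - {i}) \<union> W"
    assume "e i \<in> span ?S"
    then have "e ` {..<k} \<union> W \<subseteq> span ?S" by (auto intro: span_base)
    then have "V \<subseteq> span ?S" unfolding span by (intro span_minimal) auto
    then have "dim V \<le> dim ?S" by (metis dim_subset dim_span)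
    also have "\<dots> \<le> dim W + card (e ` ({..<k} - {i}))"
    proof -
      have "dim (A \<union> W) \<le> dim W + card A" if "finite A" for A :: "'v set"
        using that by induction (auto simp: dim_insert)
      then show ?thesis by simp
    qed
    also have "card (e ` ({..<k} - {i})) \<le> card ({..<k} - {i})" by (rule card_image_le) simp
    also have "\<dots> = k - 1" using i by simp
    finally show False using dim i by simp
  qed
  have "\<exists>\<gamma>::'v \<Rightarrow> real. linear \<gamma> \<and> (\<forall>s\<in>e ` ({..<k} - {i}) \<union> W. \<gamma> s = 0) \<and> \<gamma> (e i) = 1" if i: "i < k" for i
    using separating_functional[OF subspace_span notin[OF i]] span_base by metis
  then obtain c :: "nat \<Rightarrow> 'v \<Rightarrow> real" where c: "\<And>i. i < k \<Longrightarrow> linear (c i)"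
    "\<And>i s. i < k \<Longrightarrow> s \<in> e ` ({..<k} - {i}) \<union> W \<Longrightarrow> c i s = 0" "\<And>i. i < k \<Longrightarrow> c i (e i) = 1"
    by metis
  have ce: "c i (e j) = (if i = j then 1 else 0)" if "i < k" "j < k" for i j
    using c(2)[OF that(1), of "e j"] c(3)[OF that(1)] that by auto
  let ?g = "\<lambda>v. v - (\<Sum>i<k. c i v *\<^sub>R e i)"
  have "linear ?g"
    using c(1) by (intro linear_compose_sub linear_ident linear_compose_sum ballI linearI)
      (auto simp: linear_add linear_scale scaleR_add_left)
  then have "subspace {v. ?g v \<in> W}"
    using linear_subspace_vimage[OF _ W] by (simp add: vimage_def)
  moreover have "e ` {..<k} \<union> W \<subseteq> {v. ?g v \<in> W}"
  proof -
    have "?g (e j) = 0" if "j < k" for j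
    proof -
      have "(\<Sum>i<k. c i (e j) *\<^sub>R e i) = (\<Sum>i<k. if i = j then e i else 0)"
        using ce that by (intro sum.cong) auto
      then show ?thesis using that by simp
    qed
    moreover have "?g w = w" if "w \<in> W" for w using c(2) that by (simp add: sum.neutral)
    ultimately show ?thesis using subspace_0[OF W] by auto
  qed
  ultimately have "V \<subseteq> {v. ?g v \<in> W}" unfolding span by (intro span_minimal)
  then have "coords_mod V W k e c" using e c ce by (auto simp: coords_mod_def)
  then show ?thesis by blast
qed

lemma coords_mod_exists:
  fixes V W :: "'v::euclidean_space set"
  assumes V: "subspace V"
  shows "subspace W \<Longrightarrow> W \<subseteq> V \<Longrightarrow> dim V = dim W + k \<Longrightarrow> \<exists>e c. coords_mod V W k e c"
proof -
  have "subspace W \<Longrightarrow> W \<subseteq> V \<Longrightarrow> dim V = dim W + k \<Longrightarrow> \<exists>e. (\<forall>i<k. e i \<in> V) \<and> V = span (e ` {..<k} \<union> W)" for W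
  proof (induction k arbitrary: W)
    case 0
    then have "W = V" using subspace_dim_equal[of W V] V by simp
    then show ?case using V by (simp add: span_eq_iff[THEN iffD2])
  next
    case (Suc k)
    then have "W \<noteq> V" by auto
    then obtain x where x: "x \<in> V" "x \<notin> W" using Suc.prems by blast
    let ?W = "span (insert x W)"
    have "dim ?W = Suc (dim W)" using x(2) Suc.prems(1) by (simp add: dim_insert span_eq_iff[THEN iffD2])
    moreover have "?W \<subseteq> V" using x Suc.prems V by (intro span_minimal) auto
    ultimately obtain e where e: "\<forall>i<k. e i \<in> V" "V = span (e ` {..<k} \<union> ?W)"
      using Suc.IH[of ?W] Suc.prems by auto
    let ?e = "\<lambda>i. if i = k then x else e i"
    have im: "?e ` {..<Suc k} = insert x (e ` {..<k})" by (auto simp: lessThan_Suc)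
    have "span (e ` {..<k} \<union> ?W) = span (?e ` {..<Suc k} \<union> W)"
      unfolding im
    proof (intro subset_antisym span_minimal subspace_span)
      show "e ` {..<k} \<union> ?W \<subseteq> span (insert x (e ` {..<k}) \<union> W)"
        using span_mono[of "insert x W" "insert x (e ` {..<k}) \<union> W"] by (auto intro: span_base)
      show "insert x (e ` {..<k}) \<union> W \<subseteq> span (e ` {..<k} \<union> ?W)"
        by (auto intro!: span_base)
    qed
    then show ?case using e x by (intro exI[of _ ?e]) auto
  qed
  then show "subspace W \<Longrightarrow> W \<subseteq> V \<Longrightarrow> dim V = dim W + k \<Longrightarrow> \<exists>e c. coords_mod V W k e c"
    using coords_mod_spanning[OF V] by metis
qed

section \<open>Algebras with vanishing second and third cohomology\<close>

lemma linear_alternating2: "alternating2 \<beta> \<Longrightarrow> linear (\<beta> x)" "alternating2 \<beta> \<Longrightarrow> linear (\<lambda>x. \<beta> x y)"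
  by (auto simp: alternating2_def bilinear_def)

lemma linear_alternating3:
  "alternating3 \<omega> \<Longrightarrow> linear (\<lambda>z. \<omega> z x y)" "alternating3 \<omega> \<Longrightarrow> linear (\<lambda>z. \<omega> x z y)"
  "alternating3 \<omega> \<Longrightarrow> linear (\<lambda>z. \<omega> x y z)"
  by (auto simp: alternating3_def)

lemma wedge2_alternating:
  fixes f g :: "'a::real_vector \<Rightarrow> real"
  assumes "linear f" "linear g"
  shows "alternating2 (\<lambda>x y. f x * g y - g x * f y)"
  using assms by (auto simp: alternating2_def bilinear_def linear_iff algebra_simps)

lemma alternating2_add: "alternating2 \<sigma> \<Longrightarrow> alternating2 \<tau> \<Longrightarrow> alternating2 (\<lambda>x y. \<sigma> x y + \<tau> x y)"
  by (auto simp: alternating2_def bilinear_def intro: linear_compose_add)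

lemma alternating2_scale: "alternating2 \<sigma> \<Longrightarrow> alternating2 (\<lambda>x y. c * \<sigma> x y)"
  by (auto simp: alternating2_def bilinear_def linear_iff algebra_simps)

lemma wedge21_alternating:
  fixes g :: "'a::real_vector \<Rightarrow> real"
  assumes "alternating2 p" "linear g"
  shows "alternating3 (\<lambda>x y z. p x y * g z + p y z * g x + p z x * g y)"
proof -
  note l = linear_alternating2[OF assms(1)]
  have 0: "p x x = 0" for x using assms(1) by (simp add: alternating2_def)
  have "p x y + p y x = 0" for x y using alternating2_antisym[OF assms(1), of x y] by simp
  then have "p x y * c + p y x * c = 0" for x y and c :: real by (metis distrib_right mult_zero_left)
  then show ?thesis
    unfolding alternating3_def
    by (auto simp: 0 add.commute intro!: linearI simp: linear_add[OF l(1)] linear_add[OF l(2)] linear_scale[OF l(1)]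
      linear_scale[OF l(2)] linear_add[OF assms(2)] linear_scale[OF assms(2)] algebra_simps)
qed

lemma alternating3_add: "alternating3 \<sigma> \<Longrightarrow> alternating3 \<tau> \<Longrightarrow> alternating3 (\<lambda>x y z. \<sigma> x y z + \<tau> x y z)"
  by (auto simp: alternating3_def intro: linear_compose_add)

context lie_algebra
begin

lemma alternating3_diff2:
  assumes \<beta>: "alternating2 \<beta>"
  shows "alternating3 (diff2 br \<beta>)"
proof -
  note l = linear_alternating2[OF \<beta>]
  have a: "\<beta> (br x y) z = - \<beta> (br y x) z" for x y z
    using br_antisym[of x y] by (simp add: linear_neg[OF l(2)])
  have "linear (\<lambda>z. diff2 br \<beta> z x y)" "linear (\<lambda>z. diff2 br \<beta> x z y)" "linear (diff2 br \<beta> x y)" for x y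
    unfolding diff2_def
    by (rule linearI; simp add: br_add br_scaleR linear_add[OF l(1)] linear_add[OF l(2)]
        linear_scale[OF l(1)] linear_scale[OF l(2)] algebra_simps)+
  moreover have "diff2 br \<beta> x x y = 0" "diff2 br \<beta> x y x = 0" "diff2 br \<beta> x y y = 0" for x y
    using a[of x y x] a[of x y y] by (simp_all add: diff2_def br_self linear_0[OF l(2)])
  ultimately show ?thesis by (simp add: alternating3_def)
qed

end

locale cohomology_trivial = euclidean_lie_algebra br for br :: "'e::euclidean_space \<Rightarrow> 'e \<Rightarrow> 'e" +
  assumes dim7: "DIM('e) = 7" and exact2: "closed2_exact br" and exact3: "closed3_exact br"
begin

section \<open>The derived algebra and its lower central series\<close>

definition h :: "'e set" where "h = lie_prod br UNIV UNIV"

text \<open>Indexing starts at \<open>n 0 = h\<close>, so \<open>[h,h]\<close> is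
  \<open>n 1\<close>. Once \<open>h\<close> is known to be the nilradical, the quotients
  \<open>n i / n (Suc i)\<close> are those of strong unimodularity.\<close>

definition n :: "nat \<Rightarrow> 'e set" where "n i = lower_central_series br h i"

lemma subspace_h: "subspace h"
  by (simp add: h_def subspace_lie_prod)

lemma br_h: "br x y \<in> h"
  by (simp add: h_def lie_prod_in)

lemma nilpotent_h: "\<exists>k. n k = {0}"
  using closed3_exact_imp_derived_nilpotent[OF exact3] by (simp add: n_def h_def lie_nilpotent_def)

lemma n_0: "n 0 = h" and n_Suc: "n (Suc i) = lie_prod br h (n i)"
  by (simp_all add: n_def)

lemma subspace_n: "subspace (n i)"
  using subspace_lower_central_series[OF subspace_h] by (simp add: n_def)

lemma n_ideal: "x \<in> n i \<Longrightarrow> br y x \<in> n i"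
proof (induction i arbitrary: x y)
  case 0
  then show ?case by (simp add: n_0 br_h)
next
  case (Suc i)
  then show ?case using lie_prod_ideal[of h y "n i" x] br_h by (simp add: n_Suc)
qed

lemma n_dec: "n (Suc i) \<subseteq> n i"
  unfolding n_Suc by (intro lie_prod_subset subspace_n n_ideal)

lemma n_mono: "i \<le> j \<Longrightarrow> n j \<subseteq> n i"
  using n_dec lift_Suc_antimono_le[of n] by blast

lemma n_stable:
  assumes "n (Suc i) = n i"
  shows "n i = {0}"
proof -
  have "n (i + j) = n i" for j
    by (induction j) (use assms in \<open>auto simp: n_Suc\<close>)
  moreover obtain k where "n k = {0}" using nilpotent_h by blast
  moreover have "n (i + k) \<subseteq> n k" by (rule n_mono) simp
  ultimately show ?thesis using subspace_0[OF subspace_n] by auto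
qed

lemma br_h_n: "x \<in> h \<Longrightarrow> y \<in> n i \<Longrightarrow> br x y \<in> n (Suc i)"
  by (simp add: n_Suc lie_prod_in)

text \<open>Induction by the Jacobi identity; the additional \<open>Suc\<close> reflects the
  indexing from \<open>n 0 = h\<close>.\<close>

lemma br_n_n: "x \<in> n i \<Longrightarrow> y \<in> n j \<Longrightarrow> br x y \<in> n (Suc (i + j))"
proof (induction i arbitrary: x y j)
  case 0
  then show ?case using br_h_n by (simp add: n_0)
next
  case (Suc i)
  have "n (Suc i) \<subseteq> {x. \<forall>j. \<forall>y\<in>n j. br x y \<in> n (Suc (Suc i + j))}"
    unfolding n_Suc[of i]
  proof (rule lie_prod_subset)
    show "subspace {x. \<forall>j. \<forall>y\<in>n j. br x y \<in> n (Suc (Suc i + j))}"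
      using subspace_n by (auto simp: subspace_def br_zero br_add br_scaleR)
    fix a b assume ab: "a \<in> h" "b \<in> n i"
    have "br (br a b) y \<in> n (Suc (Suc i + j))" if y: "y \<in> n j" for y j
    proof -
      have "br a (br b y) \<in> n (Suc (Suc (i + j)))" using Suc.IH[OF ab(2) y] ab br_h_n by blast
      moreover have "br b (br a y) \<in> n (Suc (i + Suc j))" using Suc.IH[OF ab(2)] br_h_n[OF ab(1) y] by blast
      ultimately show ?thesis using subspace_diff[OF subspace_n] by (simp add: jacobi')
    qed
    then show "br a b \<in> {x. \<forall>j. \<forall>y\<in>n j. br x y \<in> n (Suc (Suc i + j))}" by blast
  qed
  then show ?case using Suc.prems by blast
qed

lemma h_neq_UNIV: "h \<noteq> UNIV"
proof
  assume h: "h = UNIV"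
  then have "n (Suc 0) = n 0" by (simp add: n_Suc n_0 h_def)
  then have "(UNIV :: 'e set) = {0}" using n_stable n_0 h by metis
  then show False using nonzero_Basis nonempty_Basis by (metis UNIV_I ex_in_conv singletonD)
qed

text \<open>If \<open>y \<in> ker \<alpha>\<close> is not in \<open>[ker \<alpha>, ker \<alpha>]\<close> but \<open>[t, y]\<close> is, then \<open>\<alpha> \<and> \<gamma>\<close> is closed but not exact
  for a suitable linear form \<open>\<gamma>\<close>.\<close>

lemma derivation_injective_aux:
  assumes \<alpha>: "linear \<alpha>" "\<And>x y. \<alpha> (br x y) = 0" "\<alpha> t = 1"
    and y: "\<alpha> y = 0" "br t y \<in> lie_prod br {x. \<alpha> x = 0} {x. \<alpha> x = 0}"
  shows "y \<in> lie_prod br {x. \<alpha> x = (0::real)} {x. \<alpha> x = 0}"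
proof (rule ccontr)
  let ?K = "{x. \<alpha> x = 0}"
  let ?K' = "lie_prod br ?K ?K"
  assume nin: "y \<notin> ?K'"
  have K': "\<alpha> z = 0" if "z \<in> ?K'" for z
    using lie_prod_subset[OF linear_subspace_kernel[OF \<alpha>(1)], of ?K ?K br] \<alpha>(2) that by blast
  have "y \<notin> span (insert t ?K')"
  proof
    assume "y \<in> span (insert t ?K')"
    then obtain c where c: "y - c *\<^sub>R t \<in> ?K'"
      by (auto simp: span_insert span_eq_iff[THEN iffD2, OF subspace_lie_prod])
    then have "\<alpha> y - c = 0" using K'[OF c] by (simp add: linear_diff[OF \<alpha>(1)] linear_scale[OF \<alpha>(1)] \<alpha>(3))
    then show False using c nin y by simp
  qed
  then obtain \<gamma> :: "'e \<Rightarrow> real" where \<gamma>: "linear \<gamma>" "\<And>s. s \<in> span (insert t ?K') \<Longrightarrow> \<gamma> s = 0" "\<gamma> y = 1"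
    using separating_functional[OF subspace_span] by blast
  have \<gamma>t: "\<gamma> t = 0" and \<gamma>K': "\<And>s. s \<in> ?K' \<Longrightarrow> \<gamma> s = 0" using \<gamma>(2) span_base by blast+
  define \<sigma> where "\<sigma> x y = \<alpha> x * \<gamma> y - \<gamma> x * \<alpha> y" for x y
  have alt: "alternating2 \<sigma>" unfolding \<sigma>_def by (rule wedge2_alternating[OF \<alpha>(1) \<gamma>(1)])
  have g: "\<gamma> (br x z) = \<alpha> x * \<gamma> (br t z) - \<alpha> z * \<gamma> (br t x)" for x z
  proof -
    have "x - \<alpha> x *\<^sub>R t \<in> ?K" "z - \<alpha> z *\<^sub>R t \<in> ?K"
      by (simp_all add: linear_diff[OF \<alpha>(1)] linear_scale[OF \<alpha>(1)] \<alpha>(3))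
    then have "\<gamma> (br (x - \<alpha> x *\<^sub>R t) (z - \<alpha> z *\<^sub>R t)) = 0" by (intro \<gamma>K' lie_prod_in)
    then show ?thesis
      using br_antisym[of x t] by (simp add: br_diff br_scaleR br_self linear_add[OF \<gamma>(1)] linear_diff[OF \<gamma>(1)] linear_scale[OF \<gamma>(1)] linear_neg[OF \<gamma>(1)])
  qed
  have "diff2 br \<sigma> x y z = 0" for x y z
    by (simp add: diff2_def \<sigma>_def \<alpha>(2) g[of x y] g[of y z] g[of z x] algebra_simps)
  then obtain \<theta> where \<theta>: "linear \<theta>" "\<And>x y. \<sigma> x y = \<theta> (br x y)"
    using exact2 alt unfolding closed2_exact_def by blast
  have "?K' \<subseteq> {z. \<theta> z = 0}"
  proof (rule lie_prod_subset[OF linear_subspace_kernel[OF \<theta>(1)]])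
    fix a b assume "a \<in> ?K" "b \<in> ?K"
    then show "br a b \<in> {z. \<theta> z = 0}" by (simp add: \<theta>(2)[symmetric] \<sigma>_def)
  qed
  then have "\<theta> (br t y) = 0" using y(2) by blast
  then show False using \<theta>(2)[of t y] \<alpha>(3) \<gamma>(3) \<gamma>t y(1) by (simp add: \<sigma>_def)
qed

text \<open>Let \<open>K\<close> be the kernel of a nonzero functional that vanishes on
  \<open>h\<close>. By the preceding lemma \<open>ad t\<close> is injective on
  \<open>K/[K,K]\<close>, hence surjective by finite dimension, so \<open>K\<close> is contained in
  \<open>[t,K] + [K,K]\<close> and therefore in \<open>h\<close>.\<close>

lemma derived_codim_one: "\<exists>\<alpha> t. linear \<alpha> \<and> \<alpha> t = (1::real) \<and> h = {x. \<alpha> x = 0}"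
proof -
  obtain t where "t \<notin> h" using h_neq_UNIV by blast
  then obtain \<alpha> :: "'e \<Rightarrow> real" where \<alpha>: "linear \<alpha>" "\<And>s. s \<in> h \<Longrightarrow> \<alpha> s = 0" "\<alpha> t = 1"
    using separating_functional[OF subspace_h] by metis
  have \<alpha>br: "\<alpha> (br x y) = 0" for x y using \<alpha>(2) br_h by blast
  let ?K = "{x. \<alpha> x = 0}"
  let ?K' = "lie_prod br ?K ?K"
  have subK: "subspace ?K" using linear_subspace_kernel[OF \<alpha>(1)] .
  have K'K: "?K' \<subseteq> ?K" by (intro lie_prod_subset subK) (simp add: \<alpha>br)
  have K'h: "?K' \<subseteq> h" by (intro lie_prod_subset subspace_h br_h)
  obtain p where p: "linear p" "\<And>v. p v \<in> ?K" "\<And>w. w \<in> ?K' \<Longrightarrow> p w = 0" "\<And>u. u \<in> ?K \<Longrightarrow> p u - u \<in> ?K'" "\<And>v. p (p v) = p v"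
    using section_proj_exists[OF subK subspace_lie_prod K'K] by blast
  define S where "S v = p (br t v)" for v
  have linS: "linear S" unfolding S_def using linear_compose[OF linear_br(1) p(1)] by (simp add: o_def)
  let ?Q = "range p"
  have subQ: "subspace ?Q" using linear_subspace_image[OF p(1) subspace_UNIV] .
  have "inj_on S ?Q"
  proof (subst linear_inj_on_iff_eq_0[OF linS subQ], intro ballI impI)
    fix q assume q: "q \<in> ?Q" "S q = 0"
    have "br t q \<in> ?K" by (simp add: \<alpha>br)
    then have "- br t q \<in> ?K'" using p(4)[of "br t q"] q(2) by (simp add: S_def)
    then have "br t q \<in> ?K'" using subspace_neg[OF subspace_lie_prod] by fastforce
    moreover have "\<alpha> q = 0" using q(1) p(2) by auto
    ultimately have "q \<in> ?K'" using derivation_injective_aux[OF \<alpha>(1) \<alpha>br \<alpha>(3)] by blast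
    moreover obtain v where "q = p v" using q(1) by blast
    ultimately show "q = 0" using p(3)[of q] p(5)[of v] by simp
  qed
  then have "dim (S ` ?Q) = dim ?Q"
    using dim_image_eq[OF linS, of ?Q] subQ by (simp add: span_eq_iff[THEN iffD2])
  moreover have "S ` ?Q \<subseteq> ?Q" by (auto simp: S_def)
  ultimately have SQ: "S ` ?Q = ?Q"
    using subspace_dim_equal[OF linear_subspace_image[OF linS subQ] subQ] by simp
  have "?K \<subseteq> h"
  proof
    fix y assume y: "y \<in> ?K"
    have "p y \<in> S ` ?Q" unfolding SQ by blast
    then obtain q where "p y = p (br t q)" by (auto simp: S_def)
    then have "p (y - br t q) = 0" by (simp add: linear_diff[OF p(1)])
    moreover have "y - br t q \<in> ?K" using y by (simp add: linear_diff[OF \<alpha>(1)] \<alpha>br)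
    ultimately have "- (y - br t q) \<in> ?K'" using p(4) by fastforce
    then have "- (y - br t q) \<in> h" using K'h by blast
    then have "br t q - (- (- (y - br t q))) \<in> h \<and> y - br t q \<in> h" using br_h subspace_neg[OF subspace_h] subspace_diff[OF subspace_h] by (metis minus_minus)
    then have "(y - br t q) + br t q \<in> h" using br_h subspace_add[OF subspace_h] by blast
    then show "y \<in> h" by simp
  qed
  then have "h = ?K" using \<alpha>(2) by blast
  then show ?thesis using \<alpha>(1,3) by blast
qed

section \<open>The splitting of the algebra into a line and \<open>h\<close>\<close>

definition \<alpha> :: "'e \<Rightarrow> real" where "\<alpha> = (SOME \<alpha>. \<exists>t. linear \<alpha> \<and> \<alpha> t = 1 \<and> h = {x. \<alpha> x = 0})"
definition t :: 'e where "t = (SOME t. \<alpha> t = 1)"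

lemma linear_\<alpha>: "linear \<alpha>" and \<alpha>_t: "\<alpha> t = 1" and h_eq: "h = {x. \<alpha> x = 0}"
proof -
  have *: "\<exists>t. linear \<alpha> \<and> \<alpha> t = 1 \<and> h = {x. \<alpha> x = 0}"
    unfolding \<alpha>_def by (rule someI_ex[OF derived_codim_one])
  then show "linear \<alpha>" "h = {x. \<alpha> x = 0}" by blast+
  have "\<exists>t. \<alpha> t = 1" using * by blast
  then show "\<alpha> t = 1" unfolding t_def by (rule someI_ex)
qed

abbreviation D :: "'e \<Rightarrow> 'e" where "D \<equiv> br t"

definition P :: "'e \<Rightarrow> 'e" where "P x = x - \<alpha> x *\<^sub>R t"

lemma \<alpha>_br: "\<alpha> (br x y) = 0"
  using br_h[of x y] by (simp add: h_eq)

lemma linear_P: "linear P"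
  unfolding P_def by (rule linearI) (simp_all add: linear_add[OF linear_\<alpha>] linear_scale[OF linear_\<alpha>] algebra_simps)

lemma P_h: "P x \<in> h" and P_id: "x \<in> h \<Longrightarrow> P x = x" and P_t: "P t = 0"
  by (simp_all add: P_def h_eq linear_diff[OF linear_\<alpha>] linear_scale[OF linear_\<alpha>] \<alpha>_t)

lemma P_decomp: "x = \<alpha> x *\<^sub>R t + P x"
  by (simp add: P_def)

lemma dim_h: "dim h = 6"
proof -
  have "(UNIV :: 'e set) \<subseteq> span (insert t h)"
  proof
    fix x
    have "\<alpha> x *\<^sub>R t + P x \<in> span (insert t h)"
      using P_h[of x] by (intro span_add span_scale) (auto intro: span_base)
    then show "x \<in> span (insert t h)" using P_decomp[of x] by simp
  qed
  then have "dim (insert t h) = dim (UNIV :: 'e set)" by (metis dim_span top.extremum_uniqueI)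
  moreover have "t \<notin> span h" using subspace_h by (simp add: span_eq_iff[THEN iffD2] h_eq \<alpha>_t)
  ultimately show ?thesis using dim7 by (simp add: dim_insert)
qed

lemma D_injective: "y \<in> h \<Longrightarrow> D y \<in> n 1 \<Longrightarrow> y \<in> n 1"
  using derivation_injective_aux[OF linear_\<alpha> \<alpha>_br \<alpha>_t, of y] by (simp add: h_eq n_Suc n_0)

text \<open>Every element of \<open>h\<close> is a sum of brackets, and splitting both factors of a
  bracket along \<open>t\<close> and \<open>h\<close> leaves a value of \<open>D\<close> plus an
  element of \<open>[h,h]\<close>.\<close>

lemma D_surjective: "\<exists>q\<in>h. y - D q \<in> n 1" if "y \<in> h"
proof -
  have "lie_prod br UNIV UNIV \<subseteq> {y. \<exists>q\<in>h. y - D q \<in> n 1}"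
  proof (rule lie_prod_subset)
    show "subspace {y. \<exists>q\<in>h. y - D q \<in> n 1}"
      unfolding subspace_def
    proof (intro conjI allI ballI)
      show "0 \<in> {y. \<exists>q\<in>h. y - D q \<in> n 1}"
        using subspace_0[OF subspace_h] subspace_0[OF subspace_n] by (auto simp: br_zero intro!: bexI[of _ 0])
      fix x y assume "x \<in> {y. \<exists>q\<in>h. y - D q \<in> n 1}" "y \<in> {y. \<exists>q\<in>h. y - D q \<in> n 1}"
      then obtain q q' where q: "q \<in> h" "q' \<in> h" "x - D q \<in> n 1" "y - D q' \<in> n 1" by blast
      have e: "x + y - D (q + q') = (x - D q) + (y - D q')" by (simp add: br_add)
      have "x + y - D (q + q') \<in> n 1" unfolding e by (rule subspace_add[OF subspace_n q(3,4)])
      then show "x + y \<in> {y. \<exists>q\<in>h. y - D q \<in> n 1}" using q subspace_add[OF subspace_h] by blast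
    next
      fix c x assume "x \<in> {y. \<exists>q\<in>h. y - D q \<in> n 1}"
      then obtain q where q: "q \<in> h" "x - D q \<in> n 1" by blast
      have e: "c *\<^sub>R x - D (c *\<^sub>R q) = c *\<^sub>R (x - D q)" by (simp add: br_scaleR scaleR_diff_right)
      have "c *\<^sub>R x - D (c *\<^sub>R q) \<in> n 1" unfolding e by (rule subspace_scale[OF subspace_n q(2)])
      then show "c *\<^sub>R x \<in> {y. \<exists>q\<in>h. y - D q \<in> n 1}" using q subspace_scale[OF subspace_h] by blast
    qed
    fix x y :: 'e
    have "br x y = br (\<alpha> x *\<^sub>R t + P x) (\<alpha> y *\<^sub>R t + P y)" using P_decomp by metis
    also have "\<dots> = \<alpha> x *\<^sub>R D (P y) - \<alpha> y *\<^sub>R D (P x) + br (P x) (P y)"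
      using br_antisym[of "P x" t] by (simp add: br_add br_scaleR br_self)
    finally have "br x y - D (\<alpha> x *\<^sub>R P y - \<alpha> y *\<^sub>R P x) = br (P x) (P y)" by (simp add: br_diff br_scaleR)
    moreover have "br (P x) (P y) \<in> n 1" using br_h_n[OF P_h, of "P y" 0] P_h by (simp add: n_0)
    moreover have "\<alpha> x *\<^sub>R P y - \<alpha> y *\<^sub>R P x \<in> h"
      using P_h by (intro subspace_diff[OF subspace_h] subspace_scale[OF subspace_h])
    ultimately show "br x y \<in> {y. \<exists>q\<in>h. y - D q \<in> n 1}" by (metis (mono_tags, lifting) mem_Collect_eq)
  qed
  then show ?thesis using that by (auto simp: h_def)
qed

text \<open>The first cohomology of \<open>h\<close>: a functional on \<open>h/[h,h]\<close>
  annihilated by the transpose of \<open>D\<close> is zero, since \<open>D\<close> is onto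
  there.\<close>

lemma functional_D_zero:
  assumes "linear \<gamma>" "\<And>x. x \<in> n 1 \<Longrightarrow> \<gamma> x = (0::real)" "\<And>x. x \<in> h \<Longrightarrow> \<gamma> (D x) = 0" "x \<in> h"
  shows "\<gamma> x = 0"
proof -
  obtain q where "q \<in> h" "x - D q \<in> n 1" using D_surjective[OF assms(4)] by blast
  then show ?thesis using assms(2)[of "x - D q"] assms(3)[of q] by (simp add: linear_diff[OF assms(1)])
qed

text \<open>Injectivity of \<open>D\<close> on the second and third cohomology of \<open>h\<close>: a form on \<open>h\<close> whose Lie derivative along \<open>t\<close>
  is exact extends to a closed form on the whole algebra.\<close>

lemma closed2_on_h_exact:
  assumes \<sigma>: "alternating2 \<sigma>" and closed: "\<And>x y z. x \<in> h \<Longrightarrow> y \<in> h \<Longrightarrow> z \<in> h \<Longrightarrow> diff2 br \<sigma> x y z = 0"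
    and \<tau>: "linear \<tau>" and L: "\<And>x y. x \<in> h \<Longrightarrow> y \<in> h \<Longrightarrow> \<sigma> (D x) y + \<sigma> x (D y) = \<tau> (br x y)"
  shows "\<exists>\<theta>. linear \<theta> \<and> (\<forall>x\<in>h. \<forall>y\<in>h. \<sigma> x y = \<theta> (br x y))"
proof -
  note l = linear_alternating2[OF \<sigma>]
  \<comment> \<open>The extension is \<open>\<sigma> + \<alpha> \<and> \<tau>\<close>, with
    \<open>\<sigma>\<close> and \<open>\<tau>\<close> pulled back along \<open>P\<close>. The
    assumption on the Lie derivative is what makes \<open>diff2\<close> vanish on triples containing
    \<open>t\<close>.\<close>
  define s where "s x y = \<sigma> (P x) (P y) + (\<alpha> x * \<tau> (P y) - \<tau> (P x) * \<alpha> y)" for x y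
  have lt: "linear (\<lambda>x. \<tau> (P x))" using linear_compose[OF linear_P \<tau>] by (simp add: o_def)
  have "alternating2 (\<lambda>x y. \<sigma> (P x) (P y))"
    using \<sigma> linear_compose[OF linear_P l(1)] linear_compose[OF linear_P l(2)]
    by (simp add: alternating2_def bilinear_def o_def)
  then have alt: "alternating2 s"
    unfolding s_def by (intro alternating2_add wedge2_alternating linear_\<alpha> lt)
  have alt3: "alternating3 (diff2 br s)" by (rule alternating3_diff2[OF alt])
  note l3 = linear_alternating3[OF alt3]
  have s_h: "s x y = \<sigma> x y" if "x \<in> h" "y \<in> h" for x y
    using that by (simp add: s_def P_id) (simp add: h_eq)
  have s_t: "s x t = - \<tau> x" if "x \<in> h" for x
    using that by (simp add: s_def P_id P_t \<alpha>_t linear_0[OF l(1)] linear_0[OF \<tau>])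
  have F1: "diff2 br s x y z = 0" if "x \<in> h" "y \<in> h" "z \<in> h" for x y z
    using closed[OF that] that by (simp add: diff2_def s_h br_h)
  have F2: "diff2 br s t x y = 0" if "x \<in> h" "y \<in> h" for x y
    using L[OF that] that br_antisym[of y t] alternating2_antisym[OF \<sigma>, of x "D y"] linear_neg[OF linear_alternating2(2)[OF alt]]
    by (simp add: diff2_def s_h s_t br_h)
  have "diff2 br s x y z = 0" for x y z
  proof -
    have r: "diff2 br s t t u = 0" "diff2 br s t u t = 0" "diff2 br s u t t = 0" for u
      using alt3 by (auto simp: alternating3_def)
    have F2': "diff2 br s x t y = 0" "diff2 br s x y t = 0" if "x \<in> h" "y \<in> h" for x y
      using F2[OF that] F2[OF that(2,1)] alternating3_antisym[OF alt3, of x t y] alternating3_antisym[OF alt3, of x y t] by auto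
    have "diff2 br s x y z = diff2 br s (\<alpha> x *\<^sub>R t + P x) (\<alpha> y *\<^sub>R t + P y) (\<alpha> z *\<^sub>R t + P z)"
      using P_decomp by metis
    also have "\<dots> = 0"
      by (simp add: linear_add[OF l3(1)] linear_add[OF l3(2)] linear_add[OF l3(3)] linear_scale[OF l3(1)] linear_scale[OF l3(2)]
        linear_scale[OF l3(3)] r F1 F2 F2' P_h)
    finally show ?thesis .
  qed
  then obtain \<theta> where "linear \<theta>" "\<And>x y. s x y = \<theta> (br x y)"
    using exact2 alt unfolding closed2_exact_def by blast
  then show ?thesis using s_h by metis
qed

lemma closed3_on_h_exact:
  assumes \<omega>: "alternating3 \<omega>" and closed: "\<And>w x y z. w \<in> h \<Longrightarrow> x \<in> h \<Longrightarrow> y \<in> h \<Longrightarrow> z \<in> h \<Longrightarrow> diff3 br \<omega> w x y z = 0"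
    and \<rho>: "alternating2 \<rho>" and L: "\<And>x y z. x \<in> h \<Longrightarrow> y \<in> h \<Longrightarrow> z \<in> h \<Longrightarrow>
      \<omega> (D x) y z + \<omega> x (D y) z + \<omega> x y (D z) = diff2 br \<rho> x y z"
  shows "\<exists>\<beta>. alternating2 \<beta> \<and> (\<forall>x\<in>h. \<forall>y\<in>h. \<forall>z\<in>h. \<omega> x y z = diff2 br \<beta> x y z)"
proof -
  note l = linear_alternating3[OF \<omega>] and r = linear_alternating2[OF \<rho>]
  \<comment> \<open>The extension is \<open>\<omega>\<close> plus the wedge of \<open>\<rho>\<close>
    with \<open>\<alpha>\<close>, pulled back along \<open>P\<close>; the second term cancels the
    Lie derivative of the first.\<close>
  define s where "s x y z = \<omega> (P x) (P y) (P z) + (\<rho> (P x) (P y) * \<alpha> z + \<rho> (P y) (P z) * \<alpha> x + \<rho> (P z) (P x) * \<alpha> y)" for x y z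
  have "alternating2 (\<lambda>x y. \<rho> (P x) (P y))"
    using \<rho> linear_compose[OF linear_P r(1)] linear_compose[OF linear_P r(2)]
    by (simp add: alternating2_def bilinear_def o_def)
  moreover have "alternating3 (\<lambda>x y z. \<omega> (P x) (P y) (P z))"
    using \<omega> linear_compose[OF linear_P l(1)] linear_compose[OF linear_P l(2)] linear_compose[OF linear_P l(3)]
    by (simp add: alternating3_def o_def)
  ultimately have alt: "alternating3 s"
    unfolding s_def by (intro alternating3_add wedge21_alternating linear_\<alpha>)
  note ls = linear_alternating3[OF alt] and as = alternating3_antisym[OF alt]
  have s_h: "s x y z = \<omega> x y z" if "x \<in> h" "y \<in> h" "z \<in> h" for x y z
    using that by (simp add: s_def P_id) (simp add: h_eq)
  have s_t: "s x t y = - \<rho> x y" if "x \<in> h" "y \<in> h" for x y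
    using that alternating2_antisym[OF \<rho>, of y x]
    by (simp add: s_def P_id P_t \<alpha>_t linear_0[OF l(2)] linear_0[OF r(1)] linear_0[OF r(2)])
  define F where "F = diff3 br s"
  have sneg: "s (- a) b c = - s a b c" for a b c using linear_neg[OF ls(1)] .
  have lF: "linear (\<lambda>a. F a x y z)" for x y z
    unfolding F_def diff3_def
    by (rule linearI) (simp_all add: br_add br_scaleR linear_add[OF ls(1)] linear_add[OF ls(2)] linear_add[OF ls(3)]
      linear_scale[OF ls(1)] linear_scale[OF ls(2)] linear_scale[OF ls(3)] algebra_simps)
  \<comment> \<open>Antisymmetry under adjacent transpositions carries linearity from the first slot
    to all of them, so \<open>F\<close> need only be tested on \<open>h\<close> and on
    \<open>t\<close>.\<close>
  have F12: "F w x y z = - F x w y z" for w x y z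
    using sneg br_antisym[of w x] as(2)[of "br y z" w x] by (simp add: F_def diff3_def)
  have F23: "F w x y z = - F w y x z" for w x y z
    using sneg br_antisym[of x y] as(2)[of "br w z" x y] by (simp add: F_def diff3_def)
  have F34: "F w x y z = - F w x z y" for w x y z
    using sneg br_antisym[of y z] as(2)[of "br w x" y z] by (simp add: F_def diff3_def)
  have l2: "F w (a + b) y z = F w a y z + F w b y z" "F w (c *\<^sub>R a) y z = c * F w a y z" for w a b y z c
    unfolding F12[of w] by (simp_all add: linear_add[OF lF] linear_scale[OF lF])
  have l3: "F w x (a + b) z = F w x a z + F w x b z" "F w x (c *\<^sub>R a) z = c * F w x a z" for w a b x z c
    unfolding F23[of w x] by (simp_all add: l2)
  have l4: "F w x y (a + b) = F w x y a + F w x y b" "F w x y (c *\<^sub>R a) = c * F w x y a" for w a b x y c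
    unfolding F34[of w x y] by (simp_all add: l3)
  have Fh: "F w x y z = 0" if "w \<in> h" "x \<in> h" "y \<in> h" "z \<in> h" for w x y z
    using closed[OF that] that by (simp add: F_def diff3_def s_h br_h)
  have Ft: "F t x y z = 0" if "x \<in> h" "y \<in> h" "z \<in> h" for x y z
  proof -
    have "\<omega> (D y) x z = - \<omega> x (D y) z" "\<omega> (D z) x y = \<omega> x y (D z)"
      using alternating3_antisym[OF \<omega>, of "D y" x z] alternating3_antisym[OF \<omega>, of "D z" x y] alternating3_antisym[OF \<omega>, of x "D z" y] by auto
    moreover have "\<rho> (br z x) y = - \<rho> (br x z) y" using br_antisym[of z x] by (simp add: linear_neg[OF r(2)])
    ultimately show ?thesis
      using L[OF that] that by (simp add: F_def diff3_def diff2_def s_h s_t br_h)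
  qed
  have Ft': "F x t y z = 0" "F x y t z = 0" "F x y z t = 0" if "x \<in> h" "y \<in> h" "z \<in> h" for x y z
  proof -
    show 1: "F x t y z = 0" using F12[of x t y z] Ft[OF that] by simp
    show "F x y t z = 0" using F23[of x y t z] 1 by simp
    show "F x y z t = 0" using F34[of x y z t] F23[of x y t z] F12[of x t y z] Ft[OF that] by simp
  qed
  have r12: "F t t x y = 0" for x y using F12[of t t x y] by simp
  have r13: "F t x t y = 0" for x y using F23[of t x t y] r12 by simp
  have r14: "F t x y t = 0" for x y using F34[of t x y t] r13 by simp
  have r23: "F x t t y = 0" for x y using F12[of x t t y] r13 by simp
  have r24: "F x t y t = 0" for x y using F12[of x t y t] r14 by simp
  have r34: "F x y t t = 0" for x y using F23[of x y t t] r24 by simp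
  have "F w x y z = 0" for w x y z
  proof -
    have "F w x y z = F (\<alpha> w *\<^sub>R t + P w) (\<alpha> x *\<^sub>R t + P x) (\<alpha> y *\<^sub>R t + P y) (\<alpha> z *\<^sub>R t + P z)"
      using P_decomp by metis
    also have "\<dots> = 0"
      by (simp add: linear_add[OF lF] linear_scale[OF lF] l2 l3 l4 r12 r13 r14 r23 r24 r34 Fh Ft Ft' P_h)
    finally show ?thesis .
  qed
  then obtain \<beta> where "alternating2 \<beta>" "\<And>x y z. s x y z = diff2 br \<beta> x y z"
    using exact3 alt unfolding closed3_exact_def F_def by blast
  then show ?thesis using s_h by metis
qed

section \<open>The nilradical and solvability\<close>

lemma n1_neq_h: "n 1 \<noteq> h"
proof
  assume "n 1 = h"
  then have "h = {0}" using n_stable[of 0] by (simp add: n_0)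
  then show False using dim_h by simp
qed

text \<open>An ideal not contained in \<open>h\<close> has an element \<open>x\<close> with
  \<open>\<alpha> x \<noteq> 0\<close>, which acts on \<open>h/[h,h]\<close> as
  \<open>\<alpha> x\<close> times \<open>D\<close>. This is injective on a nonzero space, so
  iterated brackets with \<open>x\<close> never vanish and the ideal is not nilpotent.\<close>

lemma nilradical_eq: "nilradical br = h"
proof
  have "lie_ideal br h" by (simp add: lie_ideal_def subspace_h br_h)
  moreover have "lie_nilpotent br h" using nilpotent_h by (simp add: lie_nilpotent_def n_def)
  ultimately show "h \<subseteq> nilradical br" unfolding nilradical_def by (intro order_trans[OF _ span_superset]) blast
  have "I \<subseteq> h" if I: "lie_ideal br I" "lie_nilpotent br I" for I
  proof
    fix x assume x: "x \<in> I"
    show "x \<in> h"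
    proof (rule ccontr)
      assume "x \<notin> h"
      then have \<alpha>x: "\<alpha> x \<noteq> 0" by (simp add: h_eq)
      obtain k where k: "lower_central_series br I k = {0}" using I(2) by (auto simp: lie_nilpotent_def)
      obtain y where y: "y \<in> h" "y \<notin> n 1" using n1_neq_h n_dec[of 0] by (auto simp: n_0)
      have "(br x ^^ Suc j) y \<in> lower_central_series br I j" for j
      proof (induction j)
        case 0
        have "- br y x \<in> I" using I(1) x by (auto simp: lie_ideal_def intro: subspace_neg)
        then show ?case using br_antisym[of x y] by simp
      next
        case (Suc j)
        then show ?case using x by (simp add: lie_prod_in)
      qed
      from this[of k] have zero: "(br x ^^ Suc k) y = 0" using k by simp
      have "(br x ^^ j) y \<in> h \<and> (br x ^^ j) y \<notin> n 1" for j
      proof (induction j)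
        case 0
        then show ?case using y by simp
      next
        case (Suc j)
        let ?z = "(br x ^^ j) y"
        have "br x ?z = \<alpha> x *\<^sub>R D ?z + br (P x) ?z"
          by (subst P_decomp[of x]) (simp add: br_add br_scaleR)
        moreover have "br (P x) ?z \<in> n 1" using br_h_n[OF P_h, of ?z 0] Suc by (simp add: n_0)
        moreover have "D ?z \<notin> n 1" using D_injective Suc by blast
        ultimately have "br x ?z \<notin> n 1"
          using subspace_diff[OF subspace_n, of "br x ?z" 1 "br (P x) ?z"] subspace_scale[OF subspace_n, of "\<alpha> x *\<^sub>R D ?z" 1 "1 / \<alpha> x"] \<alpha>x
          by auto
        then show ?case by (simp add: br_h)
      qed
      from this[of "Suc k"] show False using zero subspace_0[OF subspace_n] by simp
    qed
  qed
  then show "nilradical br \<subseteq> h" unfolding nilradical_def using subspace_h by (intro span_minimal) auto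
qed

lemma solvable: "lie_solvable br UNIV"
proof -
  have "derived_series br UNIV (Suc i) \<subseteq> n i \<and> derived_series br UNIV (Suc i) \<subseteq> h" for i
  proof (induction i)
    case 0
    then show ?case by (simp add: n_0 h_def)
  next
    case (Suc i)
    then show ?case
      unfolding derived_series.simps(2)[of _ _ "Suc i"] n_Suc by (intro conjI lie_prod_mono lie_prod_subset subspace_h br_h) auto
  qed
  moreover obtain k where "n k = {0}" using nilpotent_h by blast
  ultimately have "derived_series br UNIV (Suc k) = {0}"
    using derived_series_0_in[OF subspace_UNIV, of br "Suc k"] by blast
  then show ?thesis unfolding lie_solvable_def by blast
qed

end

section \<open>The possible dimensions of the lower central series\<close>

lemma sum_lessThan_small:
  fixes f :: "nat \<Rightarrow> 'a::comm_monoid_add"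
  shows "(\<Sum>i<1. f i) = f 0" "(\<Sum>i<2. f i) = f 0 + f 1" "(\<Sum>i<3. f i) = f 0 + f 1 + f 2"
    "(\<Sum>i<4. f i) = f 0 + f 1 + f 2 + f 3" "(\<Sum>i<5. f i) = f 0 + f 1 + f 2 + f 3 + f 4"
  by (simp_all add: eval_nat_numeral)

lemma coords_modD:
  assumes "coords_mod V W k e c"
  shows "i < k \<Longrightarrow> e i \<in> V" "i < k \<Longrightarrow> linear (c i)" "i < k \<Longrightarrow> w \<in> W \<Longrightarrow> c i w = 0"
    "i < k \<Longrightarrow> c i (e i) = 1" "i < k \<Longrightarrow> j < k \<Longrightarrow> i \<noteq> j \<Longrightarrow> c i (e j) = 0"
    "v \<in> V \<Longrightarrow> v - (\<Sum>i<k. c i v *\<^sub>R e i) \<in> W"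
  using assms by (auto simp: coords_mod_def)

lemma alternating2_functional_br:
  assumes "lie_algebra br" "linear \<xi>"
  shows "alternating2 (\<lambda>x y. \<xi> (br x y))"
proof -
  interpret lie_algebra br by fact
  show ?thesis
    unfolding alternating2_def bilinear_def
    using linear_compose[OF linear_br(1) assms(2)] linear_compose[OF linear_br(2) assms(2)]
    by (simp add: o_def br_self linear_0[OF assms(2)])
qed

text \<open>The trace condition appears in arbitrary coordinates, free of the choice hidden in
  \<open>quot_trace\<close>, so each later proof can use a basis adapted to its brackets.\<close>

locale unimodular_cohomology_trivial = cohomology_trivial br for br :: "'e::euclidean_space \<Rightarrow> 'e \<Rightarrow> 'e" +
  assumes traceless: "coords_mod (n i) (n (Suc i)) k e c \<Longrightarrow> (\<Sum>j<k. c j (D (e j))) = 0"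
begin

lemma n_strict: "n i \<noteq> {0} \<Longrightarrow> dim (n (Suc i)) < dim (n i)"
  using n_stable[of i] subspace_dim_equal[OF subspace_n subspace_n n_dec[of i]] by linarith

lemma dim_0: "dim (n i) = 0 \<longleftrightarrow> n i = {0}"
  using subspace_0[OF subspace_n[of i]] by auto

text \<open>A traceless endomorphism of a line is zero. This is how the trace condition yields
  \<open>D\<close>-invariant vectors and forms.\<close>

lemma one_dim_section:
  assumes "dim (n i) = Suc (dim (n (Suc i)))" "z \<in> n i"
  shows "D z \<in> n (Suc i)"
proof -
  obtain e c where ec: "coords_mod (n i) (n (Suc i)) 1 e c"
    using coords_mod_exists[OF subspace_n subspace_n n_dec, of i 1] assms(1) by auto
  note co = coords_modD[OF ec]
  have "c 0 (D (e 0)) = 0" using traceless[OF ec] by (simp only: sum_lessThan_small)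
  then have De: "D (e 0) \<in> n (Suc i)"
    using co(6)[OF n_ideal[OF co(1)[of 0]], of t] by (simp add: sum_lessThan_small)
  have "z - c 0 z *\<^sub>R e 0 \<in> n (Suc i)" using co(6)[OF assms(2)] by (simp only: sum_lessThan_small)
  then have "D (z - c 0 z *\<^sub>R e 0) + c 0 z *\<^sub>R D (e 0) \<in> n (Suc i)"
    using subspace_add[OF subspace_n n_ideal subspace_scale[OF subspace_n De]] by blast
  then show ?thesis by (simp add: br_diff br_scaleR)
qed

lemma one_dim_coordinate:
  assumes "dim (n i) = 1" "n (Suc i) = {0}"
  obtains w \<eta> where "w \<in> n i" "linear \<eta>" "\<eta> w = (1::real)" "\<And>v. v \<in> n i \<Longrightarrow> v = \<eta> v *\<^sub>R w"
proof -
  obtain e c where ec: "coords_mod (n i) (n (Suc i)) 1 e c"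
    using coords_mod_exists[OF subspace_n subspace_n n_dec, of i 1] assms by auto
  note co = coords_modD[OF ec]
  show ?thesis
  proof (rule that[of "e 0" "c 0"])
    show "v = c 0 v *\<^sub>R e 0" if "v \<in> n i" for v using co(6)[OF that] assms(2) by (simp add: sum_lessThan_small)
  qed (use co in auto)
qed

lemma n1_subset:
  assumes "subspace S" "\<And>x y. x \<in> h \<Longrightarrow> y \<in> h \<Longrightarrow> br x y \<in> S"
  shows "n 1 \<subseteq> S"
  using lie_prod_subset[OF assms(1), of h h br] assms(2) by (simp add: n_Suc n_0)

lemma br_in:
  "x \<in> h \<Longrightarrow> y \<in> h \<Longrightarrow> br x y \<in> n 1" "x \<in> n 1 \<Longrightarrow> y \<in> h \<Longrightarrow> br x y \<in> n 2" "x \<in> h \<Longrightarrow> y \<in> n 1 \<Longrightarrow> br x y \<in> n 2"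
  "x \<in> n 1 \<Longrightarrow> y \<in> n 1 \<Longrightarrow> br x y \<in> n 3" "x \<in> h \<Longrightarrow> y \<in> n 2 \<Longrightarrow> br x y \<in> n 3" "x \<in> n 1 \<Longrightarrow> y \<in> n 2 \<Longrightarrow> br x y \<in> n 4"
  "x \<in> h \<Longrightarrow> y \<in> n 3 \<Longrightarrow> br x y \<in> n 4"
  using br_n_n[of x 0 y 0] br_n_n[of x 1 y 0] br_n_n[of x 0 y 1] br_n_n[of x 1 y 1] br_n_n[of x 0 y 2]
    br_n_n[of x 1 y 2] br_n_n[of x 0 y 3] by (simp_all add: n_0 eval_nat_numeral)

lemma n_sub_h: "n i \<subseteq> h"
  using n_mono[of 0 i] by (simp add: n_0)

lemma n1_h: "x \<in> n 1 \<Longrightarrow> x \<in> h"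
  using n_sub_h by blast

text \<open>If a single \<open>e 0\<close> spanned \<open>h/[h,h]\<close>, all brackets would lie in
  \<open>n 2\<close> because \<open>[e 0, e 0] = 0\<close>, and the series would stop descending
  before reaching zero.\<close>

lemma dim_n1_le: "dim (n 1) \<le> 4"
proof -
  have "n 0 \<noteq> {0}" using dim_0[of 0] dim_h by (simp add: n_0)
  then have "dim (n 1) < 6" using n_strict[of 0] dim_h by (simp add: n_0)
  moreover have "dim (n 1) \<noteq> 5"
  proof
    assume d: "dim (n 1) = 5"
    then obtain e c where ec: "coords_mod (n 0) (n 1) 1 e c"
      using coords_mod_exists[OF subspace_n subspace_n n_dec, of 0 1] dim_h by (auto simp: n_0)
    note co = coords_modD[OF ec]
    have e0: "e 0 \<in> h" using co(1)[of 0] by (simp add: n_0)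
    have exp: "x - c 0 x *\<^sub>R e 0 \<in> n 1" if "x \<in> h" for x using co(6)[of x] that by (simp only: sum_lessThan_small n_0)
    have "n 1 \<subseteq> n 2"
    proof (rule n1_subset[OF subspace_n])
      fix x y assume xy: "x \<in> h" "y \<in> h"
      have "br x y = br (x - c 0 x *\<^sub>R e 0) y + c 0 x *\<^sub>R br (e 0) (y - c 0 y *\<^sub>R e 0)"
        by (simp add: br_diff br_scaleR br_self)
      then show "br x y \<in> n 2"
        using exp xy e0 by (simp add: br_in subspace_add[OF subspace_n] subspace_scale[OF subspace_n])
    qed
    then have "n (Suc 1) = n 1" using n_dec[of 1] by (auto simp: numeral_2_eq_2)
    then show False using n_stable[of 1] d dim_0[of 1] by simp
  qed
  ultimately show ?thesis by simp
qed

text \<open>Let \<open>[x, y] = p(x, y) z\<close> and \<open>\<xi> z = 1\<close>. If \<open>p\<close> has rank 2, the closed 3-form \<open>p \<and> \<xi>\<close> gives a contradiction. If it has rank 4, then \<open>D\<close> is infinitesimally symplectic on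
  the span of \<open>a, b, c, d\<close>, hence traceless there, so that the trace condition forces \<open>D v \<in> [h, h]\<close> for \<open>v\<close> in the radical of \<open>p\<close>.\<close>

lemma dim_n1_neq_1: "dim (n 1) \<noteq> 1"
proof
  assume d1: "dim (n 1) = 1"
  then have "n 1 \<noteq> {0}" using dim_0[of 1] by simp
  then have n2: "n 2 = {0}" using n_strict[of 1] d1 dim_0[of 2] by (simp add: numeral_2_eq_2)
  obtain z \<xi> where z: "z \<in> n 1" "linear \<xi>" "\<xi> z = (1::real)" "\<And>v. v \<in> n 1 \<Longrightarrow> v = \<xi> v *\<^sub>R z"
    using one_dim_coordinate[of 1] d1 n2 by (auto simp: numeral_2_eq_2)
  have zh: "z \<in> h" using z(1) n_sub_h by blast
  have Dz: "D z = 0" using one_dim_section[of 1 z] z(1) d1 n2 by (simp add: numeral_2_eq_2)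
  define p where "p x y = \<xi> (br x y)" for x y
  have alt: "alternating2 p" unfolding p_def by (rule alternating2_functional_br[OF lie_algebra_axioms z(2)])
  note l = linear_alternating2[OF alt] and anti = alternating2_antisym[OF alt]
  have p0: "p x x = 0" for x using alt by (simp add: alternating2_def)
  have brp: "br x y = p x y *\<^sub>R z" if "x \<in> h" "y \<in> h" for x y using z(4)[OF br_in(1)[OF that]] by (simp add: p_def)
  have pn1: "p x y = 0" "p y x = 0" if "x \<in> n 1" "y \<in> h" for x y
    using br_in(2)[OF that] br_in(3)[OF that(2,1)] n2 by (simp_all add: p_def linear_0[OF z(2)])
  have pz: "p z x = 0" "p x z = 0" if "x \<in> h" for x using pn1[OF z(1) that] .
  have pD: "p (D x) y + p x (D y) = 0" if "x \<in> h" "y \<in> h" for x y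
  proof -
    have "br (D x) y + br x (D y) = D (br x y)" using jacobi'[of t x y] by simp
    also have "\<dots> = 0" using brp[OF that] Dz by (simp add: br_scaleR)
    finally show ?thesis by (simp add: p_def linear_add[OF z(2), symmetric] linear_0[OF z(2)])
  qed
  have "\<exists>a\<in>h. \<exists>b\<in>h. p a b \<noteq> 0"
  proof (rule ccontr)
    assume "\<not> ?thesis"
    then have "n 1 \<subseteq> {0}" using brp by (intro n1_subset) auto
    then show False using \<open>n 1 \<noteq> {0}\<close> subspace_0[OF subspace_n] by blast
  qed
  then obtain a b0 where ab0: "a \<in> h" "b0 \<in> h" "p a b0 \<noteq> 0" by blast
  define b where "b = (1 / p a b0) *\<^sub>R b0"
  have b: "b \<in> h" "p a b = 1" using ab0 subspace_scale[OF subspace_h] by (simp_all add: b_def linear_scale[OF l(1)])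
  note a = ab0(1)
  have ex: "\<exists>w\<in>h. \<exists>x\<in>h. \<exists>y\<in>h. \<exists>u\<in>h. p w x * p y u - p w y * p x u + p w u * p x y \<noteq> 0"
  proof (rule ccontr)
    assume "\<not> ?thesis"
    then have pf: "p w x * p y u - p w y * p x u + p w u * p x y = 0" if "w \<in> h" "x \<in> h" "y \<in> h" "u \<in> h" for w x y u
      using that by blast
    define \<omega> where "\<omega> x y w = p x y * \<xi> w + p y w * \<xi> x + p w x * \<xi> y" for x y w
    have alt3: "alternating3 \<omega>" unfolding \<omega>_def by (rule wedge21_alternating[OF alt z(2)])
    \<comment> \<open>The Lie derivative of \<open>\<omega>\<close> is the wedge of \<open>p\<close>
      with \<open>\<kappa>\<close>. It is \<open>diff2\<close> of
      \<open>\<xi> \<and> \<kappa>\<close>, because brackets are multiples of \<open>z\<close> with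
      \<open>\<xi> z = 1\<close> and \<open>\<kappa> z = 0\<close>.\<close>
    define \<kappa> where "\<kappa> x = \<xi> (D x)" for x
    have lk: "linear \<kappa>" unfolding \<kappa>_def using linear_compose[OF linear_br(1) z(2)] by (simp add: o_def)
    have kz: "\<kappa> z = 0" by (simp add: \<kappa>_def Dz linear_0[OF z(2)])
    define \<rho> where "\<rho> x y = \<xi> x * \<kappa> y - \<kappa> x * \<xi> y" for x y
    have altr: "alternating2 \<rho>" unfolding \<rho>_def by (rule wedge2_alternating[OF z(2) lk])
    have lz: "\<xi> (s *\<^sub>R z) = s" "\<kappa> (s *\<^sub>R z) = 0" for s by (simp_all add: linear_scale[OF z(2)] linear_scale[OF lk] z(3) kz)
    have \<omega>z: "\<omega> (s *\<^sub>R z) x y = s * p x y" if "x \<in> h" "y \<in> h" for s x y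
      using pz that by (simp add: \<omega>_def lz linear_scale[OF l(1)] linear_scale[OF l(2)])
    have "\<exists>\<beta>. alternating2 \<beta> \<and> (\<forall>x\<in>h. \<forall>y\<in>h. \<forall>z\<in>h. \<omega> x y z = diff2 br \<beta> x y z)"
    proof (rule closed3_on_h_exact[OF alt3 _ altr])
      fix w x y u assume hh: "w \<in> h" "x \<in> h" "y \<in> h" "u \<in> h"
      show "diff3 br \<omega> w x y u = 0"
        using pf[OF hh] hh by (simp add: diff3_def brp \<omega>z algebra_simps)
    next
      fix x y w assume hh: "x \<in> h" "y \<in> h" "w \<in> h"
      have "\<omega> (D x) y w + \<omega> x (D y) w + \<omega> x y (D w) =
        (p (D x) y + p x (D y)) * \<xi> w + (p (D y) w + p y (D w)) * \<xi> x + (p (D w) x + p w (D x)) * \<xi> y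
        + (p x y * \<kappa> w + p y w * \<kappa> x + p w x * \<kappa> y)"
        by (simp add: \<omega>_def \<kappa>_def algebra_simps)
      then show "\<omega> (D x) y w + \<omega> x (D y) w + \<omega> x y (D w) = diff2 br \<rho> x y w"
        using hh by (simp add: pD diff2_def brp \<rho>_def lz)
    qed
    then obtain \<beta> where \<beta>: "alternating2 \<beta>" "\<And>x y w. x \<in> h \<Longrightarrow> y \<in> h \<Longrightarrow> w \<in> h \<Longrightarrow> \<omega> x y w = diff2 br \<beta> x y w" by blast
    \<comment> \<open>At \<open>a\<close>, \<open>b\<close>, \<open>z\<close> the form takes the
      value \<open>1\<close>, whereas a primitive could only contribute
      \<open>\<beta> z z = 0\<close>.\<close>
    have "\<omega> a b z = diff2 br \<beta> a b z" using \<beta>(2) a b zh by blast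
    moreover have "\<omega> a b z = 1" using pz a b z(3) by (simp add: \<omega>_def)
    moreover have "diff2 br \<beta> a b z = 0"
      using \<beta>(1) a b zh pz linear_0[OF linear_alternating2(2)[OF \<beta>(1)]] by (simp add: diff2_def brp) (simp add: alternating2_def)
    ultimately show False by simp
  qed
  \<comment> \<open>If \<open>p\<close> vanished on the \<open>p\<close>-orthogonal complement of
    \<open>a\<close>, \<open>b\<close>, it would be decomposable, against \<open>ex\<close>.\<close>
  have "\<exists>c\<in>h. \<exists>d\<in>h. p c a = 0 \<and> p c b = 0 \<and> p d a = 0 \<and> p d b = 0 \<and> p c d \<noteq> 0"
  proof (rule ccontr)
    assume no: "\<not> ?thesis"
    have dec: "p x y = p x a * p y b - p x b * p y a" if xy: "x \<in> h" "y \<in> h" for x y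
    proof -
      define x' y' where "x' = x - p x b *\<^sub>R a + p x a *\<^sub>R b" and "y' = y - p y b *\<^sub>R a + p y a *\<^sub>R b"
      have "x' \<in> h" "y' \<in> h" using xy a b unfolding x'_def y'_def
        by (auto intro!: subspace_add[OF subspace_h] subspace_diff[OF subspace_h] subspace_scale[OF subspace_h])
      moreover have ba: "p b a = - 1" using anti[of b a] b by simp
      have "p x' a = 0" "p x' b = 0" "p y' a = 0" "p y' b = 0"
        by (simp_all add: x'_def y'_def linear_add[OF l(2)] linear_diff[OF l(2)] linear_scale[OF l(2)] p0 ba b(2))
      ultimately have "p x' y' = 0" using no by blast
      then show ?thesis
        using anti[of a y] anti[of b y] unfolding x'_def y'_def
        by (simp add: linear_add[OF l(1)] linear_diff[OF l(1)] linear_scale[OF l(1)]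
          linear_add[OF l(2)] linear_diff[OF l(2)] linear_scale[OF l(2)] p0 ba b(2) algebra_simps)
    qed
    obtain w x y u where hh: "w \<in> h" "x \<in> h" "y \<in> h" "u \<in> h" and ne: "p w x * p y u - p w y * p x u + p w u * p x y \<noteq> 0"
      using ex by blast
    have "p w x * p y u - p w y * p x u + p w u * p x y = 0"
      unfolding dec[OF hh(1,2)] dec[OF hh(3,4)] dec[OF hh(1,3)] dec[OF hh(2,4)] dec[OF hh(1,4)] dec[OF hh(2,3)] by algebra
    then show False using ne by blast
  qed
  then obtain c d0 where cd0: "c \<in> h" "d0 \<in> h" "p c a = 0" "p c b = 0" "p d0 a = 0" "p d0 b = 0" "p c d0 \<noteq> 0" by blast
  define d where "d = (1 / p c d0) *\<^sub>R d0"
  have d: "d \<in> h" "p c d = 1" "p d a = 0" "p d b = 0"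
    using cd0 subspace_scale[OF subspace_h] by (simp_all add: d_def linear_scale[OF l(1)] linear_scale[OF l(2)])
  note c = cd0(1,3,4)
  have ops: "p b a = - 1" "p d c = - 1" "p a c = 0" "p b c = 0" "p a d = 0" "p b d = 0"
    using anti[of b a] anti[of d c] anti[of a c] anti[of b c] anti[of a d] anti[of b d] b c d by simp_all
  let ?S1 = "insert a (n 1)" and ?S2 = "insert b (insert a (n 1))" and ?S3 = "insert c (insert b (insert a (n 1)))"
    and ?S4 = "insert d (insert c (insert b (insert a (n 1))))"
  have vanish: "x \<notin> span S" if "\<And>s. s \<in> S \<Longrightarrow> p s q = 0" "p x q \<noteq> 0" for x q S
    using linear_eq_0_on_span[OF l(2), of S q x] that by blast
  have "a \<notin> span (n 1)" by (rule vanish[of _ b]) (use pn1 b in auto)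
  moreover have "b \<notin> span ?S1" by (rule vanish[of _ a]) (use pn1 a ops p0 in auto)
  moreover have "c \<notin> span ?S2" by (rule vanish[of _ d]) (use pn1 d ops p0 in auto)
  moreover have "d \<notin> span ?S3" by (rule vanish[of _ c]) (use pn1 c ops p0 in auto)
  ultimately have dim4: "dim ?S4 = 5" using d1 by (simp add: dim_insert)
  have S4h: "span ?S4 \<subseteq> h" using a b c d n_sub_h subspace_h by (intro span_minimal) auto
  have "dim (span ?S4) = 5" using dim4 by (simp only: dim_span)
  moreover have "dim h \<noteq> 5" using dim_h by simp
  ultimately have "span ?S4 \<noteq> h" by metis
  then obtain y where y: "y \<in> h" "y \<notin> span ?S4" using S4h by blast
  \<comment> \<open>Subtracting the components along the hyperbolic pairs \<open>a\<close>,
    \<open>b\<close> and \<open>c\<close>, \<open>d\<close> makes \<open>v\<close> orthogonal to all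
    four; it completes them to a basis of \<open>h/[h,h]\<close>.\<close>
  define v where "v = y - (p y b *\<^sub>R a - p y a *\<^sub>R b + p y d *\<^sub>R c - p y c *\<^sub>R d)"
  have inS4: "p y b *\<^sub>R a - p y a *\<^sub>R b + p y d *\<^sub>R c - p y c *\<^sub>R d \<in> span ?S4"
    by (intro span_add span_diff span_scale) (auto intro: span_base)
  then have vh: "v \<in> h" using y S4h subspace_diff[OF subspace_h] by (auto simp: v_def)
  have vS4: "v \<notin> span ?S4" using y(2) inS4 span_add[of v ?S4 "y - v"] by (auto simp: v_def)
  have pv4: "p v a = 0" "p v b = 0" "p v c = 0" "p v d = 0"
    using ops b c d by (simp_all add: v_def linear_add[OF l(2)] linear_diff[OF l(2)] linear_scale[OF l(2)] p0)
  define e where "e i = [a, b, c, d, v] ! i" for i :: nat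
  have es: "e 0 = a" "e 1 = b" "e 2 = c" "e 3 = d" "e 4 = v" by (simp_all add: e_def)
  have im: "e ` {..<5} = {a, b, c, d, v}"
    by (simp add: eval_nat_numeral lessThan_Suc e_def) blast
  have eh: "e i \<in> h" if "i < 5" for i
  proof -
    have "e i \<in> e ` {..<5}" using that by blast
    then show ?thesis unfolding im using a b c d vh by auto
  qed
  have un: "e ` {..<5} \<union> n 1 = insert v ?S4" unfolding im by auto
  have spanh: "h = span (e ` {..<5} \<union> n 1)"
  proof (rule sym, rule subspace_dim_equal)
    show "span (e ` {..<5} \<union> n 1) \<subseteq> h" using eh n_sub_h subspace_h by (intro span_minimal) auto
    show "dim h \<le> dim (span (e ` {..<5} \<union> n 1))" using dim_h dim4 vS4 unfolding un dim_span by (simp add: dim_insert)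
  qed (use subspace_h in auto)
  have "\<exists>c. coords_mod h (n 1) 5 e c"
    using coords_mod_spanning[OF subspace_h subspace_n _ eh spanh] dim_h d1 by auto
  then obtain k where k: "coords_mod h (n 1) 5 e k" by blast
  note co = coords_modD[OF k]
  have Dh: "D x \<in> h" for x by (rule br_h)
  have exp: "p x q = k 0 x * p a q + k 1 x * p b q + k 2 x * p c q + k 3 x * p d q + k 4 x * p v q" if "x \<in> h" "q \<in> h" for x q
  proof -
    have "p (x - (k 0 x *\<^sub>R a + k 1 x *\<^sub>R b + k 2 x *\<^sub>R c + k 3 x *\<^sub>R d + k 4 x *\<^sub>R v)) q = 0"
      using co(6)[OF that(1)] pn1(1)[OF _ that(2)] by (simp only: sum_lessThan_small es)
    then show ?thesis by (simp add: linear_add[OF l(2)] linear_diff[OF l(2)] linear_scale[OF l(2)])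
  qed
  have kk: "k 0 x = p x b" "k 1 x = - p x a" "k 2 x = p x d" "k 3 x = - p x c" if "x \<in> h" for x
    using exp[OF that b(1)] exp[OF that a] exp[OF that d(1)] exp[OF that c(1)] pv4 ops b c d p0 by simp_all
  have pv: "p v x = 0" if "x \<in> h" for x
    using exp[OF that vh] anti[of v x] anti[of a v] anti[of b v] anti[of c v] anti[of d v] pv4 p0 by simp
  have "(\<Sum>j<5. k j (D (e j))) = 0" using traceless[of 0 5 e k] k by (simp add: n_0)
  then have "k 0 (D a) + k 1 (D b) + k 2 (D c) + k 3 (D d) + k 4 (D v) = 0" by (simp only: sum_lessThan_small es)
  moreover have "k 0 (D a) + k 1 (D b) = 0"
    using kk(1)[OF Dh, of a] kk(2)[OF Dh, of b] pD[OF a b(1)] anti[of a "D b"] by simp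
  moreover have "k 2 (D c) + k 3 (D d) = 0"
    using kk(3)[OF Dh, of c] kk(4)[OF Dh, of d] pD[OF c(1) d(1)] anti[of c "D d"] by simp
  ultimately have "k 4 (D v) = 0" by simp
  moreover have "p (D v) x = 0" if "x \<in> h" for x using pD[OF vh that] pv[OF Dh, of x] by simp
  then have "k 0 (D v) = 0" "k 1 (D v) = 0" "k 2 (D v) = 0" "k 3 (D v) = 0"
    using kk[OF Dh, of v] a b c d by simp_all
  ultimately have "D v \<in> n 1" using co(6)[OF Dh, of v] by (simp only: sum_lessThan_small scaleR_zero_left diff_zero add_0_left)
  then have "v \<in> n 1" by (rule D_injective[OF vh])
  then show False using vS4 span_base[of v ?S4] by blast
qed

text \<open>Otherwise \<open>n 1 / n 2\<close> and \<open>n 2\<close> are lines and both are killed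
  by \<open>D\<close>. For \<open>z\<close> in \<open>n 1\<close> the functional
  \<open>x \<mapsto> \<xi> [x, z]\<close> on \<open>h/[h,h]\<close> is then invariant, hence zero,
  and \<open>n 2\<close> vanishes after all.\<close>

lemma dim_n1_2_imp_n2_zero:
  assumes d1: "dim (n 1) = 2"
  shows "n 2 = {0}"
proof (rule ccontr)
  assume n2: "n 2 \<noteq> {0}"
  have "n 1 \<noteq> {0}" using d1 dim_0[of 1] by simp
  then have "dim (n 2) < 2" using n_strict[of 1] d1 by (simp add: numeral_2_eq_2)
  then have d2: "dim (n 2) = 1" using n2 dim_0[of 2] by linarith
  then have n3: "n 3 = {0}" using n_strict[of 2] n2 dim_0[of 3] by (simp add: eval_nat_numeral)
  obtain w \<xi> where w: "w \<in> n 2" "linear \<xi>" "\<xi> w = (1::real)" "\<And>v. v \<in> n 2 \<Longrightarrow> v = \<xi> v *\<^sub>R w"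
    using one_dim_coordinate[of 2] d2 n3 by (auto simp: eval_nat_numeral)
  have D1: "D z \<in> n 2" if "z \<in> n 1" for z using one_dim_section[of 1 z] that d1 d2 by (simp add: eval_nat_numeral)
  have D2: "D z = 0" if "z \<in> n 2" for z using one_dim_section[of 2 z] that d2 n3 by (simp add: eval_nat_numeral)
  have "br x z = 0" if x: "x \<in> h" and z: "z \<in> n 1" for x z
  proof -
    have "\<xi> (br x z) = 0"
    proof (rule functional_D_zero[of "\<lambda>x. \<xi> (br x z)", OF _ _ _ x])
      show "linear (\<lambda>x. \<xi> (br x z))" using linear_compose[OF linear_br(2) w(2)] by (simp add: o_def)
      show "\<xi> (br x z) = 0" if "x \<in> n 1" for x using br_in(4)[OF that z] n3 by (simp add: linear_0[OF w(2)])
      fix x assume x: "x \<in> h"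
      have "br (D x) z = D (br x z) - br x (D z)" using jacobi'[of t x z] by simp
      moreover have "D (br x z) = 0" using D2 br_in(3)[OF x z] .
      moreover have "br x (D z) = 0" using br_in(5)[OF x D1[OF z]] n3 by simp
      ultimately show "\<xi> (br (D x) z) = 0" by (simp add: linear_0[OF w(2)])
    qed
    then show ?thesis using w(4)[OF br_in(3)[OF x z]] by simp
  qed
  then have "lie_prod br h (n 1) \<subseteq> {0}" by (intro lie_prod_subset) auto
  then have "n 2 \<subseteq> {0}" by (simp add: n_Suc eval_nat_numeral)
  then show False using n2 subspace_0[OF subspace_n] by blast
qed

end

lemma lessThan_small: "{..<1::nat} = {0}" "{..<2::nat} = {0, 1}" "{..<3::nat} = {0, 1, 2}"
  by auto

context unimodular_cohomology_trivial
begin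

lemma n_2: "n 2 = lie_prod br h (n 1)" and n_3: "n 3 = lie_prod br h (n 2)"
  using n_Suc[of 1] n_Suc[of 2] by (simp_all add: eval_nat_numeral)

lemma n1_sub_n0: "n 1 \<subseteq> n 0"
  by (rule n_mono) simp

lemma br_cong_mod_n2:
  assumes "x \<in> h" "y \<in> h" "x' \<in> h" "y' \<in> h" "x - x' \<in> n 1" "y - y' \<in> n 1"
  shows "br x y - br x' y' \<in> n 2"
proof -
  have e: "br x y - br x' y' = br (x - x') y + br x' (y - y')" by (simp add: br_diff)
  show ?thesis unfolding e using assms by (intro subspace_add[OF subspace_n] br_in)
qed

text \<open>The main case is the one where the three brackets \<open>f\<^sub>i\<close> of the generators \<open>e\<^sub>i\<close> are independent modulo \<open>n 2\<close>. With dual forms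
  \<open>e\<^sup>i\<close>, \<open>f\<^sup>i\<close>, the contradiction comes from the 2-form \<open>\<Sum>\<^sub>i (e\<^sup>i \<circ> D) \<and> f\<^sup>i\<close>.\<close>

lemma dim_n1_neq_3: "dim (n 1) \<noteq> 3"
proof
  note One_nat_def [simp del]
  assume d1: "dim (n 1) = 3"
  have "\<exists>e c. coords_mod (n 0) (n 1) 3 e c"
    using coords_mod_exists[OF subspace_n subspace_n n1_sub_n0, of 3] d1 dim_h by (simp add: n_0)
  then obtain e c where ec: "coords_mod (n 0) (n 1) 3 e c" by blast
  note co = coords_modD[OF ec]
  have eh: "e 0 \<in> h" "e 1 \<in> h" "e 2 \<in> h" using co(1) by (simp_all add: n_0)
  have lc: "linear (c 0)" "linear (c 1)" "linear (c 2)" using co(2) by simp_all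
  have cn1: "c 0 v = 0" "c 1 v = 0" "c 2 v = 0" if "v \<in> n 1" for v using co(3) that by simp_all
  have ce: "c 0 (e 0) = 1" "c 1 (e 1) = 1" "c 2 (e 2) = 1" "c 0 (e 1) = 0" "c 0 (e 2) = 0" "c 1 (e 0) = 0"
    "c 1 (e 2) = 0" "c 2 (e 0) = 0" "c 2 (e 1) = 0"
    using co(4,5) by simp_all
  define xb where "xb x = c 0 x *\<^sub>R e 0 + c 1 x *\<^sub>R e 1 + c 2 x *\<^sub>R e 2" for x
  have xb: "x - xb x \<in> n 1" if "x \<in> h" for x
    using co(6)[of x] that unfolding xb_def by (simp only: sum_lessThan_small n_0)
  have xbh: "xb x \<in> h" for x
    unfolding xb_def using eh by (intro subspace_add[OF subspace_h] subspace_scale[OF subspace_h])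
  \<comment> \<open>The cyclic order identifies the exterior square of the three-dimensional
    quotient \<open>h/[h,h]\<close> with its dual.\<close>
  define f0 f1 f2 where "f0 = br (e 1) (e 2)" and "f1 = br (e 2) (e 0)" and "f2 = br (e 0) (e 1)"
  have fn1: "f0 \<in> n 1" "f1 \<in> n 1" "f2 \<in> n 1" unfolding f0_def f1_def f2_def using br_in(1) eh by blast+
  define \<epsilon>0 \<epsilon>1 \<epsilon>2 where "\<epsilon>0 x y = c 1 x * c 2 y - c 2 x * c 1 y" and "\<epsilon>1 x y = c 2 x * c 0 y - c 0 x * c 2 y"
    and "\<epsilon>2 x y = c 0 x * c 1 y - c 1 x * c 0 y" for x y
  have brf: "br x y - (\<epsilon>0 x y *\<^sub>R f0 + \<epsilon>1 x y *\<^sub>R f1 + \<epsilon>2 x y *\<^sub>R f2) \<in> n 2" if "x \<in> h" "y \<in> h" for x y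
  proof -
    have "br (xb x) (xb y) = \<epsilon>0 x y *\<^sub>R f0 + \<epsilon>1 x y *\<^sub>R f1 + \<epsilon>2 x y *\<^sub>R f2"
      using br_antisym[of "e 2" "e 1"] br_antisym[of "e 0" "e 2"] br_antisym[of "e 1" "e 0"]
      by (simp add: xb_def \<epsilon>0_def \<epsilon>1_def \<epsilon>2_def f0_def f1_def f2_def br_add br_scaleR br_self algebra_simps)
    then show ?thesis using br_cong_mod_n2[OF that xbh xbh xb[OF that(1)] xb[OF that(2)]] by simp
  qed
  define A where "A i j = c i (D (e j))" for i j :: nat
  have "(\<Sum>j<3. c j (D (e j))) = 0" using traceless[of 0 3 e c] ec by (simp add: One_nat_def)
  then have tr: "A 2 2 = - A 0 0 - A 1 1" by (simp only: sum_lessThan_small A_def)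
  have cD: "c i (D x) = A i 0 * c 0 x + A i 1 * c 1 x + A i 2 * c 2 x" if i: "i < 3" and x: "x \<in> h" for i x
  proof -
    note li = co(2)[OF i]
    have "c i (D (x - xb x)) = 0" using n_ideal[OF xb[OF x]] co(3)[OF i] by blast
    then show ?thesis
      by (simp add: br_diff br_add br_scaleR xb_def linear_diff[OF li] linear_add[OF li] linear_scale[OF li] A_def)
  qed
  have Dh: "D x \<in> h" for x by (rule br_h)
  have \<mu>br: "\<mu> (br x y) = \<epsilon>0 x y * \<mu> f0 + \<epsilon>1 x y * \<mu> f1 + \<epsilon>2 x y * \<mu> f2"
    if "linear \<mu>" "\<And>v. v \<in> n 2 \<Longrightarrow> \<mu> v = (0::real)" "x \<in> h" "y \<in> h" for \<mu> x y
    using that(2)[OF brf[OF that(3,4)]] by (simp add: linear_diff[OF that(1)] linear_add[OF that(1)] linear_scale[OF that(1)])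
  \<comment> \<open>Under that identification, and because \<open>A\<close> is traceless,
    \<open>D\<close> acts on the \<open>f\<close>-vectors modulo \<open>n 2\<close> by minus the
    transpose of \<open>A\<close>.\<close>
  have \<mu>Df: "\<mu> (D f0) = - (A 0 0 * \<mu> f0 + A 0 1 * \<mu> f1 + A 0 2 * \<mu> f2)"
    "\<mu> (D f1) = - (A 1 0 * \<mu> f0 + A 1 1 * \<mu> f1 + A 1 2 * \<mu> f2)"
    "\<mu> (D f2) = - (A 2 0 * \<mu> f0 + A 2 1 * \<mu> f1 + A 2 2 * \<mu> f2)"
    if \<mu>: "linear \<mu>" "\<And>v. v \<in> n 2 \<Longrightarrow> \<mu> v = (0::real)" for \<mu>
  proof -
    have "D (br x y) = br (D x) y + br x (D y)" for x y using jacobi'[of t x y] by simp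
    then have Dbr: "\<mu> (D (br x y)) = \<mu> (br (D x) y) + \<mu> (br x (D y))" for x y by (simp add: linear_add[OF \<mu>(1)])
    have "\<mu> (D f0) = \<mu> (br (D (e 1)) (e 2)) + \<mu> (br (e 1) (D (e 2)))"
      "\<mu> (D f1) = \<mu> (br (D (e 2)) (e 0)) + \<mu> (br (e 2) (D (e 0)))"
      "\<mu> (D f2) = \<mu> (br (D (e 0)) (e 1)) + \<mu> (br (e 0) (D (e 1)))"
      unfolding f0_def f1_def f2_def by (rule Dbr)+
    then show "\<mu> (D f0) = - (A 0 0 * \<mu> f0 + A 0 1 * \<mu> f1 + A 0 2 * \<mu> f2)"
      "\<mu> (D f1) = - (A 1 0 * \<mu> f0 + A 1 1 * \<mu> f1 + A 1 2 * \<mu> f2)"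
      "\<mu> (D f2) = - (A 2 0 * \<mu> f0 + A 2 1 * \<mu> f1 + A 2 2 * \<mu> f2)"
      by (simp_all add: \<mu>br[OF \<mu>] eh Dh \<epsilon>0_def \<epsilon>1_def \<epsilon>2_def ce cD tr algebra_simps)
  qed
  have \<mu>zero: "\<mu> v = 0" if "linear \<mu>" "\<And>v. v \<in> n 2 \<Longrightarrow> \<mu> v = (0::real)" "\<mu> f0 = 0" "\<mu> f1 = 0" "\<mu> f2 = 0" "v \<in> n 1" for \<mu> v
  proof -
    have "n 1 \<subseteq> {v. \<mu> v = 0}"
      by (rule n1_subset[OF linear_subspace_kernel[OF that(1)]]) (simp add: \<mu>br[OF that(1,2)] that(3-5))
    then show ?thesis using that(6) by blast
  qed
  \<comment> \<open>Injectivity of the transpose of \<open>A\<close>, the matrix of \<open>D\<close>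
    on \<open>h/[h,h]\<close>.\<close>
  have cD_zero: "k0 = 0 \<and> k1 = 0 \<and> k2 = (0::real)"
    if k: "k0 * A 0 0 + k1 * A 1 0 + k2 * A 2 0 = 0" "k0 * A 0 1 + k1 * A 1 1 + k2 * A 2 1 = 0"
      "k0 * A 0 2 + k1 * A 1 2 + k2 * A 2 2 = 0" for k0 k1 k2
  proof -
    let ?\<phi> = "\<lambda>x. k0 * c 0 x + k1 * c 1 x + k2 * c 2 x"
    have lin: "linear ?\<phi>"
      by (rule linearI) (simp_all add: linear_add[OF lc(1)] linear_add[OF lc(2)] linear_add[OF lc(3)]
        linear_scale[OF lc(1)] linear_scale[OF lc(2)] linear_scale[OF lc(3)] algebra_simps)
    have "?\<phi> (D x) = 0" if x: "x \<in> h" for x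
    proof -
      have "?\<phi> (D x) = (k0 * A 0 0 + k1 * A 1 0 + k2 * A 2 0) * c 0 x + (k0 * A 0 1 + k1 * A 1 1 + k2 * A 2 1) * c 1 x
         + (k0 * A 0 2 + k1 * A 1 2 + k2 * A 2 2) * c 2 x"
        by (simp add: cD[OF _ x] algebra_simps)
      then show ?thesis unfolding k by simp
    qed
    then have "?\<phi> x = 0" if "x \<in> h" for x
      by (intro functional_D_zero[OF lin _ _ that]) (simp add: cn1)
    from this[OF eh(1)] this[OF eh(2)] this[OF eh(3)] show ?thesis by (simp add: ce)
  qed
  have "n 1 \<noteq> {0}" using d1 dim_0[of 1] by simp
  then have "dim (n 2) < 3" using n_strict[of 1] d1 by simp
  then consider "dim (n 2) = 2" | "dim (n 2) = 1" | "dim (n 2) = 0" by linarith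
  then show False
  proof cases
    case 1
    have D1: "D v \<in> n 2" if "v \<in> n 1" for v using one_dim_section[of 1 v] that d1 1 by simp
    have "\<exists>u d. coords_mod (n 1) (n 2) 1 u d"
      using coords_mod_exists[OF subspace_n subspace_n n_dec, of 1 1] d1 1 by simp
    then obtain u d where ud: "coords_mod (n 1) (n 2) 1 u d" by blast
    note cu = coords_modD[OF ud]
    define \<mu> where "\<mu> = d 0"
    have \<mu>: "linear \<mu>" "\<And>v. v \<in> n 2 \<Longrightarrow> \<mu> v = 0" using cu(2,3) by (simp_all add: \<mu>_def)
    have \<mu>D: "A 0 0 * \<mu> f0 + A 0 1 * \<mu> f1 + A 0 2 * \<mu> f2 = 0" "A 1 0 * \<mu> f0 + A 1 1 * \<mu> f1 + A 1 2 * \<mu> f2 = 0"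
      "A 2 0 * \<mu> f0 + A 2 1 * \<mu> f1 + A 2 2 * \<mu> f2 = 0"
      using \<mu>Df[OF \<mu>] \<mu>(2)[OF D1] fn1 by (simp_all add: \<mu>(2) D1)
    \<comment> \<open>On the line \<open>n 1 / n 2\<close> the map \<open>D\<close> is zero, so the
      vector of the values of \<open>\<mu>\<close> on the brackets lies in the kernel of
      \<open>A\<close>; \<open>?y\<close> is the corresponding element of \<open>h\<close>.\<close>
    let ?y = "\<mu> f0 *\<^sub>R e 0 + \<mu> f1 *\<^sub>R e 1 + \<mu> f2 *\<^sub>R e 2"
    have yh: "?y \<in> h" using eh by (intro subspace_add[OF subspace_h] subspace_scale[OF subspace_h])
    have cy: "c 0 ?y = \<mu> f0" "c 1 ?y = \<mu> f1" "c 2 ?y = \<mu> f2"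
      by (simp_all add: linear_add[OF lc(1)] linear_add[OF lc(2)] linear_add[OF lc(3)]
        linear_scale[OF lc(1)] linear_scale[OF lc(2)] linear_scale[OF lc(3)] ce)
    have "c 0 (D ?y) = 0" "c 1 (D ?y) = 0" "c 2 (D ?y) = 0"
      using \<mu>D by (simp_all only: cD[OF _ yh, of 0, simplified] cD[OF _ yh, of 1, simplified] cD[OF _ yh, of 2, simplified] cy)
    then have "xb (D ?y) = 0" by (simp only: xb_def scaleR_zero_left add_0)
    then have "D ?y \<in> n 1" using xb[OF Dh, of ?y] by simp
    then have "?y \<in> n 1" by (rule D_injective[OF yh])
    then have "\<mu> f0 = 0" "\<mu> f1 = 0" "\<mu> f2 = 0" using cn1[of ?y] cy by simp_all
    then have "\<mu> (u 0) = 0" using \<mu>zero[OF \<mu>] cu(1)[of 0] by simp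
    then show False using cu(4)[of 0] by (simp add: \<mu>_def)
  next
    case 2
    have "\<exists>u d. coords_mod (n 1) (n 2) 2 u d"
      using coords_mod_exists[OF subspace_n subspace_n n_dec, of 1 2] d1 2 by simp
    then obtain u d where ud: "coords_mod (n 1) (n 2) 2 u d" by blast
    note cu = coords_modD[OF ud]
    have ld: "linear (d 0)" "linear (d 1)" and dn2: "\<And>v. v \<in> n 2 \<Longrightarrow> d 0 v = 0" "\<And>v. v \<in> n 2 \<Longrightarrow> d 1 v = 0"
      using cu(2,3) by simp_all
    define M where "M i j = d i (D (u j))" for i j :: nat
    have "(\<Sum>j<2. d j (D (u j))) = 0" using traceless[of 1 2 u d] ud by simp
    then have trM: "M 1 1 = - M 0 0" by (simp only: sum_lessThan_small M_def)
    have dD: "d i (D v) = d 0 v * M i 0 + d 1 v * M i 1" if i: "i < 2" and v: "v \<in> n 1" for i v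
    proof -
      note li = cu(2)[OF i]
      have "v - (d 0 v *\<^sub>R u 0 + d 1 v *\<^sub>R u 1) \<in> n 2" using cu(6)[OF v] by (simp only: sum_lessThan_small)
      then have "d i (D (v - (d 0 v *\<^sub>R u 0 + d 1 v *\<^sub>R u 1))) = 0" using n_ideal cu(3)[OF i] by blast
      then show ?thesis
        by (simp add: br_diff br_add br_scaleR linear_diff[OF li] linear_add[OF li] linear_scale[OF li] M_def)
    qed
    define a0 a1 a2 b0 b1 b2 where "a0 = d 0 f0" and "a1 = d 0 f1" and "a2 = d 0 f2"
      and "b0 = d 1 f0" and "b1 = d 1 f1" and "b2 = d 1 f2"
    note ab = a0_def[symmetric] a1_def[symmetric] a2_def[symmetric] b0_def[symmetric] b1_def[symmetric] b2_def[symmetric]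
    have E: "A 0 0 * a0 + A 0 1 * a1 + A 0 2 * a2 = - (a0 * M 0 0 + b0 * M 0 1)"
      "A 1 0 * a0 + A 1 1 * a1 + A 1 2 * a2 = - (a1 * M 0 0 + b1 * M 0 1)"
      "A 2 0 * a0 + A 2 1 * a1 + A 2 2 * a2 = - (a2 * M 0 0 + b2 * M 0 1)"
      "A 0 0 * b0 + A 0 1 * b1 + A 0 2 * b2 = - (a0 * M 1 0 + b0 * M 1 1)"
      "A 1 0 * b0 + A 1 1 * b1 + A 1 2 * b2 = - (a1 * M 1 0 + b1 * M 1 1)"
      "A 2 0 * b0 + A 2 1 * b1 + A 2 2 * b2 = - (a2 * M 1 0 + b2 * M 1 1)"
      using \<mu>Df[OF ld(1) dn2(1)] \<mu>Df[OF ld(2) dn2(2)] dD[of 0, OF _ fn1(1)] dD[of 0, OF _ fn1(2)] dD[of 0, OF _ fn1(3)]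
        dD[of 1, OF _ fn1(1)] dD[of 1, OF _ fn1(2)] dD[of 1, OF _ fn1(3)]
      unfolding ab by linarith+
    \<comment> \<open>The cross product \<open>a \<times> b\<close>. In general the transpose of
      \<open>A\<close> maps it to \<open>tr A\<close> times \<open>a \<times> b\<close> minus
      \<open>Aa \<times> b\<close> minus \<open>a \<times> Ab\<close>; by \<open>E\<close> the last
      two add up to a multiple of the trace of \<open>M\<close>, so everything vanishes.\<close>
    define k0 k1 k2 where "k0 = a1 * b2 - a2 * b1" and "k1 = a2 * b0 - a0 * b2" and "k2 = a0 * b1 - a1 * b0"
    have "k0 * A 0 0 + k1 * A 1 0 + k2 * A 2 0 = 0"
    proof -
      have "k0 * A 0 0 + k1 * A 1 0 + k2 * A 2 0 = (A 0 0 + A 1 1 + A 2 2) * k0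
        - ((A 1 0 * a0 + A 1 1 * a1 + A 1 2 * a2) * b2 - (A 2 0 * a0 + A 2 1 * a1 + A 2 2 * a2) * b1)
        - (a1 * (A 2 0 * b0 + A 2 1 * b1 + A 2 2 * b2) - a2 * (A 1 0 * b0 + A 1 1 * b1 + A 1 2 * b2))"
        unfolding k0_def k1_def k2_def by algebra
      also have "\<dots> = 0" unfolding E by (simp add: tr trM k0_def algebra_simps)
      finally show ?thesis .
    qed
    moreover have "k0 * A 0 1 + k1 * A 1 1 + k2 * A 2 1 = 0"
    proof -
      have "k0 * A 0 1 + k1 * A 1 1 + k2 * A 2 1 = (A 0 0 + A 1 1 + A 2 2) * k1
        - ((A 2 0 * a0 + A 2 1 * a1 + A 2 2 * a2) * b0 - (A 0 0 * a0 + A 0 1 * a1 + A 0 2 * a2) * b2)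
        - (a2 * (A 0 0 * b0 + A 0 1 * b1 + A 0 2 * b2) - a0 * (A 2 0 * b0 + A 2 1 * b1 + A 2 2 * b2))"
        unfolding k0_def k1_def k2_def by algebra
      also have "\<dots> = 0" unfolding E by (simp add: tr trM k1_def algebra_simps)
      finally show ?thesis .
    qed
    moreover have "k0 * A 0 2 + k1 * A 1 2 + k2 * A 2 2 = 0"
    proof -
      have "k0 * A 0 2 + k1 * A 1 2 + k2 * A 2 2 = (A 0 0 + A 1 1 + A 2 2) * k2
        - ((A 0 0 * a0 + A 0 1 * a1 + A 0 2 * a2) * b1 - (A 1 0 * a0 + A 1 1 * a1 + A 1 2 * a2) * b0)
        - (a0 * (A 1 0 * b0 + A 1 1 * b1 + A 1 2 * b2) - a1 * (A 0 0 * b0 + A 0 1 * b1 + A 0 2 * b2))"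
        unfolding k0_def k1_def k2_def by algebra
      also have "\<dots> = 0" unfolding E by (simp add: tr trM k2_def algebra_simps)
      finally show ?thesis .
    qed
    ultimately have "k0 = 0 \<and> k1 = 0 \<and> k2 = 0" by (rule cD_zero)
    then have k: "a1 * b2 = a2 * b1" "a2 * b0 = a0 * b2" "a0 * b1 = a1 * b0" by (simp_all add: k0_def k1_def k2_def)
    have "\<exists>s r. (s \<noteq> 0 \<or> r \<noteq> 0) \<and> s * a0 + r * b0 = 0 \<and> s * a1 + r * b1 = 0 \<and> s * a2 + r * b2 = (0::real)"
    proof -
      consider "a0 = 0 \<and> a1 = 0 \<and> a2 = 0" | "a0 \<noteq> 0" | "a1 \<noteq> 0" | "a2 \<noteq> 0" by blast
      then show ?thesis
      proof cases
        case 1 then show ?thesis by (intro exI[of _ 1] exI[of _ 0]) simp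
      next
        case 2 then show ?thesis using k by (intro exI[of _ b0] exI[of _ "- a0"]) (simp add: mult.commute)
      next
        case 3 then show ?thesis using k by (intro exI[of _ b1] exI[of _ "- a1"]) (simp add: mult.commute)
      next
        case 4 then show ?thesis using k by (intro exI[of _ b2] exI[of _ "- a2"]) (simp add: mult.commute)
      qed
    qed
    then obtain s r where sr: "s \<noteq> 0 \<or> r \<noteq> 0" "s * a0 + r * b0 = 0" "s * a1 + r * b1 = 0" "s * a2 + r * b2 = 0" by blast
    let ?\<mu> = "\<lambda>x. s * d 0 x + r * d 1 x"
    have lin: "linear ?\<mu>"
      by (rule linearI) (simp_all add: linear_add[OF ld(1)] linear_add[OF ld(2)] linear_scale[OF ld(1)] linear_scale[OF ld(2)] algebra_simps)
    have "?\<mu> v = 0" if "v \<in> n 1" for v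
      by (rule \<mu>zero[OF lin _ _ _ _ that]) (use sr dn2 in \<open>simp_all add: ab\<close>)
    from this[OF cu(1)[of 0]] this[OF cu(1)[of 1]] show False using sr(1) cu(4,5) by simp
  next
    case 3
    then have n2: "n 2 = {0}" by (simp add: dim_0 del: dim_eq_0)
    define f where "f i = [f0, f1, f2] ! i" for i :: nat
    have fs: "f 0 = f0" "f 1 = f1" "f 2 = f2" by (simp_all add: f_def One_nat_def)
    have im: "f ` {..<3} = {f0, f1, f2}" by (simp add: lessThan_small f_def One_nat_def)
    have "n 1 = span (f ` {..<3} \<union> n 2)"
    proof
      show "n 1 \<subseteq> span (f ` {..<3} \<union> n 2)"
      proof (rule n1_subset[OF subspace_span])
        fix x y assume xy: "x \<in> h" "y \<in> h"
        have "br x y = \<epsilon>0 x y *\<^sub>R f0 + \<epsilon>1 x y *\<^sub>R f1 + \<epsilon>2 x y *\<^sub>R f2" using brf[OF xy] n2 by simp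
        also have "\<dots> \<in> span (f ` {..<3} \<union> n 2)"
          unfolding im by (intro span_add span_scale) (auto intro: span_base)
        finally show "br x y \<in> span (f ` {..<3} \<union> n 2)" .
      qed
      show "span (f ` {..<3} \<union> n 2) \<subseteq> n 1"
        unfolding im using fn1 subspace_n n_dec[of 1] by (intro span_minimal) auto
    qed
    moreover have "f i \<in> n 1" if "i < 3" for i
    proof -
      have "f i \<in> f ` {..<3}" using that by blast
      then show ?thesis unfolding im using fn1 by auto
    qed
    ultimately have "\<exists>d. coords_mod (n 1) (n 2) 3 f d"
      using coords_mod_spanning[OF subspace_n subspace_n, of 1 2 3 f] d1 3 by simp
    then obtain d where fd: "coords_mod (n 1) (n 2) 3 f d" by blast
    note cf = coords_modD[OF fd]
    \<comment> \<open>The coordinates \<open>d\<close> are corrected to vanish on the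
      \<open>e i\<close>, so that \<open>c\<close> and \<open>g\<close> together are dual to the
      basis of \<open>h\<close> formed by the \<open>e i\<close> and the three brackets.\<close>
    define g where "g l x = d l x - (d l (e 0) * c 0 x + d l (e 1) * c 1 x + d l (e 2) * c 2 x)" for l x
    have lg: "linear (g l)" if "l < 3" for l
      unfolding g_def using cf(2)[OF that]
      by (intro linearI) (simp_all add: linear_add[OF lc(1)] linear_add[OF lc(2)] linear_add[OF lc(3)] linear_add
        linear_scale[OF lc(1)] linear_scale[OF lc(2)] linear_scale[OF lc(3)] linear_scale algebra_simps)
    have lgs: "linear (g 0)" "linear (g 1)" "linear (g 2)" using lg by simp_all
    have gn1: "g l v = d l v" if "v \<in> n 1" for l v using cn1[OF that] by (simp add: g_def)
    have gf: "g 0 f0 = 1" "g 0 f1 = 0" "g 0 f2 = 0" "g 1 f0 = 0" "g 1 f1 = 1" "g 1 f2 = 0" "g 2 f0 = 0" "g 2 f1 = 0" "g 2 f2 = 1"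
      using cf(4)[of 0] cf(4)[of 1] cf(4)[of 2] cf(5)[of 0 1] cf(5)[of 0 2] cf(5)[of 1 0] cf(5)[of 1 2] cf(5)[of 2 0] cf(5)[of 2 1]
      by (simp_all add: gn1 fn1 fs)
    have ge: "g l (e 0) = 0" "g l (e 1) = 0" "g l (e 2) = 0" for l by (simp_all add: g_def ce)
    have g0: "g l 0 = 0" if "l < 3" for l using linear_0[OF lg[OF that]] .
    have gn2: "g 0 v = 0" "g 1 v = 0" "g 2 v = 0" if "v \<in> n 2" for v using that n2 g0 by simp_all
    have gbr: "g 0 (br x y) = \<epsilon>0 x y" "g 1 (br x y) = \<epsilon>1 x y" "g 2 (br x y) = \<epsilon>2 x y" if "x \<in> h" "y \<in> h" for x y
      using \<mu>br[OF lgs(1) gn2(1) that] \<mu>br[OF lgs(2) gn2(2) that] \<mu>br[OF lgs(3) gn2(3) that] by (simp_all add: gf)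
    have dec: "x = xb x + (g 0 x *\<^sub>R f0 + g 1 x *\<^sub>R f1 + g 2 x *\<^sub>R f2)" if x: "x \<in> h" for x
    proof -
      let ?v = "x - xb x"
      have "?v - (d 0 ?v *\<^sub>R f0 + d 1 ?v *\<^sub>R f1 + d 2 ?v *\<^sub>R f2) = 0"
        using cf(6)[OF xb[OF x]] n2 by (simp only: sum_lessThan_small fs singleton_iff)
      moreover have "d l ?v = g l x" if "l < 3" for l
      proof -
        have "d l ?v = g l ?v" using gn1[OF xb[OF x]] by simp
        also have "\<dots> = g l x" unfolding linear_diff[OF lg[OF that]] xb_def
          by (simp add: linear_add[OF lg[OF that]] linear_scale[OF lg[OF that]] ge)
        finally show ?thesis .
      qed
      ultimately show ?thesis by (simp add: algebra_simps)
    qed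
    define k where "k j i = g j (D (e i))" for j i :: nat
    have gD: "g j (D x) = k j 0 * c 0 x + k j 1 * c 1 x + k j 2 * c 2 x - (A 0 j * g 0 x + A 1 j * g 1 x + A 2 j * g 2 x)"
      if j: "j = 0 \<or> j = 1 \<or> j = 2" and x: "x \<in> h" for j x
    proof -
      have lj: "linear (g j)" using j lgs by blast
      have n2j: "g j v = 0" if "v \<in> n 2" for v using j gn2[OF that] by blast
      have "g j (D x) = g j (D (xb x + (g 0 x *\<^sub>R f0 + g 1 x *\<^sub>R f1 + g 2 x *\<^sub>R f2)))" using dec[OF x] by simp
      also have "\<dots> = k j 0 * c 0 x + k j 1 * c 1 x + k j 2 * c 2 x + (g 0 x * g j (D f0) + g 1 x * g j (D f1) + g 2 x * g j (D f2))"
        by (simp add: xb_def br_add br_scaleR linear_add[OF lj] linear_scale[OF lj] k_def)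
      also have "\<dots> = k j 0 * c 0 x + k j 1 * c 1 x + k j 2 * c 2 x - (A 0 j * g 0 x + A 1 j * g 1 x + A 2 j * g 2 x)"
        using j by (auto simp: \<mu>Df[OF lj n2j] gf)
      finally show ?thesis .
    qed
    have lcD: "linear (\<lambda>x. c j (D x))" if "j < 3" for j
      using linear_compose[OF linear_br(1) co(2)[OF that]] by (simp add: o_def)
    define \<sigma> where "\<sigma> x y = (c 0 (D x) * g 0 y - g 0 x * c 0 (D y)) + (c 1 (D x) * g 1 y - g 1 x * c 1 (D y))
      + (c 2 (D x) * g 2 y - g 2 x * c 2 (D y))" for x y
    have alt: "alternating2 \<sigma>"
      unfolding \<sigma>_def by (intro alternating2_add wedge2_alternating lcD lgs) simp_all
    \<comment> \<open>In the Lie derivative of \<open>\<sigma>\<close> the terms containing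
      \<open>g\<close> cancel. What remains is the sum of \<open>N m i\<close> times
      \<open>c m \<and> c i\<close>, and each \<open>c m \<and> c i\<close> is up to sign a
      coordinate of the bracket; \<open>\<tau>\<close> collects the antisymmetric part of
      \<open>N\<close>.\<close>
    define N where "N m i = A 0 m * k 0 i + A 1 m * k 1 i + A 2 m * k 2 i" for m i :: nat
    define \<tau> where "\<tau> x = (N 1 2 - N 2 1) * g 0 x + (N 2 0 - N 0 2) * g 1 x + (N 0 1 - N 1 0) * g 2 x" for x
    have lt: "linear \<tau>"
      unfolding \<tau>_def by (rule linearI) (simp_all add: linear_add[OF lgs(1)] linear_add[OF lgs(2)] linear_add[OF lgs(3)]
        linear_scale[OF lgs(1)] linear_scale[OF lgs(2)] linear_scale[OF lgs(3)] algebra_simps)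
    have "\<exists>\<theta>. linear \<theta> \<and> (\<forall>x\<in>h. \<forall>y\<in>h. \<sigma> x y = \<theta> (br x y))"
    proof (rule closed2_on_h_exact[OF alt _ lt])
      fix x y z assume hh: "x \<in> h" "y \<in> h" "z \<in> h"
      have "c 0 (D (br u v)) = 0" "c 1 (D (br u v)) = 0" "c 2 (D (br u v)) = 0" if "u \<in> h" "v \<in> h" for u v
        using cn1[OF n_ideal[OF br_in(1)[OF that]]] by simp_all
      then show "diff2 br \<sigma> x y z = 0"
        using hh by (simp add: diff2_def \<sigma>_def gbr cD \<epsilon>0_def \<epsilon>1_def \<epsilon>2_def tr algebra_simps)
    next
      fix x y assume hh: "x \<in> h" "y \<in> h"
      have r: "\<tau> (br x y) = (N 1 2 - N 2 1) * \<epsilon>0 x y + (N 2 0 - N 0 2) * \<epsilon>1 x y + (N 0 1 - N 1 0) * \<epsilon>2 x y"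
        by (simp add: \<tau>_def gbr hh)
      have cDD: "c j (D (D x)) = A j 0 * c 0 (D x) + A j 1 * c 1 (D x) + A j 2 * c 2 (D x)" if "j < 3" for j x
        using cD[OF that Dh] .
      have "\<sigma> (D x) y + \<sigma> x (D y) =
        (k 0 0 * c 0 y + k 0 1 * c 1 y + k 0 2 * c 2 y) * c 0 (D x) + (k 1 0 * c 0 y + k 1 1 * c 1 y + k 1 2 * c 2 y) * c 1 (D x)
        + (k 2 0 * c 0 y + k 2 1 * c 1 y + k 2 2 * c 2 y) * c 2 (D x)
        - ((k 0 0 * c 0 x + k 0 1 * c 1 x + k 0 2 * c 2 x) * c 0 (D y) + (k 1 0 * c 0 x + k 1 1 * c 1 x + k 1 2 * c 2 x) * c 1 (D y)
        + (k 2 0 * c 0 x + k 2 1 * c 1 x + k 2 2 * c 2 x) * c 2 (D y))"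
        by (simp add: \<sigma>_def cDD gD hh algebra_simps)
      also have "\<dots> = \<tau> (br x y)"
        unfolding r by (simp add: cD hh N_def \<epsilon>0_def \<epsilon>1_def \<epsilon>2_def algebra_simps)
      finally show "\<sigma> (D x) y + \<sigma> x (D y) = \<tau> (br x y)" .
    qed
    then obtain \<theta> where \<theta>: "linear \<theta>" "\<And>x y. x \<in> h \<Longrightarrow> y \<in> h \<Longrightarrow> \<sigma> x y = \<theta> (br x y)" by blast
    have cDf: "c j (D v) = 0" if "v \<in> n 1" "j < 3" for j v using co(3)[OF that(2) n_ideal[OF that(1)]] by simp
    \<comment> \<open>As \<open>n 2\<close> is zero, an exact form vanishes when one argument lies
      in \<open>n 1\<close>. Evaluating at the three brackets reads off the first column of
      \<open>A\<close>, so \<open>D (e 0)\<close> falls into \<open>[h,h]\<close>.\<close>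
    have "\<sigma> (e 0) v = 0" if v: "v \<in> n 1" for v
      using \<theta>(2)[OF eh(1) n1_h[OF v]] br_in(3)[OF eh(1) v] n2 linear_0[OF \<theta>(1)] by simp
    from this[OF fn1(1)] this[OF fn1(2)] this[OF fn1(3)]
    have "c 0 (D (e 0)) = 0" "c 1 (D (e 0)) = 0" "c 2 (D (e 0)) = 0"
      by (simp_all add: \<sigma>_def gf ge cDf fn1)
    then have "xb (D (e 0)) = 0" by (simp add: xb_def)
    then have "D (e 0) \<in> n 1" using xb[OF Dh, of "e 0"] by simp
    then have "e 0 \<in> n 1" by (rule D_injective[OF eh(1)])
    then show False using cn1(1) ce(1) by simp
  qed
qed

text \<open>The main case is the one where \<open>n 3\<close> is spanned by a single vector \<open>w\<close>. With \<open>\<eta> w = 1\<close>, the contradiction comes from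
  the 3-form \<open>e\<^sup>0 \<and> e\<^sup>1 \<and> \<eta>\<close>.\<close>

lemma dim_n1_neq_4: "dim (n 1) \<noteq> 4"
proof
  note One_nat_def [simp del]
  assume d1: "dim (n 1) = 4"
  have "\<exists>e c. coords_mod (n 0) (n 1) 2 e c"
    using coords_mod_exists[OF subspace_n subspace_n n1_sub_n0, of 2] d1 dim_h by (simp add: n_0)
  then obtain e c where ec: "coords_mod (n 0) (n 1) 2 e c" by blast
  note co = coords_modD[OF ec]
  have eh: "e 0 \<in> h" "e 1 \<in> h" using co(1) by (simp_all add: n_0)
  have lc: "linear (c 0)" "linear (c 1)" using co(2) by simp_all
  have cn1: "c 0 v = 0" "c 1 v = 0" if "v \<in> n 1" for v using co(3) that by simp_all
  have ce: "c 0 (e 0) = 1" "c 1 (e 1) = 1" "c 0 (e 1) = 0" "c 1 (e 0) = 0" using co(4,5) by simp_all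
  define xb where "xb x = c 0 x *\<^sub>R e 0 + c 1 x *\<^sub>R e 1" for x
  have xb: "x - xb x \<in> n 1" if "x \<in> h" for x
    using co(6)[of x] that unfolding xb_def by (simp only: sum_lessThan_small n_0)
  have xbh: "xb x \<in> h" for x
    unfolding xb_def using eh by (intro subspace_add[OF subspace_h] subspace_scale[OF subspace_h])
  define p where "p x y = c 0 x * c 1 y - c 1 x * c 0 y" for x y
  have altp: "alternating2 p" unfolding p_def by (rule wedge2_alternating[OF lc])
  define z where "z = br (e 0) (e 1)"
  have zn1: "z \<in> n 1" unfolding z_def using br_in(1) eh by blast
  have brz: "br (xb x) (xb y) = p x y *\<^sub>R z" for x y
    using br_antisym[of "e 1" "e 0"] by (simp add: xb_def p_def z_def br_add br_scaleR br_self algebra_simps)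
  have Dh: "D x \<in> h" for x by (rule br_h)
  define A where "A i j = c i (D (e j))" for i j :: nat
  have "(\<Sum>j<2. c j (D (e j))) = 0" using traceless[of 0 2 e c] ec by (simp add: One_nat_def)
  then have tr: "A 1 1 = - A 0 0" by (simp only: sum_lessThan_small A_def)
  have cD: "c i (D x) = A i 0 * c 0 x + A i 1 * c 1 x" if i: "i < 2" and x: "x \<in> h" for i x
  proof -
    note li = co(2)[OF i]
    have "c i (D (x - xb x)) = 0" using n_ideal[OF xb[OF x]] co(3)[OF i] by blast
    then show ?thesis
      by (simp add: br_diff br_add br_scaleR xb_def linear_diff[OF li] linear_add[OF li] linear_scale[OF li] A_def)
  qed
  have n1span: "n 1 \<subseteq> span (insert z (n 2))"
  proof (rule n1_subset[OF subspace_span])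
    fix x y assume xy: "x \<in> h" "y \<in> h"
    have "br x y - p x y *\<^sub>R z \<in> n 2"
      using br_cong_mod_n2[OF xy xbh xbh xb[OF xy(1)] xb[OF xy(2)]] by (simp add: brz)
    then have "(br x y - p x y *\<^sub>R z) + p x y *\<^sub>R z \<in> span (insert z (n 2))"
      by (intro span_add span_scale) (auto intro: span_base)
    then show "br x y \<in> span (insert z (n 2))" by simp
  qed
  have n1ne: "n 1 \<noteq> {0}" using d1 dim_0[of 1] by simp
  have "dim (n 1) \<le> Suc (dim (n 2))"
    using dim_subset[OF n1span] by (simp add: dim_insert split: if_splits)
  then have d2: "dim (n 2) = 3" using n_strict[of 1] n1ne d1 by simp
  have Dn1: "D v \<in> n 2" if "v \<in> n 1" for v using one_dim_section[of 1 v] that d1 d2 by simp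
  have n2n1: "n 2 \<subseteq> n 1" and n3n2: "n 3 \<subseteq> n 2" using n_mono by simp_all
  have im1: "(\<lambda>_. z) ` {..<1::nat} = {z}" by auto
  have "n 1 = span ((\<lambda>_. z) ` {..<1::nat} \<union> n 2)"
    unfolding im1 using n1span zn1 n2n1 subspace_n by (intro subset_antisym span_minimal) auto
  then have "\<exists>c. coords_mod (n 1) (n 2) 1 (\<lambda>_. z) c"
    using coords_mod_spanning[OF subspace_n subspace_n, of 1 2 1 "\<lambda>_. z"] d1 d2 zn1 by simp
  then obtain \<zeta>' where \<zeta>': "coords_mod (n 1) (n 2) 1 (\<lambda>_. z) \<zeta>'" by blast
  note cz = coords_modD[OF \<zeta>']
  define \<zeta> where "\<zeta> x = \<zeta>' 0 x - (\<zeta>' 0 (e 0) * c 0 x + \<zeta>' 0 (e 1) * c 1 x)" for x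
  have lz: "linear \<zeta>" unfolding \<zeta>_def
    by (rule linearI) (simp_all add: linear_add[OF lc(1)] linear_add[OF lc(2)] linear_scale[OF lc(1)] linear_scale[OF lc(2)]
      linear_add[OF cz(2)[of 0, simplified]] linear_scale[OF cz(2)[of 0, simplified]] algebra_simps)
  have \<zeta>n1: "\<zeta> v = \<zeta>' 0 v" if "v \<in> n 1" for v using cn1[OF that] by (simp add: \<zeta>_def)
  have \<zeta>z: "\<zeta> z = 1" using \<zeta>n1[OF zn1] cz(4)[of 0] by simp
  have \<zeta>n2: "\<zeta> v = 0" if "v \<in> n 2" for v using \<zeta>n1[of v] that n2n1 cz(3)[of 0 v] by auto
  have \<zeta>e: "\<zeta> (e 0) = 0" "\<zeta> (e 1) = 0" by (simp_all add: \<zeta>_def ce)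
  have \<zeta>dec: "v - \<zeta> v *\<^sub>R z \<in> n 2" if "v \<in> n 1" for v
    using cz(6)[OF that] \<zeta>n1[OF that] by (simp add: sum_lessThan_small)
  have \<zeta>xb: "\<zeta> (x - xb x) = \<zeta> x" for x
    by (simp add: xb_def linear_diff[OF lz] linear_add[OF lz] linear_scale[OF lz] \<zeta>e)
  define u0 u1 where "u0 = br (e 0) z" and "u1 = br (e 1) z"
  have un2: "u0 \<in> n 2" "u1 \<in> n 2" unfolding u0_def u1_def using br_in(3) eh zn1 by blast+
  have brn1: "br x v - \<zeta> v *\<^sub>R (c 0 x *\<^sub>R u0 + c 1 x *\<^sub>R u1) \<in> n 3" if x: "x \<in> h" and v: "v \<in> n 1" for x v
  proof -
    have "br x v - \<zeta> v *\<^sub>R (c 0 x *\<^sub>R u0 + c 1 x *\<^sub>R u1) = br x (v - \<zeta> v *\<^sub>R z) + \<zeta> v *\<^sub>R br (x - xb x) z"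
      by (simp add: xb_def u0_def u1_def br_add br_diff br_scaleR algebra_simps)
    also have "\<dots> \<in> n 3"
      using br_in(5)[OF x \<zeta>dec[OF v]] br_in(4)[OF xb[OF x] zn1] by (intro subspace_add[OF subspace_n] subspace_scale[OF subspace_n])
    finally show ?thesis .
  qed
  have n2span: "n 2 \<subseteq> span ({u0, u1} \<union> n 3)"
  proof -
    have "lie_prod br h (n 1) \<subseteq> span ({u0, u1} \<union> n 3)"
    proof (rule lie_prod_subset[OF subspace_span])
      fix x v assume xv: "x \<in> h" "v \<in> n 1"
      have "(br x v - \<zeta> v *\<^sub>R (c 0 x *\<^sub>R u0 + c 1 x *\<^sub>R u1)) + \<zeta> v *\<^sub>R (c 0 x *\<^sub>R u0 + c 1 x *\<^sub>R u1) \<in> span ({u0, u1} \<union> n 3)"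
        using brn1[OF xv] by (intro span_add span_scale) (auto intro: span_base)
      then show "br x v \<in> span ({u0, u1} \<union> n 3)" by simp
    qed
    then show ?thesis by (simp add: n_2)
  qed
  \<comment> \<open>Since \<open>D z\<close> lies in \<open>n 2\<close>, differentiating
    \<open>[e j, z]\<close> only moves \<open>e j\<close> modulo \<open>n 3\<close>, so
    \<open>D\<close> acts on \<open>u0\<close>, \<open>u1\<close> through \<open>A\<close>.\<close>
  have Du: "D u0 - (A 0 0 *\<^sub>R u0 + A 1 0 *\<^sub>R u1) \<in> n 3" "D u1 - (A 0 1 *\<^sub>R u0 + A 1 1 *\<^sub>R u1) \<in> n 3"
  proof -
    have *: "D (br (e j) z) - (A 0 j *\<^sub>R u0 + A 1 j *\<^sub>R u1) \<in> n 3" if "e j \<in> h" for j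
    proof -
      have "D (br (e j) z) = br (D (e j)) z + br (e j) (D z)" using jacobi'[of t "e j" z] by simp
      then have "D (br (e j) z) - (A 0 j *\<^sub>R u0 + A 1 j *\<^sub>R u1) = (br (D (e j)) z - \<zeta> z *\<^sub>R (A 0 j *\<^sub>R u0 + A 1 j *\<^sub>R u1)) + br (e j) (D z)"
        by (simp add: \<zeta>z)
      also have "\<dots> \<in> n 3"
        using brn1[OF Dh zn1, of "e j"] br_in(5)[OF that Dn1[OF zn1]] unfolding A_def by (rule subspace_add[OF subspace_n])
      finally show ?thesis .
    qed
    show "D u0 - (A 0 0 *\<^sub>R u0 + A 1 0 *\<^sub>R u1) \<in> n 3" "D u1 - (A 0 1 *\<^sub>R u0 + A 1 1 *\<^sub>R u1) \<in> n 3"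
      unfolding u0_def[symmetric, THEN sym] using *[OF eh(1)] *[OF eh(2)] by (simp_all add: u0_def u1_def)
  qed
  have n2ne: "n 2 \<noteq> {0}" using d2 dim_0[of 2] by simp
  have "dim (n 2) \<le> dim (n 3) + 2"
    using dim_subset[OF n2span] by (simp add: dim_insert split: if_splits)
  moreover have "dim (n 3) < 3" using n_strict[of 2] n2ne d2 by simp
  ultimately consider "dim (n 3) = 2" | "dim (n 3) = 1" using d2 by linarith
  then show False
  proof cases
    case 1
    have Dn2: "D v \<in> n 3" if "v \<in> n 2" for v using one_dim_section[of 2 v] that d2 1 by simp
    have "\<exists>u d. coords_mod (n 2) (n 3) 1 u d"
      using coords_mod_exists[OF subspace_n subspace_n n_dec, of 2 1] d2 1 by simp
    then obtain u d where ud: "coords_mod (n 2) (n 3) 1 u d" by blast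
    note cu = coords_modD[OF ud]
    define \<mu> where "\<mu> = d 0"
    have \<mu>: "linear \<mu>" "\<And>v. v \<in> n 3 \<Longrightarrow> \<mu> v = 0" using cu(2,3) by (simp_all add: \<mu>_def)
    have \<mu>D: "A 0 0 * \<mu> u0 + A 1 0 * \<mu> u1 = 0" "A 0 1 * \<mu> u0 + A 1 1 * \<mu> u1 = 0"
      using \<mu>(2)[OF Du(1)] \<mu>(2)[OF Du(2)] \<mu>(2)[OF Dn2[OF un2(1)]] \<mu>(2)[OF Dn2[OF un2(2)]]
      by (simp_all add: linear_diff[OF \<mu>(1)] linear_add[OF \<mu>(1)] linear_scale[OF \<mu>(1)])
    \<comment> \<open>On the line \<open>n 2 / n 3\<close> the map \<open>D\<close> is zero, so the
      values of \<open>\<mu>\<close> on \<open>u0\<close>, \<open>u1\<close> are the coefficients of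
      an invariant functional on \<open>h/[h,h]\<close>.\<close>
    let ?\<phi> = "\<lambda>x. \<mu> u0 * c 0 x + \<mu> u1 * c 1 x"
    have lin: "linear ?\<phi>"
      by (rule linearI) (simp_all add: linear_add[OF lc(1)] linear_add[OF lc(2)] linear_scale[OF lc(1)] linear_scale[OF lc(2)] algebra_simps)
    have "?\<phi> (D x) = 0" if x: "x \<in> h" for x
    proof -
      have "?\<phi> (D x) = (A 0 0 * \<mu> u0 + A 1 0 * \<mu> u1) * c 0 x + (A 0 1 * \<mu> u0 + A 1 1 * \<mu> u1) * c 1 x"
        by (simp add: cD[OF _ x] algebra_simps)
      then show ?thesis unfolding \<mu>D by simp
    qed
    then have "?\<phi> x = 0" if "x \<in> h" for x
      by (intro functional_D_zero[OF lin _ _ that]) (simp add: cn1)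
    from this[OF eh(1)] this[OF eh(2)] have "\<mu> u0 = 0" "\<mu> u1 = 0" by (simp_all add: ce)
    then have "span ({u0, u1} \<union> n 3) \<subseteq> {v. \<mu> v = 0}"
      using \<mu> by (intro span_minimal linear_subspace_kernel) auto
    then have "\<mu> (u 0) = 0" using n2span cu(1)[of 0] by auto
    then show False using cu(4)[of 0] by (simp add: \<mu>_def)
  next
    case 2
    have n3ne: "n 3 \<noteq> {0}" using 2 dim_0[of 3] by simp
    then have n4: "n 4 = {0}" using n_strict[of 3] 2 dim_0[of 4] by simp
    obtain w \<eta> where w: "w \<in> n 3" "linear \<eta>" "\<eta> w = (1::real)" "\<And>v. v \<in> n 3 \<Longrightarrow> v = \<eta> v *\<^sub>R w"
      using one_dim_coordinate[of 3] 2 n4 by auto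
    have Dn3: "D v = 0" if "v \<in> n 3" for v using one_dim_section[of 3 v] that 2 n4 by simp
    have im2: "(\<lambda>i. [u0, u1] ! i) ` {..<2::nat} = {u0, u1}" by (simp add: lessThan_small One_nat_def)
    have uin: "[u0, u1] ! i \<in> n 2" if "i < 2" for i
    proof -
      have "[u0, u1] ! i \<in> (\<lambda>i. [u0, u1] ! i) ` {..<2::nat}" using that by blast
      then show ?thesis unfolding im2 using un2 by auto
    qed
    have "n 2 = span ((\<lambda>i. [u0, u1] ! i) ` {..<2::nat} \<union> n 3)"
      unfolding im2 using n2span un2 n3n2 subspace_n by (intro subset_antisym span_minimal) auto
    then have "\<exists>c. coords_mod (n 2) (n 3) 2 (\<lambda>i. [u0, u1] ! i) c"
      using coords_mod_spanning[OF subspace_n subspace_n, of 2 3 2 "\<lambda>i. [u0, u1] ! i"] uin d2 2 by simp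
    then obtain \<upsilon> where \<upsilon>: "coords_mod (n 2) (n 3) 2 (\<lambda>i. [u0, u1] ! i) \<upsilon>" by blast
    note cu = coords_modD[OF \<upsilon>]
    \<comment> \<open>A coordinate dual to \<open>u0\<close>, corrected to vanish at
      \<open>z\<close>; composed with the bracket it becomes
      \<open>c 0 \<and> \<zeta>\<close>.\<close>
    define \<nu> where "\<nu> x = \<upsilon> 0 x - \<upsilon> 0 z * \<zeta> x" for x
    have lu: "linear (\<upsilon> 0)" using cu(2) by simp
    have ln: "linear \<nu>" unfolding \<nu>_def
      by (rule linearI) (simp_all add: linear_add[OF lu] linear_add[OF lz] linear_scale[OF lu] linear_scale[OF lz] algebra_simps)
    have \<nu>u: "\<nu> u0 = 1" "\<nu> u1 = 0" "\<nu> z = 0" using cu(4)[of 0] cu(5)[of 0 1] \<zeta>n2 un2 \<zeta>z by (simp_all add: \<nu>_def)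
    have \<nu>n3: "\<nu> v = 0" if "v \<in> n 3" for v using cu(3)[of 0 v] that \<zeta>n2[of v] n3n2 by (auto simp: \<nu>_def)
    have \<zeta>n3: "\<zeta> v = 0" if "v \<in> n 3" for v using \<zeta>n2[of v] that n3n2 by auto
    define \<kappa> where "\<kappa> x = \<eta> (D x)" for x
    have lk: "linear \<kappa>" unfolding \<kappa>_def using linear_compose[OF linear_br(1) w(2)] by (simp add: o_def)
    have \<kappa>n3: "\<kappa> v = 0" if "v \<in> n 3" for v using Dn3[OF that] by (simp add: \<kappa>_def linear_0[OF w(2)])
    have n2n1br: "br v v' = 0" if "v \<in> n 2" "v' \<in> n 1" for v v'
      using br_in(6)[OF that(2,1)] n4 br_antisym[of v v'] by simp
    \<comment> \<open>\<open>n 1\<close> is abelian: it is spanned by \<open>z\<close> modulo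
      \<open>n 2\<close>, and its brackets with \<open>n 2\<close> lie in
      \<open>n 4 = {0}\<close>.\<close>
    have n1n1br: "br v v' = 0" if "v \<in> n 1" "v' \<in> n 1" for v v'
    proof -
      have "br v v' = br (v - \<zeta> v *\<^sub>R z) v' + \<zeta> v *\<^sub>R br z (v' - \<zeta> v' *\<^sub>R z)"
        by (simp add: br_diff br_scaleR br_self)
      moreover have "br z (v' - \<zeta> v' *\<^sub>R z) = 0" using br_in(6)[OF zn1 \<zeta>dec[OF that(2)]] n4 by simp
      ultimately show ?thesis using n2n1br[OF \<zeta>dec[OF that(1)] that(2)] by simp
    qed
    have hn3br: "br x v = 0" if "x \<in> h" "v \<in> n 3" for x v using br_in(7)[OF that] n4 by simp
    have brdec: "br x y = p x y *\<^sub>R z + (c 0 x *\<^sub>R br (e 0) (y - xb y) + c 1 x *\<^sub>R br (e 1) (y - xb y))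
        - (c 0 y *\<^sub>R br (e 0) (x - xb x) + c 1 y *\<^sub>R br (e 1) (x - xb x))" if "x \<in> h" "y \<in> h" for x y
    proof -
      have "br x y = br (xb x) (xb y) + br (xb x) (y - xb y) - br (xb y) (x - xb x) + br (x - xb x) (y - xb y)"
        using br_antisym[of "xb y" "x - xb x"] br_antisym[of "xb y" "xb x"] br_antisym[of "xb y" x] by (simp add: br_diff)
      then show ?thesis
        using n1n1br[OF xb[OF that(1)] xb[OF that(2)]] by (simp only: brz) (simp add: xb_def br_add br_scaleR)
    qed
    have \<mu>br: "\<mu> (br x y) = p x y * \<mu> z + (c 0 x * \<zeta> y - c 0 y * \<zeta> x) * \<mu> u0 + (c 1 x * \<zeta> y - c 1 y * \<zeta> x) * \<mu> u1"
      if \<mu>: "linear \<mu>" "\<And>v. v \<in> n 3 \<Longrightarrow> \<mu> v = (0::real)" and xy: "x \<in> h" "y \<in> h" for \<mu> x y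
    proof -
      have "\<mu> (br (e 0) (x - xb x)) = \<zeta> x * \<mu> u0" "\<mu> (br (e 1) (x - xb x)) = \<zeta> x * \<mu> u1" if x: "x \<in> h" for x
        using \<mu>(2)[OF brn1[OF eh(1) xb[OF x]]] \<mu>(2)[OF brn1[OF eh(2) xb[OF x]]]
        by (simp_all add: \<zeta>xb ce linear_diff[OF \<mu>(1)] linear_scale[OF \<mu>(1)])
      then show ?thesis
        using xy by (subst brdec[OF xy]) (simp add: linear_diff[OF \<mu>(1)] linear_add[OF \<mu>(1)] linear_scale[OF \<mu>(1)] algebra_simps)
    qed
    have \<zeta>u: "\<zeta> u0 = 0" "\<zeta> u1 = 0" using \<zeta>n2 un2 by auto
    note brs = \<mu>br[OF lz \<zeta>n3, unfolded \<zeta>z \<zeta>u] \<mu>br[OF ln \<nu>n3, unfolded \<nu>u] \<mu>br[OF lk \<kappa>n3]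
    \<comment> \<open>The matrix of the double brackets \<open>[e i, [e j, z]]\<close> with respect
      to \<open>w\<close>. It is symmetric by Jacobi, as \<open>n 1\<close> is abelian, and nonzero
      because it accounts for all of \<open>n 3\<close>.\<close>
    define s where "s i j = \<eta> (br (e i) (br (e j) z))" for i j :: nat
    have sw: "br (e i) (br (e j) z) = s i j *\<^sub>R w" if "e i \<in> h" "e j \<in> h" for i j
      using w(4)[OF br_in(5)[OF that(1) br_in(3)[OF that(2) zn1]]] by (simp add: s_def)
    have ssym: "s 0 1 = s 1 0"
    proof -
      have "br (e 0) (br (e 1) z) - br (e 1) (br (e 0) z) = 0"
        using jacobi'[of "e 0" "e 1" z] by (simp add: z_def[symmetric] br_self)
      then show ?thesis by (simp add: s_def)
    qed
    have sne: "\<not> (s 0 0 = 0 \<and> s 0 1 = 0 \<and> s 1 1 = 0)"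
    proof
      assume s0: "s 0 0 = 0 \<and> s 0 1 = 0 \<and> s 1 1 = 0"
      have eu: "br (e 0) u0 = 0" "br (e 0) u1 = 0" "br (e 1) u0 = 0" "br (e 1) u1 = 0"
        unfolding u0_def u1_def using sw eh s0 ssym by simp_all
      have "lie_prod br h (n 2) \<subseteq> {0}"
      proof (rule lie_prod_subset)
        fix x v assume xv: "x \<in> h" "v \<in> n 2"
        have "br x v = br (xb x) v" using br_in(6)[OF xb[OF xv(1)] xv(2)] n4 by (simp add: br_diff)
        moreover have "span ({u0, u1} \<union> n 3) \<subseteq> {v. br (xb x) v = 0}"
        proof (rule span_minimal)
          show "{u0, u1} \<union> n 3 \<subseteq> {v. br (xb x) v = 0}"
            using hn3br[OF xbh] by (auto simp: xb_def br_add br_scaleR eu)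
        qed (rule linear_subspace_kernel[OF linear_br(1)])
        ultimately show "br x v \<in> {0}" using xv(2) n2span by auto
      qed simp
      then have "n 3 \<subseteq> {0}" by (simp add: n_3)
      then show False using n3ne subspace_0[OF subspace_n] by blast
    qed
    define \<omega> where "\<omega> x y v = p x y * \<eta> v + p y v * \<eta> x + p v x * \<eta> y" for x y v
    have alt3: "alternating3 \<omega>" unfolding \<omega>_def by (rule wedge21_alternating[OF altp w(2)])
    \<comment> \<open>The Lie derivative of \<open>\<omega>\<close> is
      \<open>p \<and> \<kappa>\<close>, while \<open>diff2\<close> of
      \<open>\<zeta> \<and> \<kappa>\<close> is \<open>p \<and> \<kappa>\<close> minus
      \<open>\<kappa> z\<close> times \<open>p \<and> \<zeta>\<close>. The term with
      \<open>\<nu> \<and> c 1\<close> restores the difference.\<close>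
    define \<rho> where "\<rho> x y = (\<zeta> x * \<kappa> y - \<kappa> x * \<zeta> y) + (- \<kappa> z) * (\<nu> x * c 1 y - c 1 x * \<nu> y)" for x y
    have altr: "alternating2 \<rho>" unfolding \<rho>_def by (intro alternating2_add alternating2_scale wedge2_alternating lz lk ln lc)
    have cbr: "c 0 (br x y) = 0" "c 1 (br x y) = 0" if "x \<in> h" "y \<in> h" for x y using cn1[OF br_in(1)[OF that]] .
    have "\<exists>\<beta>. alternating2 \<beta> \<and> (\<forall>x\<in>h. \<forall>y\<in>h. \<forall>z\<in>h. \<omega> x y z = diff2 br \<beta> x y z)"
    proof (rule closed3_on_h_exact[OF alt3 _ altr])
      fix a b x y assume hh: "a \<in> h" "b \<in> h" "x \<in> h" "y \<in> h"
      define q0 q1 where "q0 v = \<eta> (br (e 0) (v - xb v))" and "q1 v = \<eta> (br (e 1) (v - xb v))" for v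
      have \<eta>br: "\<eta> (br x y) = p x y * \<eta> z + (c 0 x * q0 y + c 1 x * q1 y) - (c 0 y * q0 x + c 1 y * q1 x)"
        if "x \<in> h" "y \<in> h" for x y
        by (subst brdec[OF that]) (simp add: q0_def q1_def linear_diff[OF w(2)] linear_add[OF w(2)] linear_scale[OF w(2)])
      have \<omega>br: "\<omega> (br x y) u v = p u v * \<eta> (br x y)" if "x \<in> h" "y \<in> h" for x y u v
        by (simp add: \<omega>_def p_def cbr[OF that])
      show "diff3 br \<omega> a b x y = 0"
        using hh by (simp add: diff3_def \<omega>br \<eta>br p_def algebra_simps)
    next
      fix x y v assume hh: "x \<in> h" "y \<in> h" "v \<in> h"
      have pD: "p (D x) y + p x (D y) = 0" if "x \<in> h" "y \<in> h" for x y
        using that by (simp add: p_def cD tr algebra_simps)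
      have "\<omega> (D x) y v + \<omega> x (D y) v + \<omega> x y (D v) =
        (p (D x) y + p x (D y)) * \<eta> v + (p (D y) v + p y (D v)) * \<eta> x + (p (D v) x + p v (D x)) * \<eta> y
        + (p x y * \<kappa> v + p y v * \<kappa> x + p v x * \<kappa> y)"
        by (simp add: \<omega>_def \<kappa>_def algebra_simps)
      also have "\<dots> = diff2 br \<rho> x y v"
        using hh by (simp add: pD diff2_def \<rho>_def brs cbr) (simp add: p_def algebra_simps)
      finally show "\<omega> (D x) y v + \<omega> x (D y) v + \<omega> x y (D v) = diff2 br \<rho> x y v" .
    qed
    then obtain \<beta> where \<beta>: "alternating2 \<beta>" "\<And>x y v. x \<in> h \<Longrightarrow> y \<in> h \<Longrightarrow> v \<in> h \<Longrightarrow> \<omega> x y v = diff2 br \<beta> x y v" by blast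
    note lb = linear_alternating2[OF \<beta>(1)] and ba = alternating2_antisym[OF \<beta>(1)]
    have zh: "z \<in> h" and wh: "w \<in> h" using zn1 w(1) n_sub_h by blast+
    have pn1: "p x v = 0" "p v x = 0" if "v \<in> n 1" for x v using cn1[OF that] by (simp_all add: p_def)
    have wn1: "w \<in> n 1" using w(1) n2n1 n3n2 by blast+
    have "\<omega> (e 0) (e 1) w = 1" using pn1[OF wn1] w(3) by (simp add: \<omega>_def) (simp add: p_def ce)
    moreover have "br w (e 0) = 0" "br (e 1) w = 0" using hn3br[OF eh(1) w(1)] hn3br[OF eh(2) w(1)] br_antisym[of w "e 0"] by simp_all
    ultimately have bzw: "\<beta> z w = 1"
      using \<beta>(2)[OF eh wh] by (simp add: diff2_def z_def linear_0[OF lb(2)])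
    \<comment> \<open>Up to sign the symmetric matrix \<open>s\<close> gives the values of the
      antisymmetric \<open>\<beta>\<close> on \<open>u0\<close>, \<open>u1\<close>, so it must
      vanish.\<close>
    have buu: "\<beta> (br (e i) z) (br (e j) z) = - s j i" if i: "e i \<in> h" "e j \<in> h" for i j
    proof -
      let ?u = "br (e j) z"
      have u: "?u \<in> n 2" "?u \<in> n 1" using br_in(3)[OF i(2) zn1] n2n1 by auto
      have "\<omega> (e i) z ?u = 0" using pn1 zn1 u by (simp add: \<omega>_def)
      moreover have "br z ?u = 0" using n1n1br zn1 u by blast
      moreover have "br ?u (e i) = - (br (e i) ?u)" by (rule br_antisym)
      ultimately have "\<beta> (br (e i) z) ?u + \<beta> (- (br (e i) ?u)) z = 0"
        using \<beta>(2)[OF i(1) zh n1_h[OF u(2)]] by (simp add: diff2_def linear_0[OF lb(2)])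
      moreover have "br (e i) ?u = s i j *\<^sub>R w" using sw i by blast
      ultimately have "\<beta> (br (e i) z) ?u + s i j * \<beta> z w = 0"
        using ba[of w z] by (simp add: linear_neg[OF lb(2)] linear_scale[OF lb(2)])
      moreover have "s i j = s j i"
      proof -
        have "br (e i) (br (e j) z) - br (e j) (br (e i) z) = br (br (e i) (e j)) z" by (simp add: jacobi')
        moreover have "br (br (e i) (e j)) z = 0" using n1n1br[OF br_in(1)[OF i] zn1] .
        ultimately show ?thesis by (simp add: s_def)
      qed
      ultimately show ?thesis using bzw by simp
    qed
    have "s 0 0 = 0" "s 1 1 = 0" using buu[OF eh(1) eh(1)] buu[OF eh(2) eh(2)] \<beta>(1) by (simp_all add: alternating2_def)
    moreover have "s 0 1 = 0" using buu[OF eh] buu[OF eh(2,1)] ba[of u0 u1] ssym by (simp add: u0_def u1_def)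
    ultimately show False using sne by blast
  qed
qed

end

section \<open>Pencils of 2-forms in dimension four\<close>

text \<open>The polarized Pfaffian: for \<open>p = q\<close> this is twice the Pfaffian of
  \<open>p\<close> on the four vectors.\<close>

definition wedge22 :: "('a \<Rightarrow> 'a \<Rightarrow> real) \<Rightarrow> ('a \<Rightarrow> 'a \<Rightarrow> real) \<Rightarrow> 'a \<Rightarrow> 'a \<Rightarrow> 'a \<Rightarrow> 'a \<Rightarrow> real"
  where "wedge22 p q w x y z = p w x * q y z - p w y * q x z + p w z * q x y
    + q w x * p y z - q w y * p x z + q w z * p x y"

text \<open>The four-dimensional determinant, expanded by Laplace along the minors of its first two
  rows.\<close>

definition det4 :: "(nat \<Rightarrow> real) \<Rightarrow> (nat \<Rightarrow> real) \<Rightarrow> (nat \<Rightarrow> real) \<Rightarrow> (nat \<Rightarrow> real) \<Rightarrow> real"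
  where "det4 w x y z =
    (w 0 * x 1 - w 1 * x 0) * (y 2 * z 3 - y 3 * z 2) - (w 0 * x 2 - w 2 * x 0) * (y 1 * z 3 - y 3 * z 1)
    + (w 0 * x 3 - w 3 * x 0) * (y 1 * z 2 - y 2 * z 1) + (w 1 * x 2 - w 2 * x 1) * (y 0 * z 3 - y 3 * z 0)
    - (w 1 * x 3 - w 3 * x 1) * (y 0 * z 2 - y 2 * z 0) + (w 2 * x 3 - w 3 * x 2) * (y 0 * z 1 - y 1 * z 0)"

text \<open>An alternating 4-form on the span of four vectors is a multiple of the determinant;
  linearity in one slot and the adjacent transpositions give the rest.\<close>

lemma wedge22_det4:
  assumes p: "alternating2 p" and q: "alternating2 q"
  shows "wedge22 p q (w 0 *\<^sub>R e0 + w 1 *\<^sub>R e1 + w 2 *\<^sub>R e2 + w 3 *\<^sub>R e3) (x 0 *\<^sub>R e0 + x 1 *\<^sub>R e1 + x 2 *\<^sub>R e2 + x 3 *\<^sub>R e3)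
    (y 0 *\<^sub>R e0 + y 1 *\<^sub>R e1 + y 2 *\<^sub>R e2 + y 3 *\<^sub>R e3) (z 0 *\<^sub>R e0 + z 1 *\<^sub>R e1 + z 2 *\<^sub>R e2 + z 3 *\<^sub>R e3)
    = det4 w x y z * wedge22 p q e0 e1 e2 e3"
proof -
  note lp = linear_alternating2[OF p] and lq = linear_alternating2[OF q]
  note ap = alternating2_antisym[OF p] and aq = alternating2_antisym[OF q]
  define F where "F = wedge22 p q"
  have l1: "F (u + v) b c d = F u b c d + F v b c d" "F (s *\<^sub>R u) b c d = s * F u b c d" for u v b c d s
    by (simp_all add: F_def wedge22_def linear_add[OF lp(2)] linear_add[OF lq(2)] linear_scale[OF lp(2)] linear_scale[OF lq(2)] algebra_simps)
  have F12: "F a b c d = - F b a c d" for a b c d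
    using ap[of a b] aq[of a b] by (simp add: F_def wedge22_def)
  have F23: "F a b c d = - F a c b d" for a b c d
    using ap[of b c] aq[of b c] by (simp add: F_def wedge22_def)
  have F34: "F a b c d = - F a b d c" for a b c d
    using ap[of c d] aq[of c d] by (simp add: F_def wedge22_def)
  have l2: "F b (u + v) c d = F b u c d + F b v c d" "F b (s *\<^sub>R u) c d = s * F b u c d" for u v b c d s
    unfolding F12[of b] by (simp_all add: l1)
  have l3: "F b c (u + v) d = F b c u d + F b c v d" "F b c (s *\<^sub>R u) d = s * F b c u d" for u v b c d s
    unfolding F23[of b c] by (simp_all add: l2)
  have l4: "F b c d (u + v) = F b c d u + F b c d v" "F b c d (s *\<^sub>R u) = s * F b c d u" for u v b c d s
    unfolding F34[of b c d] by (simp_all add: l3)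
  have r12: "F u u c d = 0" for u c d using F12[of u u c d] by simp
  have r23: "F c u u d = 0" for u c d using F23[of c u u d] by simp
  have r34: "F c d u u = 0" for u c d using F34[of c d u u] by simp
  have r13: "F u c u d = 0" for u c d using F23[of u c u d] r12 by simp
  have r24: "F c u d u = 0" for u c d using F34[of c u d u] r23 by simp
  have r14: "F u c d u = 0" for u c d using F34[of u c d u] r13 by simp
  \<comment> \<open>The 23 nontrivial permutations of the four vectors, each reached from an earlier
    one by an adjacent transposition.\<close>
  have s1: "F e1 e0 e2 e3 = - F e0 e1 e2 e3" using F12[of e1 e0 e2 e3] by simp
  have s2: "F e0 e2 e1 e3 = - F e0 e1 e2 e3" using F23[of e0 e2 e1 e3] by simp
  have s3: "F e0 e1 e3 e2 = - F e0 e1 e2 e3" using F34[of e0 e1 e3 e2] by simp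
  have s4: "F e1 e2 e0 e3 = F e0 e1 e2 e3" using F23[of e1 e2 e0 e3] s1 by simp
  have s5: "F e1 e0 e3 e2 = F e0 e1 e2 e3" using F34[of e1 e0 e3 e2] s1 by simp
  have s6: "F e2 e0 e1 e3 = F e0 e1 e2 e3" using F12[of e2 e0 e1 e3] s2 by simp
  have s7: "F e0 e2 e3 e1 = F e0 e1 e2 e3" using F34[of e0 e2 e3 e1] s2 by simp
  have s8: "F e0 e3 e1 e2 = F e0 e1 e2 e3" using F23[of e0 e3 e1 e2] s3 by simp
  have s9: "F e2 e1 e0 e3 = - F e0 e1 e2 e3" using F12[of e2 e1 e0 e3] s4 by simp
  have s10: "F e1 e2 e3 e0 = - F e0 e1 e2 e3" using F34[of e1 e2 e3 e0] s4 by simp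
  have s11: "F e1 e3 e0 e2 = - F e0 e1 e2 e3" using F23[of e1 e3 e0 e2] s5 by simp
  have s12: "F e2 e0 e3 e1 = - F e0 e1 e2 e3" using F34[of e2 e0 e3 e1] s6 by simp
  have s13: "F e0 e3 e2 e1 = - F e0 e1 e2 e3" using F23[of e0 e3 e2 e1] s7 by simp
  have s14: "F e3 e0 e1 e2 = - F e0 e1 e2 e3" using F12[of e3 e0 e1 e2] s8 by simp
  have s15: "F e2 e1 e3 e0 = F e0 e1 e2 e3" using F34[of e2 e1 e3 e0] s9 by simp
  have s16: "F e1 e3 e2 e0 = F e0 e1 e2 e3" using F23[of e1 e3 e2 e0] s10 by simp
  have s17: "F e3 e1 e0 e2 = F e0 e1 e2 e3" using F12[of e3 e1 e0 e2] s11 by simp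
  have s18: "F e2 e3 e0 e1 = F e0 e1 e2 e3" using F23[of e2 e3 e0 e1] s12 by simp
  have s19: "F e3 e0 e2 e1 = F e0 e1 e2 e3" using F12[of e3 e0 e2 e1] s13 by simp
  have s20: "F e2 e3 e1 e0 = - F e0 e1 e2 e3" using F23[of e2 e3 e1 e0] s15 by simp
  have s21: "F e3 e1 e2 e0 = - F e0 e1 e2 e3" using F12[of e3 e1 e2 e0] s16 by simp
  have s22: "F e3 e2 e0 e1 = - F e0 e1 e2 e3" using F12[of e3 e2 e0 e1] s18 by simp
  have s23: "F e3 e2 e1 e0 = F e0 e1 e2 e3" using F12[of e3 e2 e1 e0] s20 by simp
  have "F (w 0 *\<^sub>R e0 + w 1 *\<^sub>R e1 + w 2 *\<^sub>R e2 + w 3 *\<^sub>R e3) (x 0 *\<^sub>R e0 + x 1 *\<^sub>R e1 + x 2 *\<^sub>R e2 + x 3 *\<^sub>R e3)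
    (y 0 *\<^sub>R e0 + y 1 *\<^sub>R e1 + y 2 *\<^sub>R e2 + y 3 *\<^sub>R e3) (z 0 *\<^sub>R e0 + z 1 *\<^sub>R e1 + z 2 *\<^sub>R e2 + z 3 *\<^sub>R e3)
    = det4 w x y z * F e0 e1 e2 e3"
    by (simp only: l1 l2 l3 l4 r12 r13 r14 r23 r24 r34 s1 s2 s3 s4 s5 s6 s7 s8 s9 s10 s11 s12 s13 s14 s15 s16 s17 s18 s19 s20 s21 s22 s23 mult_zero_right add_0_left add_0_right)
      (simp add: det4_def algebra_simps)
  then show ?thesis by (simp add: F_def)
qed

lemma two_by_two_kernel:
  fixes u v :: real
  assumes "s * u + r * v = 0" "s' * u + r' * v = 0" "s * r' - s' * r \<noteq> 0"
  shows "u = 0" "v = 0"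
proof -
  have "(s * r' - s' * r) * u = r' * (s * u + r * v) - r * (s' * u + r' * v)" by algebra
  then show "u = 0" using assms by simp
  have "(s * r' - s' * r) * v = s * (s' * u + r' * v) - s' * (s * u + r * v)" by algebra
  then show "v = 0" using assms by simp
qed

text \<open>The quadratic formula: an indefinite binary form vanishes on two distinct real
  lines.\<close>

lemma binary_form_split:
  fixes q11 q12 q22 :: real
  assumes "q11 * q22 - q12\<^sup>2 < 0"
  obtains s r s' r' where "s * r' - s' * r \<noteq> 0" "s * s * q11 + 2 * (s * r * q12) + r * r * q22 = 0"
    "s' * s' * q11 + 2 * (s' * r' * q12) + r' * r' * q22 = 0"
proof (cases "q11 = 0")
  case True
  then have "q12 \<noteq> 0" using assms by auto
  \<comment> \<open>The instantiation follows the order \<open>s\<close>, \<open>r'\<close>,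
    \<open>s'\<close>, \<open>r\<close> of the first conclusion: the zeros are
    \<open>(s, r) = (1, 0)\<close> and \<open>(s', r') = (q22, - 2 * q12)\<close>.\<close>
  then show ?thesis
    using True by (intro that[of 1 "- 2 * q12" q22 0]) (auto simp: algebra_simps)
next
  case False
  define \<delta> where "\<delta> = sqrt (q12\<^sup>2 - q11 * q22)"
  have d: "\<delta> * \<delta> = q12\<^sup>2 - q11 * q22" "\<delta> \<noteq> 0"
    using assms real_sqrt_mult_self[of "q12\<^sup>2 - q11 * q22"] by (auto simp: \<delta>_def)
  show ?thesis
  proof (rule that[of "- q12 + \<delta>" q11 "- q12 - \<delta>" q11])
    show "(- q12 + \<delta>) * q11 - (- q12 - \<delta>) * q11 \<noteq> 0" using d False by (simp add: algebra_simps)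
    have "(- q12 + \<delta>) * (- q12 + \<delta>) * q11 + 2 * ((- q12 + \<delta>) * q11 * q12) + q11 * q11 * q22
      = q11 * (\<delta> * \<delta> - (q12\<^sup>2 - q11 * q22))" by algebra
    then show "(- q12 + \<delta>) * (- q12 + \<delta>) * q11 + 2 * ((- q12 + \<delta>) * q11 * q12) + q11 * q11 * q22 = 0" using d by simp
    have "(- q12 - \<delta>) * (- q12 - \<delta>) * q11 + 2 * ((- q12 - \<delta>) * q11 * q12) + q11 * q11 * q22
      = q11 * (\<delta> * \<delta> - (q12\<^sup>2 - q11 * q22))" by algebra
    then show "(- q12 - \<delta>) * (- q12 - \<delta>) * q11 + 2 * ((- q12 - \<delta>) * q11 * q12) + q11 * q11 * q22 = 0" using d by simp
  qed
qed

text \<open>The vector \<open>(- q12, q11)\<close> is orthogonal to \<open>(1, 0)\<close> for the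
  form, and scaling the latter by \<open>\<delta>\<close> gives both the same value.\<close>

lemma binary_form_definite:
  fixes q11 q12 q22 :: real
  assumes "q11 * q22 - q12\<^sup>2 > 0"
  obtains s r s' r' where "s * r' - s' * r \<noteq> 0" "s * s' * q11 + (s * r' + s' * r) * q12 + r * r' * q22 = 0"
    "s * s * q11 + 2 * (s * r * q12) + r * r * q22 = s' * s' * q11 + 2 * (s' * r' * q12) + r' * r' * q22"
    "s * s * q11 + 2 * (s * r * q12) + r * r * q22 \<noteq> 0"
proof -
  define \<delta> where "\<delta> = sqrt (q11 * q22 - q12\<^sup>2)"
  have d: "\<delta> * \<delta> = q11 * q22 - q12\<^sup>2" "\<delta> \<noteq> 0"
    using assms real_sqrt_mult_self[of "q11 * q22 - q12\<^sup>2"] by (auto simp: \<delta>_def)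
  have q: "q11 \<noteq> 0"
  proof
    assume "q11 = 0"
    then have "- q12\<^sup>2 > 0" using assms by simp
    then show False by (simp add: not_less)
  qed
  show ?thesis
  proof (rule that[of \<delta> q11 "- q12" 0])
    show "\<delta> * q11 - - q12 * 0 \<noteq> 0" "\<delta> * - q12 * q11 + (\<delta> * q11 + - q12 * 0) * q12 + 0 * q11 * q22 = 0"
      using d q by simp_all
    have "- q12 * - q12 * q11 + 2 * (- q12 * q11 * q12) + q11 * q11 * q22 = (q11 * q22 - q12\<^sup>2) * q11" by algebra
    then show "\<delta> * \<delta> * q11 + 2 * (\<delta> * 0 * q12) + 0 * 0 * q22 = - q12 * - q12 * q11 + 2 * (- q12 * q11 * q12) + q11 * q11 * q22"
      unfolding d by simp
    have "\<delta> * \<delta> * q11 \<noteq> 0" using d(2) q by simp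
    then show "\<delta> * \<delta> * q11 + 2 * (\<delta> * 0 * q12) + 0 * 0 * q22 \<noteq> 0" by simp
  qed
qed

context unimodular_cohomology_trivial
begin

text \<open>The components of the bracket span a pencil of 2-forms on \<open>h/[h,h]\<close>, on
  which \<open>D\<close> acts by a traceless matrix preserving the Pfaffian. Changing the basis of
  the pencil changes the basis of \<open>[h,h]\<close>, so a normal form of the Pfaffian as a binary
  form becomes a normal form of the algebra.\<close>

lemma dim_n1_2_isomorphic:
  assumes d1: "dim (n 1) = 2"
  shows "lie_isomorphic br h br_12_34 UNIV \<or> lie_isomorphic br h br_13m24_14p23 UNIV"
proof -
  note One_nat_def [simp del]
  have n2: "n 2 = {0}" by (rule dim_n1_2_imp_n2_zero[OF d1])
  have "\<exists>e c. coords_mod (n 0) (n 1) 4 e c"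
    using coords_mod_exists[OF subspace_n subspace_n n1_sub_n0, of 4] d1 dim_h by (simp add: n_0)
  then obtain e c where ec: "coords_mod (n 0) (n 1) 4 e c" by blast
  note co = coords_modD[OF ec]
  have eh: "e 0 \<in> h" "e 1 \<in> h" "e 2 \<in> h" "e 3 \<in> h" using co(1) by (simp_all add: n_0)
  have ce: "c 0 (e 0) = 1" "c 1 (e 1) = 1" "c 2 (e 2) = 1" "c 3 (e 3) = 1"
    "c 0 (e 1) = 0" "c 0 (e 2) = 0" "c 0 (e 3) = 0" "c 1 (e 0) = 0" "c 1 (e 2) = 0" "c 1 (e 3) = 0"
    "c 2 (e 0) = 0" "c 2 (e 1) = 0" "c 2 (e 3) = 0" "c 3 (e 0) = 0" "c 3 (e 1) = 0" "c 3 (e 2) = 0"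
    using co(4,5) by simp_all
  define xb where "xb x = c 0 x *\<^sub>R e 0 + c 1 x *\<^sub>R e 1 + c 2 x *\<^sub>R e 2 + c 3 x *\<^sub>R e 3" for x
  have xb: "x - xb x \<in> n 1" if "x \<in> h" for x
    using co(6)[of x] that unfolding xb_def by (simp only: sum_lessThan_small n_0)
  have xbh: "xb x \<in> h" for x
    unfolding xb_def using eh by (intro subspace_add[OF subspace_h] subspace_scale[OF subspace_h])
  have "(\<Sum>j<4. c j (D (e j))) = 0" using traceless[of 0 4 e c] ec by (simp add: One_nat_def)
  then have tr: "c 0 (D (e 0)) + c 1 (D (e 1)) + c 2 (D (e 2)) + c 3 (D (e 3)) = 0" by (simp only: sum_lessThan_small)
  have Dh: "D x \<in> h" for x by (rule br_h)
  have n12: "n (Suc 1) = {0}" using n2 by simp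
  have "\<exists>u d. coords_mod (n 1) (n (Suc 1)) 2 u d"
    using coords_mod_exists[OF subspace_n subspace_n n_dec, of 1 2] d1 n12 by simp
  then obtain u d where ud: "coords_mod (n 1) (n (Suc 1)) 2 u d" by blast
  note cu = coords_modD[OF ud]
  define z1 z2 \<xi>1 \<xi>2 where "z1 = u 0" and "z2 = u 1" and "\<xi>1 = d 0" and "\<xi>2 = d 1"
  have zn1: "z1 \<in> n 1" "z2 \<in> n 1" using cu(1) by (simp_all add: z1_def z2_def)
  then have zh: "z1 \<in> h" "z2 \<in> h" using n1_h by blast+
  have lx: "linear \<xi>1" "linear \<xi>2" using cu(2) by (simp_all add: \<xi>1_def \<xi>2_def)
  have xz: "\<xi>1 z1 = 1" "\<xi>1 z2 = 0" "\<xi>2 z1 = 0" "\<xi>2 z2 = 1" using cu(4,5) by (simp_all add: z1_def z2_def \<xi>1_def \<xi>2_def)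
  have n1dec: "v = \<xi>1 v *\<^sub>R z1 + \<xi>2 v *\<^sub>R z2" if "v \<in> n 1" for v
    using cu(6)[OF that] unfolding sum_lessThan_small n12 by (simp add: z1_def z2_def \<xi>1_def \<xi>2_def)
  define p1 p2 where "p1 x y = \<xi>1 (br x y)" and "p2 x y = \<xi>2 (br x y)" for x y
  have alt: "alternating2 p1" "alternating2 p2"
    unfolding p1_def p2_def by (rule alternating2_functional_br[OF lie_algebra_axioms lx(1)], rule alternating2_functional_br[OF lie_algebra_axioms lx(2)])
  have brp: "br x y = p1 x y *\<^sub>R z1 + p2 x y *\<^sub>R z2" if "x \<in> h" "y \<in> h" for x y
    using n1dec[OF br_in(1)[OF that]] by (simp add: p1_def p2_def)
  have brn1: "br v x = 0" "br x v = 0" if "v \<in> n 1" "x \<in> h" for v x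
    using br_in(2)[OF that] br_in(3)[OF that(2,1)] n2 by simp_all
  have pn1: "p1 v x = 0" "p1 x v = 0" "p2 v x = 0" "p2 x v = 0" if "v \<in> n 1" "x \<in> h" for v x
    using brn1[OF that] by (simp_all add: p1_def p2_def linear_0[OF lx(1)] linear_0[OF lx(2)])
  define a b k where "a = \<xi>1 (D z1)" and "b = \<xi>2 (D z1)" and "k = \<xi>1 (D z2)"
  have "(\<Sum>j<2. d j (D (u j))) = 0" using traceless[of 1 2 u d] ud by simp
  then have trz: "\<xi>2 (D z2) = - a" unfolding sum_lessThan_small by (simp add: a_def z1_def z2_def \<xi>1_def \<xi>2_def)
  have Dz: "D z1 = a *\<^sub>R z1 + b *\<^sub>R z2" "D z2 = k *\<^sub>R z1 - a *\<^sub>R z2"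
    using n1dec[OF n_ideal[OF zn1(1)], of t] n1dec[OF n_ideal[OF zn1(2)], of t] by (simp_all add: a_def b_def k_def trz[unfolded a_def])
  \<comment> \<open>Since \<open>D\<close> is a derivation, it acts on the pair \<open>p1\<close>,
    \<open>p2\<close> through its traceless matrix on \<open>n 1\<close>.\<close>
  have L: "p1 (D x) y + p1 x (D y) = a * p1 x y + k * p2 x y" "p2 (D x) y + p2 x (D y) = b * p1 x y - a * p2 x y"
    if "x \<in> h" "y \<in> h" for x y
  proof -
    have "br (D x) y + br x (D y) = D (br x y)" using jacobi'[of t x y] by simp
    also have "\<dots> = p1 x y *\<^sub>R D z1 + p2 x y *\<^sub>R D z2" unfolding brp[OF that] by (simp add: br_add br_scaleR)
    finally have e: "br (D x) y + br x (D y) = p1 x y *\<^sub>R (a *\<^sub>R z1 + b *\<^sub>R z2) + p2 x y *\<^sub>R (k *\<^sub>R z1 - a *\<^sub>R z2)"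
      unfolding Dz .
    have "p1 (D x) y + p1 x (D y) = \<xi>1 (br (D x) y + br x (D y))" "p2 (D x) y + p2 x (D y) = \<xi>2 (br (D x) y + br x (D y))"
      by (simp_all add: p1_def p2_def linear_add[OF lx(1)] linear_add[OF lx(2)])
    then show "p1 (D x) y + p1 x (D y) = a * p1 x y + k * p2 x y" "p2 (D x) y + p2 x (D y) = b * p1 x y - a * p2 x y"
      unfolding e by (simp_all add: linear_add[OF lx(1)] linear_add[OF lx(2)] linear_diff[OF lx(1)] linear_diff[OF lx(2)]
        linear_scale[OF lx(1)] linear_scale[OF lx(2)] xz)
  qed
  have indep: "s = 0" "r = 0" if "\<And>x y. x \<in> h \<Longrightarrow> y \<in> h \<Longrightarrow> s * p1 x y + r * p2 x y = 0" for s r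
  proof -
    have lin: "linear (\<lambda>v. s * \<xi>1 v + r * \<xi>2 v)"
      by (rule linearI) (simp_all add: linear_add[OF lx(1)] linear_add[OF lx(2)] linear_scale[OF lx(1)] linear_scale[OF lx(2)] algebra_simps)
    have "n 1 \<subseteq> {v. s * \<xi>1 v + r * \<xi>2 v = 0}"
      by (rule n1_subset[OF linear_subspace_kernel[OF lin]]) (use that in \<open>simp add: p1_def p2_def\<close>)
    then have "s * \<xi>1 z1 + r * \<xi>2 z1 = 0" "s * \<xi>1 z2 + r * \<xi>2 z2 = 0" using zn1 by blast+
    then show "s = 0" "r = 0" by (simp_all add: xz)
  qed
  define C where "C x i = c i x" for x and i :: nat
  \<comment> \<open>Forms that vanish on \<open>n 1\<close> live on the four-dimensional quotient,
    so the product of any two is determined by its value at the basis \<open>e\<close>.\<close>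
  have W: "wedge22 p q w x y z = det4 (C w) (C x) (C y) (C z) * wedge22 p q (e 0) (e 1) (e 2) (e 3)"
    if p: "alternating2 p" "\<And>v x. v \<in> n 1 \<Longrightarrow> x \<in> h \<Longrightarrow> p v x = 0" and q: "alternating2 q" "\<And>v x. v \<in> n 1 \<Longrightarrow> x \<in> h \<Longrightarrow> q v x = 0"
      and hh: "w \<in> h" "x \<in> h" "y \<in> h" "z \<in> h" for p q w x y z
  proof -
    have red: "f x y = f (xb x) (xb y)" if f: "alternating2 f" "\<And>v x. v \<in> n 1 \<Longrightarrow> x \<in> h \<Longrightarrow> f v x = 0"
      and xy: "x \<in> h" "y \<in> h" for f x y
    proof -
      note lf = linear_alternating2[OF f(1)]
      have "f (x - xb x) y = 0" using f(2)[OF xb[OF xy(1)] xy(2)] .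
      moreover have "f (xb x) (y - xb y) = 0" using f(2)[OF xb[OF xy(2)] xbh] alternating2_antisym[OF f(1), of "xb x"] by simp
      ultimately show ?thesis by (simp add: linear_diff[OF lf(1)] linear_diff[OF lf(2)])
    qed
    have "wedge22 p q w x y z = wedge22 p q (xb w) (xb x) (xb y) (xb z)"
      unfolding wedge22_def
      by (simp only: red[OF p hh(1,2)] red[OF p hh(1,3)] red[OF p hh(1,4)] red[OF p hh(2,3)] red[OF p hh(2,4)] red[OF p hh(3,4)]
        red[OF q hh(1,2)] red[OF q hh(1,3)] red[OF q hh(1,4)] red[OF q hh(2,3)] red[OF q hh(2,4)] red[OF q hh(3,4)])
    also have "\<dots> = det4 (C w) (C x) (C y) (C z) * wedge22 p q (e 0) (e 1) (e 2) (e 3)"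
      using wedge22_det4[OF p(1) q(1), of "C w" "e 0" "e 1" "e 2" "e 3" "C x" "C y" "C z"] by (simp add: xb_def C_def)
    finally show ?thesis .
  qed

  \<comment> \<open>The Pfaffian of the pencil and its invariance\<close>
  define comb where "comb s r x y = s * p1 x y + r * p2 x y" for s r x y
  have altc: "alternating2 (comb s r)" for s r
    unfolding comb_def by (intro alternating2_add alternating2_scale alt)
  have combn1: "comb s r v x = 0" if "v \<in> n 1" "x \<in> h" for s r v x using pn1[OF that] by (simp add: comb_def)
  have Wc: "wedge22 (comb s r) (comb s' r') w x y z
      = det4 (C w) (C x) (C y) (C z) * wedge22 (comb s r) (comb s' r') (e 0) (e 1) (e 2) (e 3)"
    if "w \<in> h" "x \<in> h" "y \<in> h" "z \<in> h" for s r s' r' w x y z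
    by (rule W[OF altc _ altc _ that]) (use combn1 in auto)
  define q11 q12 q22 where "q11 = wedge22 p1 p1 (e 0) (e 1) (e 2) (e 3)" and "q12 = wedge22 p1 p2 (e 0) (e 1) (e 2) (e 3)"
    and "q22 = wedge22 p2 p2 (e 0) (e 1) (e 2) (e 3)"
  have qc: "wedge22 (comb s r) (comb s' r') (e 0) (e 1) (e 2) (e 3) = s * s' * q11 + (s * r' + s' * r) * q12 + r * r' * q22" for s r s' r'
    by (simp add: q11_def q12_def q22_def wedge22_def comb_def algebra_simps)
  have p_comb: "p1 = comb 1 0" "p2 = comb 0 1" by (simp_all add: comb_def fun_eq_iff)
  \<comment> \<open>As \<open>D\<close> is traceless on \<open>h/[h,h]\<close>, it annihilates the
    4-form \<open>p \<and> q\<close>; the Leibniz rule distributes this over the two factors and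
    gives the invariance of the Pfaffian under the action on the pencil.\<close>
  have inv: "wedge22 (comb a k) q (e 0) (e 1) (e 2) (e 3) * s + wedge22 (comb b (- a)) q (e 0) (e 1) (e 2) (e 3) * r
      + wedge22 p (comb a k) (e 0) (e 1) (e 2) (e 3) * s' + wedge22 p (comb b (- a)) (e 0) (e 1) (e 2) (e 3) * r' = 0"
    if "p = comb s r" "q = comb s' r'" for p q s r s' r'
  proof -
    have Lc: "p (D x) y + p x (D y) = s * comb a k x y + r * comb b (- a) x y"
      "q (D x) y + q x (D y) = s' * comb a k x y + r' * comb b (- a) x y" if "x \<in> h" "y \<in> h" for x y
    proof -
      have "comb s r (D x) y + comb s r x (D y) = s * (p1 (D x) y + p1 x (D y)) + r * (p2 (D x) y + p2 x (D y))" for s r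
        by (simp add: comb_def algebra_simps)
      then show "p (D x) y + p x (D y) = s * comb a k x y + r * comb b (- a) x y"
        "q (D x) y + q x (D y) = s' * comb a k x y + r' * comb b (- a) x y"
        using L[OF that] \<open>p = comb s r\<close> \<open>q = comb s' r'\<close> by (simp_all add: comb_def)
    qed
    have "wedge22 p q (D (e 0)) (e 1) (e 2) (e 3) + wedge22 p q (e 0) (D (e 1)) (e 2) (e 3)
      + wedge22 p q (e 0) (e 1) (D (e 2)) (e 3) + wedge22 p q (e 0) (e 1) (e 2) (D (e 3))
      = (c 0 (D (e 0)) + c 1 (D (e 1)) + c 2 (D (e 2)) + c 3 (D (e 3))) * wedge22 p q (e 0) (e 1) (e 2) (e 3)"
      unfolding that Wc[OF Dh eh(2-4)] Wc[OF eh(1) Dh eh(3,4)] Wc[OF eh(1,2) Dh eh(4)] Wc[OF eh(1-3) Dh]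
      by (simp add: det4_def C_def ce algebra_simps)
    then have "wedge22 p q (D (e 0)) (e 1) (e 2) (e 3) + wedge22 p q (e 0) (D (e 1)) (e 2) (e 3)
      + wedge22 p q (e 0) (e 1) (D (e 2)) (e 3) + wedge22 p q (e 0) (e 1) (e 2) (D (e 3)) = 0" unfolding tr by simp
    moreover have "wedge22 p q (D (e 0)) (e 1) (e 2) (e 3) + wedge22 p q (e 0) (D (e 1)) (e 2) (e 3)
      + wedge22 p q (e 0) (e 1) (D (e 2)) (e 3) + wedge22 p q (e 0) (e 1) (e 2) (D (e 3))
      = wedge22 (\<lambda>x y. p (D x) y + p x (D y)) q (e 0) (e 1) (e 2) (e 3) + wedge22 p (\<lambda>x y. q (D x) y + q x (D y)) (e 0) (e 1) (e 2) (e 3)"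
      by (simp add: wedge22_def algebra_simps)
    moreover have "\<dots> = wedge22 (comb a k) q (e 0) (e 1) (e 2) (e 3) * s + wedge22 (comb b (- a)) q (e 0) (e 1) (e 2) (e 3) * r
      + wedge22 p (comb a k) (e 0) (e 1) (e 2) (e 3) * s' + wedge22 p (comb b (- a)) (e 0) (e 1) (e 2) (e 3) * r'"
      unfolding wedge22_def by (simp only: Lc eh) (simp add: algebra_simps)
    ultimately show ?thesis by simp
  qed
  have I1: "a * q11 + k * q12 = 0" and I2: "k * q22 + b * q11 = 0" and I3: "b * q12 - a * q22 = 0"
    using inv[OF p_comb(1) p_comb(1)] inv[OF p_comb(1) p_comb(2)] inv[OF p_comb(2) p_comb(2)]
    unfolding p_comb qc by (simp_all add: algebra_simps)
  \<comment> \<open>Injectivity on the third cohomology applied to \<open>\<Sum>\<^sub>i\<^sub>j m\<^sub>i\<^sub>j p\<^sub>i \<and> \<xi>\<^sub>j\<close>, which the last assumption makes closed and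
    the others invariant.\<close>
  have K4: "m11 = 0 \<and> m12 = 0 \<and> m22 = 0"
    if m: "a * m11 + b * m12 = 0" "k * m11 + b * m22 = 0" "k * m12 - a * m22 = 0"
      and mq: "m11 * q11 + 2 * (m12 * q12) + m22 * q22 = 0" for m11 m12 m22
  proof -
    define g1 g2 where "g1 x = m11 * \<xi>1 x + m12 * \<xi>2 x" and "g2 x = m12 * \<xi>1 x + m22 * \<xi>2 x" for x
    have lg: "linear g1" "linear g2" unfolding g1_def g2_def
      by (rule linearI; simp add: linear_add[OF lx(1)] linear_add[OF lx(2)] linear_scale[OF lx(1)] linear_scale[OF lx(2)] algebra_simps)+
    define \<omega> where "\<omega> x y w = (p1 x y * g1 w + p1 y w * g1 x + p1 w x * g1 y) + (p2 x y * g2 w + p2 y w * g2 x + p2 w x * g2 y)" for x y w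
    have alt3: "alternating3 \<omega>" unfolding \<omega>_def by (intro alternating3_add wedge21_alternating alt lg)
    \<comment> \<open>These are \<open>\<xi>1 \<circ> D\<close> and \<open>\<xi>2 \<circ> D\<close>
      minus the combinations of \<open>\<xi>1\<close>, \<open>\<xi>2\<close> with which they agree
      on \<open>n 1\<close>. They build the primitive \<open>\<rho>\<close> of the Lie derivative of
      \<open>\<omega>\<close>.\<close>
    define r1 r2 where "r1 x = \<xi>1 (D x) - a * \<xi>1 x - k * \<xi>2 x" and "r2 x = \<xi>2 (D x) - b * \<xi>1 x + a * \<xi>2 x" for x
    have lD: "linear (\<lambda>x. \<xi>1 (D x))" "linear (\<lambda>x. \<xi>2 (D x))"
      using linear_compose[OF linear_br(1) lx(1)] linear_compose[OF linear_br(1) lx(2)] by (simp_all add: o_def)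
    have lr: "linear r1" "linear r2" unfolding r1_def r2_def
      by (rule linearI; simp add: linear_add[OF lx(1)] linear_add[OF lx(2)] linear_scale[OF lx(1)] linear_scale[OF lx(2)]
        linear_add[OF lD(1)] linear_add[OF lD(2)] linear_scale[OF lD(1)] linear_scale[OF lD(2)] algebra_simps)+
    have rn1: "r1 v = 0" "r2 v = 0" if "v \<in> n 1" for v
    proof -
      have "D v = \<xi>1 v *\<^sub>R (a *\<^sub>R z1 + b *\<^sub>R z2) + \<xi>2 v *\<^sub>R (k *\<^sub>R z1 - a *\<^sub>R z2)"
        by (subst n1dec[OF that]) (simp only: br_add br_scaleR Dz)
      then show "r1 v = 0" "r2 v = 0"
        unfolding r1_def r2_def by (simp_all only: linear_add[OF lx(1)] linear_add[OF lx(2)] linear_diff[OF lx(1)] linear_diff[OF lx(2)]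
          linear_scale[OF lx(1)] linear_scale[OF lx(2)] xz) (simp_all add: algebra_simps)
    qed
    define \<rho> where "\<rho> x y = m11 * (\<xi>1 x * r1 y - r1 x * \<xi>1 y) + (m12 * (\<xi>1 x * r2 y - r2 x * \<xi>1 y)
      + (m12 * (\<xi>2 x * r1 y - r1 x * \<xi>2 y) + m22 * (\<xi>2 x * r2 y - r2 x * \<xi>2 y)))" for x y
    have altr: "alternating2 \<rho>" unfolding \<rho>_def by (intro alternating2_add alternating2_scale wedge2_alternating lx lr)
    have "\<exists>\<beta>. alternating2 \<beta> \<and> (\<forall>x\<in>h. \<forall>y\<in>h. \<forall>z\<in>h. \<omega> x y z = diff2 br \<beta> x y z)"
    proof (rule closed3_on_h_exact[OF alt3 _ altr])
      fix w x y z assume hh: "w \<in> h" "x \<in> h" "y \<in> h" "z \<in> h"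
      have \<omega>br: "\<omega> (br s s') s'' s''' = p1 s'' s''' * (m11 * p1 s s' + m12 * p2 s s') + p2 s'' s''' * (m12 * p1 s s' + m22 * p2 s s')"
        if "s \<in> h" "s' \<in> h" "s'' \<in> h" "s''' \<in> h" for s s' s'' s'''
        using pn1[OF br_in(1)[OF that(1,2)] that(3)] pn1[OF br_in(1)[OF that(1,2)] that(4)]
        by (simp add: \<omega>_def g1_def g2_def p1_def[symmetric] p2_def[symmetric])
      have "diff3 br \<omega> w x y z = m11 * wedge22 p1 p1 w x y z + 2 * (m12 * wedge22 p1 p2 w x y z) + m22 * wedge22 p2 p2 w x y z"
        using hh by (simp add: diff3_def \<omega>br wedge22_def algebra_simps)
      also have "\<dots> = det4 (C w) (C x) (C y) (C z) * (m11 * q11 + 2 * (m12 * q12) + m22 * q22)"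
        unfolding Wc[OF hh, of 1 0 1 0, folded p_comb] Wc[OF hh, of 1 0 0 1, folded p_comb] Wc[OF hh, of 0 1 0 1, folded p_comb]
          q11_def q12_def q22_def by (simp add: algebra_simps)
      finally show "diff3 br \<omega> w x y z = 0" using mq by simp
    next
      fix x y w assume hh: "x \<in> h" "y \<in> h" "w \<in> h"
      have key: "(p1 (D x) y + p1 x (D y)) * g1 w + (p2 (D x) y + p2 x (D y)) * g2 w + p1 x y * g1 (D w) + p2 x y * g2 (D w)
        = p1 x y * (m11 * r1 w + m12 * r2 w) + p2 x y * (m12 * r1 w + m22 * r2 w)" if "x \<in> h" "y \<in> h" for x y w
      proof -
        have "(p1 (D x) y + p1 x (D y)) * g1 w + (p2 (D x) y + p2 x (D y)) * g2 w + p1 x y * g1 (D w) + p2 x y * g2 (D w)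
          - (p1 x y * (m11 * r1 w + m12 * r2 w) + p2 x y * (m12 * r1 w + m22 * r2 w))
          = 2 * (a * m11 + b * m12) * (p1 x y * \<xi>1 w) + (k * m11 + b * m22) * (p1 x y * \<xi>2 w + p2 x y * \<xi>1 w)
            + 2 * (k * m12 - a * m22) * (p2 x y * \<xi>2 w)"
          unfolding L[OF that] g1_def g2_def r1_def r2_def by (simp add: algebra_simps)
        then show ?thesis unfolding m by simp
      qed
      have \<rho>br: "\<rho> (br s s') v = p1 s s' * (m11 * r1 v + m12 * r2 v) + p2 s s' * (m12 * r1 v + m22 * r2 v)"
        if "s \<in> h" "s' \<in> h" for s s' v
        using rn1[OF br_in(1)[OF that]] by (simp add: \<rho>_def p1_def[symmetric] p2_def[symmetric] algebra_simps)
      have "\<omega> (D x) y w + \<omega> x (D y) w + \<omega> x y (D w) =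
        ((p1 (D x) y + p1 x (D y)) * g1 w + (p2 (D x) y + p2 x (D y)) * g2 w + p1 x y * g1 (D w) + p2 x y * g2 (D w))
        + ((p1 (D y) w + p1 y (D w)) * g1 x + (p2 (D y) w + p2 y (D w)) * g2 x + p1 y w * g1 (D x) + p2 y w * g2 (D x))
        + ((p1 (D w) x + p1 w (D x)) * g1 y + (p2 (D w) x + p2 w (D x)) * g2 y + p1 w x * g1 (D y) + p2 w x * g2 (D y))"
        unfolding \<omega>_def by (simp add: algebra_simps)
      also have "\<dots> = diff2 br \<rho> x y w"
        unfolding key[OF hh(1,2)] key[OF hh(2,3)] key[OF hh(3,1)] diff2_def \<rho>br[OF hh(1,2)] \<rho>br[OF hh(2,3)] \<rho>br[OF hh(3,1)] ..
      finally show "\<omega> (D x) y w + \<omega> x (D y) w + \<omega> x y (D w) = diff2 br \<rho> x y w" .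
    qed
    then obtain \<beta> where \<beta>: "alternating2 \<beta>" "\<And>x y w. x \<in> h \<Longrightarrow> y \<in> h \<Longrightarrow> w \<in> h \<Longrightarrow> \<omega> x y w = diff2 br \<beta> x y w" by blast
    note lb = linear_alternating2[OF \<beta>(1)]
    have b0: "\<beta> x x = 0" for x using \<beta>(1) by (simp add: alternating2_def)
    have ev: "p1 x y * g1 z + p2 x y * g2 z = p1 x y * \<beta> z1 z + p2 x y * \<beta> z2 z" if "x \<in> h" "y \<in> h" "z \<in> n 1" for x y z
    proof -
      have z: "z \<in> h" using that(3) n1_h by blast
      have "\<omega> x y z = p1 x y * g1 z + p2 x y * g2 z" using pn1[OF that(3,1)] pn1[OF that(3,2)] by (simp add: \<omega>_def)
      moreover have "diff2 br \<beta> x y z = p1 x y * \<beta> z1 z + p2 x y * \<beta> z2 z"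
        using brn1[OF that(3,1)] brn1[OF that(3,2)] by (simp add: diff2_def linear_0[OF lb(2)])
          (simp add: brp[OF that(1,2)] linear_add[OF lb(2)] linear_scale[OF lb(2)])
      ultimately show ?thesis using \<beta>(2)[OF that(1,2) z] by simp
    qed
    have gz: "g1 z1 = m11" "g1 z2 = m12" "g2 z1 = m12" "g2 z2 = m22" by (simp_all add: g1_def g2_def xz)
    \<comment> \<open>The off-diagonal entry \<open>m12\<close> equals both
      \<open>\<beta> z2 z1\<close> and \<open>\<beta> z1 z2\<close> by independence of the pencil,
      so it is zero by antisymmetry.\<close>
    have "m11 * p1 x y + (m12 - \<beta> z2 z1) * p2 x y = 0" "(m12 - \<beta> z1 z2) * p1 x y + m22 * p2 x y = 0" if "x \<in> h" "y \<in> h" for x y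
      using ev[OF that zn1(1)] ev[OF that zn1(2)] by (simp_all add: gz b0 algebra_simps)
    then have "m11 = 0" "m12 - \<beta> z2 z1 = 0" "m12 - \<beta> z1 z2 = 0" "m22 = 0" using indep by blast+
    then show ?thesis using alternating2_antisym[OF \<beta>(1), of z1 z2] by simp
  qed
  have det: "q11 * q22 - q12\<^sup>2 \<noteq> 0"
  proof
    assume d0: "q11 * q22 - q12\<^sup>2 = 0"
    show False
    proof (cases "a = 0 \<and> b = 0 \<and> k = 0")
      case True
      \<comment> \<open>When \<open>D\<close> acts trivially on the pencil every \<open>m\<close> is
        invariant, and a nonzero one orthogonal to the Pfaffian always exists: this choice first,
        then \<open>(1, 0, 0)\<close> once \<open>q11\<close> is known to vanish.\<close>
      have "q22 = 0 \<and> (0::real) = 0 \<and> - q11 = 0" by (rule K4) (use True in auto)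
      then have "(1::real) = 0 \<and> (0::real) = 0 \<and> (0::real) = 0" using True by (intro K4) auto
      then show False by simp
    next
      case False
      \<comment> \<open>A traceless matrix becomes a symmetric tensor, here
        \<open>(b, - a, - k)\<close>, by means of the area form of the plane, and it is invariant
        under itself. By \<open>K4\<close> it can be orthogonal to the Pfaffian only if it is
        zero.\<close>
      have X: "b * q11 - 2 * (a * q12) - k * q22 \<noteq> 0"
      proof
        assume "b * q11 - 2 * (a * q12) - k * q22 = 0"
        then have "b = 0 \<and> - a = 0 \<and> - k = 0" by (intro K4) (auto simp: algebra_simps)
        then show False using False by simp
      qed
      define Y where "Y = b * q11 - a * q12"
      have Y: "Y \<noteq> 0" using X I2 by (simp add: Y_def)
      have "Y * q22 = b * (q11 * q22 - q12\<^sup>2) + q12 * (b * q12 - a * q22)" unfolding Y_def by algebra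
      then have q22: "q22 = 0" using Y d0 I3 by simp
      have "Y * q11 = - k * (q11 * q22 - q12\<^sup>2) + q11 * (k * q22 + b * q11) - q12 * (a * q11 + k * q12)" unfolding Y_def by algebra
      then have q11: "q11 = 0" using Y d0 I1 I2 by simp
      then have "q12 = 0" using d0 by simp
      then show False using Y q11 by (simp add: Y_def)
    qed
  qed
  \<comment> \<open>Some product of two members of the pencil is a nonzero multiple of the
    determinant. Putting \<open>x\<close> into each slot in turn shows that its four coordinates
    vanish.\<close>
  have center: "x \<in> n 1" if x: "x \<in> h" and x0: "\<And>y. y \<in> h \<Longrightarrow> p1 x y = 0" "\<And>y. y \<in> h \<Longrightarrow> p2 x y = 0" for x
  proof -
    obtain s r s' r' where ne: "wedge22 (comb s r) (comb s' r') (e 0) (e 1) (e 2) (e 3) \<noteq> 0"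
    proof -
      have "q11 \<noteq> 0 \<or> q12 \<noteq> 0" using det by auto
      then show ?thesis
      proof
        assume "q11 \<noteq> 0" then show ?thesis by (intro that[of 1 0 1 0]) (simp add: qc)
      next
        assume "q12 \<noteq> 0" then show ?thesis by (intro that[of 1 0 0 1]) (simp add: qc)
      qed
    qed
    have cx: "comb s r x y = 0" "comb s r y x = 0" if "y \<in> h" for s r y
      using x0 that alternating2_antisym[OF altc, of s r y x] by (simp_all add: comb_def)
    have "c 0 x = 0" using Wc[OF x eh(2-4), of s r s' r'] ne by (simp add: wedge22_def cx eh) (simp add: det4_def C_def ce)
    moreover have "c 1 x = 0" using Wc[OF eh(1) x eh(3,4), of s r s' r'] ne by (simp add: wedge22_def cx eh) (simp add: det4_def C_def ce)
    moreover have "c 2 x = 0" using Wc[OF eh(1,2) x eh(4), of s r s' r'] ne by (simp add: wedge22_def cx eh) (simp add: det4_def C_def ce)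
    moreover have "c 3 x = 0" using Wc[OF eh(1-3) x, of s r s' r'] ne by (simp add: wedge22_def cx eh) (simp add: det4_def C_def ce)
    ultimately have "xb x = 0" by (simp add: xb_def)
    then show ?thesis using xb[OF x] by simp
  qed
  have lc: "linear (\<lambda>x. comb s r x y)" for s r y using linear_alternating2(2)[OF altc] .
  have iso: "lie_isomorphic br h (two_step_bracket A B) UNIV"
    if l: "linear f1" "linear f2" "linear f3" "linear f4"
      and fn1: "\<And>v. v \<in> n 1 \<Longrightarrow> f1 v = 0 \<and> f2 v = 0 \<and> f3 v = 0 \<and> f4 v = 0"
      and ne: "s * r' - s' * r \<noteq> 0"
      and A: "\<And>x y X Y. x \<in> h \<Longrightarrow> y \<in> h \<Longrightarrow> X $ 1 = f1 x \<Longrightarrow> X $ 2 = f2 x \<Longrightarrow> X $ 3 = f3 x \<Longrightarrow> X $ 4 = f4 x \<Longrightarrow>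
        Y $ 1 = f1 y \<Longrightarrow> Y $ 2 = f2 y \<Longrightarrow> Y $ 3 = f3 y \<Longrightarrow> Y $ 4 = f4 y \<Longrightarrow> A X Y = comb s r x y \<and> B X Y = comb s' r' x y"
      and ker: "\<And>x y. x \<in> h \<Longrightarrow> y \<in> h \<Longrightarrow> f1 x = 0 \<Longrightarrow> f2 x = 0 \<Longrightarrow> f3 x = 0 \<Longrightarrow> f4 x = 0 \<Longrightarrow> comb s r x y = 0 \<and> comb s' r' x y = 0"
    for f1 f2 f3 f4 :: "'e \<Rightarrow> real" and s r s' r' and A B :: "real^6 \<Rightarrow> real^6 \<Rightarrow> real"
  proof -
    \<comment> \<open>The last two components carry the minus sign of
      \<open>two_step_bracket\<close>; the first four vanish on \<open>[h,h]\<close>.\<close>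
    define f :: "'e \<Rightarrow> real^6" where "f x = (\<chi> i. if i = 1 then f1 x else if i = 2 then f2 x else if i = 3 then f3 x else if i = 4 then f4 x
      else if i = 5 then - (s * \<xi>1 x + r * \<xi>2 x) else if i = 6 then - (s' * \<xi>1 x + r' * \<xi>2 x) else 0)" for x
    have fc: "f x $ 1 = f1 x" "f x $ 2 = f2 x" "f x $ 3 = f3 x" "f x $ 4 = f4 x"
      "f x $ 5 = - (s * \<xi>1 x + r * \<xi>2 x)" "f x $ 6 = - (s' * \<xi>1 x + r' * \<xi>2 x)" for x
      by (simp_all add: f_def)
    have lf: "linear f"
      by (rule linearI) (simp_all add: f_def vec_eq_iff linear_add[OF l(1)] linear_add[OF l(2)] linear_add[OF l(3)] linear_add[OF l(4)]
        linear_add[OF lx(1)] linear_add[OF lx(2)] linear_scale[OF l(1)] linear_scale[OF l(2)] linear_scale[OF l(3)] linear_scale[OF l(4)]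
        linear_scale[OF lx(1)] linear_scale[OF lx(2)] algebra_simps)
    have inj: "inj_on f h"
    proof (subst linear_inj_on_iff_eq_0[OF lf subspace_h], intro ballI impI)
      fix x assume x: "x \<in> h" and fx: "f x = 0"
      have f0: "f1 x = 0" "f2 x = 0" "f3 x = 0" "f4 x = 0" "s * \<xi>1 x + r * \<xi>2 x = 0" "s' * \<xi>1 x + r' * \<xi>2 x = 0"
        using fc[of x] unfolding fx by simp_all
      have "s * p1 x y + r * p2 x y = 0" "s' * p1 x y + r' * p2 x y = 0" if "y \<in> h" for y
        using ker[OF x that f0(1-4)] by (simp_all add: comb_def)
      then have "p1 x y = 0" "p2 x y = 0" if "y \<in> h" for y
        using two_by_two_kernel[OF _ _ ne] that by blast+
      then have "x \<in> n 1" by (rule center[OF x])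
      moreover have "\<xi>1 x = 0" "\<xi>2 x = 0" using two_by_two_kernel[OF f0(5,6) ne] .
      ultimately show "x = 0" using n1dec by fastforce
    qed
    have "dim (f ` h) = 6" using dim_image_eq[OF lf, of h] inj subspace_h dim_h by (simp add: span_eq_iff[THEN iffD2])
    then have "f ` h = UNIV"
      using subspace_dim_equal[OF linear_subspace_image[OF lf subspace_h] subspace_UNIV] by simp
    then have bij: "bij_betw f h UNIV" using inj by (simp add: bij_betw_def)
    have hom: "f (br x y) = two_step_bracket A B (f x) (f y)" if "x \<in> h" "y \<in> h" for x y
    proof -
      have AB: "A (f x) (f y) = comb s r x y" "B (f x) (f y) = comb s' r' x y" using A[OF that] fc by blast+
      have "f1 (br x y) = 0" "f2 (br x y) = 0" "f3 (br x y) = 0" "f4 (br x y) = 0" using fn1[OF br_in(1)[OF that]] by blast+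
      then show ?thesis
        unfolding two_step_bracket_def AB
        by (simp add: vec_eq_iff f_def axis_def comb_def p1_def p2_def)
    qed
    show ?thesis
      unfolding lie_isomorphic_def
      using bij hom linear_add[OF lf] linear_scale[OF lf] by blast
  qed
  have cn1': "comb s r v x = 0" if "v \<in> n 1" "x \<in> h" for s r v x using combn1 that by blast
  have cnz: "\<exists>x\<in>h. \<exists>y\<in>h. comb s r x y \<noteq> 0" if "s \<noteq> 0 \<or> r \<noteq> 0" for s r
    using indep[of s r] that unfolding comb_def by blast
  consider "q11 * q22 - q12\<^sup>2 < 0" | "q11 * q22 - q12\<^sup>2 > 0" using det by linarith
  then show ?thesis
  proof cases
    case 1
    then obtain s r s' r' where ne: "s * r' - s' * r \<noteq> 0" and q0: "s * s * q11 + 2 * (s * r * q12) + r * r * q22 = 0"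
      "s' * s' * q11 + 2 * (s' * r' * q12) + r' * r' * q22 = 0"
      using binary_form_split by metis
    \<comment> \<open>A 2-form with zero Pfaffian is decomposable: its square, evaluated at
      \<open>x\<close>, \<open>y\<close>, \<open>u\<close>, \<open>v\<close> with value
      \<open>1\<close> at \<open>(u, v)\<close>, is the decomposition.\<close>
    have dec: "\<exists>u\<in>h. \<exists>v\<in>h. \<forall>x\<in>h. \<forall>y\<in>h. comb s r x y = comb s r x u * comb s r y v - comb s r x v * comb s r y u"
      if nz: "s \<noteq> 0 \<or> r \<noteq> 0" and q: "s * s * q11 + 2 * (s * r * q12) + r * r * q22 = 0" for s r
    proof -
      obtain u v0 where u: "u \<in> h" "v0 \<in> h" "comb s r u v0 \<noteq> 0" using cnz[OF nz] by blast
      define v where "v = (1 / comb s r u v0) *\<^sub>R v0"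
      have v: "v \<in> h" "comb s r u v = 1"
        using u subspace_scale[OF subspace_h] by (simp_all add: v_def linear_scale[OF linear_alternating2(1)[OF altc]])
      have "comb s r x y = comb s r x u * comb s r y v - comb s r x v * comb s r y u" if "x \<in> h" "y \<in> h" for x y
      proof -
        have "wedge22 (comb s r) (comb s r) x y u v = 0"
          using q unfolding Wc[OF that u(1) v(1)] qc by (simp add: algebra_simps)
        then show ?thesis using v(2) by (simp add: wedge22_def)
      qed
      then show ?thesis using u v by blast
    qed
    have nz: "s \<noteq> 0 \<or> r \<noteq> 0" "s' \<noteq> 0 \<or> r' \<noteq> 0" using ne by auto
    obtain u v where uv: "u \<in> h" "v \<in> h" "\<And>x y. x \<in> h \<Longrightarrow> y \<in> h \<Longrightarrow> comb s r x y = comb s r x u * comb s r y v - comb s r x v * comb s r y u"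
      using dec[OF nz(1) q0(1)] by blast
    obtain u' v' where uv': "u' \<in> h" "v' \<in> h"
      "\<And>x y. x \<in> h \<Longrightarrow> y \<in> h \<Longrightarrow> comb s' r' x y = comb s' r' x u' * comb s' r' y v' - comb s' r' x v' * comb s' r' y u'"
      using dec[OF nz(2) q0(2)] by blast
    have "lie_isomorphic br h br_12_34 UNIV"
      unfolding br_12_34_def
    proof (rule iso[OF lc[of s r u] lc[of s r v] lc[of s' r' u'] lc[of s' r' v'] _ ne])
      show "comb s r w u = 0 \<and> comb s r w v = 0 \<and> comb s' r' w u' = 0 \<and> comb s' r' w v' = 0" if "w \<in> n 1" for w
        using cn1'[OF that] uv uv' by blast
    next
      fix x y and X Y :: "real^6"
      assume xy: "x \<in> h" "y \<in> h" and XY: "X $ 1 = comb s r x u" "X $ 2 = comb s r x v" "X $ 3 = comb s' r' x u'" "X $ 4 = comb s' r' x v'"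
        "Y $ 1 = comb s r y u" "Y $ 2 = comb s r y v" "Y $ 3 = comb s' r' y u'" "Y $ 4 = comb s' r' y v'"
      show "wedge 1 2 X Y = comb s r x y \<and> wedge 3 4 X Y = comb s' r' x y"
        unfolding wedge_def XY uv(3)[OF xy] uv'(3)[OF xy] by simp
    next
      fix x y assume xy: "x \<in> h" "y \<in> h" and 0: "comb s r x u = 0" "comb s r x v = 0" "comb s' r' x u' = 0" "comb s' r' x v' = 0"
      show "comb s r x y = 0 \<and> comb s' r' x y = 0" unfolding uv(3)[OF xy] uv'(3)[OF xy] 0 by simp
    qed
    then show ?thesis ..
  next
    case 2
    then obtain s r s' r' where ne: "s * r' - s' * r \<noteq> 0" and q0: "s * s' * q11 + (s * r' + s' * r) * q12 + r * r' * q22 = 0"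
      "s * s * q11 + 2 * (s * r * q12) + r * r * q22 = s' * s' * q11 + 2 * (s' * r' * q12) + r' * r' * q22"
      "s * s * q11 + 2 * (s * r * q12) + r * r * q22 \<noteq> 0"
      by (rule binary_form_definite) blast
    let ?P = "comb s r" and ?P' = "comb s' r'"
    \<comment> \<open>Otherwise \<open>?P (e 0)\<close> would be \<open>m\<close> times
      \<open>?P' (e 0)\<close> as a functional, so the combination of \<open>?P\<close> and
      \<open>?P'\<close> with weights \<open>1\<close> and \<open>- m\<close> would be degenerate.
      Its Pfaffian, however, is \<open>1 + m^2\<close> times a nonzero number.\<close>
    have "\<exists>u\<in>h. \<exists>w\<in>h. ?P' u w = 0 \<and> ?P u w \<noteq> 0"
    proof (rule ccontr)
      assume no: "\<not> ?thesis"
      have "\<exists>w\<in>h. ?P' (e 0) w \<noteq> 0"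
      proof (rule ccontr)
        assume "\<not> ?thesis"
        then have "?P' (e 0) y = 0" if "y \<in> h" for y using that by blast
        then have "?P (e 0) y = 0" if "y \<in> h" for y using no eh(1) that by blast
        then have "wedge22 ?P ?P (e 0) (e 1) (e 2) (e 3) = 0" by (simp add: wedge22_def eh)
        then show False using q0(3) unfolding qc by (simp add: algebra_simps)
      qed
      then obtain w0 where w0: "w0 \<in> h" "?P' (e 0) w0 \<noteq> 0" by blast
      define m where "m = ?P (e 0) w0 / ?P' (e 0) w0"
      have "comb (s - m * s') (r - m * r') (e 0) w = 0" if w: "w \<in> h" for w
      proof -
        let ?w = "w - (?P' (e 0) w / ?P' (e 0) w0) *\<^sub>R w0"
        note ll = linear_alternating2(1)[OF altc]
        have "?w \<in> h" using w w0 subspace_diff[OF subspace_h] subspace_scale[OF subspace_h] by blast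
        moreover have "?P' (e 0) ?w = 0" using w0 by (simp add: linear_diff[OF ll] linear_scale[OF ll])
        ultimately have "?P (e 0) ?w = 0" using no eh(1) by blast
        then have "?P (e 0) w = m * ?P' (e 0) w" by (simp add: linear_diff[OF ll] linear_scale[OF ll] m_def)
        then show ?thesis by (simp add: comb_def algebra_simps)
      qed
      then have "wedge22 (comb (s - m * s') (r - m * r')) (comb (s - m * s') (r - m * r')) (e 0) (e 1) (e 2) (e 3) = 0"
        by (simp add: wedge22_def eh)
      moreover have "wedge22 (comb (s - m * s') (r - m * r')) (comb (s - m * s') (r - m * r')) (e 0) (e 1) (e 2) (e 3)
        = (s * s * q11 + 2 * (s * r * q12) + r * r * q22) - 2 * m * (s * s' * q11 + (s * r' + s' * r) * q12 + r * r' * q22)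
          + m\<^sup>2 * (s' * s' * q11 + 2 * (s' * r' * q12) + r' * r' * q22)"
        unfolding qc by algebra
      ultimately have "(1 + m\<^sup>2) * (s * s * q11 + 2 * (s * r * q12) + r * r * q22) = 0"
        unfolding q0(1) q0(2)[symmetric] by (simp add: algebra_simps)
      moreover have "1 + m\<^sup>2 \<noteq> 0" by (metis add_nonneg_eq_0_iff zero_le_one zero_le_power2 zero_neq_one)
      ultimately show False using q0(3) by simp
    qed
    then obtain u w0 where u: "u \<in> h" "w0 \<in> h" "?P' u w0 = 0" "?P u w0 \<noteq> 0" by blast
    define w where "w = (1 / ?P u w0) *\<^sub>R w0"
    have w: "w \<in> h" "?P u w = 1" "?P' u w = 0"
      using u subspace_scale[OF subspace_h] by (simp_all add: w_def linear_scale[OF linear_alternating2(1)[OF altc]])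
    \<comment> \<open>The normal form of the Pfaffian says that the complex form
      \<open>?P + i ?P'\<close> has square zero. It takes the value \<open>1\<close> at
      \<open>(u, w)\<close>, so it is decomposable; these are the real and imaginary parts of the
      decomposition.\<close>
    have dec: "?P x y = (?P x u * ?P y w - ?P x w * ?P y u) - (?P' x u * ?P' y w - ?P' x w * ?P' y u)"
      "?P' x y = (?P x u * ?P' y w - ?P' x w * ?P y u) + (?P' x u * ?P y w - ?P x w * ?P' y u)" if xy: "x \<in> h" "y \<in> h" for x y
    proof -
      have "wedge22 ?P ?P x y u w - wedge22 ?P' ?P' x y u w = 0"
        using q0(2) unfolding Wc[OF xy u(1) w(1)] qc right_diff_distrib[symmetric] by (simp add: algebra_simps)
      then show "?P x y = (?P x u * ?P y w - ?P x w * ?P y u) - (?P' x u * ?P' y w - ?P' x w * ?P' y u)"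
        using w by (simp add: wedge22_def)
      have "wedge22 ?P ?P' x y u w = 0" using q0(1) unfolding Wc[OF xy u(1) w(1)] qc by simp
      then show "?P' x y = (?P x u * ?P' y w - ?P' x w * ?P y u) + (?P' x u * ?P y w - ?P x w * ?P' y u)"
        using w by (simp add: wedge22_def algebra_simps)
    qed
    have "lie_isomorphic br h br_13m24_14p23 UNIV"
      unfolding br_13m24_14p23_def
    proof (rule iso[OF lc[of s r u] lc[of s' r' u] lc[of s r w] lc[of s' r' w] _ ne])
      show "?P v u = 0 \<and> ?P' v u = 0 \<and> ?P v w = 0 \<and> ?P' v w = 0" if "v \<in> n 1" for v
        using cn1'[OF that] u w by blast
    next
      fix x y and X Y :: "real^6"
      assume xy: "x \<in> h" "y \<in> h" and XY: "X $ 1 = ?P x u" "X $ 2 = ?P' x u" "X $ 3 = ?P x w" "X $ 4 = ?P' x w"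
        "Y $ 1 = ?P y u" "Y $ 2 = ?P' y u" "Y $ 3 = ?P y w" "Y $ 4 = ?P' y w"
      show "wedge 1 3 X Y - wedge 2 4 X Y = ?P x y \<and> wedge 1 4 X Y + wedge 2 3 X Y = ?P' x y"
        unfolding wedge_def XY by (subst dec(1)[OF xy], subst dec(2)[OF xy]) simp
    next
      fix x y assume xy: "x \<in> h" "y \<in> h" and 0: "?P x u = 0" "?P' x u = 0" "?P x w = 0" "?P' x w = 0"
      show "?P x y = 0 \<and> ?P' x y = 0" by (subst dec(1)[OF xy], subst dec(2)[OF xy]) (simp add: 0)
    qed
    then show ?thesis ..
  qed
qed

lemma nilradical_classification:
  "lie_abelian br h \<or> lie_isomorphic br h br_12_34 UNIV \<or> lie_isomorphic br h br_13m24_14p23 UNIV"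
proof (cases "n 1 = {0}")
  case True
  then show ?thesis using br_in(1) by (auto simp: lie_abelian_def)
next
  case False
  then have "dim (n 1) = 2" using dim_n1_le dim_n1_neq_1 dim_n1_neq_3 dim_n1_neq_4 dim_0[of 1] by linarith
  then show ?thesis using dim_n1_2_isomorphic by blast
qed

end

section \<open>Transport to Euclidean space\<close>

lemma lie_prod_image:
  assumes "linear \<phi>" and hom: "\<And>x y. \<phi> (br x y) = br' (\<phi> x) (\<phi> y)"
  shows "\<phi> ` lie_prod br A B = lie_prod br' (\<phi> ` A) (\<phi> ` B)"
proof -
  have "\<phi> ` {br x y |x y. x \<in> A \<and> y \<in> B} = {br' x y |x y. x \<in> \<phi> ` A \<and> y \<in> \<phi> ` B}"
  proof (intro equalityI subsetI)
    fix z assume "z \<in> {br' x y |x y. x \<in> \<phi> ` A \<and> y \<in> \<phi> ` B}"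
    then obtain x y where "x \<in> A" "y \<in> B" "z = \<phi> (br x y)" by (auto simp: hom)
    then show "z \<in> \<phi> ` {br x y |x y. x \<in> A \<and> y \<in> B}" by blast
  next
    fix z assume "z \<in> \<phi> ` {br x y |x y. x \<in> A \<and> y \<in> B}"
    then obtain x y where "x \<in> A" "y \<in> B" "z = br' (\<phi> x) (\<phi> y)" by (auto simp: hom)
    then show "z \<in> {br' x y |x y. x \<in> \<phi> ` A \<and> y \<in> \<phi> ` B}" by blast
  qed
  then show ?thesis by (simp add: lie_prod_def linear_span_image[OF assms(1), symmetric])
qed

lemma lower_central_series_image:
  assumes "linear \<phi>" "\<And>x y. \<phi> (br x y) = br' (\<phi> x) (\<phi> y)"
  shows "\<phi> ` lower_central_series br L i = lower_central_series br' (\<phi> ` L) i"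
  by (induction i) (simp_all add: lie_prod_image[where br = br and br' = br', OF assms])

lemma derived_series_image:
  assumes "linear \<phi>" "\<And>x y. \<phi> (br x y) = br' (\<phi> x) (\<phi> y)"
  shows "\<phi> ` derived_series br L i = derived_series br' (\<phi> ` L) i"
  by (induction i) (simp_all add: lie_prod_image[where br = br and br' = br', OF assms])

lemma lie_solvable_image:
  assumes "linear \<phi>" "\<And>x y. \<phi> (br x y) = br' (\<phi> x) (\<phi> y)" "lie_solvable br L"
  shows "lie_solvable br' (\<phi> ` L)"
proof -
  obtain k where "derived_series br L k = {0}" using assms(3) by (auto simp: lie_solvable_def)
  then have "derived_series br' (\<phi> ` L) k = {0}"
    using derived_series_image[where br = br and br' = br', OF assms(1,2), of L k] linear_0[OF assms(1)] by simp
  then show ?thesis unfolding lie_solvable_def by blast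
qed

lemma nilradical_image_subset:
  assumes "linear \<phi>" "surj \<phi>" and hom: "\<And>x y. \<phi> (br x y) = br' (\<phi> x) (\<phi> y)"
  shows "\<phi> ` nilradical br \<subseteq> nilradical br'"
proof -
  have "lie_ideal br' (\<phi> ` I) \<and> lie_nilpotent br' (\<phi> ` I)" if I: "lie_ideal br I" "lie_nilpotent br I" for I
  proof
    have "br' x (\<phi> y) \<in> \<phi> ` I" if "y \<in> I" for x y
    proof -
      obtain x0 where "x = \<phi> x0" using assms(2) by (meson surjD)
      then show ?thesis using I(1) that by (auto simp: lie_ideal_def hom[symmetric])
    qed
    then show "lie_ideal br' (\<phi> ` I)" using I(1) linear_subspace_image[OF assms(1)] by (auto simp: lie_ideal_def)
    show "lie_nilpotent br' (\<phi> ` I)"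
    proof -
      obtain k where "lower_central_series br I k = {0}" using I(2) by (auto simp: lie_nilpotent_def)
      then have "lower_central_series br' (\<phi> ` I) k = {0}"
        using lower_central_series_image[where br = br and br' = br', OF assms(1) hom, of I k] linear_0[OF assms(1)] by simp
      then show ?thesis unfolding lie_nilpotent_def by blast
    qed
  qed
  then have "\<phi> ` (\<Union>{I. lie_ideal br I \<and> lie_nilpotent br I}) \<subseteq> \<Union>{I. lie_ideal br' I \<and> lie_nilpotent br' I}"
    by blast
  then show ?thesis
    unfolding nilradical_def linear_span_image[OF assms(1), symmetric] by (rule span_mono)
qed

text \<open>The given algebra lives on an arbitrary real vector space, whereas the projections,
  traces and dimension counts above use a Euclidean type; the bracket is carried across an
  isomorphism.\<close>

locale lie_algebra_transport = lie_algebra br for br :: "'a::real_vector \<Rightarrow> 'a \<Rightarrow> 'a" +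
  fixes \<phi> :: "'a \<Rightarrow> 'e::euclidean_space" and \<psi> :: "'e \<Rightarrow> 'a"
  assumes linear_\<phi>: "linear \<phi>" and linear_\<psi>: "linear \<psi>"
    and \<psi>_\<phi>: "\<psi> (\<phi> x) = x" and \<phi>_\<psi>: "\<phi> (\<psi> y) = y"
begin

definition br' :: "'e \<Rightarrow> 'e \<Rightarrow> 'e" where "br' x y = \<phi> (br (\<psi> x) (\<psi> y))"

lemma \<phi>_br: "\<phi> (br x y) = br' (\<phi> x) (\<phi> y)" and \<psi>_br': "\<psi> (br' x' y') = br (\<psi> x') (\<psi> y')"
  by (simp_all add: br'_def \<psi>_\<phi>)

lemma surj_\<phi>: "surj \<phi>" and surj_\<psi>: "surj \<psi>"
  by (rule surjI, rule \<phi>_\<psi>, rule surjI, rule \<psi>_\<phi>)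

lemma image_\<psi>_\<phi>: "\<psi> ` \<phi> ` A = A" and image_\<phi>_\<psi>: "\<phi> ` \<psi> ` A' = A'"
  by (simp_all add: image_image \<psi>_\<phi> \<phi>_\<psi>)

lemma lie_algebra_br': "lie_algebra br'"
proof
  show "bilinear br'"
    unfolding bilinear_def br'_def
    by (auto intro!: linearI simp: linear_add[OF linear_\<phi>] linear_add[OF linear_\<psi>] linear_scale[OF linear_\<phi>] linear_scale[OF linear_\<psi>] br_add br_scaleR)
  show "br' x x = 0" for x by (simp add: br'_def br_self linear_0[OF linear_\<phi>])
  show "br' x (br' y z) + br' y (br' z x) + br' z (br' x y) = 0" for x y z
    by (simp add: br'_def \<psi>_\<phi> linear_add[OF linear_\<phi>, symmetric] jacobi linear_0[OF linear_\<phi>])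
qed

lemma image_nilradical: "\<psi> ` nilradical br' = nilradical br" "\<phi> ` nilradical br = nilradical br'"
proof -
  have 1: "\<psi> ` nilradical br' \<subseteq> nilradical br" by (rule nilradical_image_subset[where br = br' and br' = br, OF linear_\<psi> surj_\<psi> \<psi>_br'])
  have 2: "\<phi> ` nilradical br \<subseteq> nilradical br'" by (rule nilradical_image_subset[where br = br and br' = br', OF linear_\<phi> surj_\<phi> \<phi>_br])
  show "\<psi> ` nilradical br' = nilradical br" "\<phi> ` nilradical br = nilradical br'"
    using 1 2 image_mono[OF 1, of \<phi>] image_mono[OF 2, of \<psi>] by (auto simp: image_\<psi>_\<phi> image_\<phi>_\<psi>)
qed

lemma alternating2_pullback: "alternating2 \<sigma> \<Longrightarrow> alternating2 (\<lambda>x y. \<sigma> (\<phi> x) (\<phi> y))"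
  using linear_compose[OF linear_\<phi>] unfolding alternating2_def bilinear_def o_def by auto

lemma alternating2_pullback': "alternating2 \<sigma> \<Longrightarrow> alternating2 (\<lambda>x y. \<sigma> (\<psi> x) (\<psi> y))"
  using linear_compose[OF linear_\<psi>] unfolding alternating2_def bilinear_def o_def by auto

lemma closed2_exact_br': "closed2_exact br'" if closed: "closed2_exact br"
  unfolding closed2_exact_def
proof (intro allI impI, elim conjE)
  fix \<sigma> assume \<sigma>: "alternating2 \<sigma>" and d: "\<forall>x y z. diff2 br' \<sigma> x y z = 0"
  have "diff2 br (\<lambda>x y. \<sigma> (\<phi> x) (\<phi> y)) x y z = 0" for x y z using d by (simp add: diff2_def \<phi>_br)
  then obtain \<theta> where \<theta>: "linear \<theta>" "\<And>x y. \<sigma> (\<phi> x) (\<phi> y) = \<theta> (br x y)"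
    using closed alternating2_pullback[OF \<sigma>] unfolding closed2_exact_def by fast
  have "\<sigma> x y = (\<theta> \<circ> \<psi>) (br' x y)" for x y using \<theta>(2)[of "\<psi> x" "\<psi> y"] by (simp add: \<phi>_\<psi> \<psi>_br')
  then show "\<exists>\<theta>. linear \<theta> \<and> (\<forall>x y. \<sigma> x y = \<theta> (br' x y))" using linear_compose[OF linear_\<psi> \<theta>(1)] by blast
qed

lemma closed3_exact_br': "closed3_exact br'" if closed: "closed3_exact br"
  unfolding closed3_exact_def
proof (intro allI impI, elim conjE)
  fix \<omega> assume \<omega>: "alternating3 \<omega>" and d: "\<forall>w x y z. diff3 br' \<omega> w x y z = 0"
  have "diff3 br (\<lambda>x y z. \<omega> (\<phi> x) (\<phi> y) (\<phi> z)) w x y z = 0" for w x y z using d by (simp add: diff3_def \<phi>_br)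
  moreover have "alternating3 (\<lambda>x y z. \<omega> (\<phi> x) (\<phi> y) (\<phi> z))"
    using \<omega> linear_compose[OF linear_\<phi>] unfolding alternating3_def o_def by auto
  ultimately obtain \<beta> where \<beta>: "alternating2 \<beta>" "\<And>x y z. \<omega> (\<phi> x) (\<phi> y) (\<phi> z) = diff2 br \<beta> x y z"
    using closed unfolding closed3_exact_def by fast
  have "\<omega> x y z = diff2 br' (\<lambda>x y. \<beta> (\<psi> x) (\<psi> y)) x y z" for x y z
    using \<beta>(2)[of "\<psi> x" "\<psi> y" "\<psi> z"] by (simp add: \<phi>_\<psi> \<psi>_br' diff2_def)
  then show "\<exists>\<beta>. alternating2 \<beta> \<and> (\<forall>x y z. \<omega> x y z = diff2 br' \<beta> x y z)" using alternating2_pullback'[OF \<beta>(1)] by blast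
qed

text \<open>Coordinates on the Euclidean copy are pulled back by \<open>\<phi>\<close> and
  \<open>\<psi>\<close>, where \<open>quot_trace_eq\<close> evaluates the quotient trace in them.
  \<open>H\<close> and \<open>V\<close> stand for \<open>h\<close> and a term of its lower central
  series, whose names belong to another locale.\<close>

lemma traceless_br':
  assumes su: "strongly_unimodular br" and c: "coords_mod V (lie_prod br' H V) k e c"
    and V: "V = lower_central_series br' H i" and H: "nilradical br' = H" and sV: "subspace V"
    and ideal: "\<And>x v. v \<in> V \<Longrightarrow> br' x v \<in> V" "\<And>x v. v \<in> lie_prod br' H V \<Longrightarrow> br' x v \<in> lie_prod br' H V"
    and sub: "lie_prod br' H V \<subseteq> V"
  shows "(\<Sum>j<k. c j (br' t (e j))) = 0"
proof -
  let ?W = "lie_prod br' H V"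
  note co = c[unfolded coords_mod_def]
  have Vi: "\<psi> ` V = lower_central_series br (nilradical br) i"
    unfolding V H[symmetric] lower_central_series_image[where br = br' and br' = br, OF linear_\<psi> \<psi>_br'] image_nilradical ..
  have Wi: "\<psi> ` ?W = lower_central_series br (nilradical br) (Suc i)"
    unfolding lie_prod_image[where br = br' and br' = br, OF linear_\<psi> \<psi>_br'] H[symmetric] image_nilradical Vi[unfolded H[symmetric]] by (simp add: Vi[unfolded H[symmetric]])
  have "quot_trace (\<psi> ` V) (\<psi> ` ?W) (br (\<psi> t)) = (\<Sum>j<k. (c j \<circ> \<phi>) (br (\<psi> t) ((\<psi> \<circ> e) j)))"
  proof (rule quot_trace_eq)
    show "subspace (\<psi> ` V)" "subspace (\<psi> ` ?W)" by (rule linear_subspace_image[OF linear_\<psi>]; rule sV subspace_lie_prod)+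
    show "\<psi> ` ?W \<subseteq> \<psi> ` V" using sub by blast
    show "linear (br (\<psi> t))" by (rule linear_br)
    show "br (\<psi> t) v \<in> \<psi> ` V" if "v \<in> \<psi> ` V" for v using that ideal(1) by (auto simp: \<psi>_br'[symmetric])
    show "br (\<psi> t) v \<in> \<psi> ` ?W" if "v \<in> \<psi> ` ?W" for v using that ideal(2) by (auto simp: \<psi>_br'[symmetric])
    show "(\<psi> \<circ> e) j \<in> \<psi> ` V" if "j < k" for j using co that by auto
    show "linear (c j \<circ> \<phi>)" if "j < k" for j using co that linear_compose[OF linear_\<phi>] by blast
    show "(c j \<circ> \<phi>) w = 0" if "j < k" "w \<in> \<psi> ` ?W" for j w using co that by (auto simp: \<phi>_\<psi>)
    show "(c i \<circ> \<phi>) ((\<psi> \<circ> e) j) = (if i = j then 1 else 0)" if "i < k" "j < k" for i j using co that by (auto simp: \<phi>_\<psi>)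
    show "v - (\<Sum>j<k. (c j \<circ> \<phi>) v *\<^sub>R (\<psi> \<circ> e) j) \<in> \<psi> ` ?W" if v: "v \<in> \<psi> ` V" for v
    proof -
      obtain v' where v': "v = \<psi> v'" "v' \<in> V" using v by blast
      have "v - (\<Sum>j<k. (c j \<circ> \<phi>) v *\<^sub>R (\<psi> \<circ> e) j) = \<psi> (v' - (\<Sum>j<k. c j v' *\<^sub>R e j))"
        by (simp add: v'(1) \<phi>_\<psi> linear_diff[OF linear_\<psi>] linear_sum[OF linear_\<psi>] linear_scale[OF linear_\<psi>])
      then show ?thesis using co v'(2) by blast
    qed
  qed
  moreover have "quot_trace (\<psi> ` V) (\<psi> ` ?W) (br (\<psi> t)) = 0" using su unfolding Vi Wi strongly_unimodular_def by blast
  ultimately show ?thesis by (simp add: br'_def)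
qed

lemma lie_isomorphic_nilradical:
  assumes "lie_isomorphic br' (nilradical br') b UNIV"
  shows "lie_isomorphic br (nilradical br) b UNIV"
proof -
  obtain f where f: "bij_betw f (nilradical br') UNIV" "\<forall>x\<in>nilradical br'. \<forall>y\<in>nilradical br'. f (x + y) = f x + f y"
    "\<forall>c. \<forall>x\<in>nilradical br'. f (c *\<^sub>R x) = c *\<^sub>R f x" "\<forall>x\<in>nilradical br'. \<forall>y\<in>nilradical br'. f (br' x y) = b (f x) (f y)"
    using assms unfolding lie_isomorphic_def by blast
  have "bij_betw \<phi> (nilradical br) (nilradical br')"
    using image_nilradical(2) by (auto simp: bij_betw_def intro: inj_on_inverseI[of _ \<psi>] \<psi>_\<phi>)
  then have bij: "bij_betw (f \<circ> \<phi>) (nilradical br) UNIV" using f(1) by (rule bij_betw_trans)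
  have mem: "\<phi> x \<in> nilradical br'" if "x \<in> nilradical br" for x using that image_nilradical(2) by blast
  show ?thesis
    unfolding lie_isomorphic_def using bij f(2-4) mem
    by (intro exI[of _ "f \<circ> \<phi>"]) (simp add: linear_add[OF linear_\<phi>] linear_scale[OF linear_\<phi>] \<phi>_br)
qed

lemma lie_abelian_nilradical:
  assumes "lie_abelian br' (nilradical br')"
  shows "lie_abelian br (nilradical br)"
  unfolding lie_abelian_def
proof (intro ballI)
  fix x y assume "x \<in> nilradical br" "y \<in> nilradical br"
  then have "br' (\<phi> x) (\<phi> y) = 0" using assms image_nilradical(2) unfolding lie_abelian_def by blast
  then have "\<psi> (\<phi> (br x y)) = 0" by (simp add: \<phi>_br[symmetric] linear_0[OF linear_\<psi>])
  then show "br x y = 0" by (simp only: \<psi>_\<phi>)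
qed

end

lemma finite_dim_isomorphic_euclidean:
  assumes "dim (UNIV :: 'a::real_vector set) = DIM('e::euclidean_space)"
  obtains B :: "'a::real_vector set" and \<phi> :: "'a \<Rightarrow> 'e::euclidean_space" and \<psi> :: "'e \<Rightarrow> 'a"
  where "finite B" "span B = UNIV" "linear \<phi>" "linear \<psi>" "\<And>x. \<psi> (\<phi> x) = x" "\<And>y. \<phi> (\<psi> y) = y"
proof -
  obtain B :: "'a set" where B: "B \<subseteq> UNIV" "independent B" "(UNIV :: 'a set) \<subseteq> span B" "card B = DIM('e)"
    using basis_exists[of "UNIV :: 'a set"] assms by metis
  \<comment> \<open>An infinite set has \<open>card\<close> zero, so a basis of positive cardinality
    is finite.\<close>
  have fin: "finite B" using B(4) by (metis DIM_positive card.infinite less_irrefl)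
  obtain g where g: "bij_betw g B (Basis :: 'e set)"
    using fin B(4) finite_same_card_bij[of B "Basis :: 'e set"] by auto
  let ?g = "the_inv_into B g"
  obtain \<phi> where \<phi>: "linear \<phi>" "\<And>x. x \<in> B \<Longrightarrow> \<phi> x = g x" using linear_independent_extend[OF B(2), of g] by blast
  obtain \<psi> where \<psi>: "linear \<psi>" "\<And>y. y \<in> Basis \<Longrightarrow> \<psi> y = ?g y" using linear_independent_extend[OF independent_Basis, of ?g] by blast
  have "\<psi> (\<phi> x) = x" if "x \<in> B" for x
    using that g \<phi>(2) \<psi>(2) by (simp add: bij_betwE the_inv_into_f_f bij_betw_imp_inj_on)
  then have 1: "(\<psi> \<circ> \<phi>) x = id x" if "x \<in> span B" for x
    using linear_eq_on_span[OF linear_compose[OF \<phi>(1) \<psi>(1)] linear_id _ that] by simp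
  have "\<phi> (\<psi> y) = y" if "y \<in> Basis" for y
    using that g \<phi>(2) \<psi>(2) by (metis bij_betw_def f_the_inv_into_f the_inv_into_into subset_refl)
  then have 2: "(\<phi> \<circ> \<psi>) y = id y" if "y \<in> span Basis" for y
    using linear_eq_on_span[OF linear_compose[OF \<psi>(1) \<phi>(1)] linear_id _ that] by simp
  show ?thesis
    using 1 2 B(3) by (intro that[OF fin _ \<phi>(1) \<psi>(1)]) auto
qed

theorem theorem2p3:
  fixes br :: "'a::real_vector \<Rightarrow> 'a \<Rightarrow> 'a"
  assumes "lie_algebra br"
    and "dim (UNIV :: 'a set) = 7"
    and "two_three_trivial br"
    and "strongly_unimodular br"
  shows "lie_solvable br UNIV \<and> dim (nilradical br) = 6 \<and>
    (lie_abelian br (nilradical br) \<or>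
     lie_isomorphic br (nilradical br) br_12_34 UNIV \<or>
     lie_isomorphic br (nilradical br) br_13m24_14p23 UNIV)"
proof -
  obtain B :: "'a set" and \<phi> :: "'a \<Rightarrow> real^7" and \<psi> where B: "finite B" "span B = UNIV"
    and iso: "linear \<phi>" "linear \<psi>" "\<And>x. \<psi> (\<phi> x) = x" "\<And>y. \<phi> (\<psi> y) = y"
    using finite_dim_isomorphic_euclidean[where 'a = 'a and 'e = "real^7"] assms(2) by auto
  interpret lie_algebra_transport br \<phi> \<psi>
    using assms(1) iso by (simp add: lie_algebra_transport_def lie_algebra_transport_axioms_def)
  note exact = two_three_trivial_exact[OF assms(1) B assms(3)]
  interpret T: cohomology_trivial br'
    using lie_algebra_br' closed2_exact_br'[OF exact(1)] closed3_exact_br'[OF exact(2)]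
    by (simp add: cohomology_trivial_def cohomology_trivial_axioms_def euclidean_lie_algebra_def)
  interpret T: unimodular_cohomology_trivial br'
  proof
    fix i k e c assume c: "coords_mod (T.n i) (T.n (Suc i)) k e c"
    show "(\<Sum>j<k. c j (br' T.t (e j))) = 0"
      by (rule traceless_br'[OF assms(4) c[unfolded T.n_Suc] T.n_def T.nilradical_eq T.subspace_n T.n_ideal
        T.n_ideal[of _ "Suc i", unfolded T.n_Suc] T.n_dec[of i, unfolded T.n_Suc]])
  qed
  have "lie_solvable br (\<psi> ` UNIV)" by (rule lie_solvable_image[where br = br' and br' = br, OF linear_\<psi> \<psi>_br' T.solvable])
  then have "lie_solvable br UNIV" using surj_\<psi> by simp
  moreover have "dim (nilradical br) = 6"
  proof -
    have "inj_on \<psi> (span (nilradical br'))" by (rule inj_on_inverseI) (rule \<phi>_\<psi>)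
    then have "dim (\<psi> ` nilradical br') = dim (nilradical br')" by (rule dim_image_eq[OF linear_\<psi>])
    then show ?thesis using T.dim_h unfolding image_nilradical by (simp only: T.nilradical_eq)
  qed
  moreover have "lie_abelian br (nilradical br) \<or> lie_isomorphic br (nilradical br) br_12_34 UNIV \<or>
     lie_isomorphic br (nilradical br) br_13m24_14p23 UNIV"
    using T.nilradical_classification lie_abelian_nilradical lie_isomorphic_nilradical
    unfolding T.nilradical_eq by blast
  ultimately show ?thesis by blast
qed

end
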